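(* Fix $\alpha\in(0,1)$ and $\ell\in\mathbb{N}=\{1,2,\dots\}$, and let $s\mapsto(\tilde\rho_\ell(s),\lambda_\ell(s))$, $s\in(-\delta_\ell,\delta_\ell)$, be the bifurcating branch of solutions of the reduced bifurcation equation through $(0,\ell)$ described in the context. Then: (a) the set $$\Big\{\psi(\tilde\rho_\ell(s))+1/\lambda_\ell(s):s\in(-\delta_\ell,\delta_\ell)\Big\}\subset h^{4+\alpha}(\mathbb{T})$$ is an analytic curve of equilibria for the axisymmetric surface diffusion problem (ASD) which bifurcates subcritically from the family of cylinders $r_\star\in(0,\infty)$, at the cylinder $r_\star=1/\ell$. (b) There exists some $\varepsilon_\ell>0$ so that for every $s\in(-\delta_\ell,\delta_\ell)$ $$\psi(\tilde\rho_\ell(s))+1/\lambda_\ell(s)=R(B,\ell)\qquad\text{for some } B\in(-\varepsilon_\ell,\varepsilon_\ell),$$ i.e. the family of equilibria in (a) consists of exactly the even presentations of $2\pi/\ell$-periodic undulary curves in some neighborhood of the cylinder $r_\star=1/\ell$. (c) The undulary curves $R(B,\ell)$ are unstable (as equilibria of (ASD)) for $|B|>0$ chosen sufficiently small.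
   Context: Problem (ASD): for a positive function $r=r(t,x)$, $2\pi$-periodic in $x$ (i.e. $x\in\mathbb{T}=[-\pi,\pi]$ with endpoints identified), $$r_t=G(r):=\frac1r\,\partial_x\Big[\frac{r}{\sqrt{1+r_x^2}}\,\partial_x\mathcal{H}(r)\Big]\ (t>0),\quad r(0,\cdot)=r_0,\quad \mathcal{H}(r)=\frac{1}{r\sqrt{1+r_x^2}}-\frac{r_{xx}}{(1+r_x^2)^{3/2}}.$$ Equilibria of (ASD) are the positive $\bar r\in h^{4+\alpha}(\mathbb{T})$ with $G(\bar r)=0$; constants $r_\star>0$ are equilibria (cylinders of radius $r_\star$). Function spaces: $h^{k+\alpha}(\mathbb{T})$ is the little-Hölder space of real $f\in C^{k+\alpha}(\mathbb{T})$ with $\lim_{\delta\to0}\sup_{0<d(x,y)<\delta}|f^{(k)}(x)-f^{(k)}(y)|/d(x,y)^\alpha=0$ ($d$ the metric of the circle of length $2\pi$), with the $C^{k+\alpha}$ norm. $P_0\rho=\rho-\frac1{2\pi}\int_{\mathbb{T}}\rho\,dx$, $h^\sigma_0(\mathbb{T})=P_0h^\sigma(\mathbb{T})$ (mean-zero functions), and $h^{4+\alpha}_{0,\mathrm{even}}(\mathbb{T})$ is the subspace of even functions in $h^{4+\alpha}_0(\mathbb{T})$. Lifting map: for $\lambda>0$ put $r_\star=1/\lambda$ and $F_\star(\rho)=\int_{\mathbb{T}}(\rho+r_\star)^2dx$. By the implicit function theorem, for $\tilde\rho$ in a neighborhood of $0$ in $h^{\alpha}_0(\mathbb{T})$ there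 is a unique $\psi(\tilde\rho)$ in a neighborhood of $0$ in $h^{\alpha}(\mathbb{T})$ with $P_0\psi(\tilde\rho)=\tilde\rho$ and $F_\star(\psi(\tilde\rho))=F_\star(0)$; $\psi$ is real analytic, depends on $\lambda$, preserves the regularity of $\tilde\rho$, and the neighborhood is taken small enough that $\psi(\tilde\rho)>-r_\star$ on $\mathbb{T}$. In the expression $\psi(\tilde\rho_\ell(s))$, the map $\psi$ is the one for $\lambda=\lambda_\ell(s)$. Reduced bifurcation equation: $\bar{\mathcal{G}}(\tilde\rho,\lambda):=P_0\,G(\psi(\tilde\rho)+1/\lambda)=0$, for $\lambda\in(0,\infty)$ and $\tilde\rho$ near $0$ in $h^{4+\alpha}_{0,\mathrm{even}}(\mathbb{T})$. For each $\ell\in\mathbb{N}$ there is an analytic curve $\{(\tilde\rho_\ell(s),\lambda_\ell(s)):s\in(-\delta_\ell,\delta_\ell)\}\subset h^{4+\alpha}_{0,\mathrm{even}}(\mathbb{T})\times\mathbb{R}$ of solutions, nontrivial for $s\neq0$, with $(\tilde\rho_\ell(0),\lambda_\ell(0))=(0,\ell)$, such that all solutions in a neighborhood of $(0,\ell)$ are either trivial, $(0,\lambda)$, or lie on the curve (the curve given by the Crandall–Rabinowitz theorem on bifurcation from a simple eigenvalue, with tangent direction $\cos(\ell x)$ at $s=0$). "Bifurcates subcritically" means that, with bifurcation parameter $\lambda=1/r_\star$, $\dot\lambda_\ell(0)=0$ and $\ddot\lambda_\ell(0)<0$ (derivatives in $s$). Undulary curves: for $\mathcal{H}>0$, $|B|<1$,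 $R(\mathcal{H},B)$ is the curve in $\mathbb{R}^2$ $$s\mapsto\Bigg(\int_{\pi/2\mathcal{H}}^{s}\frac{1+B\sin(\mathcal{H}t)}{\sqrt{1+B^2+2B\sin(\mathcal{H}t)}}\,dt,\ \frac{\sqrt{1+B^2+2B\sin(\mathcal{H}s)}}{\mathcal{H}}\Bigg),\quad s\in\mathbb{R},$$ which is the graph of a positive function over the $x$-axis. For $k\in\mathbb{N}$ and $-1<B<1$, $R(B,k)$ denotes the $2\pi/k$-periodic (in $x$) undulary curve with $\mathcal{H}=\mathcal{H}(B)$ fixed by $$\frac{\pi\mathcal{H}}{k}=\int_{\pi/2}^{3\pi/2}\frac{1+B\sin t}{\sqrt{1+B^2+2B\sin t}}\,dt,$$ and is identified with the function of $x$ of which it is the graph; $R(0,\ell)$ is the constant $1/\ell$. Instability: an equilibrium $\bar r$ is unstable if it is not stable, i.e. (for $\mu\in[1/2,1]$, $4\mu+\alpha\notin\mathbb{Z}$, in the topology of $h^{4\mu+\alpha}(\mathbb{T})$) there exist $\varepsilon>0$ and positive initial values $r_n\to\bar r$ in $h^{4\mu+\alpha}(\mathbb{T})$ such that for each $n$ the maximal solution $r(\cdot,r_n)$ of (ASD) satisfies $\|r(t_n,r_n)-\bar r\|_{h^{4\mu+\alpha}}\ge\varepsilon$ for some $t_n$ in its interval of existence. *)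

theory Defs
  imports "HOL-Analysis.Analysis"
begin

section \<open>Little Hoelder spaces on the circle\<close>

text \<open>Functions on the circle of length \<open>2 \<pi>\<close> are \<open>2 \<pi>\<close>-periodic functions on the real line.\<close>

definition periodic_2pi :: "(real \<Rightarrow> real) \<Rightarrow> bool" where
  "periodic_2pi f \<longleftrightarrow> (\<forall>x. f (x + 2 * pi) = f x)"

definition circle_dist :: "real \<Rightarrow> real \<Rightarrow> real" where
  "circle_dist x y = (INF n::int. \<bar>x - y + 2 * pi * of_int n\<bar>)"

definition nth_deriv :: "nat \<Rightarrow> (real \<Rightarrow> real) \<Rightarrow> real \<Rightarrow> real" where
  "nth_deriv j f = (deriv ^^ j) f"

definition holder_quot :: "real \<Rightarrow> (real \<Rightarrow> real) \<Rightarrow> real \<Rightarrow> real \<Rightarrow> real" where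
  "holder_quot \<beta> g x y = \<bar>g x - g y\<bar> / circle_dist x y powr \<beta>"

text \<open>Throughout, a non-integer order \<open>\<sigma> > 0\<close> stands for \<open>k + \<beta>\<close> with \<open>k = \<lfloor>\<sigma>\<rfloor>\<close> and
  \<open>\<beta> = frac \<sigma>\<close>, so \<open>little_holder \<sigma>\<close> is \<open>h\<^sup>k\<^sup>+\<^sup>\<beta>\<close>.\<close>

definition holder_space :: "real \<Rightarrow> (real \<Rightarrow> real) set" where
  "holder_space \<sigma> = {f. periodic_2pi f \<and>
     (\<forall>j<nat \<lfloor>\<sigma>\<rfloor>. \<forall>x. nth_deriv j f differentiable (at x)) \<and>
     continuous_on UNIV (nth_deriv (nat \<lfloor>\<sigma>\<rfloor>) f) \<and>
     (\<exists>C. \<forall>x y. 0 < circle_dist x y \<longrightarrow> holder_quot (frac \<sigma>) (nth_deriv (nat \<lfloor>\<sigma>\<rfloor>) f) x y \<le> C)}"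

definition little_holder :: "real \<Rightarrow> (real \<Rightarrow> real) set" where
  "little_holder \<sigma> = {f \<in> holder_space \<sigma>.
     \<forall>e>0. \<exists>d>0. \<forall>x y. 0 < circle_dist x y \<and> circle_dist x y < d \<longrightarrow>
       holder_quot (frac \<sigma>) (nth_deriv (nat \<lfloor>\<sigma>\<rfloor>) f) x y \<le> e}"

text \<open>Only meaningful on \<open>holder_space \<sigma>\<close>, where all suprema are over bounded sets.\<close>

definition holder_norm :: "real \<Rightarrow> (real \<Rightarrow> real) \<Rightarrow> real" where
  "holder_norm \<sigma> f = (\<Sum>j\<le>nat \<lfloor>\<sigma>\<rfloor>. SUP x. \<bar>nth_deriv j f x\<bar>) +
     (SUP (x, y)\<in>{(x, y). 0 < circle_dist x y}.
        holder_quot (frac \<sigma>) (nth_deriv (nat \<lfloor>\<sigma>\<rfloor>) f) x y)"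

definition mean_free :: "(real \<Rightarrow> real) \<Rightarrow> real \<Rightarrow> real" where
  "mean_free f = (\<lambda>x. f x - integral {-pi..pi} f / (2 * pi))"

definition little_holder_0 :: "real \<Rightarrow> (real \<Rightarrow> real) set" where
  "little_holder_0 \<sigma> = mean_free ` little_holder \<sigma>"

definition little_holder_0_even :: "real \<Rightarrow> (real \<Rightarrow> real) set" where
  "little_holder_0_even \<sigma> = {f \<in> little_holder_0 \<sigma>. \<forall>x. f (- x) = f x}"

definition lh_open :: "real \<Rightarrow> (real \<Rightarrow> real) set \<Rightarrow> bool" where
  "lh_open \<sigma> N \<longleftrightarrow> N \<subseteq> little_holder \<sigma> \<and>
     (\<forall>f\<in>N. \<exists>e>0. \<forall>g\<in>little_holder \<sigma>. holder_norm \<sigma> (\<lambda>x. g x - f x) < e \<longrightarrow> g \<in> N)"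

definition lh_continuous_on :: "real \<Rightarrow> real set \<Rightarrow> (real \<Rightarrow> real \<Rightarrow> real) \<Rightarrow> bool" where
  "lh_continuous_on \<sigma> J c \<longleftrightarrow> (\<forall>t\<in>J. c t \<in> little_holder \<sigma>) \<and>
     (\<forall>t\<in>J. ((\<lambda>u. holder_norm \<sigma> (\<lambda>x. c u x - c t x)) \<longlongrightarrow> 0) (at t within J))"

text \<open>Real analyticity of a curve: near each parameter value it is the sum of a power series,
  convergent in the norm of \<open>h\<^sup>\<sigma>\<close>, respectively in the real numbers.\<close>

definition lh_analytic_on :: "real \<Rightarrow> real set \<Rightarrow> (real \<Rightarrow> real \<Rightarrow> real) \<Rightarrow> bool" where
  "lh_analytic_on \<sigma> J c \<longleftrightarrow> (\<forall>s\<in>J. c s \<in> little_holder \<sigma>) \<and>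
     (\<forall>s0\<in>J. \<exists>a e. e > 0 \<and> (\<forall>n. a n \<in> little_holder \<sigma>) \<and>
        (\<forall>s\<in>J. \<bar>s - s0\<bar> < e \<longrightarrow>
          (\<lambda>N. holder_norm \<sigma> (\<lambda>x. c s x - (\<Sum>n<N. (s - s0) ^ n * a n x))) \<longlonglongrightarrow> 0))"

definition real_analytic_on :: "real set \<Rightarrow> (real \<Rightarrow> real) \<Rightarrow> bool" where
  "real_analytic_on J f \<longleftrightarrow>
     (\<forall>s0\<in>J. \<exists>a e. e > 0 \<and> (\<forall>s\<in>J. \<bar>s - s0\<bar> < e \<longrightarrow> (\<lambda>n. a n * (s - s0) ^ n) sums f s))"


section \<open>The axisymmetric surface diffusion problem\<close>

definition mean_curv :: "(real \<Rightarrow> real) \<Rightarrow> real \<Rightarrow> real" where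
  "mean_curv r x = 1 / (r x * sqrt (1 + (deriv r x)\<^sup>2))
     - deriv (deriv r) x / (1 + (deriv r x)\<^sup>2) powr (3 / 2)"

definition asd_G :: "(real \<Rightarrow> real) \<Rightarrow> real \<Rightarrow> real" where
  "asd_G r x = 1 / r x * deriv (\<lambda>z. r z / sqrt (1 + (deriv r z)\<^sup>2) * deriv (mean_curv r) z) x"

definition asd_equilibrium :: "real \<Rightarrow> (real \<Rightarrow> real) \<Rightarrow> bool" where
  "asd_equilibrium \<alpha> r \<longleftrightarrow> r \<in> little_holder (4 + \<alpha>) \<and> (\<forall>x. r x > 0) \<and> (\<forall>x. asd_G r x = 0)"

text \<open>Solutions on \<open>[0, T)\<close>, \<open>0 < T \<le> \<infinity>\<close>, with initial value in \<open>h\<^sup>4\<^sup>\<mu>\<^sup>+\<^sup>\<alpha>\<close>: continuous up to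
  \<open>t = 0\<close> with values in \<open>h\<^sup>4\<^sup>\<mu>\<^sup>+\<^sup>\<alpha>\<close>, and for \<open>t > 0\<close> continuous with values in \<open>h\<^sup>4\<^sup>+\<^sup>\<alpha>\<close> and
  continuously differentiable with values in \<open>h\<^sup>\<alpha>\<close>.\<close>

definition asd_solution ::
  "real \<Rightarrow> real \<Rightarrow> (real \<Rightarrow> real) \<Rightarrow> ereal \<Rightarrow> (real \<Rightarrow> real \<Rightarrow> real) \<Rightarrow> bool" where
  "asd_solution \<alpha> \<mu> r0 T r \<longleftrightarrow> 0 < T \<and> r 0 = r0 \<and>
     (\<forall>t x. 0 \<le> t \<and> ereal t < T \<longrightarrow> r t x > 0) \<and>
     lh_continuous_on (4 * \<mu> + \<alpha>) {t. 0 \<le> t \<and> ereal t < T} r \<and>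
     lh_continuous_on (4 + \<alpha>) {t. 0 < t \<and> ereal t < T} r \<and>
     lh_continuous_on \<alpha> {t. 0 < t \<and> ereal t < T} (\<lambda>t. asd_G (r t)) \<and>
     (\<forall>t. 0 < t \<and> ereal t < T \<longrightarrow>
        ((\<lambda>u. holder_norm \<alpha> (\<lambda>x. (r u x - r t x) / (u - t) - asd_G (r t) x)) \<longlongrightarrow> 0) (at t))"

definition asd_maximal_solution ::
  "real \<Rightarrow> real \<Rightarrow> (real \<Rightarrow> real) \<Rightarrow> ereal \<Rightarrow> (real \<Rightarrow> real \<Rightarrow> real) \<Rightarrow> bool" where
  "asd_maximal_solution \<alpha> \<mu> r0 T r \<longleftrightarrow> asd_solution \<alpha> \<mu> r0 T r \<and>
     \<not> (\<exists>T' r'. T < T' \<and> asd_solution \<alpha> \<mu> r0 T' r' \<and>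
          (\<forall>t. 0 \<le> t \<and> ereal t < T \<longrightarrow> r' t = r t))"

text \<open>Maximal solutions are unique by well-posedness, so \<^emph>\<open>the\<close> maximal solution is expressed
  here as: there is one, and every one has the stated property.\<close>

definition asd_unstable_in :: "real \<Rightarrow> real \<Rightarrow> (real \<Rightarrow> real) \<Rightarrow> bool" where
  "asd_unstable_in \<alpha> \<mu> rbar \<longleftrightarrow> (\<exists>\<epsilon>>0. \<exists>rn :: nat \<Rightarrow> real \<Rightarrow> real.
     (\<forall>n. rn n \<in> little_holder (4 * \<mu> + \<alpha>) \<and> (\<forall>x. rn n x > 0)) \<and>
     (\<lambda>n. holder_norm (4 * \<mu> + \<alpha>) (\<lambda>x. rn n x - rbar x)) \<longlonglongrightarrow> 0 \<and>
     (\<forall>n. (\<exists>T r. asd_maximal_solution \<alpha> \<mu> (rn n) T r) \<and>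
          (\<forall>T r. asd_maximal_solution \<alpha> \<mu> (rn n) T r \<longrightarrow>
             (\<exists>t. 0 \<le> t \<and> ereal t < T \<and>
                holder_norm (4 * \<mu> + \<alpha>) (\<lambda>x. r t x - rbar x) \<ge> \<epsilon>))))"

definition asd_unstable_equilibrium :: "real \<Rightarrow> (real \<Rightarrow> real) \<Rightarrow> bool" where
  "asd_unstable_equilibrium \<alpha> rbar \<longleftrightarrow> asd_equilibrium \<alpha> rbar \<and>
     (\<forall>\<mu>\<in>{1/2..1}. 4 * \<mu> + \<alpha> \<notin> \<int> \<longrightarrow> asd_unstable_in \<alpha> \<mu> rbar)"


section \<open>The lifting map and the bifurcation branch\<close>

definition F_star :: "real \<Rightarrow> (real \<Rightarrow> real) \<Rightarrow> real" where
  "F_star lam v = integral {-pi..pi} (\<lambda>x. (v x + 1 / lam)\<^sup>2)"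

text \<open>The neighbourhood of \<open>0\<close> in \<open>h\<^sup>\<alpha>\<close> in which the lifting is sought is the largest admissible
  one, namely all \<open>v > - r\<^sub>\<star>\<close> with \<open>r\<^sub>\<star> = 1 / lam\<close>; uniqueness holds on all of it.\<close>

definition is_lift :: "real \<Rightarrow> real \<Rightarrow> (real \<Rightarrow> real) \<Rightarrow> (real \<Rightarrow> real) \<Rightarrow> bool" where
  "is_lift \<alpha> lam \<rho> v \<longleftrightarrow> v \<in> little_holder \<alpha> \<and> (\<forall>x. v x > - (1 / lam)) \<and>
     mean_free v = \<rho> \<and> F_star lam v = F_star lam (\<lambda>x. 0)"

definition lift :: "real \<Rightarrow> real \<Rightarrow> (real \<Rightarrow> real) \<Rightarrow> real \<Rightarrow> real" where
  "lift \<alpha> lam \<rho> = (THE v. is_lift \<alpha> lam \<rho> v)"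

definition lift_domain :: "real \<Rightarrow> real \<Rightarrow> (real \<Rightarrow> real) set" where
  "lift_domain \<alpha> lam = {\<rho> \<in> little_holder_0 \<alpha>. \<exists>v. is_lift \<alpha> lam \<rho> v}"

lemma little_holder_continuous:
  assumes "0 < \<alpha>" "\<alpha> < 1" "v \<in> little_holder \<alpha>"
  shows "continuous_on UNIV v"
proof -
  have "nat \<lfloor>\<alpha>\<rfloor> = 0" using assms by (simp add: nat_eq_iff2 floor_eq_iff)
  then show ?thesis using assms(3)
    by (simp add: little_holder_def holder_space_def nth_deriv_def)
qed

lemma is_lift_unique:
  assumes "0 < \<alpha>" "\<alpha> < 1" "is_lift \<alpha> lam \<rho> v" "is_lift \<alpha> lam \<rho> w"
  shows "v = w"
proof -
  define q where "q = 1 / lam"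
  define c where "c = integral {-pi..pi} v / (2 * pi) - integral {-pi..pi} w / (2 * pi)"
  have cont: "continuous_on {-pi..pi} v" "continuous_on {-pi..pi} w"
    using assms little_holder_continuous unfolding is_lift_def
    by (meson continuous_on_subset subset_UNIV)+
  have vw: "v x = w x + c" for x
  proof -
    have "mean_free v x = mean_free w x"
      using assms unfolding is_lift_def by simp
    then show ?thesis unfolding mean_free_def c_def by linarith
  qed
  have pos_int: "integral {-pi..pi} (\<lambda>x. u x + q) > 0"
    if "is_lift \<alpha> lam \<rho> u" "continuous_on {-pi..pi} u" for u
  proof -
    have "u x + q > 0" for x
      using that(1) unfolding is_lift_def q_def
      by (metis add.commute diff_gt_0_iff_gt diff_minus_eq_add)
    moreover have "continuous_on {-pi..pi} (\<lambda>x. u x + q)"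
      using that(2) by (intro continuous_intros)
    ultimately have "integral {-pi..pi} (\<lambda>x. 0 :: real) < integral {-pi..pi} (\<lambda>x. u x + q)"
      using pi_gt_zero by (intro integral_less_real) (auto simp: not_le)
    then show ?thesis by simp
  qed
  have "integral {-pi..pi} (\<lambda>x. (v x + q)\<^sup>2) = integral {-pi..pi} (\<lambda>x. (w x + q)\<^sup>2)"
    using assms unfolding is_lift_def F_star_def q_def by simp
  also have "(\<lambda>x. (v x + q)\<^sup>2) = (\<lambda>x. (w x + q)\<^sup>2 + c * ((v x + q) + (w x + q)))"
    by (rule ext) (simp add: vw power2_eq_square algebra_simps)
  also have "integral {-pi..pi} (\<lambda>x. (w x + q)\<^sup>2 + c * ((v x + q) + (w x + q)))
    = integral {-pi..pi} (\<lambda>x. (w x + q)\<^sup>2) + integral {-pi..pi} (\<lambda>x. c * ((v x + q) + (w x + q)))"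
    by (intro integral_add integrable_continuous_real continuous_intros cont)
  also have "integral {-pi..pi} (\<lambda>x. c * ((v x + q) + (w x + q)))
    = c * integral {-pi..pi} (\<lambda>x. (v x + q) + (w x + q))"
    by (rule integral_mult_right)
  also have "integral {-pi..pi} (\<lambda>x. (v x + q) + (w x + q))
    = integral {-pi..pi} (\<lambda>x. v x + q) + integral {-pi..pi} (\<lambda>x. w x + q)"
    by (intro integral_add integrable_continuous_real continuous_intros cont)
  finally have "c * (integral {-pi..pi} (\<lambda>x. v x + q) + integral {-pi..pi} (\<lambda>x. w x + q)) = 0"
    by simp
  then have "c = 0"
    using pos_int[OF assms(3) cont(1)] pos_int[OF assms(4) cont(2)] by auto
  then show ?thesis using vw by auto
qed

lemma is_lift_lift:
  assumes "0 < \<alpha>" "\<alpha> < 1" "\<rho> \<in> lift_domain \<alpha> lam"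
  shows "is_lift \<alpha> lam \<rho> (lift \<alpha> lam \<rho>)"
proof -
  obtain v where "is_lift \<alpha> lam \<rho> v"
    using assms unfolding lift_domain_def by auto
  then show ?thesis
    unfolding lift_def using is_lift_unique[OF assms(1,2)] by (metis (full_types) theI)
qed

definition lifted_profile :: "real \<Rightarrow> real \<Rightarrow> (real \<Rightarrow> real) \<Rightarrow> real \<Rightarrow> real" where
  "lifted_profile \<alpha> lam \<rho> = (\<lambda>x. lift \<alpha> lam \<rho> x + 1 / lam)"

definition reduced_G :: "real \<Rightarrow> (real \<Rightarrow> real) \<Rightarrow> real \<Rightarrow> real \<Rightarrow> real" where
  "reduced_G \<alpha> \<rho> lam = mean_free (asd_G (lifted_profile \<alpha> lam \<rho>))"

definition reduced_solution :: "real \<Rightarrow> (real \<Rightarrow> real) \<Rightarrow> real \<Rightarrow> bool" where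
  "reduced_solution \<alpha> \<rho> lam \<longleftrightarrow> lam > 0 \<and> \<rho> \<in> little_holder_0_even (4 + \<alpha>) \<and>
     \<rho> \<in> lift_domain \<alpha> lam \<and> reduced_G \<alpha> \<rho> lam = (\<lambda>x. 0)"

text \<open>\<open>Z\<close> is an algebraic complement of the line spanned by \<open>cos (l x)\<close> in \<open>h\<^sup>\<sigma>\<^sub>0\<^sub>,\<^sub>e\<^sub>v\<^sub>e\<^sub>n\<close>.\<close>

definition cos_complement :: "real \<Rightarrow> nat \<Rightarrow> (real \<Rightarrow> real) set \<Rightarrow> bool" where
  "cos_complement \<sigma> l Z \<longleftrightarrow> Z \<subseteq> little_holder_0_even \<sigma> \<and>
     (\<forall>f\<in>Z. \<forall>g\<in>Z. \<forall>a b. (\<lambda>x. a * f x + b * g x) \<in> Z) \<and>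
     (\<forall>f\<in>little_holder_0_even \<sigma>. \<exists>!c. (\<lambda>x. f x - c * cos (real l * x)) \<in> Z)"

text \<open>The Crandall--Rabinowitz branch through \<open>(0, l)\<close>. As in that theorem, the curve is
  \<open>s cos (l x) + z s\<close> with \<open>z s = o(s)\<close> in a complement \<open>Z\<close> of the kernel; the choice of \<open>Z\<close>
  only affects the parametrization, so it is left arbitrary.\<close>

definition bifurcation_branch ::
  "real \<Rightarrow> nat \<Rightarrow> real \<Rightarrow> (real \<Rightarrow> real \<Rightarrow> real) \<Rightarrow> (real \<Rightarrow> real) \<Rightarrow> bool" where
  "bifurcation_branch \<alpha> l \<delta> \<rho> lam \<longleftrightarrow> \<delta> > 0 \<and>
     lh_analytic_on (4 + \<alpha>) {-\<delta><..<\<delta>} \<rho> \<and> real_analytic_on {-\<delta><..<\<delta>} lam \<and>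
     (\<forall>s\<in>{-\<delta><..<\<delta>}. reduced_solution \<alpha> (\<rho> s) (lam s)) \<and>
     \<rho> 0 = (\<lambda>x. 0) \<and> lam 0 = real l \<and>
     (\<forall>s\<in>{-\<delta><..<\<delta>}. s \<noteq> 0 \<longrightarrow> \<rho> s \<noteq> (\<lambda>x. 0)) \<and>
     ((\<lambda>s. holder_norm (4 + \<alpha>) (\<lambda>x. \<rho> s x / s - cos (real l * x))) \<longlongrightarrow> 0) (at 0) \<and>
     (\<exists>Z. cos_complement (4 + \<alpha>) l Z \<and>
        (\<forall>s\<in>{-\<delta><..<\<delta>}. (\<lambda>x. \<rho> s x - s * cos (real l * x)) \<in> Z)) \<and>
     (\<exists>\<eta>>0. \<forall>\<rho>' lam'. reduced_solution \<alpha> \<rho>' lam' \<and>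
        holder_norm (4 + \<alpha>) \<rho>' < \<eta> \<and> \<bar>lam' - real l\<bar> < \<eta> \<longrightarrow>
        \<rho>' = (\<lambda>x. 0) \<or> (\<exists>s\<in>{-\<delta><..<\<delta>}. \<rho>' = \<rho> s \<and> lam' = lam s))"


section \<open>Undulary curves\<close>

definition undulary_x :: "real \<Rightarrow> real \<Rightarrow> real \<Rightarrow> real" where
  "undulary_x H B s = (LBINT t=ereal (pi / (2 * H))..ereal s.
     (1 + B * sin (H * t)) / sqrt (1 + B\<^sup>2 + 2 * B * sin (H * t)))"

definition undulary_y :: "real \<Rightarrow> real \<Rightarrow> real \<Rightarrow> real" where
  "undulary_y H B s = sqrt (1 + B\<^sup>2 + 2 * B * sin (H * s)) / H"

definition undulary_fun :: "real \<Rightarrow> real \<Rightarrow> real \<Rightarrow> real" where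
  "undulary_fun H B x = (THE y. \<exists>s. undulary_x H B s = x \<and> undulary_y H B s = y)"

definition undulary_H :: "real \<Rightarrow> nat \<Rightarrow> real" where
  "undulary_H B k = real k / pi *
     integral {pi / 2..3 * pi / 2} (\<lambda>t. (1 + B * sin t) / sqrt (1 + B\<^sup>2 + 2 * B * sin t))"

text \<open>The function whose graph is the \<open>2 \<pi> / k\<close>-periodic undulary curve \<open>R(B, k)\<close>, for
  \<open>-1 < B < 1\<close>. Since the curve starts at \<open>s = \<pi> / (2 H)\<close>, an extremum of its height, it is even.\<close>

definition undulary :: "real \<Rightarrow> nat \<Rightarrow> real \<Rightarrow> real" where
  "undulary B k = undulary_fun (undulary_H B k) B"

end

theory Submission
  imports Defs "HOL-Complex_Analysis.Complex_Analysis"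
begin

text \<open>
  Multiplied by \<open>2 r\<close>, the equation says that the time derivative of \<open>r\<^sup>2\<close> is the divergence of a flux which is
  rational in \<open>r\<^sup>2\<close> and its first three derivatives, and it is invariant under \<open>r(x) \<mapsto> r(l x) / l\<close>.

  A contraction in a weighted \<open>\<ell>\<^sup>1\<close>-algebra of series in \<open>z\<close> and \<open>e^(ix)\<close> produces, for every small \<open>B \<noteq> 0\<close>, a profile which
  at \<open>z = 0\<close> is an equilibrium with neck ratio determined by \<open>B\<close> and which solves the flow for \<open>z\<close> growing
  exponentially in time: an explicit orbit in the unstable manifold of this equilibrium. An energy estimate for the difference
  of two squared profiles shows that every solution from a point of this orbit follows it, and Zorn's lemma gives a maximal
  one; hence instability.

  Equilibria have constant mean curvature, as their flux, being constant, must vanish; in arc length they solve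
  a linear oscillator, so they are undulary curves. On the bifurcating branch the number of periods is an integer
  depending continuously on the parameter, hence constantly \<open>l\<close>. The series at \<open>z = 0\<close> bounds the mean of \<open>r\<^sup>2\<close> for these
  curves from below, and the volume constraint turns this bound into the sign of the second derivative of \<open>\<lambda>\<close>.\<close>

text \<open>Instability is obtained without a spectral or semigroup theory of the linearisation: one
  explicit orbit leaving the equilibrium suffices, provided that its points admit no other solution.
  To leading order the amplitude A of the mode \<open>cos x\<close> obeys t z A' = (3/8) A^3 - v A,
  where e^2 v is the excess of the mean of r^2 over 1. The flow conserves this mean, so v is a
  single number along the orbit. The equilibrium A = 1 forces v = 3/8, and the slope there is t =
  9/8 - 3/8 = 3/4 > 0. The sign of the cubic term thus governs both the unstable direction and the
  direction of bifurcation. This amplitude equation has no small parameter; its contraction property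
  comes from the weight of the powers of z. The modes |k| >= 2 are slaved to A. Their unknown is a
  third derivative, and inverting k^4 - k^2 regains exactly the four derivatives lost in the flux
  and its divergence. For uniqueness the obstacle is the initial time, at which a general solution
  may have only two controlled derivatives; the estimate is therefore arranged so that only the
  explicit orbit needs a bounded third derivative.\<close>

no_notation Infinite_Set_Sum.abs_summable_on (infix "abs'_summable'_on" 50)

section \<open>A Banach algebra of weighted power series\<close>

text \<open>The index \<open>(n, k)\<close> stands for \<open>z^n e^(ikx)\<close>. Because \<open>0 - 1 = 0\<close>, both \<open>1\<close> and \<open>z\<close> have weight 1;
  the decay afterwards makes products of two terms with \<open>n > 0\<close> small, and restricts evaluation to \<open>\<bar>z\<bar> \<le> 1 / 64\<close>.\<close>

definition wtn :: "nat \<Rightarrow> real" where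
  "wtn n = (1 / 64) ^ (n - 1)"

text \<open>The square in k allows a series to be differentiated once in x with a Lipschitz
  derivative. Applied to the third derivative of the profile, this makes its fourth derivative
  Lipschitz, so that the profile lies in \<open>h^(4+\<alpha>)\<close> for every \<alpha> <
  1.\<close>

definition wt :: "nat \<times> int \<Rightarrow> real" where
  "wt i = wtn (fst i) * (1 + \<bar>of_int (snd i)\<bar>)^2"

lemma wtn_pos [simp]: "wtn n > 0" unfolding wtn_def by (rule zero_less_power) simp

lemma wtn_0 [simp]: "wtn 0 = 1" and wtn_1 [simp]: "wtn (Suc 0) = 1" by (simp_all add: wtn_def)

lemma wtn_add: "wtn (m + n) \<le> wtn m * wtn n"
proof (cases "m = 0 \<or> n = 0")
  case False
  hence "m + n - 1 = (m - 1) + (n - 1) + 1" by auto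
  hence "wtn (m + n) = wtn m * wtn n * (1 / 64)" unfolding wtn_def by (simp only: power_add power_one_right)
  thus ?thesis using mult_pos_pos[OF wtn_pos[of m] wtn_pos[of n]] by linarith
qed (auto simp: wtn_def)

text \<open>The gain of 1/64 appears when both exponents are positive, because (m + n) - 1 then
  exceeds (m - 1) + (n - 1) by one.\<close>

lemma wtn_add_pos:
  assumes "m > 0" "n > 0"
  shows "wtn (m + n) = wtn m * wtn n * (1 / 64)"
proof -
  have "m + n - 1 = (m - 1) + (n - 1) + 1" using assms by auto
  thus ?thesis unfolding wtn_def by (simp only: power_add power_one_right)
qed

lemma wt_pos [simp]: "wt i > 0" by (simp add: wt_def add_pos_nonneg)

lemma wt_nonneg [simp]: "wt i \<ge> 0" using wt_pos[of i] by linarith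

lemma wt_nonzero [simp]: "wt i \<noteq> 0" using wt_pos[of i] by linarith

lemma wt_add: "wt (i + j) \<le> wt i * wt j"
proof -
  define a b where "a = \<bar>real_of_int (snd i)\<bar>" and "b = \<bar>real_of_int (snd j)\<bar>"
  have "1 + \<bar>real_of_int (snd (i + j))\<bar> \<le> (1 + a) * (1 + b)"
    by (simp add: a_def b_def algebra_simps) (smt (verit) mult_nonneg_nonneg)
  hence "(1 + \<bar>real_of_int (snd (i + j))\<bar>)^2 \<le> ((1 + a) * (1 + b))^2" by (intro power_mono) auto
  also have "\<dots> = (1 + a)^2 * (1 + b)^2" by (simp add: power_mult_distrib)
  finally have "wt (i + j) \<le> (wtn (fst i) * wtn (fst j)) * ((1 + a)^2 * (1 + b)^2)"
    unfolding wt_def using wtn_add[of "fst i" "fst j"] by (intro mult_mono) (auto simp: less_imp_le)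
  thus ?thesis by (simp add: wt_def a_def b_def mult_ac)
qed

section \<open>Weighted absolutely summable double series and their norm\<close>

typedef wser = "{f :: nat \<times> int \<Rightarrow> real. (\<lambda>i. wt i * \<bar>f i\<bar>) summable_on UNIV}"
  morphisms coef Wser by (rule exI[of _ "\<lambda>_. 0"]) simp

setup_lifting type_definition_wser

lemma coef_summable: "(\<lambda>i. wt i * \<bar>coef a i\<bar>) summable_on UNIV" using coef[of a] by simp

lemma coef_Wser: "(\<lambda>i. wt i * \<bar>f i\<bar>) summable_on UNIV \<Longrightarrow> coef (Wser f) = f" by (simp add: Wser_inverse)

lemma wser_eqI: "(\<And>i. coef a i = coef b i) \<Longrightarrow> a = b" using coef_inject by blast

lemma wsum_comparison:
  assumes "g summable_on (UNIV :: 'i set)" "\<And>i. \<bar>f i\<bar> \<le> (g i :: real)"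
  shows "f summable_on UNIV"
proof -
  have "(\<lambda>i. norm (f i)) summable_on UNIV" by (rule summable_on_comparison_test[OF assms(1)]) (use assms(2) in auto)
  thus ?thesis by (rule abs_summable_summable)
qed

instantiation wser :: real_vector
begin

lift_definition zero_wser :: wser is "\<lambda>_. 0" by simp
lift_definition plus_wser :: "wser \<Rightarrow> wser \<Rightarrow> wser" is "\<lambda>f g i. f i + g i"
  subgoal for f g by (rule wsum_comparison[OF summable_on_add[of "\<lambda>i. wt i * \<bar>f i\<bar>" _ "\<lambda>i. wt i * \<bar>g i\<bar>"]])
       (auto simp: abs_mult distrib_left[symmetric] intro!: mult_left_mono)
  done
lift_definition uminus_wser :: "wser \<Rightarrow> wser" is "\<lambda>f i. - f i" by simp
lift_definition scaleR_wser :: "real \<Rightarrow> wser \<Rightarrow> wser" is "\<lambda>r f i. r * f i"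
  by (auto simp: abs_mult mult.left_commute intro: summable_on_cmult_right)
definition minus_wser :: "wser \<Rightarrow> wser \<Rightarrow> wser" where "minus_wser a b = a + (- b)"

instance
proof
  fix a b c :: wser and r s :: real
  show "a + b + c = a + (b + c)" by transfer (simp add: add.assoc)
  show "a + b = b + a" by transfer (simp add: add.commute)
  show "0 + a = a" by transfer simp
  show "- a + a = 0" by transfer simp
  show "a - b = a + - b" by (rule minus_wser_def)
  show "r *\<^sub>R (a + b) = r *\<^sub>R a + r *\<^sub>R b" by transfer (simp add: distrib_left)
  show "(r + s) *\<^sub>R a = r *\<^sub>R a + s *\<^sub>R a" by transfer (simp add: distrib_right)
  show "r *\<^sub>R s *\<^sub>R a = (r * s) *\<^sub>R a" by transfer (simp only: mult.assoc)
  show "1 *\<^sub>R a = a" by transfer simp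
qed
end

lemma coef_0 [simp]: "coef 0 i = 0" by transfer simp
lemma coef_add [simp]: "coef (a + b) i = coef a i + coef b i" by transfer simp
lemma coef_uminus [simp]: "coef (- a) i = - coef a i" by transfer simp
lemma coef_diff [simp]: "coef (a - b) i = coef a i - coef b i" unfolding minus_wser_def coef_add coef_uminus by simp
lemma coef_scaleR [simp]: "coef (r *\<^sub>R a) i = r * coef a i" by transfer simp

instantiation wser :: real_normed_vector
begin

definition norm_wser :: "wser \<Rightarrow> real" where
  "norm_wser a = (\<Sum>\<^sub>\<infinity>i. wt i * \<bar>coef a i\<bar>)"
definition dist_wser :: "wser \<Rightarrow> wser \<Rightarrow> real" where "dist_wser a b = norm (a - b)"
definition sgn_wser :: "wser \<Rightarrow> wser" where "sgn_wser a = a /\<^sub>R norm a"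
definition uniformity_wser :: "(wser \<times> wser) filter" where
  "uniformity_wser = (INF e\<in>{0 <..}. principal {(x, y). dist x y < e})"
definition open_wser :: "wser set \<Rightarrow> bool" where
  "open_wser U = (\<forall>x\<in>U. eventually (\<lambda>(x', y). x' = x \<longrightarrow> y \<in> U) uniformity)"

instance
proof
  fix a b :: wser and r :: real
  show "dist a b = norm (a - b)" by (rule dist_wser_def)
  show "sgn a = a /\<^sub>R norm a" by (rule sgn_wser_def)
  show "uniformity = (INF e\<in>{0 <..}. principal {(x, y :: wser). dist x y < e})" by (rule uniformity_wser_def)
  show "open U = (\<forall>x\<in>U. eventually (\<lambda>(x', y). x' = x \<longrightarrow> y \<in> U) uniformity)" for U :: "wser set" by (rule open_wser_def)
  show "norm (r *\<^sub>R a) = \<bar>r\<bar> * norm a" unfolding norm_wser_def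
    by (simp add: abs_mult mult.left_commute[of _ "\<bar>r\<bar>"] infsum_cmult_right')
  show "norm (a + b) \<le> norm a + norm b"
  proof -
    have "(\<Sum>\<^sub>\<infinity>i. wt i * \<bar>coef (a + b) i\<bar>) \<le> (\<Sum>\<^sub>\<infinity>i. wt i * \<bar>coef a i\<bar> + wt i * \<bar>coef b i\<bar>)"
      by (rule infsum_mono[OF coef_summable summable_on_add[OF coef_summable coef_summable]])
         (simp add: distrib_left[symmetric] abs_triangle_ineq)
    also have "\<dots> = norm a + norm b" unfolding norm_wser_def by (rule infsum_add[OF coef_summable coef_summable])
    finally show ?thesis unfolding norm_wser_def .
  qed
  show "norm a = 0 \<longleftrightarrow> a = 0"
  proof
    assume "norm a = 0"
    hence "wt i * \<bar>coef a i\<bar> = 0" for i unfolding norm_wser_def by (intro nonneg_infsum_le_0D[OF _ coef_summable[of a]]) auto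
    thus "a = 0" by (intro wser_eqI) auto
  qed (simp add: norm_wser_def)
qed
end

lemma wt_coef_le_norm: "wt i * \<bar>coef a i\<bar> \<le> norm a" unfolding norm_wser_def
  using finite_sum_le_infsum[OF coef_summable[of a], of "{i}"] by simp

lemma coef_le_norm_wt: "\<bar>coef a i\<bar> \<le> norm a / wt i" using wt_coef_le_norm[of i a] by (simp add: field_simps)

lemma wser_norm_leI:
  assumes "\<And>F. finite F \<Longrightarrow> (\<Sum>i\<in>F. wt i * \<bar>coef a i\<bar>) \<le> C"
  shows "norm a \<le> C" unfolding norm_wser_def using assms by (intro infsum_le_finite_sums coef_summable) auto

lemma wser_sum_le_norm: "finite F \<Longrightarrow> (\<Sum>i\<in>F. wt i * \<bar>coef a i\<bar>) \<le> norm a"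
  unfolding norm_wser_def by (intro finite_sum_le_infsum coef_summable) auto

lemma wser_norm_mono:
  assumes "\<And>i. \<bar>coef a i\<bar> \<le> C * \<bar>coef b i\<bar>"
  shows "norm a \<le> C * norm b"
proof (rule wser_norm_leI)
  fix F :: "(nat \<times> int) set" assume F: "finite F"
  show "(\<Sum>i\<in>F. wt i * \<bar>coef a i\<bar>) \<le> C * norm b"
  proof (cases "C \<ge> 0")
    case True
    have "(\<Sum>i\<in>F. wt i * \<bar>coef a i\<bar>) \<le> (\<Sum>i\<in>F. C * (wt i * \<bar>coef b i\<bar>))"
      using assms by (intro sum_mono) (simp add: mult.left_commute mult_left_mono)
    also have "\<dots> \<le> C * norm b" using wser_sum_le_norm[OF F, of b] True by (simp add: sum_distrib_left[symmetric] mult_left_mono)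
    finally show ?thesis .
  next
    case False
    hence "coef b i = 0" for i using assms[of i] by (smt (verit) mult_neg_pos zero_less_abs_iff)
    hence "coef a i = 0" "b = 0" for i using assms[of i] by (auto intro!: wser_eqI)
    thus ?thesis by simp
  qed
qed

lemma Wser_bounded:
  assumes "\<And>F. finite F \<Longrightarrow> (\<Sum>i\<in>F. wt i * \<bar>f i\<bar>) \<le> C"
  shows "coef (Wser f) = f" "norm (Wser f) \<le> C"
proof -
  have "(\<lambda>i. wt i * \<bar>f i\<bar>) summable_on UNIV"
    by (rule nonneg_bounded_partial_sums_imp_summable_on[of _ _ C]) (use assms in \<open>auto simp: eventually_finite_subsets_at_top\<close>)
  thus c: "coef (Wser f) = f" by (rule coef_Wser)
  show "norm (Wser f) \<le> C" by (rule wser_norm_leI) (use assms c in simp)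
qed

lemma Wser_dominated:
  assumes "\<And>i. \<bar>f i\<bar> \<le> C * \<bar>coef a i\<bar>"
  shows "coef (Wser f) = f" "norm (Wser f) \<le> C * norm a"
proof -
  have "(\<lambda>i. wt i * \<bar>f i\<bar>) summable_on UNIV" by (rule wsum_comparison[OF summable_on_cmult_right[OF coef_summable[of a], of C]])
       (use assms in \<open>auto simp: abs_mult mult.left_commute intro!: mult_left_mono\<close>)
  thus c: "coef (Wser f) = f" by (rule coef_Wser)
  show "norm (Wser f) \<le> C * norm a" by (rule wser_norm_mono) (use assms c in simp)
qed

text \<open>A Cauchy sequence converges coefficientwise. Finite partial sums of the norm pass to the
  limit, which gives both that the limit belongs to the space and that the convergence holds in
  norm.\<close>

instance wser :: banach
proof
  fix X :: "nat \<Rightarrow> wser" assume X: "Cauchy X"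
  have "Cauchy (\<lambda>n. coef (X n) i)" for i
  proof (rule metric_CauchyI)
    fix e :: real assume "e > 0"
    then obtain M where M: "\<And>m n. m \<ge> M \<Longrightarrow> n \<ge> M \<Longrightarrow> dist (X m) (X n) < e * wt i" using metric_CauchyD[OF X, of "e * wt i"] by auto
    have "dist (coef (X m) i) (coef (X n) i) < e" if "m \<ge> M" "n \<ge> M" for m n
    proof -
      have "wt i * \<bar>coef (X m) i - coef (X n) i\<bar> < wt i * e"
        using wt_coef_le_norm[of i "X m - X n"] M[OF that] unfolding dist_norm coef_diff by (simp only: mult.commute[of e])
      thus ?thesis unfolding dist_real_def by (metis mult_less_cancel_left_pos wt_pos)
    qed
    thus "\<exists>M. \<forall>m\<ge>M. \<forall>n\<ge>M. dist (coef (X m) i) (coef (X n) i) < e" by blast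
  qed
  hence "\<exists>l. (\<lambda>n. coef (X n) i) \<longlonglongrightarrow> l" for i using Cauchy_convergent convergent_def by blast
  then obtain f where f: "\<And>i. (\<lambda>n. coef (X n) i) \<longlonglongrightarrow> f i" by metis
  have bound: "(\<Sum>i\<in>F. wt i * \<bar>f i - coef (X m) i\<bar>) \<le> e"
    if "finite F" "\<And>n. n \<ge> m \<Longrightarrow> dist (X n) (X m) \<le> e" for F m e
  proof (rule LIMSEQ_le_const2)
    show "(\<lambda>n. \<Sum>i\<in>F. wt i * \<bar>coef (X n) i - coef (X m) i\<bar>) \<longlonglongrightarrow> (\<Sum>i\<in>F. wt i * \<bar>f i - coef (X m) i\<bar>)" by (intro tendsto_intros f)
    have "(\<Sum>i\<in>F. wt i * \<bar>coef (X n) i - coef (X m) i\<bar>) \<le> e" if "n \<ge> m" for n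
      using wser_sum_le_norm[OF \<open>finite F\<close>, of "X n - X m"] \<open>\<And>n. n \<ge> m \<Longrightarrow> dist (X n) (X m) \<le> e\<close>[OF that] by (simp add: dist_norm)
    thus "\<exists>N. \<forall>n\<ge>N. (\<Sum>i\<in>F. wt i * \<bar>coef (X n) i - coef (X m) i\<bar>) \<le> e" by blast
  qed
  obtain M where M: "\<And>m n. m \<ge> M \<Longrightarrow> n \<ge> M \<Longrightarrow> dist (X m) (X n) < 1" using metric_CauchyD[OF X, of 1] by auto
  have "coef (Wser (\<lambda>i. f i - coef (X M) i)) = (\<lambda>i. f i - coef (X M) i)"
    by (rule Wser_bounded[of _ 1]) (rule bound, use M in \<open>auto simp: less_imp_le\<close>)
  then obtain L where L: "\<And>i. coef L i = f i" by (metis (no_types, lifting) coef_add diff_add_cancel)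
  have "X \<longlonglongrightarrow> L"
  proof (rule metric_LIMSEQ_I)
    fix e :: real assume "e > 0"
    then obtain M where M: "\<And>m n. m \<ge> M \<Longrightarrow> n \<ge> M \<Longrightarrow> dist (X m) (X n) < e / 2" using metric_CauchyD[OF X, of "e / 2"] by auto
    have "dist (X n) L < e" if "n \<ge> M" for n
    proof -
      have "norm (L - X n) \<le> e / 2"
      proof (rule wser_norm_leI)
        fix F :: "(nat \<times> int) set" assume "finite F"
        thus "(\<Sum>i\<in>F. wt i * \<bar>coef (L - X n) i\<bar>) \<le> e / 2" using bound[of F n "e / 2"] M[of _ n] that by (simp add: L less_imp_le)
      qed
      thus ?thesis using \<open>e > 0\<close> by (simp add: dist_norm norm_minus_commute)
    qed
    thus "\<exists>no. \<forall>n\<ge>no. dist (X n) L < e" by blast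
  qed
  thus "convergent X" by (auto simp: convergent_def)
qed

text \<open>A series acts as a functional on every family that grows at most like \<open>wt\<close>.
  Coefficients of products, real and complex point evaluations and their derivatives are all of this
  form, which is why the target is a general Banach space.\<close>

lemma wser_pairing:
  fixes \<phi> :: "nat \<times> int \<Rightarrow> 'c :: banach"
  assumes "\<And>i. norm (\<phi> i) \<le> C * wt i"
  shows "(\<lambda>i. coef a i *\<^sub>R \<phi> i) abs_summable_on UNIV"
    and "(\<lambda>i. coef a i *\<^sub>R \<phi> i) summable_on UNIV"
    and "(\<Sum>\<^sub>\<infinity>i. norm (coef a i *\<^sub>R \<phi> i)) \<le> C * norm a"
    and "norm (\<Sum>\<^sub>\<infinity>i. coef a i *\<^sub>R \<phi> i) \<le> C * norm a"
proof -
  have le: "norm (coef a i *\<^sub>R \<phi> i) \<le> C * (wt i * \<bar>coef a i\<bar>)" for i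
    using mult_left_mono[OF assms[of i], of "\<bar>coef a i\<bar>"] by (simp add: mult_ac)
  have s: "(\<lambda>i. C * (wt i * \<bar>coef a i\<bar>)) summable_on UNIV" by (intro summable_on_cmult_right coef_summable)
  show 1: "(\<lambda>i. coef a i *\<^sub>R \<phi> i) abs_summable_on UNIV" by (rule summable_on_comparison_test[OF s]) (use le in auto)
  thus "(\<lambda>i. coef a i *\<^sub>R \<phi> i) summable_on UNIV" by (rule abs_summable_summable)
  have "(\<Sum>\<^sub>\<infinity>i. norm (coef a i *\<^sub>R \<phi> i)) \<le> (\<Sum>\<^sub>\<infinity>i. C * (wt i * \<bar>coef a i\<bar>))" by (rule infsum_mono[OF 1 s le])
  also have "\<dots> = C * norm a" unfolding norm_wser_def by (rule infsum_cmult_right')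
  finally show 2: "(\<Sum>\<^sub>\<infinity>i. norm (coef a i *\<^sub>R \<phi> i)) \<le> C * norm a" .
  show "norm (\<Sum>\<^sub>\<infinity>i. coef a i *\<^sub>R \<phi> i) \<le> C * norm a" using norm_infsum_bound[OF 1] 2 by linarith
qed

text \<open>\<open>shift g i a\<close> is the coefficient of g at i - a. The case distinction puts 0
  where the truncated subtraction of the z-exponents would give a wrong index.\<close>

definition shift :: "(nat \<times> int \<Rightarrow> real) \<Rightarrow> nat \<times> int \<Rightarrow> nat \<times> int \<Rightarrow> real" where
  "shift g i a = (if fst a \<le> fst i then g (fst i - fst a, snd i - snd a) else 0)"

lemma shift_add [simp]: "shift g (a + b) a = g b" by (simp add: shift_def)

lemma shift_out: "i \<notin> range ((+) a) \<Longrightarrow> shift g i a = 0"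
proof -
  assume i: "i \<notin> range ((+) a)"
  have "i = a + (fst i - fst a, snd i - snd a)" if "fst a \<le> fst i" using that by (simp add: prod_eq_iff)
  thus ?thesis using i unfolding shift_def by (metis rangeI)
qed

lemma inj_plus_index: "inj ((+) (a :: nat \<times> int))" by (rule injI) (simp add: prod_eq_iff)

lemma shift_summable_iff:
  fixes \<phi> :: "nat \<times> int \<Rightarrow> 'c :: real_normed_vector"
  shows "(\<lambda>i. shift g i a *\<^sub>R \<phi> i) summable_on UNIV \<longleftrightarrow> (\<lambda>b. g b *\<^sub>R \<phi> (a + b)) summable_on UNIV"
proof -
  have "(\<lambda>i. shift g i a *\<^sub>R \<phi> i) summable_on UNIV \<longleftrightarrow> (\<lambda>i. shift g i a *\<^sub>R \<phi> i) summable_on range ((+) a)"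
    by (rule summable_on_cong_neutral) (auto simp: shift_out)
  thus ?thesis by (subst (asm) summable_on_reindex[OF inj_plus_index]) (simp add: o_def)
qed

lemma shift_infsum:
  fixes \<phi> :: "nat \<times> int \<Rightarrow> 'c :: real_normed_vector"
  shows "(\<Sum>\<^sub>\<infinity>i. shift g i a *\<^sub>R \<phi> i) = (\<Sum>\<^sub>\<infinity>b. g b *\<^sub>R \<phi> (a + b))"
proof -
  have "(\<Sum>\<^sub>\<infinity>i. shift g i a *\<^sub>R \<phi> i) = (\<Sum>\<^sub>\<infinity>i\<in>range ((+) a). shift g i a *\<^sub>R \<phi> i)"
    by (rule infsum_cong_neutral) (auto simp: shift_out)
  thus ?thesis by (subst (asm) infsum_reindex[OF inj_plus_index]) (simp add: o_def)
qed

lemma shift_bound: "norm (shift (coef g) i a) \<le> norm g / wt i * wt a"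
proof (cases "fst a \<le> fst i")
  case True
  define b where "b = (fst i - fst a, snd i - snd a)"
  have i: "i = a + b" using True by (simp add: b_def prod_eq_iff)
  have "\<bar>coef g b\<bar> * wt i \<le> \<bar>coef g b\<bar> * (wt b * wt a)" using wt_add[of a b] by (intro mult_left_mono) (auto simp: i mult.commute)
  also have "\<dots> = (wt b * \<bar>coef g b\<bar>) * wt a" by simp
  also have "\<dots> \<le> norm g * wt a" by (rule mult_right_mono[OF wt_coef_le_norm]) simp
  finally show ?thesis by (simp add: i field_simps)
qed (simp add: shift_def)

definition conv :: "wser \<Rightarrow> wser \<Rightarrow> nat \<times> int \<Rightarrow> real" where
  "conv f g i = (\<Sum>\<^sub>\<infinity>a. coef f a * shift (coef g) i a)"

lemma conv_has_sum: "(\<lambda>a. coef f a * shift (coef g) i a) summable_on UNIV"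
proof -
  show ?thesis using wser_pairing(2)[of "shift (coef g) i" "norm g / wt i" f, OF shift_bound] by simp
qed

text \<open>Fubini for the double series over (a, i), justified by absolute summability. The growth
  condition on \<open>\<phi>\<close> is imposed only at pairs where both coefficients are nonzero,
  so that supports away from z^0 can be exploited.\<close>

lemma conv_pairing_strong:
  fixes \<phi> :: "nat \<times> int \<Rightarrow> 'c :: banach"
  assumes C: "C \<ge> 0"
    and \<phi>: "\<And>a b. coef f a \<noteq> 0 \<Longrightarrow> coef g b \<noteq> 0 \<Longrightarrow> norm (\<phi> (a + b)) \<le> C * wt a * wt b"
  shows "(\<lambda>i. conv f g i *\<^sub>R \<phi> i) abs_summable_on UNIV"
    and "(\<Sum>\<^sub>\<infinity>i. conv f g i *\<^sub>R \<phi> i) = (\<Sum>\<^sub>\<infinity>a. coef f a *\<^sub>R (\<Sum>\<^sub>\<infinity>b. coef g b *\<^sub>R \<phi> (a + b)))"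
    and "(\<Sum>\<^sub>\<infinity>i. norm (conv f g i *\<^sub>R \<phi> i)) \<le> C * norm f * norm g"
proof -
  define F where "F a i = (coef f a * shift (coef g) i a) *\<^sub>R \<phi> i" for a i
  have nF: "norm (F a i) = \<bar>coef f a\<bar> * (shift (\<lambda>b. \<bar>coef g b\<bar>) i a *\<^sub>R norm (\<phi> i))" for a i
    by (auto simp: F_def abs_mult shift_def)
  have inner: "(\<lambda>i. shift (\<lambda>b. \<bar>coef g b\<bar>) i a *\<^sub>R norm (\<phi> i)) summable_on UNIV"
    "(\<Sum>\<^sub>\<infinity>i. shift (\<lambda>b. \<bar>coef g b\<bar>) i a *\<^sub>R norm (\<phi> i)) \<le> C * wt a * norm g"
    if "coef f a \<noteq> 0" for a
  proof -
    define \<xi> where "\<xi> b = (if coef g b = 0 then 0 else \<phi> (a + b))" for b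
    have \<xi>: "norm (\<xi> b) \<le> (C * wt a) * wt b" for b using \<phi>[OF that, of b] C by (simp add: \<xi>_def)
    have eq: "norm (coef g b *\<^sub>R \<xi> b) = \<bar>coef g b\<bar> *\<^sub>R norm (\<phi> (a + b))" for b by (simp add: \<xi>_def)
    show "(\<lambda>i. shift (\<lambda>b. \<bar>coef g b\<bar>) i a *\<^sub>R norm (\<phi> i)) summable_on UNIV"
      "(\<Sum>\<^sub>\<infinity>i. shift (\<lambda>b. \<bar>coef g b\<bar>) i a *\<^sub>R norm (\<phi> i)) \<le> C * wt a * norm g"
      using wser_pairing(1)[of \<xi> "C * wt a" g, OF \<xi>] wser_pairing(3)[of \<xi> "C * wt a" g, OF \<xi>]
      unfolding shift_summable_iff shift_infsum eq .
  qed
  have outer_le: "(\<Sum>\<^sub>\<infinity>i. norm (F a i)) \<le> C * norm g * (wt a * \<bar>coef f a\<bar>)" for a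
  proof (cases "coef f a = 0")
    case False
    thus ?thesis unfolding nF infsum_cmult_right' using mult_left_mono[OF inner(2)[of a], of "\<bar>coef f a\<bar>"] by (simp add: mult_ac)
  qed (simp add: F_def)
  have outer_s: "(\<lambda>a. C * norm g * (wt a * \<bar>coef f a\<bar>)) summable_on UNIV" by (intro summable_on_cmult_right coef_summable)
  have FS: "(\<lambda>a. \<Sum>\<^sub>\<infinity>i. norm (F a i)) summable_on UNIV"
    by (rule wsum_comparison[OF outer_s]) (use outer_le in \<open>simp add: infsum_nonneg abs_of_nonneg\<close>)
  have abs: "(\<lambda>(a, i). F a i) abs_summable_on UNIV \<times> UNIV"
    unfolding Infinite_Sum.abs_summable_on_Sigma_iff[where f = "\<lambda>(a, i). F a i" and A = UNIV and B = "\<lambda>_. UNIV"]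
  proof (intro conjI ballI)
    fix a
    show "(\<lambda>i. case (a, i) of (a, i) \<Rightarrow> F a i) abs_summable_on UNIV"
      unfolding prod.case nF by (cases "coef f a = 0", simp) (rule summable_on_cmult_right, rule inner)
    show "(\<lambda>a. \<Sum>\<^sub>\<infinity>i. norm (case (a, i) of (a, i) \<Rightarrow> F a i)) abs_summable_on UNIV" using FS by (simp add: infsum_nonneg)
  qed
  have abs': "(\<lambda>(i, a). F a i) abs_summable_on UNIV \<times> UNIV"
    using summable_on_swap[of "\<lambda>p. norm (case p of (a, i) \<Rightarrow> F a i)" UNIV UNIV] abs by (simp add: case_prod_unfold)
  have row: "(\<Sum>\<^sub>\<infinity>a. F a i) = conv f g i *\<^sub>R \<phi> i" for i unfolding F_def conv_def by (rule infsum_scaleR_left) (rule conv_has_sum)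
  have rows: "(\<lambda>i. \<Sum>\<^sub>\<infinity>a. norm (F a i)) summable_on UNIV"
    "\<And>i. (\<lambda>a. F a i) abs_summable_on UNIV"
    using abs' unfolding Infinite_Sum.abs_summable_on_Sigma_iff by (auto intro: abs_summable_summable)
  have le: "norm (conv f g i *\<^sub>R \<phi> i) \<le> (\<Sum>\<^sub>\<infinity>a. norm (F a i))" for i using norm_infsum_bound[OF rows(2)[of i]] unfolding row .
  show 1: "(\<lambda>i. conv f g i *\<^sub>R \<phi> i) abs_summable_on UNIV" by (rule summable_on_comparison_test[OF rows(1)]) (use le in auto)
  have "(\<Sum>\<^sub>\<infinity>i. conv f g i *\<^sub>R \<phi> i) = (\<Sum>\<^sub>\<infinity>i. \<Sum>\<^sub>\<infinity>a. F a i)" by (simp add: row)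
  also have "\<dots> = (\<Sum>\<^sub>\<infinity>a. \<Sum>\<^sub>\<infinity>i. F a i)" using infsum_swap_banach[OF abs_summable_summable[OF abs]] by simp
  also have "\<dots> = (\<Sum>\<^sub>\<infinity>a. coef f a *\<^sub>R (\<Sum>\<^sub>\<infinity>b. coef g b *\<^sub>R \<phi> (a + b)))"
    unfolding F_def scaleR_scaleR[symmetric] infsum_scaleR_right shift_infsum ..
  finally show "(\<Sum>\<^sub>\<infinity>i. conv f g i *\<^sub>R \<phi> i) = (\<Sum>\<^sub>\<infinity>a. coef f a *\<^sub>R (\<Sum>\<^sub>\<infinity>b. coef g b *\<^sub>R \<phi> (a + b)))" .
  have "(\<Sum>\<^sub>\<infinity>i. norm (conv f g i *\<^sub>R \<phi> i)) \<le> (\<Sum>\<^sub>\<infinity>i. \<Sum>\<^sub>\<infinity>a. norm (F a i))" by (rule infsum_mono[OF 1 rows(1) le])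
  also have "\<dots> = (\<Sum>\<^sub>\<infinity>a. \<Sum>\<^sub>\<infinity>i. norm (F a i))"
    using infsum_swap_banach[of "\<lambda>i a. norm (F a i)" UNIV UNIV] abs' by (simp add: case_prod_unfold)
  also have "\<dots> \<le> (\<Sum>\<^sub>\<infinity>a. C * norm g * (wt a * \<bar>coef f a\<bar>))" by (rule infsum_mono[OF FS outer_s outer_le])
  also have "\<dots> = C * norm f * norm g" by (simp add: infsum_cmult_right' norm_wser_def)
  finally show "(\<Sum>\<^sub>\<infinity>i. norm (conv f g i *\<^sub>R \<phi> i)) \<le> C * norm f * norm g" .
qed

lemma conv_pairing:
  fixes \<phi> :: "nat \<times> int \<Rightarrow> 'c :: banach"
  assumes "\<And>i. norm (\<phi> i) \<le> C * wt i"
  shows "(\<lambda>i. conv f g i *\<^sub>R \<phi> i) abs_summable_on UNIV" (is "?A abs_summable_on _")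
    and "(\<Sum>\<^sub>\<infinity>i. conv f g i *\<^sub>R \<phi> i) = (\<Sum>\<^sub>\<infinity>a. coef f a *\<^sub>R (\<Sum>\<^sub>\<infinity>b. coef g b *\<^sub>R \<phi> (a + b)))" (is "?B = ?C")
    and "(\<Sum>\<^sub>\<infinity>i. norm (conv f g i *\<^sub>R \<phi> i)) \<le> C * norm f * norm g" (is "?D \<le> _")
proof -
  have C: "C \<ge> 0" using assms[of 0] by (smt (verit) norm_ge_zero wt_pos mult_neg_pos)
  have "norm (\<phi> (a + b)) \<le> C * wt a * wt b" for a b
    using assms[of "a + b"] mult_left_mono[OF wt_add[of a b] C] by (simp add: mult.assoc)
  note conv_pairing_strong[OF C this, where f = f and g = g]
  thus "?A abs_summable_on UNIV" "?B = ?C" "?D \<le> C * norm f * norm g" by blast+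
qed

instantiation wser :: "{comm_ring_1, real_normed_algebra_1}"
begin

definition times_wser :: "wser \<Rightarrow> wser \<Rightarrow> wser" where "times_wser f g = Wser (conv f g)"
definition one_wser :: wser where "one_wser = Wser (\<lambda>i. if i = 0 then 1 else 0)"

lemma conv_norm: "(\<lambda>i. wt i * \<bar>conv f g i\<bar>) summable_on UNIV"
    "(\<Sum>\<^sub>\<infinity>i. wt i * \<bar>conv f g i\<bar>) \<le> norm f * norm g" using conv_pairing(1,3)[of wt 1 f g] by (simp_all add: mult_ac abs_mult)

lemma coef_times: "coef (f * g) i = conv f g i" unfolding times_wser_def by (subst coef_Wser[OF conv_norm(1)]) simp

lemma coef_one [simp]: "coef 1 i = (if i = 0 then 1 else 0)" unfolding one_wser_def
  by (subst coef_Wser, rule finite_nonzero_values_imp_summable_on) (auto intro: finite_subset[of _ "{0}"])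

instance
proof
  fix f g h :: wser and r :: real
  show comm: "f * g = g * f" for f g :: wser
  proof (rule wser_eqI)
    fix i :: "nat \<times> int"
    have "(\<Sum>\<^sub>\<infinity>a\<in>{a. fst a \<le> fst i}. coef f a * shift (coef g) i a)
        = (\<Sum>\<^sub>\<infinity>a\<in>{a. fst a \<le> fst i}. coef g a * shift (coef f) i a)"
      by (rule infsum_reindex_bij_witness[where i = "\<lambda>a. (fst i - fst a, snd i - snd a)"
            and j = "\<lambda>a. (fst i - fst a, snd i - snd a)"]) (auto simp: shift_def)
    moreover have "conv f g i = (\<Sum>\<^sub>\<infinity>a\<in>{a. fst a \<le> fst i}. coef f a * shift (coef g) i a)" for f g
      unfolding conv_def by (rule infsum_cong_neutral) (auto simp: shift_def)
    ultimately show "coef (f * g) i = coef (g * f) i" by (simp add: coef_times)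
  qed
  show "f * g * h = f * (g * h)"
  proof (rule wser_eqI)
    fix i :: "nat \<times> int"
    \<comment> \<open>Associativity is the pairing formula for a product, applied to the functional
      \<open>shift (coef h) i\<close>.\<close>
    have "coef (f * g * h) i = (\<Sum>\<^sub>\<infinity>s. conv f g s *\<^sub>R shift (coef h) i s)" by (simp add: coef_times conv_def[of "f * g"])
    also have "\<dots> = (\<Sum>\<^sub>\<infinity>a. coef f a *\<^sub>R (\<Sum>\<^sub>\<infinity>b. coef g b *\<^sub>R shift (coef h) i (a + b)))" by (rule conv_pairing(2)[OF shift_bound])
    also have "\<dots> = (\<Sum>\<^sub>\<infinity>a. coef f a * shift (coef (g * h)) i a)"
    proof (rule infsum_cong)
      fix a :: "nat \<times> int"
      have "(\<Sum>\<^sub>\<infinity>b. coef g b *\<^sub>R shift (coef h) i (a + b)) = shift (coef (g * h)) i a"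
      proof (cases "fst a \<le> fst i")
        case True
        have "shift (coef h) i (a + b) = shift (coef h) (fst i - fst a, snd i - snd a) b" for b
          using True by (auto simp: shift_def algebra_simps)
        thus ?thesis using True by (simp add: shift_def[of "coef (g * h)"] coef_times conv_def)
      qed (simp add: shift_def)
      thus "coef f a *\<^sub>R (\<Sum>\<^sub>\<infinity>b. coef g b *\<^sub>R shift (coef h) i (a + b)) = coef f a * shift (coef (g * h)) i a" by simp
    qed
    finally show "coef (f * g * h) i = coef (f * (g * h)) i" by (simp add: coef_times conv_def)
  qed
  show one: "1 * f = f" for f :: wser
  proof (rule wser_eqI)
    fix i :: "nat \<times> int"
    have "conv 1 f i = (\<Sum>\<^sub>\<infinity>a\<in>{0}. coef 1 a * shift (coef f) i a)" unfolding conv_def by (rule infsum_cong_neutral) auto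
    thus "coef (1 * f) i = coef f i" by (simp add: coef_times shift_def)
  qed
  show "f * 1 = f" unfolding comm[of f] by (rule one)
  show dist: "(f + g) * h = f * h + g * h" for f g h :: wser
    by (rule wser_eqI) (simp add: coef_times conv_def distrib_right infsum_add conv_has_sum)
  show "f * (g + h) = f * g + f * h" unfolding comm[of f] by (rule dist)
  show sc: "r *\<^sub>R f * g = r *\<^sub>R (f * g)" for f g :: wser
    by (rule wser_eqI) (simp add: coef_times conv_def mult.assoc infsum_cmult_right')
  show "f * r *\<^sub>R g = r *\<^sub>R (f * g)" unfolding comm[of f] by (rule sc)
  show "norm (f * g) \<le> norm f * norm g" using conv_norm(2)[of f g] by (simp add: norm_wser_def[of "f * g"] coef_times)
  have "coef 1 0 = (1 :: real)" "coef 0 0 = (0 :: real)" by simp_all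
  thus "(0 :: wser) \<noteq> 1" by force
  have "(\<Sum>\<^sub>\<infinity>i. wt i * \<bar>coef 1 i\<bar>) = (\<Sum>\<^sub>\<infinity>i\<in>{0}. wt i * \<bar>coef 1 i\<bar>)" by (rule infsum_cong_neutral) auto
  thus "norm (1 :: wser) = 1" by (simp add: norm_wser_def wt_def)
qed
end


text \<open>This gain makes the nonlinear part of the amplitude equation contractive, although z
  itself has norm 1.\<close>

lemma norm_times_positive_support:
  assumes "\<And>k. coef f (0, k) = 0" "\<And>k. coef g (0, k) = 0"
  shows "norm (f * g) \<le> norm f * norm g / 64"
proof -
  have *: "norm (wt (a + b)) \<le> 1 / 64 * wt a * wt b" if "coef f a \<noteq> 0" "coef g b \<noteq> 0" for a b
  proof -
    define x y where "x = \<bar>real_of_int (snd a)\<bar>" and "y = \<bar>real_of_int (snd b)\<bar>"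
    have "fst a > 0" "fst b > 0" using that assms by (metis gr0I prod.collapse)+
    hence w: "wtn (fst (a + b)) = wtn (fst a) * wtn (fst b) * (1 / 64)" by (simp add: wtn_add_pos)
    have "1 + \<bar>real_of_int (snd (a + b))\<bar> \<le> (1 + x) * (1 + y)"
      by (simp add: x_def y_def algebra_simps) (smt (verit) mult_nonneg_nonneg)
    hence "(1 + \<bar>real_of_int (snd (a + b))\<bar>)^2 \<le> ((1 + x) * (1 + y))^2" by (intro power_mono) auto
    also have "\<dots> = (1 + x)^2 * (1 + y)^2" by (simp add: power_mult_distrib)
    finally have "wt (a + b) \<le> wtn (fst a) * wtn (fst b) * (1 / 64) * ((1 + x)^2 * (1 + y)^2)"
      unfolding wt_def w by (intro mult_left_mono) (auto simp: less_imp_le)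
    also have "\<dots> = 1 / 64 * wt a * wt b" by (simp add: wt_def x_def y_def)
    finally show ?thesis by (simp only: real_norm_def abs_of_nonneg[OF wt_nonneg])
  qed
  have "(\<Sum>\<^sub>\<infinity>i. norm (conv f g i *\<^sub>R wt i)) \<le> 1 / 64 * norm f * norm g" by (rule conv_pairing_strong(3)) (use * in auto)
  thus ?thesis by (simp add: norm_wser_def[of "f * g"] coef_times abs_mult mult.commute[of "wt _"])
qed

definition single :: "nat \<Rightarrow> int \<Rightarrow> wser" where
  "single n k = Wser (\<lambda>i. if i = (n, k) then 1 else 0)"

lemma coef_single [simp]: "coef (single n k) i = (if i = (n, k) then 1 else 0)" unfolding single_def
  by (subst coef_Wser, rule finite_nonzero_values_imp_summable_on) (auto intro: finite_subset[of _ "{(n, k)}"])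

lemma coef_single_times: "coef (single n k * f) i = shift (coef f) i (n, k)"
proof -
  have "conv (single n k) f i = (\<Sum>\<^sub>\<infinity>a\<in>{(n, k)}. coef (single n k) a * shift (coef f) i a)"
    unfolding conv_def by (rule infsum_cong_neutral) auto
  thus ?thesis by (simp add: coef_times)
qed

lemma coef_single0_times: "coef (single 0 k * f) (m, j) = coef f (m, j - k)" by (simp add: coef_single_times shift_def)

lemma coef_times_single0: "coef (f * single 0 k) (m, j) = coef f (m, j - k)" by (simp add: coef_single0_times mult.commute[of f])

lemma one_wser_single: "(1 :: wser) = single 0 0" by (rule wser_eqI) (auto simp: zero_prod_def)

lemma single_times_single: "single m k * single n j = single (m + n) (k + j)"
  by (rule wser_eqI) (auto simp: coef_single_times shift_def)

lemma norm_single: "norm (single n k) = wt (n, k)"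
proof -
  have "(\<Sum>\<^sub>\<infinity>i. wt i * \<bar>coef (single n k) i\<bar>) = (\<Sum>\<^sub>\<infinity>i\<in>{(n, k)}. wt i * \<bar>coef (single n k) i\<bar>)" by (rule infsum_cong_neutral) auto
  thus ?thesis by (simp add: norm_wser_def)
qed

definition multop :: "(nat \<times> int \<Rightarrow> real) \<Rightarrow> wser \<Rightarrow> wser" where
  "multop m f = Wser (\<lambda>i. m i * coef f i)"

lemma multop:
  assumes "\<And>i. \<bar>m i\<bar> \<le> C"
  shows "coef (multop m f) i = m i * coef f i" "norm (multop m f) \<le> C * norm f"
proof -
  have *: "\<bar>m i * coef f i\<bar> \<le> C * \<bar>coef f i\<bar>" for i using assms by (simp add: abs_mult mult_right_mono)
  show "coef (multop m f) i = m i * coef f i" unfolding multop_def by (subst Wser_dominated(1)[OF *]) simp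
  show "norm (multop m f) \<le> C * norm f" unfolding multop_def by (rule Wser_dominated(2)[OF *])
qed

lemma multop_diff:
  assumes "\<And>i. \<bar>m i\<bar> \<le> C"
  shows "multop m f - multop m g = multop m (f - g)" by (rule wser_eqI) (simp add: multop(1)[OF assms] right_diff_distrib)

definition oinv :: "wser \<Rightarrow> wser" where "oinv e = (\<Sum>n. (- e) ^ n)"

lemma oinv:
  assumes "norm e \<le> 1 / 2"
  shows "(1 + e) * oinv e = 1" "norm (oinv e) \<le> 2"
proof -
  have n: "norm ((- e) ^ n) \<le> (1 / 2) ^ n" for n using norm_power_ineq[of "- e" n] power_mono[of "norm e" "1 / 2" n] assms by simp
  have s: "summable (\<lambda>n. norm ((- e) ^ n))"
    by (rule summable_comparison_test[of _ "\<lambda>n. (1 / 2) ^ n"]) (use n in \<open>auto simp: summable_geometric_iff\<close>)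
  have s': "summable (\<lambda>n. (- e) ^ n)" by (rule summable_norm_cancel[OF s])
  have "(\<Sum>n. (- e) ^ n) = 1 + (\<Sum>n. (- e) ^ Suc n)" using suminf_split_head[OF s'] by (metis add.commute diff_add_cancel power_0)
  hence "oinv e = 1 + (- e) * oinv e" using suminf_mult[OF s', of "- e"] unfolding oinv_def power_Suc by simp
  thus "(1 + e) * oinv e = 1" by (simp add: algebra_simps)
  have "norm (oinv e) \<le> (\<Sum>n. norm ((- e) ^ n))" unfolding oinv_def by (rule summable_norm[OF s])
  also have "\<dots> \<le> (\<Sum>n. (1 / 2 :: real) ^ n)" by (rule suminf_le[OF n s]) (simp add: summable_geometric_iff)
  also have "\<dots> = 2" by (simp add: suminf_geometric)
  finally show "norm (oinv e) \<le> 2" .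
qed

lemma oinv_diff:
  assumes "norm e \<le> 1 / 2" "norm e' \<le> 1 / 2"
  shows "norm (oinv e - oinv e') \<le> 4 * norm (e - e')"
proof -
  have "oinv e - oinv e' = oinv e * ((1 + e') * oinv e') - ((1 + e) * oinv e) * oinv e'"
    by (simp only: oinv(1)[OF assms(1)] oinv(1)[OF assms(2)] mult_1_right mult_1_left)
  also have "\<dots> = oinv e * oinv e' * (e' - e)" by (simp add: algebra_simps)
  finally have "norm (oinv e - oinv e') \<le> norm (oinv e) * norm (oinv e') * norm (e' - e)"
    using norm_mult_ineq[of "oinv e * oinv e'" "e' - e"] mult_right_mono[OF norm_mult_ineq[of "oinv e" "oinv e'"], of "norm (e' - e)"]
    by auto
  also have "\<dots> \<le> 2 * 2 * norm (e' - e)" by (intro mult_mono oinv assms) auto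
  finally show ?thesis by (simp add: norm_minus_commute)
qed

text \<open>With r = 1 + y the equation becomes y = (u - y^2) / 2, whose right-hand side maps the
  ball of radius \<open>norm u\<close> to itself and contracts it by the factor 1/2.\<close>

lemma wser_sqrt:
  assumes "norm u \<le> (1 / 2 :: real)"
  obtains r :: wser where "r * r = 1 + u" "norm (r - 1) \<le> norm u"
proof -
  define T where "T y = (1 / 2) *\<^sub>R (u - y * y)" for y :: wser
  have sq: "norm (y * y) \<le> norm u" if "norm y \<le> norm u" for y :: wser
  proof -
    have "norm (y * y) \<le> norm y * norm y" by (rule norm_mult_ineq)
    also have "\<dots> \<le> norm u * 1" using that assms by (intro mult_mono) auto
    finally show ?thesis by simp
  qed
  have "\<exists>!y\<in>cball 0 (norm u). T y = y"
  proof (rule Banach_fix[where c = "1 / 2"])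
    show "T ` cball 0 (norm u) \<subseteq> cball 0 (norm u)"
    proof clarsimp
      fix y :: wser assume y: "norm y \<le> norm u"
      show "norm (T y) \<le> norm u" unfolding T_def using norm_triangle_ineq4[of u "y * y"] sq[OF y] by simp
    qed
    fix x y :: wser assume "x \<in> cball 0 (norm u)" "y \<in> cball 0 (norm u)"
    hence xy: "norm x \<le> 1 / 2" "norm y \<le> 1 / 2" using assms by auto
    have "T x - T y = - ((1 / 2) *\<^sub>R ((x + y) * (x - y)))" by (simp add: T_def algebra_simps)
    hence "norm (T x - T y) \<le> 1 / 2 * (norm (x + y) * norm (x - y))" using norm_mult_ineq[of "x + y" "x - y"] by simp
    also have "\<dots> \<le> 1 / 2 * (1 * norm (x - y))" using norm_triangle_ineq[of x y] xy by (intro mult_left_mono mult_right_mono) auto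
    finally show "dist (T x) (T y) \<le> 1 / 2 * dist x y" by (simp add: dist_norm)
  qed (auto simp: complete_eq_closed)
  then obtain y where y: "norm y \<le> norm u" "T y = y" by auto
  have "(2 :: real) *\<^sub>R T y = u - y * y" unfolding T_def by simp
  hence "y + y = u - y * y" unfolding y(2) by (simp add: scaleR_2)
  hence "(1 + y) * (1 + y) = 1 + u" by (simp add: algebra_simps scaleR_2)
  thus thesis using that[of "1 + y"] y(1) by simp
qed

section \<open>Maps depending on a small parameter e, bounded and Lipschitz uniformly in e\<close>

definition ulip :: "wser set \<Rightarrow> (real \<Rightarrow> wser \<Rightarrow> 'b :: real_normed_vector) \<Rightarrow> bool" where
  "ulip S G \<longleftrightarrow> (\<exists>L e1. L \<ge> 0 \<and> e1 > 0 \<and> (\<forall>e. \<bar>e\<bar> \<le> e1 \<longrightarrow>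
     (\<forall>x\<in>S. norm (G e x) \<le> L) \<and> (\<forall>x\<in>S. \<forall>y\<in>S. norm (G e x - G e y) \<le> L * norm (x - y))))"

lemma ulipI:
  assumes "d > 0" "\<And>e x. \<bar>e\<bar> \<le> d \<Longrightarrow> x \<in> S \<Longrightarrow> norm (G e x) \<le> L"
    "\<And>e x y. \<bar>e\<bar> \<le> d \<Longrightarrow> x \<in> S \<Longrightarrow> y \<in> S \<Longrightarrow> norm (G e x - G e y) \<le> L' * norm (x - y)"
  shows "ulip S G" unfolding ulip_def
proof (intro exI conjI allI impI ballI)
  show "max 0 (max L L') \<ge> 0" by simp
  fix e x y assume *: "\<bar>e\<bar> \<le> d" "x \<in> S"
  show "norm (G e x) \<le> max 0 (max L L')" using assms(2)[OF *] by simp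
  assume "y \<in> S"
  hence "norm (G e x - G e y) \<le> L' * norm (x - y)" using * assms(3) by blast
  also have "\<dots> \<le> max 0 (max L L') * norm (x - y)" by (intro mult_right_mono) auto
  finally show "norm (G e x - G e y) \<le> max 0 (max L L') * norm (x - y)" .
qed (rule assms)

lemma ulipE:
  assumes "ulip S G"
  obtains L e1 where "L \<ge> 0" "e1 > 0" "\<And>e x. \<bar>e\<bar> \<le> e1 \<Longrightarrow> x \<in> S \<Longrightarrow> norm (G e x) \<le> L"
    "\<And>e x y. \<bar>e\<bar> \<le> e1 \<Longrightarrow> x \<in> S \<Longrightarrow> y \<in> S \<Longrightarrow> norm (G e x - G e y) \<le> L * norm (x - y)" using assms unfolding ulip_def by blast

lemma ulip_const: "ulip S (\<lambda>e x. c)" by (rule ulipI[where L = "norm c" and L' = 0 and d = 1]) auto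

lemma ulip_eps: "ulip S (\<lambda>e x. e)" by (rule ulipI[where L = 1 and L' = 0 and d = 1]) auto

lemma ulip_id: "bounded S \<Longrightarrow> ulip S (\<lambda>e x. x)"
  unfolding bounded_iff by (metis ulipI[where L' = 1 and d = 1 and G = "\<lambda>e x. x"] mult_1 order_refl zero_less_one)

lemma ulip_add:
  assumes "ulip S F" "ulip S G"
  shows "ulip S (\<lambda>e x. F e x + G e x)"
proof -
  obtain L e1 where F: "L \<ge> 0" "e1 > 0" "\<And>e x. \<bar>e\<bar> \<le> e1 \<Longrightarrow> x \<in> S \<Longrightarrow> norm (F e x) \<le> L"
    "\<And>e x y. \<bar>e\<bar> \<le> e1 \<Longrightarrow> x \<in> S \<Longrightarrow> y \<in> S \<Longrightarrow> norm (F e x - F e y) \<le> L * norm (x - y)" using assms(1) by (rule ulipE) blast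
  obtain M e2 where G: "M \<ge> 0" "e2 > 0" "\<And>e x. \<bar>e\<bar> \<le> e2 \<Longrightarrow> x \<in> S \<Longrightarrow> norm (G e x) \<le> M"
    "\<And>e x y. \<bar>e\<bar> \<le> e2 \<Longrightarrow> x \<in> S \<Longrightarrow> y \<in> S \<Longrightarrow> norm (G e x - G e y) \<le> M * norm (x - y)" using assms(2) by (rule ulipE) blast
  show ?thesis
  proof (rule ulipI[where d = "min e1 e2" and L = "L + M" and L' = "L + M"])
    fix e x y assume *: "\<bar>e\<bar> \<le> min e1 e2" "x \<in> S"
    thus "norm (F e x + G e x) \<le> L + M" using F(3)[of e x] G(3)[of e x] norm_triangle_ineq[of "F e x" "G e x"] by auto
    assume "y \<in> S"
    hence "norm (F e x - F e y) \<le> L * norm (x - y)" "norm (G e x - G e y) \<le> M * norm (x - y)" using * F(4) G(4) by auto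
    thus "norm (F e x + G e x - (F e y + G e y)) \<le> (L + M) * norm (x - y)"
      using norm_triangle_ineq[of "F e x - F e y" "G e x - G e y"] by (simp add: algebra_simps)
  qed (use F(2) G(2) in auto)
qed

lemma ulip_bilinear:
  assumes "bounded_bilinear B" "ulip S F" "ulip S G"
  shows "ulip S (\<lambda>e x. B (F e x) (G e x))"
proof -
  interpret bounded_bilinear B by fact
  obtain K where K: "K > 0" "\<And>a b. norm (B a b) \<le> norm a * norm b * K" using pos_bounded by blast
  obtain L e1 where F: "L \<ge> 0" "e1 > 0" "\<And>e x. \<bar>e\<bar> \<le> e1 \<Longrightarrow> x \<in> S \<Longrightarrow> norm (F e x) \<le> L"
    "\<And>e x y. \<bar>e\<bar> \<le> e1 \<Longrightarrow> x \<in> S \<Longrightarrow> y \<in> S \<Longrightarrow> norm (F e x - F e y) \<le> L * norm (x - y)" using assms(2) by (rule ulipE) blast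
  obtain M e2 where G: "M \<ge> 0" "e2 > 0" "\<And>e x. \<bar>e\<bar> \<le> e2 \<Longrightarrow> x \<in> S \<Longrightarrow> norm (G e x) \<le> M"
    "\<And>e x y. \<bar>e\<bar> \<le> e2 \<Longrightarrow> x \<in> S \<Longrightarrow> y \<in> S \<Longrightarrow> norm (G e x - G e y) \<le> M * norm (x - y)" using assms(3) by (rule ulipE) blast
  show ?thesis
  proof (rule ulipI[where d = "min e1 e2" and L = "L * M * K" and L' = "2 * (L * M * K)"])
    fix e x y assume *: "\<bar>e\<bar> \<le> min e1 e2" "x \<in> S"
    have "norm (F e x) * norm (G e x) * K \<le> L * M * K" using * F G K by (intro mult_mono) auto
    thus "norm (B (F e x) (G e x)) \<le> L * M * K" using K(2) order_trans by blast
    assume y: "y \<in> S"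
    have "B (F e x) (G e x) - B (F e y) (G e y) = B (F e x - F e y) (G e x) + B (F e y) (G e x - G e y)"
      by (simp add: diff_left diff_right)
    hence "norm (B (F e x) (G e x) - B (F e y) (G e y))
        \<le> norm (F e x - F e y) * norm (G e x) * K + norm (F e y) * norm (G e x - G e y) * K"
      using norm_triangle_ineq[of "B (F e x - F e y) (G e x)" "B (F e y) (G e x - G e y)"]
        K(2)[of "F e x - F e y" "G e x"] K(2)[of "F e y" "G e x - G e y"] by simp
    also have "\<dots> \<le> (L * norm (x - y)) * M * K + L * (M * norm (x - y)) * K" using * y F G K by (intro add_mono mult_mono) auto
    also have "\<dots> = 2 * (L * M * K) * norm (x - y)" by simp
    finally show "norm (B (F e x) (G e x) - B (F e y) (G e y)) \<le> 2 * (L * M * K) * norm (x - y)" .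
  qed (use F(2) G(2) in auto)
qed

lemma ulip_linear:
  assumes "bounded_linear T" "ulip S F"
  shows "ulip S (\<lambda>e x. T (F e x))"
proof -
  have "bounded_bilinear (\<lambda>a b. b *\<^sub>R T a)" using bounded_bilinear.comp[OF bounded_bilinear_scaleR bounded_linear_ident assms(1)]
    by (rule bounded_bilinear.flip)
  from ulip_bilinear[OF this assms(2) ulip_const[of S "1 :: real"]] show ?thesis by simp
qed

lemmas ulip_mult = ulip_bilinear[OF bounded_bilinear_mult]
lemmas ulip_scaleR = ulip_bilinear[OF bounded_bilinear_scaleR]

lemma ulip_minus: "ulip S F \<Longrightarrow> ulip S (\<lambda>e x. - F e x)" by (rule ulip_linear[OF bounded_linear_minus[OF bounded_linear_ident]])

lemma ulip_diff: "ulip S F \<Longrightarrow> ulip S G \<Longrightarrow> ulip S (\<lambda>e x. F e x - G e x)" using ulip_add[OF _ ulip_minus, of S F G] by simp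

lemma ulip_power:
  fixes F :: "real \<Rightarrow> wser \<Rightarrow> 'b :: real_normed_algebra_1"
  shows "ulip S F \<Longrightarrow> ulip S (\<lambda>e x. F e x ^ n)" by (induction n) (simp_all add: ulip_const ulip_mult)

text \<open>The factor e pushes the argument into the ball of radius 1/2, where the Neumann series
  is available, once the range of e is shrunk.\<close>

lemma ulip_oinv:
  assumes "ulip S F"
  shows "ulip S (\<lambda>e x. oinv (e *\<^sub>R F e x))"
    and "\<exists>e1>0. \<forall>e x. \<bar>e\<bar> \<le> e1 \<longrightarrow> x \<in> S \<longrightarrow> norm (e *\<^sub>R F e x) \<le> 1 / 2"
proof -
  obtain L e1 where F: "L \<ge> 0" "e1 > 0" "\<And>e x. \<bar>e\<bar> \<le> e1 \<Longrightarrow> x \<in> S \<Longrightarrow> norm (F e x) \<le> L"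
    "\<And>e x y. \<bar>e\<bar> \<le> e1 \<Longrightarrow> x \<in> S \<Longrightarrow> y \<in> S \<Longrightarrow> norm (F e x - F e y) \<le> L * norm (x - y)" using assms(1) by (rule ulipE) blast
  define e2 where "e2 = min e1 (1 / (2 * (L + 1)))"
  have e2: "e2 > 0" using F by (simp add: e2_def)
  have half: "norm (e *\<^sub>R F e x) \<le> 1 / 2" if "\<bar>e\<bar> \<le> e2" "x \<in> S" for e x
  proof -
    have "\<bar>e\<bar> * norm (F e x) \<le> (1 / (2 * (L + 1))) * L" using that F by (intro mult_mono) (auto simp: e2_def)
    also have "\<dots> \<le> 1 / 2" using F by (simp add: field_simps)
    finally show ?thesis by simp
  qed
  thus "\<exists>e1>0. \<forall>e x. \<bar>e\<bar> \<le> e1 \<longrightarrow> x \<in> S \<longrightarrow> norm (e *\<^sub>R F e x) \<le> 1 / 2" using e2 by blast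
  show "ulip S (\<lambda>e x. oinv (e *\<^sub>R F e x))"
  proof (rule ulipI[OF e2, where L = 2 and L' = "4 * (e2 * L)"])
    fix e x y assume *: "\<bar>e\<bar> \<le> e2" "x \<in> S"
    show "norm (oinv (e *\<^sub>R F e x)) \<le> 2" by (rule oinv(2)[OF half[OF *]])
    assume y: "y \<in> S"
    have "norm (oinv (e *\<^sub>R F e x) - oinv (e *\<^sub>R F e y)) \<le> 4 * norm (e *\<^sub>R F e x - e *\<^sub>R F e y)"
      by (rule oinv_diff[OF half[OF *] half[OF *(1) y]])
    also have "norm (e *\<^sub>R F e x - e *\<^sub>R F e y) = \<bar>e\<bar> * norm (F e x - F e y)" by (simp add: scaleR_right_diff_distrib[symmetric])
    also have "\<dots> \<le> e2 * (L * norm (x - y))" using * y F e2 by (intro mult_mono) (auto simp: e2_def)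
    finally show "norm (oinv (e *\<^sub>R F e x) - oinv (e *\<^sub>R F e y)) \<le> 4 * (e2 * L) * norm (x - y)" by simp
  qed
qed

text \<open>\<open>F = F0 + O(\<epsilon>)\<close> in the Lipschitz norm.\<close>

definition expands :: "wser set \<Rightarrow> (real \<Rightarrow> wser \<Rightarrow> 'b :: real_normed_vector) \<Rightarrow> (wser \<Rightarrow> 'b) \<Rightarrow> bool" where
  "expands S F F0 \<longleftrightarrow> ulip S (\<lambda>e. F0) \<and>
     (\<exists>G e1. e1 > 0 \<and> ulip S G \<and> (\<forall>e x. \<bar>e\<bar> \<le> e1 \<longrightarrow> x \<in> S \<longrightarrow> F e x = F0 x + e *\<^sub>R G e x))"

lemma expandsI:
  assumes "ulip S (\<lambda>e. F0)" "ulip S G" "\<And>e x. F e x = F0 x + e *\<^sub>R G e x"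
  shows "expands S F F0" unfolding expands_def using assms by (auto intro!: exI[of _ G] exI[of _ 1])

lemma expands_const: "expands S (\<lambda>e x. c) (\<lambda>x. c)" by (rule expandsI[where G = "\<lambda>_ _. 0"]) (auto intro: ulip_const)

lemma expands_fixed: "ulip S (\<lambda>e. F) \<Longrightarrow> expands S (\<lambda>e. F) F" by (rule expandsI[where G = "\<lambda>_ _. 0"]) (auto intro: ulip_const)

lemma expands_eps:
  assumes "ulip S G"
  shows "expands S (\<lambda>e x. e *\<^sub>R G e x) (\<lambda>x. 0)" by (rule expandsI[OF ulip_const assms]) simp

lemma expands_ulip:
  assumes "expands S F F0"
  shows "ulip S F"
proof -
  obtain G e1 where F0: "ulip S (\<lambda>e. F0)" and G: "e1 > 0" "ulip S G"
    "\<And>e x. \<bar>e\<bar> \<le> e1 \<Longrightarrow> x \<in> S \<Longrightarrow> F e x = F0 x + e *\<^sub>R G e x" using assms unfolding expands_def by blast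
  have "ulip S (\<lambda>e x. F0 x + e *\<^sub>R G e x)" by (intro ulip_add F0 ulip_scaleR ulip_eps G)
  then obtain L e2 where L: "L \<ge> 0" "e2 > 0" "\<And>e x. \<bar>e\<bar> \<le> e2 \<Longrightarrow> x \<in> S \<Longrightarrow> norm (F0 x + e *\<^sub>R G e x) \<le> L"
    "\<And>e x y. \<bar>e\<bar> \<le> e2 \<Longrightarrow> x \<in> S \<Longrightarrow> y \<in> S \<Longrightarrow> norm (F0 x + e *\<^sub>R G e x - (F0 y + e *\<^sub>R G e y)) \<le> L * norm (x - y)" by (rule ulipE) blast
  show ?thesis by (rule ulipI[where d = "min e1 e2" and L = L and L' = L]) (use G L in auto)
qed

lemma expands_add:
  assumes "expands S F F0" "expands S G G0"
  shows "expands S (\<lambda>e x. F e x + G e x) (\<lambda>x. F0 x + G0 x)"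
proof -
  obtain F1 e1 where F: "ulip S (\<lambda>e. F0)" "e1 > 0" "ulip S F1"
    "\<And>e x. \<bar>e\<bar> \<le> e1 \<Longrightarrow> x \<in> S \<Longrightarrow> F e x = F0 x + e *\<^sub>R F1 e x" using assms(1) unfolding expands_def by blast
  obtain G1 e2 where G: "ulip S (\<lambda>e. G0)" "e2 > 0" "ulip S G1"
    "\<And>e x. \<bar>e\<bar> \<le> e2 \<Longrightarrow> x \<in> S \<Longrightarrow> G e x = G0 x + e *\<^sub>R G1 e x" using assms(2) unfolding expands_def by blast
  show ?thesis unfolding expands_def
  proof (intro conjI exI)
    show "ulip S (\<lambda>e x. F0 x + G0 x)" "ulip S (\<lambda>e x. F1 e x + G1 e x)" by (intro ulip_add F G)+
    show "min e1 e2 > 0" using F G by simp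
    show "\<forall>e x. \<bar>e\<bar> \<le> min e1 e2 \<longrightarrow> x \<in> S \<longrightarrow> F e x + G e x = F0 x + G0 x + e *\<^sub>R (F1 e x + G1 e x)"
      using F(4) G(4) by (auto simp: algebra_simps)
  qed
qed

lemma expands_bilinear:
  assumes B: "bounded_bilinear B" and "expands S F F0" "expands S G G0"
  shows "expands S (\<lambda>e x. B (F e x) (G e x)) (\<lambda>x. B (F0 x) (G0 x))"
proof -
  interpret bounded_bilinear B by fact
  obtain F1 e1 where F: "ulip S (\<lambda>e. F0)" "e1 > 0" "ulip S F1"
    "\<And>e x. \<bar>e\<bar> \<le> e1 \<Longrightarrow> x \<in> S \<Longrightarrow> F e x = F0 x + e *\<^sub>R F1 e x" using assms(2) unfolding expands_def by blast
  obtain G1 e2 where G: "ulip S (\<lambda>e. G0)" "e2 > 0" "ulip S G1"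
    "\<And>e x. \<bar>e\<bar> \<le> e2 \<Longrightarrow> x \<in> S \<Longrightarrow> G e x = G0 x + e *\<^sub>R G1 e x" using assms(3) unfolding expands_def by blast
  show ?thesis unfolding expands_def
  proof (intro conjI exI)
    show "ulip S (\<lambda>e x. B (F0 x) (G0 x))"
      "ulip S (\<lambda>e x. B (F0 x) (G1 e x) + (B (F1 e x) (G0 x) + e *\<^sub>R B (F1 e x) (G1 e x)))"
      by (intro ulip_add ulip_scaleR ulip_eps ulip_bilinear[OF B] F G)+
    show "min e1 e2 > 0" using F G by simp
    show "\<forall>e x. \<bar>e\<bar> \<le> min e1 e2 \<longrightarrow> x \<in> S \<longrightarrow> B (F e x) (G e x) = B (F0 x) (G0 x) +
      e *\<^sub>R (B (F0 x) (G1 e x) + (B (F1 e x) (G0 x) + e *\<^sub>R B (F1 e x) (G1 e x)))"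
      using F(4) G(4) by (auto simp: add_left add_right scaleR_left scaleR_right algebra_simps)
  qed
qed

lemmas expands_mult = expands_bilinear[OF bounded_bilinear_mult]
lemmas expands_scaleR = expands_bilinear[OF bounded_bilinear_scaleR]

lemma expands_minus:
  assumes "expands S F F0"
  shows "expands S (\<lambda>e x. - F e x) (\<lambda>x. - F0 x)" using expands_scaleR[OF expands_const[of S "- 1 :: real"] assms] by simp

lemma expands_diff:
  assumes "expands S F F0" "expands S G G0"
  shows "expands S (\<lambda>e x. F e x - G e x) (\<lambda>x. F0 x - G0 x)" using expands_add[OF assms(1) expands_minus[OF assms(2)]] by simp

lemma expands_power:
  fixes F :: "real \<Rightarrow> wser \<Rightarrow> 'b :: real_normed_algebra_1"
  assumes "expands S F F0"
  shows "expands S (\<lambda>e x. F e x ^ n) (\<lambda>x. F0 x ^ n)" by (induction n) (simp_all add: expands_const expands_mult assms)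

text \<open>From 1 / (1 + y) = 1 - y / (1 + y) with y = e F.\<close>

lemma expands_oinv:
  assumes "ulip S F"
  shows "expands S (\<lambda>e x. oinv (e *\<^sub>R F e x)) (\<lambda>x. 1)"
proof -
  obtain e1 where e1: "e1 > 0" "\<And>e x. \<bar>e\<bar> \<le> e1 \<Longrightarrow> x \<in> S \<Longrightarrow> norm (e *\<^sub>R F e x) \<le> 1 / 2" using ulip_oinv(2)[OF assms] by blast
  show ?thesis unfolding expands_def
  proof (intro conjI exI)
    show "ulip S (\<lambda>e x. - (F e x * oinv (e *\<^sub>R F e x)))" by (intro ulip_minus ulip_mult ulip_oinv assms)
    show "\<forall>e x. \<bar>e\<bar> \<le> e1 \<longrightarrow> x \<in> S \<longrightarrow> oinv (e *\<^sub>R F e x) = 1 + e *\<^sub>R (- (F e x * oinv (e *\<^sub>R F e x)))"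
      using oinv(1)[OF e1(2)] by (auto simp: algebra_simps)
  qed (auto intro: ulip_const e1)
qed

section \<open>The unstable manifold of an undulary as a fixed point\<close>

definition "flip f = Wser (\<lambda>i. coef f (fst i, - snd i))"

lemma bij_flip_index: "bij (\<lambda>i :: nat \<times> int. (fst i, - snd i))" by (rule involuntory_imp_bij) simp

lemma coef_flip [simp]: "coef (flip f) (n, k) = coef f (n, - k)"
  and norm_flip: "norm (flip f) = norm f"
proof -
  have "(\<lambda>i. wt i * \<bar>coef f (fst i, - snd i)\<bar>) = (\<lambda>i. wt i * \<bar>coef f i\<bar>) \<circ> (\<lambda>i. (fst i, - snd i))" by (auto simp: wt_def)
  hence "(\<lambda>i. wt i * \<bar>coef f (fst i, - snd i)\<bar>) summable_on UNIV"
    and s: "(\<Sum>\<^sub>\<infinity>i. wt i * \<bar>coef f (fst i, - snd i)\<bar>) = (\<Sum>\<^sub>\<infinity>i. wt i * \<bar>coef f i\<bar>)"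
    using summable_on_reindex_bij_betw[OF bij_flip_index, of "\<lambda>i. wt i * \<bar>coef f i\<bar>"]
      infsum_reindex_bij_betw[OF bij_flip_index, of "\<lambda>i. wt i * \<bar>coef f i\<bar>"] coef_summable[of f] by (simp_all add: o_def)
  hence c: "coef (flip f) = (\<lambda>i. coef f (fst i, - snd i))" unfolding flip_def by (intro coef_Wser)
  show "coef (flip f) (n, k) = coef f (n, - k)" by (simp add: c)
  show "norm (flip f) = norm f" by (simp add: norm_wser_def c s)
qed

lemma flip_add: "flip (f + g) = flip f + flip g"
  and flip_diff: "flip (f - g) = flip f - flip g"
  and flip_minus: "flip (- f) = - flip f"
  and flip_scaleR: "flip (r *\<^sub>R f) = r *\<^sub>R flip f" by (rule wser_eqI, clarsimp)+

lemma flip_single: "flip (single n k) = single n (- k)" by (rule wser_eqI) (auto simp: minus_equation_iff[of _ k] split: if_splits)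

lemma flip_mult: "flip (f * g) = flip f * flip g"
proof (rule wser_eqI, clarify)
  fix n :: nat and k :: int
  have "conv f g (n, - k) = (\<Sum>\<^sub>\<infinity>a. coef f (fst a, - snd a) * shift (coef g) (n, - k) (fst a, - snd a))" unfolding conv_def
    by (rule infsum_reindex_bij_betw[OF bij_flip_index, symmetric, where f = "\<lambda>a. coef f a * shift (coef g) (n, - k) a"])
  also have "\<dots> = conv (flip f) (flip g) (n, k)" unfolding conv_def by (rule infsum_cong) (auto simp: shift_def)
  finally show "coef (flip (f * g)) (n, k) = coef (flip f * flip g) (n, k)" by (simp add: coef_times)
qed

lemma flip_one: "flip 1 = 1" by (simp add: one_wser_single flip_single)

lemma flip_power: "flip (f ^ n) = flip f ^ n" by (induction n) (simp_all add: flip_one flip_mult)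

text \<open>\<open>flip\<close> is a ring homomorphism, and inverses in a commutative ring are
  unique.\<close>

lemma flip_oinv:
  assumes "norm e \<le> 1 / 2"
  shows "flip (oinv e) = oinv (flip e)"
proof -
  have 1: "(1 + flip e) * flip (oinv e) = 1"
    using arg_cong[OF oinv(1)[OF assms], of flip] by (simp add: flip_mult flip_add flip_one)
  have 2: "(1 + flip e) * oinv (flip e) = 1" using oinv(1)[of "flip e"] assms by (simp add: norm_flip)
  have "flip (oinv e) = ((1 + flip e) * oinv (flip e)) * flip (oinv e)" by (simp only: 2 mult_1_left)
  also have "\<dots> = oinv (flip e) * ((1 + flip e) * flip (oinv e))" by (simp only: mult_ac)
  finally show ?thesis by (simp only: 1 mult_1_right)
qed

definition wpair :: "(nat \<times> int \<Rightarrow> 'c :: banach) \<Rightarrow> wser \<Rightarrow> 'c" where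
  "wpair \<phi> f = (\<Sum>\<^sub>\<infinity>i. coef f i *\<^sub>R \<phi> i)"

lemma bounded_linear_wpair:
  assumes "\<And>i. norm (\<phi> i) \<le> C * wt i"
  shows "bounded_linear (wpair \<phi>)"
proof (rule bounded_linear_intro)
  show "wpair \<phi> (f + g) = wpair \<phi> f + wpair \<phi> g" for f g
    unfolding wpair_def by (simp add: scaleR_left_distrib infsum_add wser_pairing(2)[OF assms])
  show "wpair \<phi> (r *\<^sub>R f) = r *\<^sub>R wpair \<phi> f" for r f
    unfolding wpair_def by (simp add: scaleR_scaleR[symmetric] infsum_scaleR_right del: scaleR_scaleR)
  show "norm (wpair \<phi> f) \<le> norm f * C" for f unfolding wpair_def using wser_pairing(4)[OF assms] by (simp add: mult.commute)
qed

lemma bounded_linear_multop: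
  assumes "\<And>i. \<bar>m i\<bar> \<le> C"
  shows "bounded_linear (multop m)"
proof (rule bounded_linear_intro)
  show "multop m (f + g) = multop m f + multop m g" for f g by (rule wser_eqI) (simp add: multop(1)[OF assms] algebra_simps)
  show "multop m (r *\<^sub>R f) = r *\<^sub>R multop m f" for r f by (rule wser_eqI) (simp add: multop(1)[OF assms])
  show "norm (multop m f) \<le> norm f * C" for f using multop(2)[OF assms] by (simp add: mult.commute)
qed

lemma bounded_linear_coef: "bounded_linear (\<lambda>f. coef f i)"
proof (rule bounded_linear_intro)
  show "norm (coef f i) \<le> norm f * (1 / wt i)" for f using coef_le_norm_wt[of f i] by simp
qed auto

text \<open>Selects the Taylor coefficients of the amplitude that remain once those at z^0 and z^1
  are normalised to 1. Scaling z makes the second normalisation possible.\<close>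

definition modeA :: "nat \<times> int \<Rightarrow> real" where
  "modeA i = (if fst i \<ge> 2 \<and> snd i = 0 then 1 else 0)"

text \<open>Up to powers of i, \<open>WO j x\<close> is the j-th derivative of the function whose
  modes are those of x divided by |k|^3. Hence x itself measures the third derivative, the highest
  one in the flux, and the operators for j = 0, ..., 3 are all bounded.\<close>

definition modeW :: "nat \<Rightarrow> nat \<times> int \<Rightarrow> real" where
  "modeW j i = (if \<bar>snd i\<bar> \<ge> 2 then of_int (snd i) ^ j / \<bar>of_int (snd i)\<bar> ^ 3 else 0)"

lemma modeA_le: "\<bar>modeA i\<bar> \<le> 1" by (simp add: modeA_def)

lemma modeW_le: "j \<le> 3 \<Longrightarrow> \<bar>modeW j i\<bar> \<le> 1"
proof -
  assume j: "j \<le> 3"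
  have "\<bar>real_of_int k ^ j / \<bar>of_int k\<bar> ^ 3\<bar> \<le> 1" if "\<bar>k\<bar> \<ge> 2" for k
  proof -
    have "\<bar>real_of_int k\<bar> ^ j \<le> \<bar>real_of_int k\<bar> ^ 3" using that j by (intro power_increasing) linarith+
    thus ?thesis using that by (simp add: power_abs abs_divide)
  qed
  thus ?thesis by (simp add: modeW_def)
qed

abbreviation PA :: "wser \<Rightarrow> wser" where "PA \<equiv> multop modeA"
abbreviation WO :: "nat \<Rightarrow> wser \<Rightarrow> wser" where "WO j \<equiv> multop (modeW j)"

lemmas bl_PA = bounded_linear_multop[OF modeA_le]
lemmas bl_WO = bounded_linear_multop[OF modeW_le]
lemmas coef_PA = multop(1)[OF modeA_le]
lemmas coef_WO = multop(1)[OF modeW_le]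

text \<open>The ansatz is \<open>r\<^sup>2 = 1 + e V\<close> with \<open>V = A cos x + e v + e^2 K W\<close>, where \<open>A\<close> depends on \<open>z\<close> only, \<open>v\<close> is a constant,
  \<open>W\<close> collects the modes \<open>\<bar>k\<bar> \<ge> 2\<close>, and \<open>z' = e^2 t z\<close>. At lowest order \<open>v = 3 / 8\<close>, \<open>t = 3 / 4\<close> and
  \<open>A = 1 + z + \<dots>\<close>; the unknown \<open>x\<close> of small norm encodes the deviations. \<open>Vp\<close>, \<open>Vq\<close>, \<open>Vs\<close> carry
  the factors \<open>k\<close>, \<open>k\<^sup>2\<close>, \<open>k\<^sup>3\<close> of the derivatives of \<open>V\<close>, the constant \<open>kap\<close> normalises \<open>r\<^sup>2\<close> at \<open>z = 0\<close> so that
  its values at \<open>0\<close> and \<open>\<pi>\<close> are in the ratio \<open>1 + e : 1 - e\<close>, and \<open>No\<close> is the remainder in \<open>flux_identity\<close>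
  below.\<close>

definition E1 :: wser where "E1 = single 0 1"
definition F1 :: wser where "F1 = single 0 (- 1)"
definition c1 :: wser where "c1 = (1 / 2) *\<^sub>R (E1 + F1)"
definition s1 :: wser where "s1 = (1 / 2) *\<^sub>R (E1 - F1)"
definition zz :: wser where "zz = single 1 0"

text \<open>A single series serves as the list of unknowns: its coefficient (0, 0) corrects v, the
  coefficient (1, 0) corrects t, the coefficients (n, 0) with n >= 2 belong to the amplitude, and
  the modes |k| >= 2 describe W.\<close>

definition "vv x = 3 / 8 + coef x (0, 0)"
definition "ta x = 3 / 4 + coef x (1, 0)"
definition "At0 x = 1 + zz + PA x"

text \<open>Pairing with these weights sums the even or the odd modes of the part at z = 0. The sum
  and the difference of the two results are the values at x = 0 and x = \<pi>.\<close>

definition par :: "bool \<Rightarrow> nat \<times> int \<Rightarrow> real" where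
  "par b i = (if fst i = 0 \<and> even (snd i) = b then 1 else 0)"

definition "kap K e x = e *\<^sub>R vv x + e *\<^sub>R (e *\<^sub>R (K *\<^sub>R wpair (par True) (WO 0 x))) - e *\<^sub>R (K *\<^sub>R wpair (par False) (WO 0 x))"

definition "Atot K e x = At0 x + e *\<^sub>R (kap K e x *\<^sub>R 1)"

definition "Vv K e x = Atot K e x * c1 + e *\<^sub>R (vv x *\<^sub>R 1 + e *\<^sub>R (K *\<^sub>R WO 0 x))"
definition "Vp K e x = Atot K e x * s1 + e *\<^sub>R (e *\<^sub>R (K *\<^sub>R WO 1 x))"
definition "Vq K e x = Atot K e x * c1 + e *\<^sub>R (e *\<^sub>R (K *\<^sub>R WO 2 x))"
definition "Vs K e x = Atot K e x * s1 + e *\<^sub>R (e *\<^sub>R (K *\<^sub>R WO 3 x))"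
definition "Yy K x = K *\<^sub>R (WO 0 x - WO 2 x)"
text \<open>For Q = 1 + e V, the series 1 + e \<open>ee\<close> is (4 Q + Q'^2) / 4, the denominator
  of the flux. The minus sign arises because \<open>Vp\<close> evaluates to i times a real function.
  Accordingly \<open>hh\<close> is the inverse of this denominator and e \<open>ff\<close> is (2 Q
  Q'' - Q'^2) \<open>hh\<close>.\<close>

definition "ee K e x = Vv K e x - e *\<^sub>R ((1 / 4) *\<^sub>R (Vp K e x) ^ 2)"
definition "hh K e x = oinv (e *\<^sub>R ee K e x)"
definition "ff K e x = (- 2) *\<^sub>R Vq K e x + e *\<^sub>R ((Vp K e x) ^ 2 * hh K e x * (1 - e *\<^sub>R ((1 / 2) *\<^sub>R Vq K e x)))"
definition "No K e x = Vp K e x * ((vv x *\<^sub>R 1 + e *\<^sub>R Yy K x) * hh K e x - (1 / 4) *\<^sub>R ((Vp K e x) ^ 2 * hh K e x)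
      + (1 / 2) *\<^sub>R ((Vp K e x) ^ 2 * (hh K e x) ^ 2)
      - e *\<^sub>R ((1 / 4) *\<^sub>R ((hh K e x) ^ 2 * (Vp K e x) ^ 2 * Vq K e x))
      + (3 / 16) *\<^sub>R (hh K e x * (ff K e x) ^ 2))
    + Vs K e x * ((1 / 2) *\<^sub>R ((Vp K e x) ^ 2 * hh K e x)
      + e *\<^sub>R (e *\<^sub>R ((1 / 16) *\<^sub>R ((Vp K e x) ^ 4 * (hh K e x) ^ 2))))"

definition "N0 x = vv x *\<^sub>R (At0 x * s1) + (3 / 16) *\<^sub>R (At0 x ^ 3 * (E1 ^ 3 - E1 + F1 - F1 ^ 3))"

lemma E1_F1: "E1 * F1 = 1" by (simp add: E1_def F1_def single_times_single one_wser_single)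

definition XS :: "wser set" where
  "XS = {x \<in> cball 0 (1 / 4). \<forall>n k. coef x (n, - k) = coef x (n, k)}"

lemma bounded_XS: "bounded XS" by (rule bounded_subset[OF bounded_cball[of 0 "1 / 4"]]) (auto simp: XS_def)

lemma norm_XS: "x \<in> XS \<Longrightarrow> norm x \<le> 1 / 4" by (simp add: XS_def)

lemma par_le: "norm (par b i) \<le> 1 * wt i"
proof -
  have "1 \<le> (1 + \<bar>real_of_int (snd i)\<bar>)^2" by (simp add: power2_eq_square algebra_simps)
  hence "1 \<le> wt i" if "fst i = 0" using that by (simp add: wt_def)
  thus ?thesis by (simp add: par_def)
qed

lemma ulip_vv: "ulip XS (\<lambda>e. vv)"
  and ulip_ta: "ulip XS (\<lambda>e. ta)" unfolding vv_def[abs_def] ta_def[abs_def]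
  by (intro ulip_add ulip_const ulip_linear[OF bounded_linear_coef] ulip_id bounded_XS)+

lemma ulip_At0: "ulip XS (\<lambda>e. At0)"
  unfolding At0_def[abs_def] by (intro ulip_add ulip_const ulip_linear[OF bl_PA] ulip_id bounded_XS)

lemma ulip_WO: "j \<le> 3 \<Longrightarrow> ulip XS (\<lambda>e. WO j)" by (intro ulip_linear[OF bl_WO] ulip_id bounded_XS)

lemma ulip_kap: "ulip XS (kap K)" unfolding kap_def[abs_def]
  by (intro ulip_add ulip_diff ulip_scaleR ulip_eps ulip_vv ulip_const ulip_linear[OF bounded_linear_wpair[OF par_le]] ulip_WO) auto

lemma expands_Atot: "expands XS (Atot K) At0"
  using expands_add[OF expands_fixed[OF ulip_At0] expands_eps[OF ulip_scaleR[OF ulip_kap[of K] ulip_const[of _ 1]]]]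
  by (simp add: Atot_def[abs_def])

lemma expands_V:
  shows expands_Vv: "expands XS (Vv K) (\<lambda>x. At0 x * c1)"
    and expands_Vp: "expands XS (Vp K) (\<lambda>x. At0 x * s1)"
    and expands_Vq: "expands XS (Vq K) (\<lambda>x. At0 x * c1)"
    and expands_Vs: "expands XS (Vs K) (\<lambda>x. At0 x * s1)"
proof -
  have *: "expands XS (\<lambda>e x. Atot K e x * c + e *\<^sub>R G e x) (\<lambda>x. At0 x * c)" if "ulip XS G" for c G
    using expands_add[OF expands_mult[OF expands_Atot[of K] expands_const[of _ c]] expands_eps[OF that]] by simp
  show "expands XS (Vv K) (\<lambda>x. At0 x * c1)" unfolding Vv_def[abs_def]
    by (intro * ulip_add ulip_scaleR ulip_eps ulip_vv ulip_const ulip_WO) auto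
  show "expands XS (Vp K) (\<lambda>x. At0 x * s1)" unfolding Vp_def[abs_def]
    by (intro * ulip_add ulip_scaleR ulip_eps ulip_vv ulip_const ulip_WO) auto
  show "expands XS (Vq K) (\<lambda>x. At0 x * c1)" unfolding Vq_def[abs_def]
    by (intro * ulip_add ulip_scaleR ulip_eps ulip_vv ulip_const ulip_WO) auto
  show "expands XS (Vs K) (\<lambda>x. At0 x * s1)" unfolding Vs_def[abs_def]
    by (intro * ulip_add ulip_scaleR ulip_eps ulip_vv ulip_const ulip_WO) auto
qed

lemmas ulip_V = expands_V[THEN expands_ulip]

lemma ulip_ee: "ulip XS (ee K)" unfolding ee_def[abs_def] by (intro ulip_diff ulip_scaleR ulip_eps ulip_const ulip_power ulip_V)

lemma expands_hh: "expands XS (hh K) (\<lambda>x. 1)" unfolding hh_def[abs_def] by (rule expands_oinv[OF ulip_ee])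

lemma expands_ff: "expands XS (ff K) (\<lambda>x. (- 2) *\<^sub>R (At0 x * c1) + 0)" unfolding ff_def[abs_def]
  by (intro expands_add expands_scaleR expands_const expands_Vq expands_eps ulip_mult ulip_power ulip_diff
      ulip_scaleR ulip_V ulip_eps ulip_const expands_ulip[OF expands_hh])

text \<open>At e = 0 the inverse \<open>hh\<close> becomes 1 and \<open>ff\<close> becomes -2 A c1.
  The remaining cubic combination of s1 and c1 collapses by \<open>E1 * F1 = 1\<close> to the modes
  1 and 3.\<close>

lemma expands_No: "expands XS (No K) N0"
proof -
  have Y: "ulip XS (\<lambda>e. Yy K)" unfolding Yy_def[abs_def] by (intro ulip_scaleR ulip_const ulip_diff ulip_WO) auto
  have "expands XS (No K) (\<lambda>x. (At0 x * s1) * ((vv x *\<^sub>R 1 + 0) * 1 - (1 / 4) *\<^sub>R ((At0 x * s1) ^ 2 * 1)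
      + (1 / 2) *\<^sub>R ((At0 x * s1) ^ 2 * 1 ^ 2) - 0
      + (3 / 16) *\<^sub>R (1 * ((- 2) *\<^sub>R (At0 x * c1) + 0) ^ 2))
    + (At0 x * s1) * ((1 / 2) *\<^sub>R ((At0 x * s1) ^ 2 * 1) + 0))" unfolding No_def[abs_def]
    by (intro expands_add expands_diff expands_mult expands_scaleR expands_power expands_const expands_Vp expands_Vs
        expands_hh expands_ff expands_fixed[OF ulip_vv] expands_eps ulip_scaleR ulip_eps ulip_const ulip_mult ulip_power
        ulip_V expands_ulip[OF expands_hh] Y)
  also have "(\<lambda>x. (At0 x * s1) * ((vv x *\<^sub>R 1 + 0) * 1 - (1 / 4) *\<^sub>R ((At0 x * s1) ^ 2 * 1)
      + (1 / 2) *\<^sub>R ((At0 x * s1) ^ 2 * 1 ^ 2) - 0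
      + (3 / 16) *\<^sub>R (1 * ((- 2) *\<^sub>R (At0 x * c1) + 0) ^ 2))
    + (At0 x * s1) * ((1 / 2) *\<^sub>R ((At0 x * s1) ^ 2 * 1) + 0)) = N0"
  proof
    fix x
    define A where "A = At0 x"
    have two: "y * 2 = 2 *\<^sub>R y" for y :: wser by (simp add: scaleR_2 mult_2_right)
    have "A * s1 * ((1 / 4) *\<^sub>R (A * s1)\<^sup>2 + (3 / 4) *\<^sub>R (A * c1)\<^sup>2) + A * s1 * (1 / 2) *\<^sub>R (A * s1)\<^sup>2
      = (3 / 4) *\<^sub>R (A ^ 3 * (s1 * (s1 ^ 2 + c1 ^ 2)))"
      by (simp add: power2_eq_square power3_eq_cube algebra_simps scaleR_left_distrib[symmetric])
    also have "s1 ^ 2 + c1 ^ 2 = (1 / 2) *\<^sub>R (E1 ^ 2 + F1 ^ 2)"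
      by (simp add: s1_def c1_def power2_eq_square algebra_simps scaleR_left_distrib[symmetric] two)
    also have "s1 * \<dots> = (1 / 4) *\<^sub>R (E1 ^ 3 - (E1 * F1) * E1 + (E1 * F1) * F1 - F1 ^ 3)"
      by (simp add: s1_def power2_eq_square power3_eq_cube algebra_simps)
    finally have *: "A * s1 * ((1 / 4) *\<^sub>R (A * s1)\<^sup>2 + (3 / 4) *\<^sub>R (A * c1)\<^sup>2) + A * s1 * (1 / 2) *\<^sub>R (A * s1)\<^sup>2
      = (3 / 16) *\<^sub>R (A ^ 3 * (E1 ^ 3 - E1 + F1 - F1 ^ 3))" by (simp add: E1_F1)
    have "A * s1 * (vv x *\<^sub>R 1 - (1 / 4) *\<^sub>R (A * s1)\<^sup>2 + (1 / 2) *\<^sub>R (A * s1)\<^sup>2 + (3 / 16) *\<^sub>R ((- 2) *\<^sub>R (A * c1))\<^sup>2)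
       + A * s1 * (1 / 2) *\<^sub>R (A * s1)\<^sup>2 = vv x *\<^sub>R (A * s1)
       + (A * s1 * ((1 / 4) *\<^sub>R (A * s1)\<^sup>2 + (3 / 4) *\<^sub>R (A * c1)\<^sup>2) + A * s1 * (1 / 2) *\<^sub>R (A * s1)\<^sup>2)"
      by (simp add: power2_eq_square algebra_simps scaleR_left_distrib[symmetric] two)
    thus "A * s1 * ((vv x *\<^sub>R 1 + 0) * 1 - (1 / 4) *\<^sub>R ((A * s1) ^ 2 * 1)
      + (1 / 2) *\<^sub>R ((A * s1) ^ 2 * 1 ^ 2) - 0
      + (3 / 16) *\<^sub>R (1 * ((- 2) *\<^sub>R (A * c1) + 0) ^ 2))
      + (A * s1) * ((1 / 2) *\<^sub>R ((A * s1) ^ 2 * 1) + 0) = N0 x" unfolding * N0_def A_def[symmetric] by simp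
  qed
  finally show ?thesis .
qed

lemma flip_At0: "flip (At0 x) = At0 x"
proof -
  have "flip (PA x) = PA x" by (rule wser_eqI) (auto simp: coef_PA modeA_def)
  thus ?thesis by (simp add: At0_def flip_add flip_one zz_def flip_single)
qed

lemma flip_WO:
  assumes "x \<in> XS" "j \<le> 3"
  shows "flip (WO j x) = (- 1) ^ j *\<^sub>R WO j x"
proof (rule wser_eqI, clarify)
  fix n k
  have "coef x (n, - k) = coef x (n, k)" using assms by (simp add: XS_def)
  moreover have "modeW j (n, - k) = (- 1) ^ j * modeW j (n, k)" by (auto simp: modeW_def power_minus[of "real_of_int k"])
  ultimately show "coef (flip (WO j x)) (n, k) = coef ((- 1) ^ j *\<^sub>R WO j x) (n, k)" by (simp add: coef_WO[OF assms(2)])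
qed

text \<open>Parity count: \<open>Vp\<close> and \<open>Vs\<close> are odd under reflection, all
  other ingredients are even, and every term of \<open>No\<close> contains an odd number of odd
  factors.\<close>

lemma flip_No:
  assumes x: "x \<in> XS" and "norm (e *\<^sub>R ee K e x) \<le> 1 / 2"
  shows "flip (No K e x) = - No K e x"
proof -
  have W: "flip (WO 0 x) = WO 0 x" "flip (WO 1 x) = - WO 1 x" "flip (WO 2 x) = WO 2 x" "flip (WO 3 x) = - WO 3 x"
    using flip_WO[OF x, of 0] flip_WO[OF x, of 1] flip_WO[OF x, of 2] flip_WO[OF x, of 3] by simp_all
  have c: "flip c1 = c1" "flip s1 = - s1"
    by (simp_all add: c1_def s1_def E1_def F1_def flip_scaleR flip_add flip_diff flip_single add.commute scaleR_right_diff_distrib)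
  have A: "flip (Atot K e x) = Atot K e x" by (simp add: Atot_def flip_add flip_scaleR flip_one flip_At0)
  have V: "flip (Vv K e x) = Vv K e x" "flip (Vp K e x) = - Vp K e x" "flip (Vq K e x) = Vq K e x" "flip (Vs K e x) = - Vs K e x"
    by (simp_all add: Vv_def Vp_def Vq_def Vs_def flip_add flip_mult flip_scaleR flip_one A c W W[unfolded One_nat_def])
  have "flip (ee K e x) = ee K e x" by (simp add: ee_def flip_diff flip_scaleR flip_power V)
  hence h: "flip (hh K e x) = hh K e x" unfolding hh_def using flip_oinv[OF assms(2)] by (simp add: flip_scaleR)
  have f: "flip (ff K e x) = ff K e x" by (simp add: ff_def flip_add flip_diff flip_scaleR flip_mult flip_power flip_one V h)
  have Y: "flip (Yy K x) = Yy K x" by (simp add: Yy_def flip_diff flip_scaleR W)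
  show ?thesis by (simp add: No_def flip_add flip_diff flip_scaleR flip_mult flip_power flip_one V h f Y)
qed

definition "bb x = zz + PA x"

lemma coef_bb: "coef (bb x) (n, k) = (if k \<noteq> 0 \<or> n = 0 then 0 else if n = 1 then 1 else coef x (n, 0))"
  by (auto simp: bb_def zz_def coef_PA modeA_def)

lemma At0_bb: "At0 x = 1 + bb x" by (simp add: At0_def bb_def)

lemma coef_At0: "coef (At0 x) (n, k) = (if k \<noteq> 0 then 0 else if n \<le> 1 then 1 else coef x (n, 0))"
  by (auto simp: At0_bb coef_bb zero_prod_def)

lemma coef_times_kzero:
  assumes "\<And>n k. k \<noteq> 0 \<Longrightarrow> coef f (n, k) = 0" "\<And>n k. k \<noteq> 0 \<Longrightarrow> coef g (n, k) = 0" "k \<noteq> 0"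
  shows "coef (f * g) (n, k) = 0"
proof -
  have "coef f a * shift (coef g) (n, k) a = 0" for a using assms by (cases a, cases "snd a = 0") (auto simp: shift_def)
  thus ?thesis unfolding coef_times conv_def by (intro infsum_0) blast
qed

lemma coef_times_nzero:
  assumes "\<And>k. coef f (0, k) = 0" "\<And>k. coef g (0, k) = 0" "n \<le> 1"
  shows "coef (f * g) (n, k) = 0"
proof -
  have "coef f a * shift (coef g) (n, k) a = 0" for a
  proof (cases "fst a = 0")
    case True thus ?thesis using assms(1)[of "snd a"] by (cases a) simp
  next
    case False
    hence "shift (coef g) (n, k) a = 0" using assms(2,3) by (cases "fst a = n") (auto simp: shift_def)
    thus ?thesis by simp
  qed
  thus ?thesis unfolding coef_times conv_def by (intro infsum_0) blast
qed

text \<open>The quadratic and cubic part of (3/8) (1 + b)^3 for b = \<open>bb x\<close>. It starts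
  at order z^2 and so leaves the two equations that determine v and t untouched.\<close>

definition "ww x = (9 / 8) *\<^sub>R (bb x * bb x) + (3 / 8) *\<^sub>R (bb x * bb x * bb x)"

lemma coef_ww_low: "n \<le> 1 \<Longrightarrow> coef (ww x) (n, k) = 0"
proof -
  assume n: "n \<le> 1"
  have 0: "coef (bb x) (0, k) = 0" for k by (simp add: coef_bb)
  have 2: "coef (bb x * bb x) (m, k) = 0" if "m \<le> 1" for m k by (rule coef_times_nzero[OF 0 0 that])
  hence "coef (bb x * bb x * bb x) (n, k) = 0" by (intro coef_times_nzero[OF _ 0 n]) simp
  thus ?thesis using 2[OF n] by (simp add: ww_def)
qed

text \<open>Up to the factor -2, mode 1 of \<open>N0\<close> is (3/8) A^3 - v A. Expanded about A =
  1, order z^0 determines v, order z^1 determines t = 9/8 - v, and the higher orders determine the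
  coefficients of A.\<close>

lemma coef_N0_1:
  "- 2 * coef (N0 x) (n, 1) = (if n = 0 then 3 / 8 - vv x else (9 / 8 - vv x) * coef (At0 x) (n, 0)) + coef (ww x) (n, 0)"
proof -
  have kA: "coef (At0 x) (n, k) = 0" if "k \<noteq> 0" for n k using that by (simp add: coef_At0)
  have kA2: "coef (At0 x * At0 x) (n, k) = 0" if "k \<noteq> 0" for n k by (rule coef_times_kzero[OF kA kA that])
  have kA3: "coef (At0 x ^ 3) (n, k) = 0" if "k \<noteq> 0" for n k unfolding power3_eq_cube by (rule coef_times_kzero[OF kA2 kA that])
  have E3: "E1 ^ 3 = single 0 3" "F1 ^ 3 = single 0 (- 3)" by (simp_all add: power3_eq_cube E1_def F1_def single_times_single)
  have "coef (N0 x) (n, 1) = vv x * ((1 / 2) * coef (At0 x) (n, 0)) - (3 / 16) * coef (At0 x ^ 3) (n, 0)" unfolding N0_def s1_def E3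
    by (simp add: ring_distribs scaleR_right_diff_distrib E1_def F1_def coef_times_single0 kA kA3 right_diff_distrib)
  moreover have A3: "(3 / 8) *\<^sub>R At0 x ^ 3 = (3 / 8) *\<^sub>R 1 + (9 / 8) *\<^sub>R bb x + ww x"
  proof -
    have "At0 x ^ 3 = 1 + (bb x + bb x + bb x) + (bb x * bb x + bb x * bb x + bb x * bb x) + bb x * bb x * bb x"
      unfolding At0_bb power3_eq_cube by (simp add: algebra_simps)
    thus ?thesis by (simp add: ww_def scaleR_right_distrib scaleR_left_distrib[symmetric])
  qed
  have "(3 / 8) * coef (At0 x ^ 3) (n, 0) = (3 / 8) * (if n = 0 then 1 else 0) + (9 / 8) * coef (bb x) (n, 0) + coef (ww x) (n, 0)"
    using arg_cong[OF A3, of "\<lambda>f. coef f (n, 0)"] by (auto simp: zero_prod_def)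
  ultimately show ?thesis by (auto simp: coef_bb coef_At0 field_simps)
qed

lemma norm_bb: "x \<in> XS \<Longrightarrow> norm (bb x) \<le> 5 / 4"
proof -
  assume x: "x \<in> XS"
  have "norm (bb x) \<le> norm zz + norm (PA x)" unfolding bb_def by (rule norm_triangle_ineq)
  also have "norm zz = 1" by (simp add: zz_def norm_single wt_def)
  also have "norm (PA x) \<le> norm x" using multop(2)[where m = modeA, OF modeA_le, where f = x] by simp
  finally show ?thesis using norm_XS[OF x] by simp
qed

text \<open>Every product of two factors gains 1/64 because \<open>bb\<close> has no term at z^0.
  For the Lipschitz bound the factor \<open>bb x - bb y\<close>, which vanishes at z^0 as well, is
  split off.\<close>

lemma norm_ww: "x \<in> XS \<Longrightarrow> norm (ww x) \<le> 1 / 24"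
  and norm_ww_diff: "x \<in> XS \<Longrightarrow> y \<in> XS \<Longrightarrow> norm (ww x - ww y) \<le> 2 / 27 * norm (x - y)"
proof -
  have z: "coef (bb x) (0, k) = 0" for x k by (simp add: coef_bb)
  have z2: "coef (bb x * bb y) (0, k) = 0" for x y k by (rule coef_times_nzero[OF z z]) simp
  have n2: "norm (bb x * bb y) \<le> 25 / 1024" if "x \<in> XS" "y \<in> XS" for x y
  proof -
    have "norm (bb x * bb y) \<le> norm (bb x) * norm (bb y) / 64" by (rule norm_times_positive_support[OF z z])
    also have "\<dots> \<le> (5 / 4) * (5 / 4) / 64" using that by (intro divide_right_mono mult_mono norm_bb) auto
    finally show ?thesis by simp
  qed
  {
    assume x: "x \<in> XS"
    have "norm (bb x * bb x * bb x) \<le> 25 / 1024 * (5 / 4)" using norm_mult_ineq[of "bb x * bb x" "bb x"] n2[OF x x] norm_bb[OF x]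
      by (smt (verit) mult_mono norm_ge_zero)
    thus "norm (ww x) \<le> 1 / 24" unfolding ww_def using n2[OF x x] by (intro norm_triangle_le) (auto simp: field_simps)
  }
  assume x: "x \<in> XS" and y: "y \<in> XS"
  define d where "d = bb x - bb y"
  have d: "norm d \<le> norm (x - y)"
  proof -
    have "d = PA (x - y)" by (simp add: d_def bb_def multop_diff[OF modeA_le])
    thus ?thesis using multop(2)[where m = modeA, OF modeA_le, where f = "x - y"] by simp
  qed
  have dz: "coef d (0, k) = 0" for k by (simp add: d_def z)
  define s where "s = (9 / 8) *\<^sub>R (bb x + bb y) + (3 / 8) *\<^sub>R (bb x * bb x + bb x * bb y + bb y * bb y)"
  have sz: "coef s (0, k) = 0" for k by (simp add: s_def z z2)
  have eq: "ww x - ww y = d * s" by (simp add: ww_def d_def s_def algebra_simps)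
  have "norm s \<le> (9 / 8) * (5 / 4 + 5 / 4) + (3 / 8) * (25 / 1024 + 25 / 1024 + 25 / 1024)"
  proof -
    have 1: "norm (bb x + bb y) \<le> 5 / 4 + 5 / 4" by (intro norm_triangle_mono norm_bb x y)
    have 2: "norm (bb x * bb x + bb x * bb y + bb y * bb y) \<le> 25 / 1024 + 25 / 1024 + 25 / 1024"
      by (intro norm_triangle_mono n2 x y)
    show ?thesis unfolding s_def using 1 2 by (intro norm_triangle_mono) auto
  qed
  hence s: "norm s \<le> 2 / 27 * 64" by simp
  have "norm (ww x - ww y) \<le> norm d * norm s / 64" unfolding eq by (rule norm_times_positive_support[OF dz sz])
  also have "\<dots> \<le> norm (x - y) * (2 / 27 * 64) / 64" by (intro divide_right_mono mult_mono d s) auto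
  finally show "norm (ww x - ww y) \<le> 2 / 27 * norm (x - y)" by simp
qed

lemma ta_bounds:
  assumes "x \<in> XS"
  shows "ta x \<ge> 1 / 2" "ta x \<le> 1" using wt_coef_le_norm[of "(1, 0)" x] norm_XS[OF assms] by (auto simp: ta_def wt_def)

lemma ta_diff: "\<bar>ta x - ta y\<bar> \<le> norm (x - y)" using wt_coef_le_norm[of "(1, 0)" "x - y"] by (simp add: ta_def wt_def)

lemma inverse_ta_diff:
  assumes "x \<in> XS" "y \<in> XS"
  shows "\<bar>1 / ta x - 1 / ta y\<bar> \<le> 4 * norm (x - y)"
proof -
  have t: "ta x \<ge> 1 / 2" "ta y \<ge> 1 / 2" using ta_bounds assms by auto
  have "1 / ta x - 1 / ta y = (ta y - ta x) * ((1 / ta x) * (1 / ta y))" using t by (simp add: field_simps)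
  hence "\<bar>1 / ta x - 1 / ta y\<bar> = \<bar>ta x - ta y\<bar> * ((1 / ta x) * (1 / ta y))" using t by (simp add: abs_mult)
  also have "\<dots> \<le> norm (x - y) * (2 * 2)" using t ta_diff[of x y] by (intro mult_mono) (auto simp: field_simps)
  finally show ?thesis by simp
qed

lemma ulip_inverse_ta: "ulip XS (\<lambda>e x. 1 / ta x)"
proof (rule ulipI[where d = 1 and L = 2 and L' = 4])
  fix x assume "x \<in> XS"
  thus "norm (1 / ta x) \<le> 2" using ta_bounds[of x] by (simp add: field_simps)
qed (use inverse_ta_diff in auto)

text \<open>At order z^n the linear part of the amplitude equation is t n - t = t (n - 1). The
  resonant order n = 1 is left out; it fixes t instead of a coefficient of A.\<close>

definition m2 :: "nat \<times> int \<Rightarrow> real" where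
  "m2 i = (if snd i = 0 \<and> fst i \<ge> 2 then 1 / (real (fst i) - 1) else 0)"

lemma m2_le: "\<bar>m2 i\<bar> \<le> 1" by (auto simp: m2_def field_simps)

text \<open>Solution operator for the modes |k| >= 2. In the denominator n e^2 t comes from the time
  derivative and k^4 - k^2 from the linearised flow. In the numerator one factor k is the divergence
  of the flux and |k|^3 the passage from W to its third derivative.\<close>

definition m3 :: "real \<Rightarrow> real \<Rightarrow> nat \<times> int \<Rightarrow> real" where
  "m3 e t i = (if \<bar>snd i\<bar> \<ge> 2 then \<bar>of_int (snd i)\<bar> ^ 3 * of_int (snd i) /
     (real (fst i) * e^2 * t + (of_int (snd i) ^ 4 - of_int (snd i) ^ 2)) else 0)"

lemma k4_k2:
  assumes "\<bar>k\<bar> \<ge> (2 :: int)"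
  shows "(real_of_int k ^ 4 - of_int k ^ 2) > 0" "real_of_int k ^ 4 \<le> 4 / 3 * (of_int k ^ 4 - of_int k ^ 2)"
    "\<bar>real_of_int k\<bar> ^ 3 * \<bar>of_int k\<bar> = of_int k ^ 4"
proof -
  have k: "\<bar>real_of_int k\<bar> \<ge> 2" using assms by linarith
  hence k2: "real_of_int k ^ 2 \<ge> 4" using power_mono[OF k, of 2] by simp
  have "real_of_int k ^ 4 = of_int k ^ 2 * of_int k ^ 2" by (simp flip: power_add)
  moreover have "real_of_int k ^ 2 * of_int k ^ 2 \<ge> 4 * of_int k ^ 2" using k2 by (intro mult_right_mono) auto
  ultimately show "(real_of_int k ^ 4 - of_int k ^ 2) > 0" "real_of_int k ^ 4 \<le> 4 / 3 * (of_int k ^ 4 - of_int k ^ 2)"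
    using k2 by auto
  show "\<bar>real_of_int k\<bar> ^ 3 * \<bar>of_int k\<bar> = of_int k ^ 4" using power_add[of "\<bar>real_of_int k\<bar>" 3 1] by simp
qed

text \<open>Since k^2 >= 4, one has k^4 <= (4/3) (k^4 - k^2), so the bound is uniform in n, e and
  t.\<close>

lemma m3_le: "t \<ge> 0 \<Longrightarrow> \<bar>m3 e t i\<bar> \<le> 4 / 3"
proof -
  assume t: "t \<ge> 0"
  define k D where "k = snd i" and "D = real (fst i) * e^2 * t"
  have D: "D \<ge> 0" using t by (simp add: D_def)
  show ?thesis
  proof (cases "\<bar>k\<bar> \<ge> 2")
    case True
    note k = k4_k2[OF True]
    have "\<bar>m3 e t i\<bar> = of_int k ^ 4 / (D + (of_int k ^ 4 - of_int k ^ 2))"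
      using True D k by (simp add: m3_def k_def D_def abs_mult abs_divide)
    also have "\<dots> \<le> 4 / 3" using D k by (simp add: divide_le_eq)
    finally show ?thesis .
  qed (simp add: m3_def k_def)
qed

text \<open>The factor M = n e^2 is unbounded, but differentiation in t only produces M / (M t' +
  \<mu>), which is at most 2 for t' >= 1/2.\<close>

lemma m3_diff:
  assumes "t \<ge> 1 / 2" "t' \<ge> 1 / 2"
  shows "\<bar>m3 e t i - m3 e t' i\<bar> \<le> 8 / 3 * \<bar>t - t'\<bar>"
proof -
  define k M where "k = snd i" and "M = real (fst i) * e^2"
  have M: "M \<ge> 0" by (simp add: M_def)
  show ?thesis
  proof (cases "\<bar>k\<bar> \<ge> 2")
    case True
    note k = k4_k2[OF True]
    define \<mu> where "\<mu> = real_of_int k ^ 4 - of_int k ^ 2"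
    have \<mu>: "\<mu> > 0" using k by (simp add: \<mu>_def)
    have p: "M * t + \<mu> > 0" "M * t' + \<mu> > 0" using M \<mu> assms by (auto intro: add_nonneg_pos)
    have "m3 e t i - m3 e t' i = \<bar>of_int k\<bar> ^ 3 * of_int k * (1 / (M * t + \<mu>) - 1 / (M * t' + \<mu>))"
      using True by (simp add: m3_def k_def[symmetric] M_def[symmetric] \<mu>_def[symmetric] right_diff_distrib)
    also have "1 / (M * t + \<mu>) - 1 / (M * t' + \<mu>) = (1 / (M * t + \<mu>)) * (M / (M * t' + \<mu>)) * (t' - t)"
      using p by (simp add: field_simps)
    finally have "\<bar>m3 e t i - m3 e t' i\<bar> = (of_int k ^ 4 / (M * t + \<mu>)) * (M / (M * t' + \<mu>)) * \<bar>t - t'\<bar>"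
      using p M k(3) by (simp add: abs_mult abs_divide abs_minus_commute)
    also have "\<dots> \<le> (4 / 3) * 2 * \<bar>t - t'\<bar>"
    proof (intro mult_right_mono mult_mono)
      show "of_int k ^ 4 / (M * t + \<mu>) \<le> 4 / 3"
      proof -
        have "M * t \<ge> 0" using M assms by simp
        thus ?thesis using k(2) p by (simp add: divide_le_eq \<mu>_def[symmetric] distrib_left)
      qed
      have "M \<le> 2 * (M * t')" using M assms mult_left_mono[of "1 / 2" t' M] by simp
      thus "M / (M * t' + \<mu>) \<le> 2" using p \<mu> by (simp add: divide_le_eq)
    qed (use p M in auto)
    finally show ?thesis by simp
  qed (simp add: m3_def k_def)
qed

lemma norm_multop_diff_le:
  assumes "\<And>i. \<bar>m i - m' i\<bar> \<le> C" "\<And>i. \<bar>m i\<bar> \<le> D" "\<And>i. \<bar>m' i\<bar> \<le> D"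
  shows "norm (multop m f - multop m' f) \<le> C * norm f"
proof -
  have "multop m f - multop m' f = multop (\<lambda>i. m i - m' i) f"
    by (rule wser_eqI) (simp add: multop(1)[OF assms(1)] multop(1)[OF assms(2)] multop(1)[OF assms(3)] left_diff_distrib)
  thus ?thesis using multop(2)[OF assms(1), where f = f] by simp
qed

lemma closed_XS: "closed XS"
proof -
  have "XS = cball 0 (1 / 4) \<inter> (\<Inter>n. \<Inter>k. {x. coef x (n, - k) = coef x (n, k)})" by (auto simp: XS_def)
  moreover have "closed {x. coef x (n, - k) = coef x (n, k)}" for n k
    by (intro closed_Collect_eq linear_continuous_on bounded_linear_coef)
  ultimately show ?thesis by (metis (no_types, lifting) closed_INT closed_Int closed_cball)
qed

text \<open>The flow equation sorted by modes: the first family is k = 1 and the second is |k| >= 2.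
  Mode -1 follows by symmetry, and mode 0 expresses conservation of the mean of r^2, which is built
  into the ansatz.\<close>

definition "modal_solution K e x \<longleftrightarrow> x \<in> XS \<and> norm (e *\<^sub>R ee K e x) \<le> 1 / 2 \<and>
       (\<forall>n. ta x * real n * coef (At0 x) (n, 0) = - 2 * coef (No K e x) (n, 1)) \<and>
       (\<forall>n k. \<bar>k\<bar> \<ge> 2 \<longrightarrow> K * (real n * e^2 * ta x + (of_int k ^ 4 - of_int k ^ 2)) * coef x (n, k) =
          - (\<bar>of_int k\<bar> ^ 3 * of_int k * coef (No K e x) (n, k)))"

theorem fixed_point:
  obtains K e0 :: real where "K > 0" "e0 > 0"
    "\<And>e. e \<noteq> 0 \<Longrightarrow> \<bar>e\<bar> \<le> e0 \<Longrightarrow> \<exists>x. modal_solution K e x"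
proof -
  have "ulip XS (\<lambda>e. N0)" using expands_No[of 1] by (simp add: expands_def)
  then obtain L0 where L0: "L0 \<ge> 0" "\<And>x. x \<in> XS \<Longrightarrow> norm (N0 x) \<le> L0"
    "\<And>x y. x \<in> XS \<Longrightarrow> y \<in> XS \<Longrightarrow> norm (N0 x - N0 y) \<le> L0 * norm (x - y)" by (rule ulipE) (metis abs_zero less_imp_le)
  \<comment> \<open>\<open>N0\<close> does not depend on K, so the bound L0 is available before K is
    chosen. Dividing by a large K then makes the slaved modes small in norm.\<close>
  define K where "K = 64 * (L0 + 1)"
  have K: "K > 0" using L0 by (simp add: K_def)
  obtain G d where d: "d > 0" and G: "ulip XS G"
    and NG: "\<And>e x. \<bar>e\<bar> \<le> d \<Longrightarrow> x \<in> XS \<Longrightarrow> No K e x = N0 x + e *\<^sub>R G e x" using expands_No[of K] unfolding expands_def by blast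
  obtain LG dG where LG: "LG \<ge> 0" "dG > 0" "\<And>e x. \<bar>e\<bar> \<le> dG \<Longrightarrow> x \<in> XS \<Longrightarrow> norm (G e x) \<le> LG"
    "\<And>e x y. \<bar>e\<bar> \<le> dG \<Longrightarrow> x \<in> XS \<Longrightarrow> y \<in> XS \<Longrightarrow> norm (G e x - G e y) \<le> LG * norm (x - y)" using G by (rule ulipE) blast
  define r where "r n g = - 2 * coef g (n, 1)" for n :: nat and g
  \<comment> \<open>The contribution of the remainder e G to the slots with k = 0: orders 0 and 1
    correct v and t, and the higher orders are solved with \<open>m2\<close>.\<close>
  define H where "H e x = (r 0 (G e x)) *\<^sub>R 1 + (r 1 (G e x) - r 0 (G e x)) *\<^sub>R zz
      + (1 / ta x) *\<^sub>R multop m2 ((- 2) *\<^sub>R (G e x * F1) - r 1 (G e x) *\<^sub>R PA x)" for e x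
  have rl: "bounded_linear (r n)" for n unfolding r_def by (intro bounded_linear_const_mult bounded_linear_coef)
  have "ulip XS H" unfolding H_def[abs_def] by (intro ulip_add ulip_diff ulip_scaleR ulip_const ulip_linear[OF rl] G ulip_inverse_ta
        ulip_linear[OF bounded_linear_multop[OF m2_le]] ulip_mult ulip_linear[OF bl_PA] ulip_id bounded_XS)
  then obtain LH dH where LH: "LH \<ge> 0" "dH > 0" "\<And>e x. \<bar>e\<bar> \<le> dH \<Longrightarrow> x \<in> XS \<Longrightarrow> norm (H e x) \<le> LH"
    "\<And>e x y. \<bar>e\<bar> \<le> dH \<Longrightarrow> x \<in> XS \<Longrightarrow> y \<in> XS \<Longrightarrow> norm (H e x - H e y) \<le> LH * norm (x - y)" by (rule ulipE) blast
  obtain dE where dE: "dE > 0" "\<And>e x. \<bar>e\<bar> \<le> dE \<Longrightarrow> x \<in> XS \<Longrightarrow> norm (e *\<^sub>R ee K e x) \<le> 1 / 2"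
    using ulip_oinv(2)[OF ulip_ee[of K]] by blast
  define e0 where "e0 = min (min d dG) (min (min dH dE) (min (1 / (16 * (LH + 1))) (1 / (LG + 1))))"
  have e0: "e0 > 0" using d LG LH dE by (simp add: e0_def)
  have "\<exists>x. modal_solution K e x" if e: "e \<noteq> 0" "\<bar>e\<bar> \<le> e0" for e
  proof -
    have le: "\<bar>e\<bar> \<le> d" "\<bar>e\<bar> \<le> dG" "\<bar>e\<bar> \<le> dH" "\<bar>e\<bar> \<le> dE" "\<bar>e\<bar> \<le> 1 / (16 * (LH + 1))" "\<bar>e\<bar> \<le> 1 / (LG + 1)"
      using e by (auto simp: e0_def)
    have eLH: "\<bar>e\<bar> * LH \<le> 1 / 16"
    proof -
      have "\<bar>e\<bar> * LH \<le> 1 / (16 * (LH + 1)) * LH" using le LH by (intro mult_right_mono) auto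
      also have "\<dots> \<le> 1 / 16" using LH by (simp add: field_simps)
      finally show ?thesis .
    qed
    have eLG: "\<bar>e\<bar> * LG \<le> 1"
    proof -
      have "\<bar>e\<bar> * LG \<le> 1 / (LG + 1) * LG" using le LG by (intro mult_right_mono) auto
      also have "\<dots> \<le> 1" using LG by (simp add: field_simps)
      finally show ?thesis .
    qed
    have No: "norm (No K e x) \<le> L0 + 1" if "x \<in> XS" for x
    proof -
      have "norm (No K e x) \<le> norm (N0 x) + norm (e *\<^sub>R G e x)" unfolding NG[OF le(1) that] by (rule norm_triangle_ineq)
      also have "norm (e *\<^sub>R G e x) \<le> \<bar>e\<bar> * LG" using LG(3)[OF le(2) that] by (simp add: mult_left_mono)
      finally show ?thesis using L0(2)[OF that] eLG by simp
    qed
    have NoL: "norm (No K e x - No K e y) \<le> (L0 + 1) * norm (x - y)" if "x \<in> XS" "y \<in> XS" for x y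
    proof -
      have "No K e x - No K e y = (N0 x - N0 y) + e *\<^sub>R (G e x - G e y)" using NG[OF le(1)] that by (simp add: algebra_simps)
      hence "norm (No K e x - No K e y) \<le> norm (N0 x - N0 y) + \<bar>e\<bar> * norm (G e x - G e y)" by (metis norm_triangle_ineq norm_scaleR)
      also have "\<bar>e\<bar> * norm (G e x - G e y) \<le> \<bar>e\<bar> * (LG * norm (x - y))" using LG(4)[OF le(2) that] by (intro mult_left_mono) auto
      also have "\<dots> \<le> 1 * norm (x - y)" unfolding mult.assoc[symmetric] using eLG by (intro mult_right_mono) auto
      finally show ?thesis using L0(3)[OF that] by (simp add: algebra_simps)
    qed
    define M where "M x = (1 / ta x) *\<^sub>R multop m2 (ww x)" for x
    define T3 where "T3 x = (1 / K) *\<^sub>R multop (m3 e (ta x)) (No K e x)" for x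
    \<comment> \<open>The three terms have norms at most 1/16, 1/12 and 1/48, together below the
      radius 1/4, and Lipschitz constants 1/16, 1/3 and 1/16, together below 1/2.\<close>
    define T where "T x = e *\<^sub>R H e x + M x - T3 x" for x
    have tb: "\<bar>1 / ta x\<bar> \<le> 2" "ta x \<ge> 0" if "x \<in> XS" for x using ta_bounds[OF that] by (auto simp: field_simps)
    have M1: "norm (M x) \<le> 1 / 12" if "x \<in> XS" for x
    proof -
      have "norm (M x) = \<bar>1 / ta x\<bar> * norm (multop m2 (ww x))" by (simp add: M_def)
      also have "\<dots> \<le> 2 * (1 / 24)"
        using tb[OF that] norm_ww[OF that] multop(2)[where m = m2, OF m2_le, where f = "ww x"] by (intro mult_mono) auto
      finally show ?thesis by simp
    qed
    have M2: "norm (M x - M y) \<le> 1 / 3 * norm (x - y)" if "x \<in> XS" "y \<in> XS" for x y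
    proof -
      have "M x - M y = (1 / ta x) *\<^sub>R multop m2 (ww x - ww y) + (1 / ta x - 1 / ta y) *\<^sub>R multop m2 (ww y)"
        unfolding multop_diff[OF m2_le, symmetric] by (simp add: M_def algebra_simps)
      also have "norm \<dots> \<le> \<bar>1 / ta x\<bar> * norm (multop m2 (ww x - ww y)) + \<bar>1 / ta x - 1 / ta y\<bar> * norm (multop m2 (ww y))"
        by (rule norm_triangle_le) simp
      also have "\<dots> \<le> 2 * (2 / 27 * norm (x - y)) + (4 * norm (x - y)) * (1 / 24)"
        using tb[OF that(1)] norm_ww_diff[OF that] norm_ww[OF that(2)] inverse_ta_diff[OF that]
          multop(2)[where m = m2, OF m2_le, where f = "ww y"] multop(2)[where m = m2, OF m2_le, where f = "ww x - ww y"]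
        by (intro add_mono mult_mono) auto
      also have "\<dots> \<le> 1 / 3 * norm (x - y)" using norm_ge_zero[of "x - y"] by linarith
      finally show ?thesis .
    qed
    have T31: "norm (T3 x) \<le> 1 / 48" if "x \<in> XS" for x
    proof -
      have "norm (T3 x) = (1 / K) * norm (multop (m3 e (ta x)) (No K e x))" using K by (simp add: T3_def)
      also have "\<dots> \<le> (1 / K) * (4 / 3 * (L0 + 1))"
        using multop(2)[where m = "m3 e (ta x)", OF m3_le[OF tb(2)[OF that], of e], where f = "No K e x"] No[OF that] K
        by (intro mult_left_mono) auto
      also have "\<dots> = 1 / 48" using L0 by (simp add: K_def field_simps)
      finally show ?thesis .
    qed
    have T32: "norm (T3 x - T3 y) \<le> 1 / 16 * norm (x - y)" if xy: "x \<in> XS" "y \<in> XS" for x y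
    proof -
      note mx = m3_le[OF tb(2)[OF xy(1)], of e] and my = m3_le[OF tb(2)[OF xy(2)], of e]
      have "T3 x - T3 y = (1 / K) *\<^sub>R (multop (m3 e (ta x)) (No K e x - No K e y)
          + (multop (m3 e (ta x)) (No K e y) - multop (m3 e (ta y)) (No K e y)))"
        unfolding multop_diff[OF mx, symmetric] by (simp add: T3_def algebra_simps)
      hence "norm (T3 x - T3 y) \<le> (1 / K) * (norm (multop (m3 e (ta x)) (No K e x - No K e y))
          + norm (multop (m3 e (ta x)) (No K e y) - multop (m3 e (ta y)) (No K e y)))"
        using K by (simp add: norm_triangle_ineq divide_right_mono)
      also have "\<dots> \<le> (1 / K) * (4 / 3 * ((L0 + 1) * norm (x - y)) + 8 / 3 * norm (x - y) * (L0 + 1))"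
      proof (intro mult_left_mono add_mono)
        show "norm (multop (m3 e (ta x)) (No K e x - No K e y)) \<le> 4 / 3 * ((L0 + 1) * norm (x - y))"
          using multop(2)[where m = "m3 e (ta x)", OF mx, where f = "No K e x - No K e y"] NoL[OF xy] by simp
        have "norm (multop (m3 e (ta x)) (No K e y) - multop (m3 e (ta y)) (No K e y)) \<le> 8 / 3 * \<bar>ta x - ta y\<bar> * norm (No K e y)"
          by (rule norm_multop_diff_le[OF m3_diff mx my]) (use ta_bounds xy in auto)
        also have "\<dots> \<le> 8 / 3 * norm (x - y) * (L0 + 1)" using ta_diff[of x y] No[OF xy(2)] by (intro mult_mono) auto
        finally show "norm (multop (m3 e (ta x)) (No K e y) - multop (m3 e (ta y)) (No K e y)) \<le> 8 / 3 * norm (x - y) * (L0 + 1)" .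
      qed (use K in auto)
      also have "\<dots> = 1 / 16 * norm (x - y)" using L0 by (simp add: K_def field_simps)
      finally show ?thesis .
    qed
    have "\<exists>!x\<in>XS. T x = x"
    proof (rule Banach_fix[where c = "1 / 2"])
      show "complete XS" using closed_XS by (simp add: complete_eq_closed)
      show "XS \<noteq> {}" by (auto simp: XS_def intro!: exI[of _ 0])
      show "T ` XS \<subseteq> XS"
      proof clarify
        fix x assume x: "x \<in> XS"
        have "norm (e *\<^sub>R H e x) \<le> 1 / 16" using mult_left_mono[OF LH(3)[OF le(3) x], of "\<bar>e\<bar>"] eLH by simp
        hence "norm (T x) \<le> 1 / 16 + 1 / 12 + 1 / 48"
          unfolding T_def using M1[OF x] T31[OF x] norm_triangle_ineq4[of "e *\<^sub>R H e x + M x" "T3 x"]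
            norm_triangle_ineq[of "e *\<^sub>R H e x" "M x"] by linarith
        moreover have "coef (T x) (n, - k) = coef (T x) (n, k)" for n k
        proof -
          have "coef (No K e x) (n, - k) = - coef (No K e x) (n, k)"
            using flip_No[OF x dE(2)[OF le(4) x]] by (metis coef_flip coef_uminus)
          moreover have "m3 e (ta x) (n, - k) = - m3 e (ta x) (n, k)" by (simp add: m3_def)
          ultimately have "coef (T3 x) (n, - k) = coef (T3 x) (n, k)" by (simp add: T3_def multop(1)[OF m3_le[OF tb(2)[OF x]]])
          thus ?thesis by (simp add: T_def M_def H_def multop(1)[OF m2_le] zz_def) (auto simp: m2_def zero_prod_def)
        qed
        ultimately show "T x \<in> XS" by (simp add: XS_def)
      qed
      fix x y assume xy: "x \<in> XS" "y \<in> XS"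
      have "norm (e *\<^sub>R (H e x - H e y)) \<le> 1 / 16 * norm (x - y)"
        using mult_left_mono[OF LH(4)[OF le(3) xy], of "\<bar>e\<bar>"] mult_right_mono[OF eLH, of "norm (x - y)"] by (simp add: mult.assoc)
      moreover have "T x - T y = e *\<^sub>R (H e x - H e y) + (M x - M y) - (T3 x - T3 y)" by (simp add: T_def algebra_simps)
      ultimately have "norm (T x - T y) \<le> 1 / 16 * norm (x - y) + 1 / 3 * norm (x - y) + 1 / 16 * norm (x - y)"
        using M2[OF xy] T32[OF xy] norm_triangle_ineq4[of "e *\<^sub>R (H e x - H e y) + (M x - M y)" "T3 x - T3 y"]
          norm_triangle_ineq[of "e *\<^sub>R (H e x - H e y)" "M x - M y"] by (simp only:)
      thus "dist (T x) (T y) \<le> 1 / 2 * dist x y" using norm_ge_zero[of "x - y"] unfolding dist_norm by linarith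
    qed auto
    then obtain x where x: "x \<in> XS" "T x = x" by blast
    define g where "g = G e x"
    have cT: "coef x i = coef (T x) i" for i using x by simp
    have cT3: "coef (T3 x) (n, k) = (1 / K) * (m3 e (ta x) (n, k) * coef (No K e x) (n, k))" for n k
      by (simp add: T3_def multop(1)[OF m3_le[OF tb(2)[OF x(1)]]])
    have T30: "coef (T3 x) (n, 0) = 0" for n by (simp add: cT3 m3_def)
    have t: "ta x > 0" using ta_bounds[OF x(1)] by simp
    have x0: "coef x (0, 0) = e * r 0 g"
      using cT[of "(0, 0)"] by (simp add: T_def M_def H_def multop(1)[OF m2_le] m2_def zz_def T30 zero_prod_def g_def)
    have x1: "coef x (1, 0) = e * (r 1 g - r 0 g)"
      using cT[of "(1, 0)"] by (simp add: T_def M_def H_def multop(1)[OF m2_le] m2_def zz_def T30 zero_prod_def g_def)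
    have xn: "(real n - 1) * ta x * coef x (n, 0) = coef (ww x) (n, 0) + e * (r n g - r 1 g * coef x (n, 0))" if "n \<ge> 2" for n
    proof -
      have "coef (g * F1) (n, 0) = coef g (n, 1)" by (simp add: F1_def coef_times_single0)
      hence "coef x (n, 0) = (1 / ta x) * ((1 / (real n - 1)) * (coef (ww x) (n, 0) + e * (r n g - r 1 g * coef x (n, 0))))"
        using cT[of "(n, 0)"] that
        by (simp add: T_def M_def H_def multop(1)[OF m2_le] m2_def zz_def T30 zero_prod_def g_def r_def coef_PA modeA_def field_simps)
           (simp add: add_divide_distrib diff_divide_distrib)
      thus ?thesis using t that by (simp add: field_simps)
    qed
    have N1: "- 2 * coef (No K e x) (n, 1) = - 2 * coef (N0 x) (n, 1) + e * r n g" for n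
      using NG[OF le(1) x(1)] by (simp add: r_def g_def)
    have "ta x * real n * coef (At0 x) (n, 0) = - 2 * coef (No K e x) (n, 1)" for n
    proof -
      consider "n = 0" | "n = 1" | "n \<ge> 2" by linarith
      thus ?thesis
      proof cases
        case 1
        thus ?thesis unfolding N1 coef_N0_1 using x0 by (simp add: coef_ww_low vv_def)
      next
        case 2
        thus ?thesis unfolding N1 coef_N0_1 using x0 x1 by (simp add: coef_ww_low vv_def ta_def coef_At0 algebra_simps)
      next
        case 3
        have "coef (ww x) (n, 0) = (real n - 1) * ta x * coef x (n, 0) - e * (r n g - r 1 g * coef x (n, 0))" using xn[OF 3] by simp
        \<comment> \<open>The linear coefficient 9/8 - v agrees with t up to the correction e
          \<open>r 1 g\<close>. This agreement is what reduces n t to (n - 1) t.\<close>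
        moreover have v: "9 / 8 - vv x = ta x - e * r 1 g" using x0 x1 by (simp add: vv_def ta_def algebra_simps)
        ultimately have "ta x * real n * coef x (n, 0) = (9 / 8 - vv x) * coef x (n, 0) + coef (ww x) (n, 0) + e * r n g"
          unfolding v by (simp add: algebra_simps)
        thus ?thesis unfolding N1 coef_N0_1 using 3 by (simp add: coef_At0)
      qed
    qed
    moreover have "K * (real n * e^2 * ta x + (of_int k ^ 4 - of_int k ^ 2)) * coef x (n, k) =
          - (\<bar>of_int k\<bar> ^ 3 * of_int k * coef (No K e x) (n, k))" if k: "\<bar>k\<bar> \<ge> 2" for n k
    proof -
      have D: "real n * e^2 * ta x + (of_int k ^ 4 - of_int k ^ 2) > 0" using k4_k2(1)[OF k] t by (intro add_nonneg_pos) auto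
      have "k \<noteq> 0" using k by auto
      hence "coef x (n, k) = - (1 / K) * (m3 e (ta x) (n, k) * coef (No K e x) (n, k))"
        using cT[of "(n, k)"] by (simp add: T_def M_def H_def multop(1)[OF m2_le] m2_def zz_def cT3 zero_prod_def)
      thus ?thesis using D K k by (simp add: m3_def)
    qed
    ultimately show ?thesis unfolding modal_solution_def using x(1) dE(2)[OF le(4) x(1)] by blast
  qed
  thus thesis using that[OF K e0] by blast
qed

section \<open>Evaluating the series: derivatives in x and z, and multiplicativity\<close>

lemma has_real_derivative_quadratic:
  fixes f :: "real \<Rightarrow> real"
  assumes "d > 0" "\<And>y. \<bar>y - x\<bar> < d \<Longrightarrow> \<bar>f y - f x - D * (y - x)\<bar> \<le> C * (y - x)^2"
  shows "(f has_real_derivative D) (at x)"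
proof -
  have "((\<lambda>y. (f y - f x) / (y - x) - D) \<longlongrightarrow> 0) (at x)"
  proof (rule Lim_null_comparison)
    show "((\<lambda>y. C * \<bar>y - x\<bar>) \<longlongrightarrow> 0) (at x)" by (auto intro!: tendsto_eq_intros)
    show "\<forall>\<^sub>F y in at x. norm ((f y - f x) / (y - x) - D) \<le> C * \<bar>y - x\<bar>" unfolding eventually_at
    proof (intro exI conjI ballI impI)
      fix y assume y: "y \<noteq> x \<and> dist y x < d"
      have "(f y - f x) / (y - x) - D = (f y - f x - D * (y - x)) / (y - x)" using y by (simp add: field_simps)
      hence "norm ((f y - f x) / (y - x) - D) = \<bar>f y - f x - D * (y - x)\<bar> / \<bar>y - x\<bar>" by simp
      also have "\<dots> \<le> C * (y - x)^2 / \<bar>y - x\<bar>" using y assms(2)[of y] by (intro divide_right_mono) (auto simp: dist_real_def)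
      also have "\<dots> = C * \<bar>y - x\<bar>" using y by (simp add: power2_eq_square field_simps flip: abs_mult)
      finally show "norm ((f y - f x) / (y - x) - D) \<le> C * \<bar>y - x\<bar>" .
    qed (rule assms)
  qed
  thus ?thesis by (simp add: DERIV_def LIM_offset_zero_iff[of _ _ x] field_simps has_field_derivative_iff LIM_zero_iff)
qed

lemma cos_lipschitz: "\<bar>cos x - cos y\<bar> \<le> \<bar>x - y\<bar>" and sin_lipschitz: "\<bar>sin x - sin y\<bar> \<le> \<bar>x - y\<bar>" for x y :: real
proof -
  have "norm (cos x - cos y) \<le> 1 * norm (x - y)"
    by (rule field_differentiable_bound[of UNIV _ "\<lambda>x. - sin x"]) (auto intro!: derivative_eq_intros)
  moreover have "norm (sin x - sin y) \<le> 1 * norm (x - y)"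
    by (rule field_differentiable_bound[of UNIV _ cos]) (auto intro!: derivative_eq_intros)
  ultimately show "\<bar>cos x - cos y\<bar> \<le> \<bar>x - y\<bar>" "\<bar>sin x - sin y\<bar> \<le> \<bar>x - y\<bar>" by auto
qed

lemma cos_taylor2: "\<bar>cos y - cos x + sin x * (y - x)\<bar> \<le> (y - x)^2"
  and sin_taylor2: "\<bar>sin y - sin x - cos x * (y - x)\<bar> \<le> (y - x)^2" for x y :: real
proof -
  have mvt: "\<bar>f y - f x - f' x * (y - x)\<bar> \<le> (y - x)^2"
    if f: "\<And>u. (f has_real_derivative f' u) (at u)" and l: "\<And>u v. \<bar>f' u - f' v\<bar> \<le> \<bar>u - v\<bar>" for f f'
  proof -
    have D: "((\<lambda>u. f u - f' x * u) has_real_derivative f' u - f' x) (at u)" for u by (auto intro!: derivative_eq_intros f)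
    have "norm ((f y - f' x * y) - (f x - f' x * x)) \<le> \<bar>y - x\<bar> * norm (y - x)"
    proof (rule field_differentiable_bound[of "closed_segment x y" _ "\<lambda>u. f' u - f' x"])
      fix u assume "u \<in> closed_segment x y"
      hence "\<bar>u - x\<bar> \<le> \<bar>y - x\<bar>" by (auto simp: closed_segment_eq_real_ivl split: if_splits)
      thus "norm (f' u - f' x) \<le> \<bar>y - x\<bar>" using l[of u x] by simp
    qed (auto intro: DERIV_subset[OF D])
    thus ?thesis by (simp add: algebra_simps power2_eq_square flip: abs_mult)
  qed
  have "\<bar>cos y - cos x - (- sin x) * (y - x)\<bar> \<le> (y - x)^2"
    by (rule mvt) (auto intro!: derivative_eq_intros simp: sin_lipschitz abs_minus_commute)
  thus "\<bar>cos y - cos x + sin x * (y - x)\<bar> \<le> (y - x)^2" by simp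
  show "\<bar>sin y - sin x - cos x * (y - x)\<bar> \<le> (y - x)^2" by (rule mvt) (auto intro!: derivative_eq_intros simp: cos_lipschitz)
qed

text \<open>A sequence \<open>\<phi>\<close> takes the place of the powers z^n. Besides z^n this
  covers n z^(n-1), differences of powers and Taylor remainders in z, so that one set of estimates
  yields values, Lipschitz bounds and time derivatives.\<close>

definition admissible :: "real \<Rightarrow> (nat \<Rightarrow> real) \<Rightarrow> bool" where
  "admissible M \<phi> \<longleftrightarrow> M \<ge> 0 \<and> (\<forall>n. \<bar>\<phi> n\<bar> \<le> M * wtn n)"

definition Cf :: "(nat \<Rightarrow> real) \<Rightarrow> wser \<Rightarrow> real \<Rightarrow> real" where
  "Cf \<phi> f x = wpair (\<lambda>i. \<phi> (fst i) * cos (of_int (snd i) * x)) f"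
definition Sf :: "(nat \<Rightarrow> real) \<Rightarrow> wser \<Rightarrow> real \<Rightarrow> real" where
  "Sf \<phi> f x = wpair (\<lambda>i. \<phi> (fst i) * sin (of_int (snd i) * x)) f"
definition Cf1 :: "(nat \<Rightarrow> real) \<Rightarrow> wser \<Rightarrow> real \<Rightarrow> real" where
  "Cf1 \<phi> f x = wpair (\<lambda>i. \<phi> (fst i) * (of_int (snd i) * cos (of_int (snd i) * x))) f"
definition Sf1 :: "(nat \<Rightarrow> real) \<Rightarrow> wser \<Rightarrow> real \<Rightarrow> real" where
  "Sf1 \<phi> f x = wpair (\<lambda>i. \<phi> (fst i) * (of_int (snd i) * sin (of_int (snd i) * x))) f"

lemma admissible_weight:
  assumes "admissible M \<phi>" "\<bar>t\<bar> \<le> C * (1 + \<bar>of_int k\<bar>)^2" "C \<ge> 0"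
  shows "norm (\<phi> n * t) \<le> (M * C) * wt (n, k)"
proof -
  have "norm (\<phi> n * t) = \<bar>\<phi> n\<bar> * \<bar>t\<bar>" by (simp add: abs_mult)
  also have "\<dots> \<le> (M * wtn n) * (C * (1 + \<bar>of_int k\<bar>)^2)" using assms by (intro mult_mono) (auto simp: admissible_def less_imp_le)
  finally show ?thesis by (simp add: wt_def mult_ac)
qed

lemma mode_bounds:
  fixes k :: int
  shows "1 \<le> 1 * (1 + \<bar>real_of_int k\<bar>)^2" "\<bar>real_of_int k\<bar> \<le> 1 * (1 + \<bar>real_of_int k\<bar>)^2"
    "\<bar>real_of_int k\<bar>\<^sup>2 \<le> 1 * (1 + \<bar>real_of_int k\<bar>)^2" by (simp_all add: power2_eq_square algebra_simps)

lemma wpair_scale_weights: "wpair (\<lambda>i. c * (u i :: real)) f = c * wpair u f"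
  unfolding wpair_def by (simp add: mult.left_commute[of _ c] infsum_cmult_right')

lemma wpair_lincomb:
  assumes "\<And>i. norm (u i :: real) \<le> A * wt i" "\<And>i. norm (v i :: real) \<le> B * wt i" "\<And>i. norm (w i :: real) \<le> D * wt i"
  shows "wpair u f - wpair v f - wpair w f * c = wpair (\<lambda>i. u i - v i - w i * c) f"
proof -
  note s = wser_pairing(2)[OF assms(1), where a = f] wser_pairing(2)[OF assms(2), where a = f] wser_pairing(2)[OF assms(3), where a = f]
  have "wpair (\<lambda>i. u i - v i - w i * c) f = (\<Sum>\<^sub>\<infinity>i. (coef f i *\<^sub>R u i + (- 1) * (coef f i *\<^sub>R v i)) + (- c) * (coef f i *\<^sub>R w i))"
    unfolding wpair_def by (rule infsum_cong) (simp add: algebra_simps)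
  also have "\<dots> = ((\<Sum>\<^sub>\<infinity>i. coef f i *\<^sub>R u i) + (- 1) * (\<Sum>\<^sub>\<infinity>i. coef f i *\<^sub>R v i)) + (- c) * (\<Sum>\<^sub>\<infinity>i. coef f i *\<^sub>R w i)"
    using s by (simp only: infsum_add infsum_cmult_right' summable_on_add summable_on_cmult_right)
  finally show ?thesis by (simp add: wpair_def)
qed

lemma wpair_le: "(\<And>i. norm (u i :: real) \<le> A * wt i) \<Longrightarrow> \<bar>wpair u f\<bar> \<le> A * norm f"
  using wser_pairing(4)[where \<phi> = u and C = A and a = f] by (simp add: wpair_def)

lemma wpair_diff_weights:
  assumes "\<And>i. norm (u i :: real) \<le> A * wt i" "\<And>i. norm (v i :: real) \<le> B * wt i"
  shows "wpair u f - wpair v f = wpair (\<lambda>i. u i - v i) f"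
proof -
  note s = wser_pairing(2)[OF assms(1), where a = f] wser_pairing(2)[OF assms(2), where a = f]
  have "wpair (\<lambda>i. u i - v i) f = (\<Sum>\<^sub>\<infinity>i. (coef f i *\<^sub>R u i + (- 1) * (coef f i *\<^sub>R v i)))"
    unfolding wpair_def by (rule infsum_cong) (simp add: algebra_simps)
  also have "\<dots> = (\<Sum>\<^sub>\<infinity>i. coef f i *\<^sub>R u i) + (- 1) * (\<Sum>\<^sub>\<infinity>i. coef f i *\<^sub>R v i)"
    using s by (simp only: infsum_add infsum_cmult_right' summable_on_cmult_right)
  finally show ?thesis by (simp add: wpair_def)
qed

text \<open>Termwise differentiation: quadratic Taylor bounds on the single terms, weighted by
  \<open>wt\<close>, add up to a quadratic bound for the whole series.\<close>

lemma wpair_deriv: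
  assumes u: "\<And>y i. \<bar>y - x\<bar> < d \<Longrightarrow> norm (u y i :: real) \<le> A * wt i" and v: "\<And>i. norm (v i :: real) \<le> D * wt i" and d: "d > 0"
    and T: "\<And>y i. \<bar>y - x\<bar> < d \<Longrightarrow> \<bar>u y i - u x i - v i * (y - x)\<bar> \<le> (C * (y - x)^2) * wt i"
  shows "((\<lambda>y. wpair (u y) f) has_real_derivative wpair v f) (at x)"
proof (rule has_real_derivative_quadratic[OF d, where C = "C * norm f"])
  fix y assume y: "\<bar>y - x\<bar> < d"
  have "wpair (u y) f - wpair (u x) f - wpair v f * (y - x) = wpair (\<lambda>i. u y i - u x i - v i * (y - x)) f"
    by (rule wpair_lincomb[OF u[OF y] u v]) (use d in simp)
  also have "\<bar>\<dots>\<bar> \<le> (C * (y - x)^2) * norm f" by (rule wpair_le) (use T[OF y] in simp)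
  finally show "\<bar>wpair (u y) f - wpair (u x) f - wpair v f * (y - x)\<bar> \<le> C * norm f * (y - x)^2" by (simp add: mult_ac)
qed

context
  fixes M :: real and \<phi> :: "nat \<Rightarrow> real"
  assumes adm: "admissible M \<phi>"
begin

lemma weights:
  "norm (\<phi> (fst i) * cos (of_int (snd i) * x)) \<le> M * wt i"
  "norm (\<phi> (fst i) * sin (of_int (snd i) * x)) \<le> M * wt i"
  "norm (\<phi> (fst i) * (of_int (snd i) * cos (of_int (snd i) * x))) \<le> M * wt i"
  "norm (\<phi> (fst i) * (of_int (snd i) * sin (of_int (snd i) * x))) \<le> M * wt i"
proof -
  obtain n k where i: "i = (n, k)" by (cases i)
  have 1: "\<bar>cos (of_int k * x)\<bar> \<le> 1 * (1 + \<bar>real_of_int k\<bar>)^2" "\<bar>sin (of_int k * x)\<bar> \<le> 1 * (1 + \<bar>real_of_int k\<bar>)^2"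
    using mode_bounds(1)[of k] by (auto intro: order_trans[OF abs_cos_le_one] order_trans[OF abs_sin_le_one])
  have 2: "\<bar>of_int k * cos (of_int k * x)\<bar> \<le> 1 * (1 + \<bar>real_of_int k\<bar>)^2" "\<bar>of_int k * sin (of_int k * x)\<bar> \<le> 1 * (1 + \<bar>real_of_int k\<bar>)^2"
    using mode_bounds(2)[of k] mult_left_mono[OF abs_cos_le_one[of "of_int k * x"], of "\<bar>real_of_int k\<bar>"]
      mult_left_mono[OF abs_sin_le_one[of "of_int k * x"], of "\<bar>real_of_int k\<bar>"] by (auto simp: abs_mult)
  show "norm (\<phi> (fst i) * cos (of_int (snd i) * x)) \<le> M * wt i"
  "norm (\<phi> (fst i) * sin (of_int (snd i) * x)) \<le> M * wt i"
  "norm (\<phi> (fst i) * (of_int (snd i) * cos (of_int (snd i) * x))) \<le> M * wt i"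
  "norm (\<phi> (fst i) * (of_int (snd i) * sin (of_int (snd i) * x))) \<le> M * wt i"
    using admissible_weight[OF adm 1(1), of n] admissible_weight[OF adm 1(2), of n]
      admissible_weight[OF adm 2(1), of n] admissible_weight[OF adm 2(2), of n] by (simp_all add: i)
qed

lemma ev_bounds:
  "\<bar>Cf \<phi> f x\<bar> \<le> M * norm f" "\<bar>Sf \<phi> f x\<bar> \<le> M * norm f"
  "\<bar>Cf1 \<phi> f x\<bar> \<le> M * norm f" "\<bar>Sf1 \<phi> f x\<bar> \<le> M * norm f" unfolding Cf_def Sf_def Cf1_def Sf1_def wpair_def
  using wser_pairing(4)[OF weights(1), where a = f] wser_pairing(4)[OF weights(2), where a = f]
    wser_pairing(4)[OF weights(3), where a = f] wser_pairing(4)[OF weights(4), where a = f] by simp_all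

text \<open>The Taylor remainder of \<open>cos (k x)\<close> or \<open>sin (k x)\<close> costs a
  factor k^2, which the weight provides.\<close>

lemma Cf_deriv: "(Cf \<phi> f has_real_derivative - Sf1 \<phi> f x) (at x)"
  and Sf_deriv: "(Sf \<phi> f has_real_derivative Cf1 \<phi> f x) (at x)"
proof -
  have k2: "\<bar>\<phi> n * t\<bar> \<le> M * (y - x)^2 * wt (n, k)" if "\<bar>t\<bar> \<le> (of_int k * y - of_int k * x)^2" for t y n k
  proof -
    have "(of_int k * y - of_int k * x)^2 = (y - x)^2 * \<bar>real_of_int k\<bar>\<^sup>2"
      by (simp add: power_mult_distrib flip: right_diff_distrib)
    also have "\<dots> \<le> (y - x)^2 * (1 + \<bar>real_of_int k\<bar>)^2" using mode_bounds(3)[of k] by (intro mult_left_mono) auto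
    finally have "\<bar>t\<bar> \<le> (y - x)^2 * (1 + \<bar>real_of_int k\<bar>)^2" using that by linarith
    from admissible_weight[OF adm this, of n] show ?thesis by simp
  qed
  have "((\<lambda>y. wpair (\<lambda>i. \<phi> (fst i) * cos (of_int (snd i) * y)) f) has_real_derivative
    wpair (\<lambda>i. (- 1) * (\<phi> (fst i) * (of_int (snd i) * sin (of_int (snd i) * x)))) f) (at x)"
  proof (rule wpair_deriv[where d = 1 and C = M])
    show "\<bar>\<phi> (fst i) * cos (of_int (snd i) * y) - \<phi> (fst i) * cos (of_int (snd i) * x)
      - (- 1) * (\<phi> (fst i) * (of_int (snd i) * sin (of_int (snd i) * x))) * (y - x)\<bar> \<le> (M * (y - x)^2) * wt i" for y i
      using k2[OF cos_taylor2, of "fst i" "snd i" y] by (simp add: algebra_simps)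
    show "norm ((- 1) * (\<phi> (fst i) * (of_int (snd i) * sin (of_int (snd i) * x)))) \<le> M * wt i" for i
      using weights(4)[of i x] by simp
  qed (use weights in auto)
  thus "(Cf \<phi> f has_real_derivative - Sf1 \<phi> f x) (at x)" unfolding wpair_scale_weights by (simp add: Cf_def[abs_def] Sf1_def)
  show "(Sf \<phi> f has_real_derivative Cf1 \<phi> f x) (at x)" unfolding Sf_def[abs_def] Cf1_def
  proof (rule wpair_deriv[where d = 1 and C = M])
    show "\<bar>\<phi> (fst i) * sin (of_int (snd i) * y) - \<phi> (fst i) * sin (of_int (snd i) * x)
      - \<phi> (fst i) * (of_int (snd i) * cos (of_int (snd i) * x)) * (y - x)\<bar> \<le> (M * (y - x)^2) * wt i" for y i
      using k2[OF sin_taylor2, of "fst i" "snd i" y] by (simp add: algebra_simps)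
  qed (use weights in auto)
qed

lemma Cf1_lipschitz: "\<bar>Cf1 \<phi> f x - Cf1 \<phi> f y\<bar> \<le> M * norm f * \<bar>x - y\<bar>"
proof -
  have "Cf1 \<phi> f x - Cf1 \<phi> f y = wpair (\<lambda>i. \<phi> (fst i) * (of_int (snd i) * cos (of_int (snd i) * x))
      - \<phi> (fst i) * (of_int (snd i) * cos (of_int (snd i) * y))) f"
    unfolding Cf1_def by (rule wpair_diff_weights[OF weights(3) weights(3)])
  also have "\<bar>\<dots>\<bar> \<le> (M * \<bar>x - y\<bar>) * norm f"
  proof (rule wpair_le)
    fix i :: "nat \<times> int"
    obtain n k where i: "i = (n, k)" by (cases i)
    have "\<bar>of_int k * (cos (of_int k * x) - cos (of_int k * y))\<bar> \<le> \<bar>real_of_int k\<bar> * \<bar>of_int k * x - of_int k * y\<bar>"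
      unfolding abs_mult by (intro mult_left_mono cos_lipschitz) auto
    also have "\<dots> = \<bar>x - y\<bar> * \<bar>real_of_int k\<bar>\<^sup>2" by (simp add: power2_eq_square abs_mult flip: right_diff_distrib)
    also have "\<dots> \<le> \<bar>x - y\<bar> * (1 + \<bar>real_of_int k\<bar>)^2" using mode_bounds(3)[of k] by (intro mult_left_mono) auto
    finally have "norm (\<phi> n * (of_int k * (cos (of_int k * x) - cos (of_int k * y)))) \<le> M * \<bar>x - y\<bar> * wt (n, k)"
      by (rule admissible_weight[OF adm]) auto
    thus "norm (\<phi> (fst i) * (of_int (snd i) * cos (of_int (snd i) * x))
      - \<phi> (fst i) * (of_int (snd i) * cos (of_int (snd i) * y))) \<le> M * \<bar>x - y\<bar> * wt i" by (simp add: i algebra_simps)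
  qed
  finally show ?thesis by (simp add: mult_ac)
qed

lemma Cf_lipschitz: "\<bar>Cf \<phi> f x - Cf \<phi> f y\<bar> \<le> M * norm f * \<bar>x - y\<bar>"
proof -
  have "norm (Cf \<phi> f x - Cf \<phi> f y) \<le> (M * norm f) * norm (x - y)"
    by (rule field_differentiable_bound[of UNIV _ "\<lambda>x. - Sf1 \<phi> f x"]) (auto intro: Cf_deriv ev_bounds(4))
  thus ?thesis by simp
qed

end

lemma ev_periodic:
  "Cf \<phi> f (x + 2 * pi) = Cf \<phi> f x" "Sf \<phi> f (x + 2 * pi) = Sf \<phi> f x" "Cf1 \<phi> f (x + 2 * pi) = Cf1 \<phi> f x"
proof -
  have "cos (of_int k * (x + 2 * pi)) = cos (of_int k * x)" "sin (of_int k * (x + 2 * pi)) = sin (of_int k * x)" for k :: int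
    using cos.plus_of_int[of "of_int k * x" k] sin.plus_of_int[of "of_int k * x" k] by (simp_all add: algebra_simps)
  thus "Cf \<phi> f (x + 2 * pi) = Cf \<phi> f x" "Sf \<phi> f (x + 2 * pi) = Sf \<phi> f x" "Cf1 \<phi> f (x + 2 * pi) = Cf1 \<phi> f x"
    by (simp_all add: Cf_def Sf_def Cf1_def)
qed

lemma Cf_even: "Cf \<phi> f (- x) = Cf \<phi> f x" by (simp add: Cf_def)

lemma ev_diff_weights:
  assumes "admissible M \<phi>" "admissible M' \<phi>'"
  shows "Cf \<phi> f x - Cf \<phi>' f x = Cf (\<lambda>n. \<phi> n - \<phi>' n) f x" "Sf \<phi> f x - Sf \<phi>' f x = Sf (\<lambda>n. \<phi> n - \<phi>' n) f x"
    "Cf1 \<phi> f x - Cf1 \<phi>' f x = Cf1 (\<lambda>n. \<phi> n - \<phi>' n) f x"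
proof -
  note w = weights[OF assms(1)] and w' = weights[OF assms(2)]
  show "Cf \<phi> f x - Cf \<phi>' f x = Cf (\<lambda>n. \<phi> n - \<phi>' n) f x"
    unfolding Cf_def wpair_diff_weights[OF w(1) w'(1)] by (simp only: left_diff_distrib)
  show "Sf \<phi> f x - Sf \<phi>' f x = Sf (\<lambda>n. \<phi> n - \<phi>' n) f x"
    unfolding Sf_def wpair_diff_weights[OF w(2) w'(2)] by (simp only: left_diff_distrib)
  show "Cf1 \<phi> f x - Cf1 \<phi>' f x = Cf1 (\<lambda>n. \<phi> n - \<phi>' n) f x"
    unfolding Cf1_def wpair_diff_weights[OF w(3) w'(3)] by (simp only: left_diff_distrib)
qed

lemma ev_scale_weights:
  "Cf (\<lambda>n. c * \<phi> n) f x = c * Cf \<phi> f x" "Sf (\<lambda>n. c * \<phi> n) f x = c * Sf \<phi> f x" "Cf1 (\<lambda>n. c * \<phi> n) f x = c * Cf1 \<phi> f x"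
  unfolding Cf_def Sf_def Cf1_def by (simp_all add: mult.assoc wpair_scale_weights)

lemma ev_scaleR:
  "Cf \<phi> (c *\<^sub>R f) x = c * Cf \<phi> f x" "Sf \<phi> (c *\<^sub>R f) x = c * Sf \<phi> f x" "Cf1 \<phi> (c *\<^sub>R f) x = c * Cf1 \<phi> f x"
  unfolding Cf_def Sf_def Cf1_def wpair_def by (simp_all add: mult.assoc infsum_cmult_right')

lemma Sf1_delta: "(\<And>n k. coef g (n, k) = of_int k * coef f (n, k)) \<Longrightarrow> Sf1 \<phi> f x = Sf \<phi> g x"
  and Cf1_delta: "(\<And>n k. coef g (n, k) = of_int k * coef f (n, k)) \<Longrightarrow> Cf1 \<phi> f x = Cf \<phi> g x"
  unfolding Sf1_def Sf_def Cf1_def Cf_def wpair_def by (rule infsum_cong, clarsimp)+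

lemma wpair_flip: "wpair (\<lambda>i. u (fst i, - snd i)) (flip f) = wpair u f"
proof -
  have "wpair u f = (\<Sum>\<^sub>\<infinity>i. coef f (fst i, - snd i) *\<^sub>R u (fst i, - snd i))"
    unfolding wpair_def by (rule infsum_reindex_bij_betw[OF bij_flip_index, symmetric])
  also have "\<dots> = wpair (\<lambda>i. u (fst i, - snd i)) (flip f)" unfolding wpair_def by (rule infsum_cong) auto
  finally show ?thesis ..
qed

lemma Sf_sym: "flip f = f \<Longrightarrow> Sf \<phi> f x = 0" using wpair_flip[of "\<lambda>i. \<phi> (fst i) * sin (of_int (snd i) * x)" f]
    wpair_scale_weights[of "- 1" "\<lambda>i. \<phi> (fst i) * sin (of_int (snd i) * x)" f] by (simp add: Sf_def)

lemma Cf_anti: "flip f = - f \<Longrightarrow> Cf \<phi> f x = 0"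
  using wpair_flip[of "\<lambda>i. \<phi> (fst i) * cos (of_int (snd i) * x)" f] ev_scaleR(1)[of \<phi> "- 1" f x] by (simp add: Cf_def)

definition pz :: "real \<Rightarrow> nat \<Rightarrow> real" where "pz z n = z ^ n"
definition dz :: "real \<Rightarrow> nat \<Rightarrow> real" where "dz z n = real n * z ^ (n - 1)"

lemma admissible_pz: "\<bar>z\<bar> \<le> 1 / 64 \<Longrightarrow> admissible 1 (pz z)"
proof -
  assume z: "\<bar>z\<bar> \<le> 1 / 64"
  have "\<bar>z ^ n\<bar> \<le> wtn n" for n
  proof -
    have "\<bar>z ^ n\<bar> = \<bar>z\<bar> ^ n" by (rule power_abs)
    also have "\<dots> \<le> \<bar>z\<bar> ^ (n - 1)" using z by (intro power_decreasing) auto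
    also have "\<dots> \<le> wtn n" unfolding wtn_def by (rule power_mono[OF z]) simp
    finally show ?thesis .
  qed
  thus ?thesis by (simp add: admissible_def pz_def)
qed

text \<open>Point evaluation as a ring homomorphism into the complex numbers, with
  \<open>Cf (pz z)\<close> and \<open>Sf (pz z)\<close> as its real and imaginary part. It turns the
  algebra of series, including inverses and square roots, into identities between functions.\<close>

definition ev :: "real \<Rightarrow> real \<Rightarrow> wser \<Rightarrow> complex" where
  "ev z x f = wpair (\<lambda>i. of_real (z ^ fst i) * cis (of_int (snd i) * x)) f"

context
  fixes z x :: real assumes z: "\<bar>z\<bar> \<le> 1 / 64"
begin

lemma ev_weight: "norm (of_real (z ^ fst i) * cis (of_int (snd i) * x)) \<le> 1 * wt i"
proof -
  have "norm (pz z (fst i) * 1) \<le> 1 * 1 * wt (fst i, snd i)"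
    by (rule admissible_weight[OF admissible_pz[OF z]]) (use mode_bounds(1)[of "snd i"] in auto)
  thus ?thesis by (simp add: pz_def norm_mult norm_power power_abs)
qed

lemma bl_ev: "bounded_linear (ev z x)" using bounded_linear_wpair[OF ev_weight] by (simp add: ev_def[abs_def])

lemma ev_add: "ev z x (f + g) = ev z x f + ev z x g"
  and ev_diff: "ev z x (f - g) = ev z x f - ev z x g"
  and ev_smult: "ev z x (c *\<^sub>R f) = of_real c * ev z x f"
proof -
  interpret bounded_linear "ev z x" by (rule bl_ev)
  show "ev z x (f + g) = ev z x f + ev z x g" "ev z x (f - g) = ev z x f - ev z x g" "ev z x (c *\<^sub>R f) = of_real c * ev z x f"
    by (simp_all only: add diff scaleR) (simp only: scaleR_conv_of_real)
qed

lemma ev_mult: "ev z x (f * g) = ev z x f * ev z x g"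
proof -
  define \<phi> where "\<phi> i = complex_of_real (z ^ fst i) * cis (of_int (snd i) * x)" for i :: "nat \<times> int"
  have \<phi>: "norm (\<phi> i) \<le> 1 * wt i" for i unfolding \<phi>_def by (rule ev_weight)
  have add: "\<phi> (a + b) = \<phi> a * \<phi> b" for a b by (simp add: \<phi>_def power_add cis_mult[symmetric] distrib_right)
  have "ev z x (f * g) = (\<Sum>\<^sub>\<infinity>i. conv f g i *\<^sub>R \<phi> i)" by (simp add: ev_def wpair_def coef_times \<phi>_def)
  also have "\<dots> = (\<Sum>\<^sub>\<infinity>a. coef f a *\<^sub>R (\<Sum>\<^sub>\<infinity>b. coef g b *\<^sub>R \<phi> (a + b)))" by (rule conv_pairing(2)[OF \<phi>])
  also have "(\<lambda>a. coef f a *\<^sub>R (\<Sum>\<^sub>\<infinity>b. coef g b *\<^sub>R \<phi> (a + b))) = (\<lambda>a. (coef f a *\<^sub>R \<phi> a) * (\<Sum>\<^sub>\<infinity>b. coef g b *\<^sub>R \<phi> b))"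
    unfolding add by (simp add: mult.left_commute[of _ "\<phi> _"] infsum_cmult_right' flip: mult_scaleR_right)
  also have "(\<Sum>\<^sub>\<infinity>a. (coef f a *\<^sub>R \<phi> a) * (\<Sum>\<^sub>\<infinity>b. coef g b *\<^sub>R \<phi> b)) = (\<Sum>\<^sub>\<infinity>a. coef f a *\<^sub>R \<phi> a) * (\<Sum>\<^sub>\<infinity>b. coef g b *\<^sub>R \<phi> b)"
    by (rule infsum_cmult_left')
  finally show ?thesis by (simp add: ev_def wpair_def \<phi>_def)
qed

lemma ev_one: "ev z x 1 = 1"
proof -
  have "ev z x 1 = (\<Sum>\<^sub>\<infinity>i\<in>{0}. coef 1 i *\<^sub>R (of_real (z ^ fst i) * cis (of_int (snd i) * x)))"
    unfolding ev_def wpair_def by (rule infsum_cong_neutral) auto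
  thus ?thesis by simp
qed

lemma ev_power: "ev z x (f ^ n) = ev z x f ^ n" by (induction n) (simp_all add: ev_one ev_mult)

lemma ev_Complex: "ev z x f = Complex (Cf (pz z) f x) (Sf (pz z) f x)"
proof -
  note s = wser_pairing(2)[OF ev_weight, where a = f]
  have "Re (ev z x f) = Cf (pz z) f x" "Im (ev z x f) = Sf (pz z) f x"
    unfolding ev_def wpair_def Cf_def Sf_def infsum_Re[OF s, symmetric] infsum_Im[OF s, symmetric] by (simp_all add: pz_def)
  thus ?thesis by (simp add: complex_eq_iff)
qed

lemma ev_norm: "norm (ev z x f) \<le> norm f" unfolding ev_def wpair_def using wser_pairing(4)[OF ev_weight, where a = f] by simp

end

section \<open>Little Hoelder spaces and the flux\<close>

lemma nth_deriv_0 [simp]: "nth_deriv 0 f = f"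
  and nth_deriv_Suc: "nth_deriv (Suc j) f = deriv (nth_deriv j f)" by (simp_all add: nth_deriv_def)

definition hdiff :: "nat \<Rightarrow> (real \<Rightarrow> real) \<Rightarrow> bool" where
  "hdiff k f \<longleftrightarrow> (\<forall>j<k. \<forall>x. nth_deriv j f differentiable (at x))"

lemma hdiff_DERIV: "hdiff k f \<Longrightarrow> j < k \<Longrightarrow> (nth_deriv j f has_real_derivative nth_deriv (Suc j) f x) (at x)"
  unfolding hdiff_def nth_deriv_Suc using DERIV_deriv_iff_real_differentiable by blast

lemma nth_deriv_lincomb:
  assumes "hdiff k f" "hdiff k g"
  shows "j \<le> k \<Longrightarrow> nth_deriv j (\<lambda>x. a * f x + b * g x) = (\<lambda>x. a * nth_deriv j f x + b * nth_deriv j g x)"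
proof (induction j)
  case (Suc j)
  hence IH: "nth_deriv j (\<lambda>x. a * f x + b * g x) = (\<lambda>x. a * nth_deriv j f x + b * nth_deriv j g x)" by simp
  show ?case
  proof
    fix x
    have "((\<lambda>x. a * nth_deriv j f x + b * nth_deriv j g x) has_real_derivative
        a * nth_deriv (Suc j) f x + b * nth_deriv (Suc j) g x) (at x)"
      using Suc by (auto intro!: derivative_eq_intros hdiff_DERIV[OF assms(1)] hdiff_DERIV[OF assms(2)])
    thus "nth_deriv (Suc j) (\<lambda>x. a * f x + b * g x) x = a * nth_deriv (Suc j) f x + b * nth_deriv (Suc j) g x"
      unfolding nth_deriv_Suc[of j "\<lambda>x. a * f x + b * g x"] IH by (rule DERIV_imp_deriv)
  qed
qed simp

lemma hdiff_lincomb: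
  assumes "hdiff k f" "hdiff k g"
  shows "hdiff k (\<lambda>x. a * f x + b * g x)" unfolding hdiff_def
proof (intro allI impI)
  fix j x assume j: "j < k"
  have "((\<lambda>x. a * nth_deriv j f x + b * nth_deriv j g x) has_real_derivative
        a * nth_deriv (Suc j) f x + b * nth_deriv (Suc j) g x) (at x)"
    using j by (auto intro!: derivative_eq_intros hdiff_DERIV[OF assms(1)] hdiff_DERIV[OF assms(2)])
  thus "nth_deriv j (\<lambda>x. a * f x + b * g x) differentiable (at x)"
    using j nth_deriv_lincomb[OF assms, of j a b] real_differentiable_def by auto
qed

lemma periodic_nth_deriv: "periodic_2pi f \<Longrightarrow> periodic_2pi (nth_deriv j f)"
proof (induction j)
  case (Suc j)
  hence "(\<lambda>x. nth_deriv j f (x + 2 * pi)) = nth_deriv j f" by (auto simp: periodic_2pi_def)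
  hence "(nth_deriv j f has_field_derivative D) (at (x + 2 * pi)) \<longleftrightarrow> (nth_deriv j f has_field_derivative D) (at x)" for D x
    using DERIV_shift[of "nth_deriv j f" D x "2 * pi"] by simp
  thus ?case by (simp add: periodic_2pi_def nth_deriv_Suc deriv_def)
qed simp

lemma periodic_2pi_of_int: "periodic_2pi f \<Longrightarrow> f (x + 2 * pi * of_int n) = f x"
proof (induction n rule: int_induct[of _ 0])
  case (step1 i)
  hence "f (x + 2 * pi * of_int i + 2 * pi) = f x" by (simp add: periodic_2pi_def)
  thus ?case by (simp add: algebra_simps)
next
  case (step2 i)
  have "f ((x + 2 * pi * of_int (i - 1)) + 2 * pi) = f (x + 2 * pi * of_int (i - 1))" using step2 by (simp only: periodic_2pi_def)
  thus ?case using step2 by (simp add: algebra_simps)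
qed simp

lemma circle_dist_le: "circle_dist x y \<le> \<bar>x - y + 2 * pi * of_int n\<bar>"
  unfolding circle_dist_def by (rule cINF_lower) (auto intro!: bdd_belowI[of _ 0])

lemma circle_dist_le_pi: "circle_dist x y \<le> pi"
proof -
  define t where "t = (x - y) / (2 * pi)"
  have t: "\<bar>of_int (round t) - t\<bar> \<le> 1 / 2" by (rule of_int_round_abs_le)
  have "x - y + 2 * pi * of_int (- round t) = 2 * pi * (t - of_int (round t))" by (simp add: t_def field_simps)
  hence "\<bar>x - y + 2 * pi * of_int (- round t)\<bar> = 2 * pi * \<bar>of_int (round t) - t\<bar>" by (simp add: abs_mult abs_minus_commute)
  also have "\<dots> \<le> 2 * pi * (1 / 2)" using t by (intro mult_left_mono) auto
  finally show ?thesis using circle_dist_le[of x y "- round t"] by simp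
qed

text \<open>Shows that the supremum in the Hoelder norm runs over a nonempty set of pairs.\<close>

lemma circle_dist_0_pi: "0 < circle_dist 0 pi"
proof -
  have "(INF n::int. \<bar>0 - pi + 2 * pi * of_int n\<bar>) \<ge> pi"
  proof (rule cINF_greatest)
    fix n :: int
    have "1 \<le> \<bar>2 * n - 1\<bar>" by presburger
    hence "real_of_int 1 \<le> real_of_int \<bar>2 * n - 1\<bar>" by (simp only: of_int_le_iff)
    hence "\<bar>2 * real_of_int n - 1\<bar> \<ge> 1" by simp
    hence "pi * 1 \<le> pi * \<bar>2 * real_of_int n - 1\<bar>" by (intro mult_left_mono) auto
    also have "\<dots> = \<bar>pi * (2 * real_of_int n - 1)\<bar>" by (simp add: abs_mult)
    also have "pi * (2 * real_of_int n - 1) = 0 - pi + 2 * pi * of_int n" by (simp add: algebra_simps)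
    finally show "pi \<le> \<bar>0 - pi + 2 * pi * of_int n\<bar>" by simp
  qed simp
  thus ?thesis using pi_gt_zero unfolding circle_dist_def by linarith
qed

lemma periodic_lipschitz_circle:
  assumes "periodic_2pi g" "\<And>x y. \<bar>g x - g y\<bar> \<le> L * \<bar>x - y\<bar>"
  shows "\<bar>g x - g y\<bar> \<le> L * circle_dist x y"
proof (cases "L > 0")
  case True
  have "\<bar>g x - g y\<bar> / L \<le> circle_dist x y" unfolding circle_dist_def
  proof (rule cINF_greatest)
    fix n :: int
    have "\<bar>g x - g y\<bar> = \<bar>g (x + 2 * pi * of_int n) - g y\<bar>" by (simp add: periodic_2pi_of_int[OF assms(1)])
    also have "\<dots> \<le> L * \<bar>x - y + 2 * pi * of_int n\<bar>" using assms(2)[of "x + 2 * pi * of_int n" y] by (simp add: algebra_simps)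
    finally show "\<bar>g x - g y\<bar> / L \<le> \<bar>x - y + 2 * pi * of_int n\<bar>" using True by (simp add: field_simps)
  qed simp
  thus ?thesis using True by (simp add: field_simps)
next
  case False
  have "\<bar>g x - g y\<bar> \<le> 0" using assms(2)[of x y] mult_right_mono[of L 0 "\<bar>x - y\<bar>"] False by linarith
  moreover have "L * circle_dist x y = 0"
  proof (cases "L = 0")
    case False
    with \<open>\<not> L > 0\<close> have "L < 0" by simp
    with assms(2)[of 0 1] show ?thesis by simp
  qed simp
  ultimately show ?thesis by linarith
qed

definition fkey :: "real \<Rightarrow> nat" where "fkey \<sigma> = nat \<lfloor>\<sigma>\<rfloor>"

lemma order_facts:
  assumes "0 < \<alpha>" "\<alpha> < 1"
  shows "fkey \<alpha> = 0" "\<alpha> \<notin> \<int>" "fkey (4 + \<alpha>) = 4" "4 + \<alpha> \<notin> \<int>" "4 + \<alpha> > 0"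
proof -
  have "\<lfloor>\<alpha>\<rfloor> = 0" "\<lfloor>4 + \<alpha>\<rfloor> = 4" using assms by (simp_all add: floor_eq_iff)
  moreover from this have "\<alpha> \<notin> \<int>" using assms by (metis Ints_cases floor_of_int of_int_0 less_irrefl)
  moreover from this have "4 + \<alpha> \<notin> \<int>" using Ints_diff[of "4 + \<alpha>" 4] by auto
  ultimately show "fkey \<alpha> = 0" "fkey (4 + \<alpha>) = 4" "\<alpha> \<notin> \<int>" "4 + \<alpha> \<notin> \<int>" "4 + \<alpha> > 0" using assms by (simp_all add: fkey_def)
qed

lemma frac_bounds: "(\<sigma> :: real) \<notin> \<int> \<Longrightarrow> 0 < frac \<sigma> \<and> frac \<sigma> < 1" using frac_lt_1[of \<sigma>] frac_gt_0_iff[of \<sigma>] by auto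

lemma holder_quot_nonneg: "holder_quot \<beta> g x y \<ge> 0" by (simp add: holder_quot_def)

lemma holder_quot_lipschitz:
  assumes "periodic_2pi g" "\<And>x y. \<bar>g x - g y\<bar> \<le> L * \<bar>x - y\<bar>" "0 < \<beta>" "\<beta> < 1" "0 < circle_dist x y"
  shows "holder_quot \<beta> g x y \<le> L * circle_dist x y powr (1 - \<beta>)" "holder_quot \<beta> g x y \<le> 4 * L"
proof -
  define d where "d = circle_dist x y"
  have d: "0 < d" "d \<le> pi" using assms(5) circle_dist_le_pi by (auto simp: d_def)
  have L: "L \<ge> 0" using assms(2)[of 0 1] by simp
  have "holder_quot \<beta> g x y \<le> L * d / d powr \<beta>"
    unfolding holder_quot_def d_def by (intro divide_right_mono periodic_lipschitz_circle assms) simp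
  also have "\<dots> = L * d powr (1 - \<beta>)" using d by (simp add: powr_diff)
  finally show 1: "holder_quot \<beta> g x y \<le> L * circle_dist x y powr (1 - \<beta>)" by (simp add: d_def)
  have "d powr (1 - \<beta>) \<le> 4 powr (1 - \<beta>)" using d pi_less_4 assms by (intro powr_mono2) auto
  also have "\<dots> \<le> 4 powr 1" using assms by (intro powr_mono) auto
  finally have "L * d powr (1 - \<beta>) \<le> L * 4" using L by (intro mult_left_mono) auto
  thus "holder_quot \<beta> g x y \<le> 4 * L" using 1 unfolding d_def[symmetric] by linarith
qed

text \<open>A Lipschitz top derivative has Hoelder quotient at most L d^(1-\<beta>), which tends to
  0 with the distance d. All profiles given by series enter the little Hoelder spaces in this way.
  The factor 4 bounds d^(1-\<beta>), as d <= \<pi> < 4.\<close>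

lemma lipschitz_little_holder:
  assumes \<sigma>: "\<sigma> > 0" "\<sigma> \<notin> \<int>" and f: "periodic_2pi f" "hdiff (fkey \<sigma>) f"
    and L: "\<And>x y. \<bar>nth_deriv (fkey \<sigma>) f x - nth_deriv (fkey \<sigma>) f y\<bar> \<le> L * \<bar>x - y\<bar>"
  shows "f \<in> little_holder \<sigma>"
    and "(\<And>j x. j \<le> fkey \<sigma> \<Longrightarrow> \<bar>nth_deriv j f x\<bar> \<le> M) \<Longrightarrow> holder_norm \<sigma> f \<le> (real (fkey \<sigma>) + 1) * M + 4 * L"
proof -
  note fr = frac_bounds[OF \<sigma>(2)]
  define g where "g = nth_deriv (fkey \<sigma>) f"
  have g: "periodic_2pi g" "\<And>x y. \<bar>g x - g y\<bar> \<le> L * \<bar>x - y\<bar>" using periodic_nth_deriv[OF f(1)] L by (auto simp: g_def)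
  have L0: "L \<ge> 0" using g(2)[of 0 1] by simp
  note q = holder_quot_lipschitz[OF g, of "frac \<sigma>"]
  have cont: "continuous_on UNIV g" by (rule lipschitz_on_continuous_on[of L]) (auto simp: lipschitz_on_def L0 dist_real_def g(2))
  have hs: "f \<in> holder_space \<sigma>" unfolding holder_space_def using f fr q(2) cont
    by (auto simp: hdiff_def fkey_def[symmetric] g_def[symmetric])
  have "\<exists>d>0. \<forall>x y. 0 < circle_dist x y \<and> circle_dist x y < d \<longrightarrow> holder_quot (frac \<sigma>) g x y \<le> e" if "e > 0" for e
  proof -
    define d where "d = (e / (L + 1)) powr (1 / (1 - frac \<sigma>))"
    have d: "d > 0" using that L0 by (simp add: d_def)
    have "holder_quot (frac \<sigma>) g x y \<le> e" if xy: "0 < circle_dist x y" "circle_dist x y < d" for x y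
    proof -
      have "circle_dist x y powr (1 - frac \<sigma>) \<le> d powr (1 - frac \<sigma>)" using xy fr by (intro powr_mono2) auto
      also have "\<dots> = e / (L + 1)" using fr \<open>e > 0\<close> L0 by (simp add: d_def powr_powr)
      finally have "L * circle_dist x y powr (1 - frac \<sigma>) \<le> L * (e / (L + 1))" using L0 by (rule mult_left_mono)
      also have "\<dots> \<le> e" using L0 \<open>e > 0\<close> by (simp add: field_simps)
      finally show ?thesis using q(1)[of x y] fr xy by linarith
    qed
    thus ?thesis using d by blast
  qed
  thus "f \<in> little_holder \<sigma>" unfolding little_holder_def using hs by (simp add: fkey_def[symmetric] g_def[symmetric])
  assume M: "\<And>j x. j \<le> fkey \<sigma> \<Longrightarrow> \<bar>nth_deriv j f x\<bar> \<le> M"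
  have "(\<Sum>j\<le>fkey \<sigma>. SUP x. \<bar>nth_deriv j f x\<bar>) \<le> (\<Sum>j\<le>fkey \<sigma>. M)" by (intro sum_mono cSUP_least M) auto
  moreover have "(SUP (x, y)\<in>{(x, y). 0 < circle_dist x y}. holder_quot (frac \<sigma>) g x y) \<le> 4 * L"
  proof (rule cSUP_least)
    show "{(x, y). 0 < circle_dist x y} \<noteq> {}" using circle_dist_0_pi by blast
  qed (use q(2) fr in auto)
  ultimately show "holder_norm \<sigma> f \<le> (real (fkey \<sigma>) + 1) * M + 4 * L"
    unfolding holder_norm_def fkey_def[symmetric] g_def[symmetric] by (simp add: algebra_simps)
qed

lemma periodic_continuous_bounded:
  assumes "periodic_2pi f" "continuous_on UNIV f"
  shows "\<exists>B. \<forall>x. \<bar>f x\<bar> \<le> B"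
proof -
  have "bounded (f ` {0..2 * pi})" by (intro compact_imp_bounded compact_continuous_image continuous_on_subset[OF assms(2)]) auto
  then obtain B where "\<forall>y\<in>f ` {0..2 * pi}. norm y \<le> B" unfolding bounded_iff by blast
  hence B: "\<bar>f x\<bar> \<le> B" if "x \<in> {0..2 * pi}" for x using that by simp
  have "\<bar>f x\<bar> \<le> B" for x
  proof -
    define t where "t = x / (2 * pi)"
    define n where "n = - \<lfloor>t\<rfloor>"
    have "of_int \<lfloor>t\<rfloor> \<le> t" "t \<le> of_int \<lfloor>t\<rfloor> + 1" by linarith+
    hence t: "0 \<le> t + of_int n" "t + of_int n \<le> 1" unfolding n_def of_int_minus by linarith+
    have "x + 2 * pi * of_int n = (t + of_int n) * (2 * pi)" by (simp add: t_def field_simps)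
    moreover have "(t + of_int n) * (2 * pi) \<le> 1 * (2 * pi)" using t by (intro mult_right_mono) auto
    moreover have "(t + of_int n) * (2 * pi) \<ge> 0" using t by (intro mult_nonneg_nonneg) auto
    ultimately have "x + 2 * pi * of_int n \<in> {0..2 * pi}" by simp
    thus ?thesis using B[of "x + 2 * pi * of_int n"] by (simp only: periodic_2pi_of_int[OF assms(1)])
  qed
  thus ?thesis by blast
qed

lemma holder_spaceD:
  assumes "f \<in> holder_space \<sigma>"
  shows "periodic_2pi f" "hdiff (fkey \<sigma>) f" "j \<le> fkey \<sigma> \<Longrightarrow> continuous_on UNIV (nth_deriv j f)"
    "\<exists>C. \<forall>x y. 0 < circle_dist x y \<longrightarrow> holder_quot (frac \<sigma>) (nth_deriv (fkey \<sigma>) f) x y \<le> C"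
proof -
  show "periodic_2pi f" and h: "hdiff (fkey \<sigma>) f"
    and "\<exists>C. \<forall>x y. 0 < circle_dist x y \<longrightarrow> holder_quot (frac \<sigma>) (nth_deriv (fkey \<sigma>) f) x y \<le> C"
    using assms by (auto simp: holder_space_def hdiff_def fkey_def)
  show "continuous_on UNIV (nth_deriv j f)" if "j \<le> fkey \<sigma>"
  proof (cases "j = fkey \<sigma>")
    case True
    thus ?thesis using assms by (simp add: holder_space_def fkey_def)
  next
    case False
    thus ?thesis using that hdiff_DERIV[OF h, of j] by (intro continuous_at_imp_continuous_on) (auto intro: DERIV_isCont)
  qed
qed

lemma little_holder_imp: "f \<in> little_holder \<sigma> \<Longrightarrow> f \<in> holder_space \<sigma>" by (simp add: little_holder_def)

lemma holder_bdd:
  assumes "f \<in> holder_space \<sigma>"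
  shows "j \<le> fkey \<sigma> \<Longrightarrow> bdd_above (range (\<lambda>x. \<bar>nth_deriv j f x\<bar>))"
    and "bdd_above ((\<lambda>(x, y). holder_quot (frac \<sigma>) (nth_deriv (fkey \<sigma>) f) x y) ` {(x, y). 0 < circle_dist x y})"
proof -
  show "bdd_above (range (\<lambda>x. \<bar>nth_deriv j f x\<bar>))" if "j \<le> fkey \<sigma>"
    using periodic_continuous_bounded[OF periodic_nth_deriv[OF holder_spaceD(1)[OF assms]] holder_spaceD(3)[OF assms that]]
    by (auto intro: bdd_aboveI)
  obtain C where "\<forall>x y. 0 < circle_dist x y \<longrightarrow> holder_quot (frac \<sigma>) (nth_deriv (fkey \<sigma>) f) x y \<le> C"
    using holder_spaceD(4)[OF assms] by blast
  thus "bdd_above ((\<lambda>(x, y). holder_quot (frac \<sigma>) (nth_deriv (fkey \<sigma>) f) x y) ` {(x, y). 0 < circle_dist x y})"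
    by (intro bdd_aboveI[of _ C]) auto
qed

lemma holder_SUP_nonneg:
  assumes "f \<in> holder_space \<sigma>"
  shows "(SUP (x, y)\<in>{(x, y). 0 < circle_dist x y}. holder_quot (frac \<sigma>) (nth_deriv (fkey \<sigma>) f) x y) \<ge> 0"
  using cSUP_upper[OF _ holder_bdd(2)[OF assms], of "(0, pi)"] circle_dist_0_pi holder_quot_nonneg by (fastforce intro: order_trans)

lemma nth_deriv_le_norm:
  assumes "f \<in> holder_space \<sigma>" "j \<le> fkey \<sigma>"
  shows "\<bar>nth_deriv j f x\<bar> \<le> holder_norm \<sigma> f"
proof -
  have up: "\<bar>nth_deriv j f x\<bar> \<le> (SUP x. \<bar>nth_deriv j f x\<bar>)" if "j \<le> fkey \<sigma>" for j x
    by (rule cSUP_upper[OF _ holder_bdd(1)[OF assms(1) that]]) simp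
  have "(SUP x. \<bar>nth_deriv j f x\<bar>) \<le> (\<Sum>j\<le>fkey \<sigma>. SUP x. \<bar>nth_deriv j f x\<bar>)"
    using assms(2) by (intro member_le_sum) (auto intro: order_trans[OF abs_ge_zero up])
  thus ?thesis using up[OF assms(2), of x] holder_SUP_nonneg[OF assms(1)] unfolding holder_norm_def fkey_def[symmetric] by linarith
qed

lemma holder_norm_nonneg: "f \<in> holder_space \<sigma> \<Longrightarrow> holder_norm \<sigma> f \<ge> 0" using nth_deriv_le_norm[of f \<sigma> 0 0] by simp

lemma holder_quot_lincomb:
  "holder_quot \<beta> (\<lambda>x. a * f x + b * g x) x y \<le> \<bar>a\<bar> * holder_quot \<beta> f x y + \<bar>b\<bar> * holder_quot \<beta> g x y"
proof -
  have "\<bar>a * f x + b * g x - (a * f y + b * g y)\<bar> \<le> \<bar>a\<bar> * \<bar>f x - f y\<bar> + \<bar>b\<bar> * \<bar>g x - g y\<bar>"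
    using abs_triangle_ineq[of "a * (f x - f y)" "b * (g x - g y)"] unfolding abs_mult by (simp add: algebra_simps)
  thus ?thesis unfolding holder_quot_def by (simp add: divide_right_mono flip: add_divide_distrib)
qed

lemma SUP_lincomb:
  fixes f g h :: "'a \<Rightarrow> real"
  assumes "bdd_above (f ` S)" "bdd_above (g ` S)" "S \<noteq> {}" "\<And>x. x \<in> S \<Longrightarrow> h x \<le> \<bar>a\<bar> * f x + \<bar>b\<bar> * g x"
  shows "(SUP x\<in>S. h x) \<le> \<bar>a\<bar> * (SUP x\<in>S. f x) + \<bar>b\<bar> * (SUP x\<in>S. g x)" by (rule cSUP_least[OF assms(3) order_trans[OF assms(4)]])
    (auto intro!: add_mono mult_left_mono cSUP_upper assms)

lemma holder_space_lincomb:
  assumes f: "f \<in> holder_space \<sigma>" and g: "g \<in> holder_space \<sigma>"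
  shows "(\<lambda>x. a * f x + b * g x) \<in> holder_space \<sigma>"
    and "holder_norm \<sigma> (\<lambda>x. a * f x + b * g x) \<le> \<bar>a\<bar> * holder_norm \<sigma> f + \<bar>b\<bar> * holder_norm \<sigma> g"
proof -
  let ?h = "\<lambda>x. a * f x + b * g x"
  have nd: "nth_deriv j ?h = (\<lambda>x. a * nth_deriv j f x + b * nth_deriv j g x)" if "j \<le> fkey \<sigma>" for j
    by (rule nth_deriv_lincomb[OF holder_spaceD(2)[OF f] holder_spaceD(2)[OF g] that])
  obtain C D where C: "\<And>x y. 0 < circle_dist x y \<Longrightarrow> holder_quot (frac \<sigma>) (nth_deriv (fkey \<sigma>) f) x y \<le> C"
    and D: "\<And>x y. 0 < circle_dist x y \<Longrightarrow> holder_quot (frac \<sigma>) (nth_deriv (fkey \<sigma>) g) x y \<le> D"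
    using holder_spaceD(4)[OF f] holder_spaceD(4)[OF g] by blast
  have "holder_quot (frac \<sigma>) (nth_deriv (fkey \<sigma>) ?h) x y \<le> \<bar>a\<bar> * C + \<bar>b\<bar> * D" if "0 < circle_dist x y" for x y
    unfolding nd[OF order_refl] by (rule order_trans[OF holder_quot_lincomb]) (intro add_mono mult_left_mono C D that, auto)
  moreover have "continuous_on UNIV (nth_deriv (fkey \<sigma>) ?h)"
    unfolding nd[OF order_refl] using holder_spaceD(3)[OF f order_refl] holder_spaceD(3)[OF g order_refl]
    by (intro continuous_intros)
  moreover have "hdiff (fkey \<sigma>) ?h" by (intro hdiff_lincomb holder_spaceD(2) f g)
  moreover have "periodic_2pi ?h" using holder_spaceD(1)[OF f] holder_spaceD(1)[OF g] by (simp add: periodic_2pi_def)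
  ultimately show "?h \<in> holder_space \<sigma>" unfolding holder_space_def hdiff_def fkey_def by blast
  have 1: "(SUP x. \<bar>nth_deriv j ?h x\<bar>) \<le> \<bar>a\<bar> * (SUP x. \<bar>nth_deriv j f x\<bar>) + \<bar>b\<bar> * (SUP x. \<bar>nth_deriv j g x\<bar>)"
    if j: "j \<le> fkey \<sigma>" for j unfolding nd[OF j] by (intro SUP_lincomb holder_bdd(1)[OF f j] holder_bdd(1)[OF g j])
      (auto simp flip: abs_mult intro: abs_triangle_ineq)
  let ?S = "{(x, y). 0 < circle_dist x y}"
  let ?q = "\<lambda>f (x, y). holder_quot (frac \<sigma>) (nth_deriv (fkey \<sigma>) f) x y"
  have 2: "(SUP p\<in>?S. ?q ?h p) \<le> \<bar>a\<bar> * (SUP p\<in>?S. ?q f p) + \<bar>b\<bar> * (SUP p\<in>?S. ?q g p)"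
    by (intro SUP_lincomb holder_bdd(2)[OF f] holder_bdd(2)[OF g]) (use circle_dist_0_pi in \<open>auto simp: nd holder_quot_lincomb\<close>)
  have "(\<Sum>j\<le>fkey \<sigma>. SUP x. \<bar>nth_deriv j ?h x\<bar>) \<le> (\<Sum>j\<le>fkey \<sigma>. \<bar>a\<bar> * (SUP x. \<bar>nth_deriv j f x\<bar>) + \<bar>b\<bar> * (SUP x. \<bar>nth_deriv j g x\<bar>))"
    by (rule sum_mono) (use 1 in auto)
  thus "holder_norm \<sigma> ?h \<le> \<bar>a\<bar> * holder_norm \<sigma> f + \<bar>b\<bar> * holder_norm \<sigma> g" using 2 unfolding holder_norm_def fkey_def[symmetric]
    by (simp add: sum.distrib sum_distrib_left distrib_left)
qed

lemma little_holder_lincomb: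
  assumes "f \<in> little_holder \<sigma>" "g \<in> little_holder \<sigma>"
  shows "(\<lambda>x. a * f x + b * g x) \<in> little_holder \<sigma>"
proof -
  let ?h = "\<lambda>x. a * f x + b * g x"
  have f: "f \<in> holder_space \<sigma>" and g: "g \<in> holder_space \<sigma>" using assms by (auto intro: little_holder_imp)
  have nd: "nth_deriv (fkey \<sigma>) ?h = (\<lambda>x. a * nth_deriv (fkey \<sigma>) f x + b * nth_deriv (fkey \<sigma>) g x)"
    by (rule nth_deriv_lincomb[OF holder_spaceD(2)[OF f] holder_spaceD(2)[OF g] order_refl])
  have "\<exists>d>0. \<forall>x y. 0 < circle_dist x y \<and> circle_dist x y < d \<longrightarrow> holder_quot (frac \<sigma>) (nth_deriv (fkey \<sigma>) ?h) x y \<le> e"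
    if e: "e > 0" for e
  proof -
    define u where "u = e / (\<bar>a\<bar> + \<bar>b\<bar> + 1)"
    have u: "u > 0" using e by (simp add: u_def add_nonneg_pos)
    obtain d1 where d1: "d1 > 0" "\<And>x y. 0 < circle_dist x y \<Longrightarrow> circle_dist x y < d1 \<Longrightarrow>
        holder_quot (frac \<sigma>) (nth_deriv (fkey \<sigma>) f) x y \<le> u" using assms(1) u unfolding little_holder_def fkey_def by blast
    obtain d2 where d2: "d2 > 0" "\<And>x y. 0 < circle_dist x y \<Longrightarrow> circle_dist x y < d2 \<Longrightarrow>
        holder_quot (frac \<sigma>) (nth_deriv (fkey \<sigma>) g) x y \<le> u" using assms(2) u unfolding little_holder_def fkey_def by blast
    have "holder_quot (frac \<sigma>) (nth_deriv (fkey \<sigma>) ?h) x y \<le> e"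
      if "0 < circle_dist x y" "circle_dist x y < min d1 d2" for x y
    proof -
      have "holder_quot (frac \<sigma>) (nth_deriv (fkey \<sigma>) ?h) x y \<le> \<bar>a\<bar> * u + \<bar>b\<bar> * u" unfolding nd using that d1 d2
        by (intro order_trans[OF holder_quot_lincomb] add_mono mult_left_mono) auto
      also have "\<dots> \<le> (\<bar>a\<bar> + \<bar>b\<bar> + 1) * u" using u by (simp add: algebra_simps)
      also have "\<dots> = e" unfolding u_def by (simp add: add_nonneg_pos)
      finally show ?thesis .
    qed
    thus ?thesis using d1 d2 by (intro exI[of _ "min d1 d2"]) auto
  qed
  thus ?thesis unfolding little_holder_def fkey_def[symmetric] using holder_space_lincomb(1)[OF f g] by blast
qed

lemma nth_deriv_const: "nth_deriv j (\<lambda>x. c) = (\<lambda>x. if j = 0 then c else 0)" by (induction j) (auto simp: nth_deriv_Suc)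

lemma const_little_holder:
  assumes "\<sigma> > 0" "\<sigma> \<notin> \<int>"
  shows "(\<lambda>x. c) \<in> little_holder \<sigma>" "holder_norm \<sigma> (\<lambda>x. c) \<le> (real (fkey \<sigma>) + 1) * \<bar>c\<bar>"
  using lipschitz_little_holder[OF assms, of "\<lambda>x. c" 0] by (auto simp: periodic_2pi_def hdiff_def nth_deriv_const)

lemma little_holder_diff:
  assumes "f \<in> little_holder \<sigma>" "g \<in> little_holder \<sigma>"
  shows "(\<lambda>x. f x - g x) \<in> little_holder \<sigma>"
    and "holder_norm \<sigma> (\<lambda>x. f x - g x) \<le> holder_norm \<sigma> f + holder_norm \<sigma> g"
  using little_holder_lincomb[OF assms, of 1 "- 1"] holder_space_lincomb(2)[OF assms[THEN little_holder_imp], of 1 "- 1"]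
  by simp_all

lemma little_holder_add:
  assumes "f \<in> little_holder \<sigma>" "g \<in> little_holder \<sigma>"
  shows "(\<lambda>x. f x + g x) \<in> little_holder \<sigma>"
    and "holder_norm \<sigma> (\<lambda>x. f x + g x) \<le> holder_norm \<sigma> f + holder_norm \<sigma> g"
  using little_holder_lincomb[OF assms, of 1 1] holder_space_lincomb(2)[OF assms[THEN little_holder_imp], of 1 1] by simp_all

lemma nth_deriv_diff_le_norm:
  assumes "f \<in> little_holder \<sigma>" "g \<in> little_holder \<sigma>" "j \<le> fkey \<sigma>"
  shows "\<bar>nth_deriv j f x - nth_deriv j g x\<bar> \<le> holder_norm \<sigma> (\<lambda>x. f x - g x)"
proof -
  note hs = assms(1,2)[THEN little_holder_imp]
  have "nth_deriv j (\<lambda>x. 1 * f x + (- 1) * g x) = (\<lambda>x. 1 * nth_deriv j f x + (- 1) * nth_deriv j g x)"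
    by (rule nth_deriv_lincomb[OF hs[THEN holder_spaceD(2)] assms(3)])
  moreover have "\<bar>nth_deriv j (\<lambda>x. 1 * f x + (- 1) * g x) x\<bar> \<le> holder_norm \<sigma> (\<lambda>x. 1 * f x + (- 1) * g x)"
    by (intro nth_deriv_le_norm holder_space_lincomb hs assms)
  ultimately show ?thesis by simp
qed

text \<open>The flux \<open>r / sqrt (1 + r'^2) * H'\<close> is a rational function of the derivatives of \<open>r\<^sup>2\<close>.\<close>

definition Jq :: "real \<Rightarrow> real \<Rightarrow> real \<Rightarrow> real \<Rightarrow> real" where
  "Jq Q a b c = - 2 * a / (4 * Q + a^2) + 4 * a * (2 * Q * b - a^2) / (4 * Q + a^2) ^ 2
     - 8 * Q^2 * c / (4 * Q + a^2) ^ 2 + 6 * a * (2 * Q * b - a^2)^2 / (4 * Q + a^2) ^ 3"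

definition "chain3 r r1 r2 r3 \<longleftrightarrow> (\<forall>x. (r has_real_derivative r1 x) (at x)) \<and>
     (\<forall>x. (r1 has_real_derivative r2 x) (at x)) \<and> (\<forall>x. (r2 has_real_derivative r3 x) (at x))"

lemma chain3_deriv: "chain3 r r1 r2 r3 \<Longrightarrow> deriv r = r1" "chain3 r r1 r2 r3 \<Longrightarrow> deriv r1 = r2"
  by (auto simp: chain3_def intro!: ext DERIV_imp_deriv)

lemma mean_curv_sqrt:
  assumes "chain3 r r1 r2 r3"
  shows "mean_curv r x = 1 / (r x * sqrt (1 + (r1 x)^2)) - r2 x / sqrt (1 + (r1 x)^2) ^ 3"
proof -
  have p: "1 + (r1 x)^2 > 0" by (simp add: add_pos_nonneg)
  have "(1 + (r1 x)^2) powr (3 / 2) = (1 + (r1 x)^2) powr (1 + 1 / 2)" by simp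
  also have "\<dots> = (1 + (r1 x)^2) * sqrt (1 + (r1 x)^2)" unfolding powr_add using p by (simp add: powr_half_sqrt)
  also have "\<dots> = sqrt (1 + (r1 x)^2) ^ 3" using p by (simp add: power3_eq_cube)
  finally show ?thesis by (simp add: mean_curv_def chain3_deriv[OF assms])
qed

text \<open>For Q = r^2 the two composite expressions simplify to 4 Q + Q'^2 = 4 r^2 S^2 and 2 Q Q''
  - Q'^2 = 4 r^3 r''. After that both sides are sums of monomials over powers of S.\<close>

lemma flux_algebra:
  fixes r :: real
  assumes r: "r > 0" and S: "S > 0" "S^2 = 1 + r1^2"
  shows "r / S * (- ((r1 * S + r * (r1 * r2 / S)) / (r * S)^2) - (r3 * S ^ 3 - r2 * (3 * S^2 * (r1 * r2 / S))) / (S ^ 3)^2)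
     = Jq (r^2) (2 * r * r1) (2 * r1^2 + 2 * r * r2) (6 * r1 * r2 + 2 * r * r3)"
proof -
  have E: "4 * r^2 + (2 * r * r1)^2 = 4 * r^2 * S^2" unfolding S by (simp add: power2_eq_square algebra_simps)
  have F: "2 * r^2 * (2 * r1^2 + 2 * r * r2) - (2 * r * r1)^2 = 4 * r ^ 3 * r2"
    by (simp add: power2_eq_square power3_eq_cube algebra_simps)
  have "Jq (r^2) (2 * r * r1) (2 * r1^2 + 2 * r * r2) (6 * r1 * r2 + 2 * r * r3)
     = - r1 / (r * S^2) + 2 * r1 * r2 / S ^ 4 - (3 * r1 * r2 + r * r3) / S ^ 4 + 3 * r * r1 * r2^2 / S ^ 6"
    unfolding Jq_def E F using r S(1) by (simp add: divide_simps power_mult_distrib) (simp add: eval_nat_numeral algebra_simps)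
  also have "\<dots> = r / S * (- ((r1 * S + r * (r1 * r2 / S)) / (r * S)^2) - (r3 * S ^ 3 - r2 * (3 * S^2 * (r1 * r2 / S))) / (S ^ 3)^2)"
    using r S(1) by (simp add: divide_simps power_mult_distrib) (simp add: eval_nat_numeral algebra_simps)
  finally show ?thesis by simp
qed

lemma asd_flux:
  assumes c: "chain3 r r1 r2 r3" and pos: "\<And>x. r x > 0"
  shows "mean_curv r differentiable (at x)"
    and "r x / sqrt (1 + (deriv r x)^2) * deriv (mean_curv r) x =
      Jq ((r x)^2) (2 * r x * r1 x) (2 * (r1 x)^2 + 2 * r x * r2 x) (6 * r1 x * r2 x + 2 * r x * r3 x)"
proof -
  define S where "S y = sqrt (1 + (r1 y)^2)" for y
  have p: "1 + (r1 y)^2 > 0" for y by (simp add: add_pos_nonneg)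
  have S: "S y > 0" "(S y)^2 = 1 + (r1 y)^2" for y using p[of y] by (simp_all add: S_def)
  have dS: "(S has_real_derivative r1 y * r2 y / S y) (at y)" for y unfolding S_def using p[of y] c
    by (auto intro!: derivative_eq_intros simp: chain3_def) (simp add: field_simps)
  have "mean_curv r = (\<lambda>y. 1 / (r y * S y) - r2 y / S y ^ 3)" by (rule ext) (simp add: mean_curv_sqrt[OF c] S_def)
  moreover have "((\<lambda>y. 1 / (r y * S y) - r2 y / S y ^ 3) has_real_derivative
     - ((r1 x * S x + r x * (r1 x * r2 x / S x)) / (r x * S x)^2)
     - (r3 x * S x ^ 3 - r2 x * (3 * (S x)^2 * (r1 x * r2 x / S x))) / (S x ^ 3)^2) (at x)"
  proof -
    have "(r has_real_derivative r1 x) (at x)" "(r2 has_real_derivative r3 x) (at x)" using c by (auto simp: chain3_def)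
    moreover have "r x \<noteq> 0" "S x \<noteq> 0" using pos[of x] S(1)[of x] by auto
    ultimately show ?thesis
      by (auto intro!: derivative_eq_intros dS simp: power2_eq_square add_divide_distrib diff_divide_distrib algebra_simps)
  qed
  ultimately have D: "(mean_curv r has_real_derivative
     - ((r1 x * S x + r x * (r1 x * r2 x / S x)) / (r x * S x)^2)
     - (r3 x * S x ^ 3 - r2 x * (3 * (S x)^2 * (r1 x * r2 x / S x))) / (S x ^ 3)^2) (at x)" by simp
  thus "mean_curv r differentiable (at x)" using real_differentiable_def by blast
  show "r x / sqrt (1 + (deriv r x)^2) * deriv (mean_curv r) x =
      Jq ((r x)^2) (2 * r x * r1 x) (2 * (r1 x)^2 + 2 * r x * r2 x) (6 * r1 x * r2 x + 2 * r x * r3 x)"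
    unfolding DERIV_imp_deriv[OF D] chain3_deriv[OF c] S_def[symmetric] by (rule flux_algebra[OF pos S])
qed

lemma asd_G_flux:
  assumes c: "chain3 r r1 r2 r3" and pos: "\<And>x. r x > 0"
  shows "asd_G r x = 1 / r x * deriv (\<lambda>x. Jq ((r x)^2) (2 * r x * r1 x) (2 * (r1 x)^2 + 2 * r x * r2 x)
    (6 * r1 x * r2 x + 2 * r x * r3 x)) x" unfolding asd_G_def asd_flux(2)[OF assms] ..

text \<open>With P = -V', q = -V'' and s = V''', the linear part is -e (V' + V'''). There is no term
  of order e^2: the quadratic part of the flux carries the factor V + V'' = V - q, which is itself
  of order e for an ansatz dominated by \<open>cos x\<close>. Hence the remainder starts at
  e^3.\<close>

lemma flux_identity:
  fixes e :: real
  assumes h: "h * (1 + e * V + e^2 * P^2 / 4) = 1" and Y: "V - q = e * (v + e * Y)"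
    and f: "f = - 2 * q - e * P^2 * h * (1 - e * q / 2)"
    and \<nu>: "\<nu> = P * ((v + e * Y) * h + P^2 * h / 4 - P^2 * h^2 / 2 + e * h^2 * P^2 * q / 4 + 3 / 16 * h * f^2)
       + s * (- (P^2 * h / 2) + e^2 * P ^ 4 * h^2 / 16)"
  shows "2 * Jq (1 + e * V) (- e * P) (- e * q) (e * s) = e * P - e * s - e ^ 3 * \<nu>"
proof -
  define Q a b c where "Q = 1 + e * V" and "a = - e * P" and "b = - e * q" and "c = e * s"
  have h0: "h \<noteq> 0" using h by auto
  have "(4 * Q + a^2) * h = 4" using h by (simp add: Q_def a_def power_mult_distrib algebra_simps)
  hence E: "4 * Q + a^2 = 4 / h" using h0 by (simp add: field_simps)
  define F where "F = 2 * Q * b - a^2"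
  have Qh: "Q * h = 1 - a^2 * h / 4" using h by (simp add: Q_def a_def power_mult_distrib algebra_simps)
  have Fh: "F * h = e * f"
  proof -
    have "F * h = 2 * b * (Q * h) - a^2 * h" by (simp add: F_def algebra_simps)
    thus ?thesis unfolding Qh f by (simp add: a_def b_def power_mult_distrib power2_eq_square algebra_simps)
  qed
  have "2 * Jq Q a b c = - a * h + a * h * (F * h) / 2 - c * (Q * h)^2 + 3 / 16 * a * h * (F * h)^2"
    unfolding Jq_def E F_def[symmetric] using h0 by (simp add: field_simps) (simp add: eval_nat_numeral algebra_simps)
  also have "\<dots> = e * P * (h - e * h * f / 2) - e * s * (1 - e^2 * P^2 * h / 4)^2 - 3 / 16 * e ^ 3 * P * h * f^2"
    unfolding Fh Qh by (simp add: a_def c_def eval_nat_numeral algebra_simps)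
  also have "h - e * h * f / 2 = 1 - e^2 * ((v + e * Y) * h + P^2 * h / 4 - P^2 * h^2 / 2 + e * h^2 * P^2 * q / 4)"
  proof -
    have "1 - e^2 * ((v + e * Y) * h + P^2 * h / 4 - P^2 * h^2 / 2 + e * h^2 * P^2 * q / 4)
      = 1 - e * (e * (v + e * Y)) * h - e^2 * P^2 * h / 4 + e^2 * P^2 * h^2 / 2 - e ^ 3 * h^2 * P^2 * q / 4"
      by (simp add: eval_nat_numeral algebra_simps)
    also have "\<dots> = h * (1 + e * V + e^2 * P^2 / 4) - e * (V - q) * h - e^2 * P^2 * h / 4 + e^2 * P^2 * h^2 / 2 - e ^ 3 * h^2 * P^2 * q / 4"
      unfolding Y[symmetric] h by simp
    also have "\<dots> = h - e * h * f / 2" unfolding f by (simp add: eval_nat_numeral field_simps)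
    finally show ?thesis by simp
  qed
  finally show ?thesis unfolding \<nu> Q_def a_def b_def c_def by (simp add: eval_nat_numeral algebra_simps)
qed

text \<open>\<open>special B d0 d1 d2 d3 \<sigma>\<close>: with \<open>z = exp (\<sigma> t)\<close>, the function \<open>Cf (pz z) d0\<close> solves the flow; at
  \<open>z = 0\<close> it is an equilibrium whose neck ratio is determined by \<open>B\<close>, and it leaves this equilibrium
  as \<open>z\<close> grows.\<close>

definition special :: "real \<Rightarrow> wser \<Rightarrow> wser \<Rightarrow> wser \<Rightarrow> wser \<Rightarrow> real \<Rightarrow> bool" where
  "special B d0 d1 d2 d3 \<sigma> \<longleftrightarrow> \<sigma> > 0 \<and>
     (\<forall>z. \<bar>z\<bar> \<le> 1 / 64 \<longrightarrow> (\<forall>x. Cf (pz z) d0 x \<ge> 1 / 2) \<and>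
        chain3 (Cf (pz z) d0) (\<lambda>x. - Sf (pz z) d1 x) (\<lambda>x. - Cf (pz z) d2 x) (Sf (pz z) d3)) \<and>
     (\<forall>z x. \<bar>z\<bar> < 1 / 128 \<longrightarrow> asd_G (Cf (pz z) d0) x = Cf (\<lambda>n. \<sigma> * (real n * z ^ n)) d0 x) \<and>
     Cf (pz 0) d0 0 - Cf (pz 0) d0 pi = B * (Cf (pz 0) d0 0 + Cf (pz 0) d0 pi) \<and>
     \<bar>Cf (pz 0) d0 0 - 1\<bar> \<le> 1 / 8 \<and> \<bar>Cf (pz 0) d2 0\<bar> \<le> 1 / 8 \<and>
     (\<forall>z. 0 < z \<longrightarrow> z < 1 / 128 \<longrightarrow> Cf (pz z) d0 0 \<noteq> Cf (pz 0) d0 0) \<and>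
     (\<exists>v. 1 / 8 \<le> v \<and> v \<le> 5 / 8 \<and> (\<forall>l::nat. l \<ge> 1 \<longrightarrow>
        integral {-pi..pi} (\<lambda>x. (Cf (pz 0) d0 (real l * x))\<^sup>2) = 2 * pi * (1 + (2 * B / (1 + B^2))^2 * v)))"

section \<open>From the fixed point to an orbit of the flow\<close>

lemma wtn_Suc_Suc: "wtn (Suc (Suc n)) = wtn (Suc n) / 64" by (simp add: wtn_def)

text \<open>Shrinking the radius from 1/64 to 1/128 leaves a factor 2^n to spare, which absorbs the
  factor n produced by differentiation in z.\<close>

lemma power_diff_small:
  fixes y z :: real
  assumes y: "\<bar>y\<bar> \<le> 1 / 128" and z: "\<bar>z\<bar> \<le> 1 / 128"
  shows "\<bar>y ^ n - z ^ n\<bar> \<le> \<bar>y - z\<bar> * wtn n"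
    and "\<bar>real n * z ^ (n - 1)\<bar> \<le> 1 * wtn n"
    and "\<bar>y ^ n - z ^ n - real n * z ^ (n - 1) * (y - z)\<bar> \<le> 256 * (y - z)^2 * wtn n"
proof -
  have z0: "\<bar>z ^ n\<bar> \<le> wtn (Suc n) / 2 ^ n" for n
  proof -
    have "\<bar>z\<bar> ^ n \<le> (1 / 128) ^ n" by (rule power_mono[OF z]) simp
    also have "\<dots> = wtn (Suc n) / 2 ^ n" unfolding wtn_def by (simp flip: power_mult_distrib power_divide)
    finally show ?thesis by (simp add: power_abs)
  qed
  have d: "\<bar>real (Suc n) * z ^ n\<bar> \<le> wtn (Suc n)" for n
  proof -
    have "real (Suc n) \<le> 2 ^ n" by (induction n) auto
    hence "real (Suc n) * \<bar>z ^ n\<bar> \<le> 2 ^ n * (wtn (Suc n) / 2 ^ n)" by (intro mult_mono z0) auto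
    thus ?thesis by (simp add: abs_mult)
  qed
  thus "\<bar>real n * z ^ (n - 1)\<bar> \<le> 1 * wtn n" by (cases n) auto
  have mul: "\<bar>a * w\<bar> \<le> 1 / 128 * W" if "\<bar>a\<bar> \<le> 1 / 128" "\<bar>w\<bar> \<le> W" for a w W :: real
    unfolding abs_mult by (rule mult_mono[OF that]) auto
  have 1: "\<bar>y ^ Suc n - z ^ Suc n\<bar> \<le> \<bar>y - z\<bar> * wtn (Suc n)" for n
  proof (induction n)
    case (Suc n)
    have "1 * \<bar>z ^ n\<bar> \<le> real (Suc n) * \<bar>z ^ n\<bar>" by (rule mult_right_mono) auto
    hence "\<bar>z ^ Suc n\<bar> \<le> 1 / 128 * wtn (Suc n)" using mul[OF z, of "z ^ n"] d[of n] by (simp add: abs_mult)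
    hence "\<bar>y - z\<bar> * \<bar>z ^ Suc n\<bar> \<le> \<bar>y - z\<bar> * (1 / 128 * wtn (Suc n))" by (rule mult_left_mono) simp
    moreover have "y ^ Suc (Suc n) - z ^ Suc (Suc n) = y * (y ^ Suc n - z ^ Suc n) + (y - z) * z ^ Suc n" by (simp add: algebra_simps)
    ultimately show ?case using mul[OF y Suc.IH] abs_triangle_ineq[of "y * (y ^ Suc n - z ^ Suc n)" "(y - z) * z ^ Suc n"]
      unfolding wtn_Suc_Suc abs_mult[of "y - z"] by simp
  qed simp
  show "\<bar>y ^ n - z ^ n\<bar> \<le> \<bar>y - z\<bar> * wtn n" using 1 by (cases n) auto
  have 3: "\<bar>y ^ Suc n - z ^ Suc n - real (Suc n) * z ^ n * (y - z)\<bar> \<le> 256 * (y - z)^2 * wtn (Suc n)" for n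
  proof (induction n)
    case (Suc n)
    define T where "T = y ^ Suc n - z ^ Suc n - real (Suc n) * z ^ n * (y - z)"
    have "\<bar>real (Suc n) * z ^ n * (y - z)^2\<bar> \<le> wtn (Suc n) * (y - z)^2"
      unfolding abs_mult[of _ "(y - z)^2"] using d[of n] by (intro mult_mono) auto
    moreover have "y ^ Suc (Suc n) - z ^ Suc (Suc n) - real (Suc (Suc n)) * z ^ Suc n * (y - z) = y * T + real (Suc n) * z ^ n * (y - z)^2"
      unfolding T_def by (simp add: power2_eq_square algebra_simps)
    moreover have "0 \<le> wtn (Suc n) * (y - z)^2" by (simp add: less_imp_le)
    ultimately show ?case using mul[OF y Suc.IH[folded T_def]] abs_triangle_ineq[of "y * T" "real (Suc n) * z ^ n * (y - z)^2"]
      unfolding wtn_Suc_Suc by (simp add: mult.commute)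
  qed simp
  show "\<bar>y ^ n - z ^ n - real n * z ^ (n - 1) * (y - z)\<bar> \<le> 256 * (y - z)^2 * wtn n" using 3 by (cases n) auto
qed

lemma admissible_dz: "\<bar>z\<bar> \<le> 1 / 128 \<Longrightarrow> admissible 1 (dz z)" using power_diff_small(2)[of z z] by (simp add: admissible_def dz_def)

lemma admissible_taylor:
  assumes "\<bar>y\<bar> \<le> 1 / 128" "\<bar>z\<bar> \<le> 1 / 128"
  shows "admissible (256 * (y - z)^2) (\<lambda>n. pz y n - pz z n - (y - z) * dz z n)"
  using power_diff_small(3)[OF assms] unfolding admissible_def pz_def dz_def by (simp add: mult.commute mult.left_commute)

lemma Cf_pz_deriv:
  assumes z: "\<bar>z\<bar> < 1 / 128"
  shows "((\<lambda>z. Cf (pz z) f x) has_real_derivative Cf (dz z) f x) (at z)" unfolding Cf_def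
proof (rule wpair_deriv)
  show "1 / 128 - \<bar>z\<bar> > 0" using z by simp
  show "norm (dz z (fst i) * cos (of_int (snd i) * x)) \<le> 1 * wt i" for i by (rule weights(1)[OF admissible_dz]) (use z in simp)
  fix y i assume "\<bar>y - z\<bar> < 1 / 128 - \<bar>z\<bar>"
  hence y: "\<bar>y\<bar> \<le> 1 / 128" by auto
  thus "norm (pz y (fst i) * cos (of_int (snd i) * x)) \<le> 1 * wt i" by (intro weights(1)[OF admissible_pz]) auto
  show "\<bar>pz y (fst i) * cos (of_int (snd i) * x) - pz z (fst i) * cos (of_int (snd i) * x)
      - dz z (fst i) * cos (of_int (snd i) * x) * (y - z)\<bar> \<le> 256 * (y - z)^2 * wt i"
    using weights(1)[OF admissible_taylor[OF y less_imp_le[OF z]], of i x] by (simp add: algebra_simps)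
qed

lemma coef_V_chain:
  "coef (Vp K e x) (n, k) = of_int k * coef (Vv K e x) (n, k)"
  "coef (Vq K e x) (n, k) = of_int k * coef (Vp K e x) (n, k)"
  "coef (Vs K e x) (n, k) = of_int k * coef (Vq K e x) (n, k)"
  and coef_Vv: "coef (Vv K e x) (n, k) = (if k = 0 then (if n = 0 then e * vv x else 0)
     else if \<bar>k\<bar> = 1 then coef (Atot K e x) (n, 0) / 2 else e\<^sup>2 * K * coef x (n, k) / \<bar>of_int k\<bar> ^ 3)"
proof -
  have A: "coef (Atot K e x) (n, k) = 0" if "k \<noteq> 0" for n k using that by (auto simp: Atot_def coef_At0 zero_prod_def)
  have kc: "k = 0 \<or> k = 1 \<or> k = - 1 \<or> \<bar>k\<bar> \<ge> 2" by arith
  have c: "coef (Atot K e x * c1) (n, k) = (if \<bar>k\<bar> = 1 then coef (Atot K e x) (n, 0) / 2 else 0)"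
    and s: "coef (Atot K e x * s1) (n, k) = (if \<bar>k\<bar> = 1 then of_int k * coef (Atot K e x) (n, 0) / 2 else 0)" for n k
    using A[of "k - 1"] A[of "k + 1"] by (auto simp: c1_def s1_def E1_def F1_def ring_distribs coef_times_single0 abs_if)
  have W: "j \<le> 3 \<Longrightarrow> coef (WO j x) (n, k) = (if \<bar>k\<bar> \<ge> 2 then of_int k ^ j / \<bar>of_int k\<bar> ^ 3 * coef x (n, k) else 0)" for j n k
    by (simp add: coef_WO modeW_def)
  note simps = Vv_def Vp_def Vq_def Vs_def c s W zero_prod_def
  show "coef (Vv K e x) (n, k) = (if k = 0 then (if n = 0 then e * vv x else 0)
     else if \<bar>k\<bar> = 1 then coef (Atot K e x) (n, 0) / 2 else e\<^sup>2 * K * coef x (n, k) / \<bar>of_int k\<bar> ^ 3)"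
    using kc by (auto simp: simps power2_eq_square)
  show "coef (Vp K e x) (n, k) = of_int k * coef (Vv K e x) (n, k)"
    "coef (Vq K e x) (n, k) = of_int k * coef (Vp K e x) (n, k)"
    "coef (Vs K e x) (n, k) = of_int k * coef (Vq K e x) (n, k)" using kc by (auto simp: simps power2_eq_square power3_eq_cube)
qed

lemma flip_V:
  assumes "x \<in> XS"
  shows "flip (Vv K e x) = Vv K e x" "flip (Vp K e x) = - Vp K e x" "flip (Vq K e x) = Vq K e x" "flip (Vs K e x) = - Vs K e x"
proof -
  have x: "coef x (n, - k) = coef x (n, k)" for n k using assms by (simp add: XS_def)
  show "flip (Vv K e x) = Vv K e x" by (rule wser_eqI, clarify) (simp add: coef_Vv x)
  show "flip (Vp K e x) = - Vp K e x" by (rule wser_eqI, clarify) (simp add: coef_V_chain coef_Vv x)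
  show "flip (Vq K e x) = Vq K e x" by (rule wser_eqI, clarify) (simp add: coef_V_chain coef_Vv x)
  show "flip (Vs K e x) = - Vs K e x" by (rule wser_eqI, clarify) (simp add: coef_V_chain coef_Vv x)
qed

lemma bounded_linear_ev:
  assumes "admissible M \<phi>"
  shows "bounded_linear (\<lambda>f. Cf \<phi> f x)" "bounded_linear (\<lambda>f. Sf \<phi> f x)" unfolding Cf_def Sf_def
  by (rule bounded_linear_wpair[OF weights(1)[OF assms]] bounded_linear_wpair[OF weights(2)[OF assms]])+

lemma norm_mult_le:
  fixes a b :: "'a :: real_normed_algebra"
  shows "norm a \<le> A \<Longrightarrow> norm b \<le> B \<Longrightarrow> norm (a * b) \<le> A * B"
  by (rule order_trans[OF norm_mult_ineq]) (auto intro!: mult_mono intro: order_trans[OF norm_ge_zero])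

lemma ev_decomp:
  assumes x: "x \<in> XS" and z: "\<bar>z\<bar> \<le> 1 / 64"
  shows "ev z y (Vv K e x) = complex_of_real (Cf (pz z) (Vv K e x) y)"
    "ev z y (Vp K e x) = \<i> * complex_of_real (Sf (pz z) (Vp K e x) y)"
    "ev z y (Vq K e x) = complex_of_real (Cf (pz z) (Vq K e x) y)"
    "ev z y (Vs K e x) = \<i> * complex_of_real (Sf (pz z) (Vs K e x) y)"
  using flip_V[OF x, of K e] by (simp_all add: ev_Complex[OF z] Sf_sym Cf_anti complex_eq_iff)

text \<open>\<open>Vq\<close> represents minus the second derivative, so this is V + V''. The
  amplitude term drops out because \<open>cos x\<close> lies in the kernel of 1 + d^2/dx^2.\<close>

lemma Vv_Vq: "Vv K e x - Vq K e x = e *\<^sub>R (vv x *\<^sub>R 1 + e *\<^sub>R Yy K x)" by (simp add: Vv_def Vq_def Yy_def algebra_simps)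

text \<open>The fixed point equation says that the time derivative of \<open>r\<^sup>2\<close> is the divergence of the flux.\<close>

lemma flux_evaluation:
  assumes x: "x \<in> XS" and z: "\<bar>z\<bar> \<le> 1 / 64" and half: "norm (e *\<^sub>R ee K e x) \<le> 1 / 2" and e: "e \<noteq> 0"
  defines "X \<equiv> e *\<^sub>R (Vp K e x - Vs K e x - e^2 *\<^sub>R No K e x)"
  shows "2 * Jq (1 + e * Cf (pz z) (Vv K e x) y) (- e * Sf (pz z) (Vp K e x) y)
      (- e * Cf (pz z) (Vq K e x) y) (e * Sf (pz z) (Vs K e x) y) = Sf (pz z) X y"
proof -
  define V P q s where "V = Cf (pz z) (Vv K e x) y" and "P = Sf (pz z) (Vp K e x) y"
    and "q = Cf (pz z) (Vq K e x) y" and "s = Sf (pz z) (Vs K e x) y"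
  note evV = ev_decomp[OF x z, of y K e, folded V_def P_def q_def s_def]
  note evs = ev_add[OF z] ev_diff[OF z] ev_smult[OF z] ev_mult[OF z] ev_power[OF z] ev_one[OF z] evV
  have ee: "ev z y (ee K e x) = complex_of_real (V + e * P^2 / 4)" by (simp add: ee_def evs power_mult_distrib)
  define D where "D = 1 + e * V + e^2 * P^2 / 4"
  have "ev z y ((1 + e *\<^sub>R ee K e x) * hh K e x) = 1" unfolding hh_def oinv(1)[OF half] by (rule ev_one[OF z])
  hence hD: "complex_of_real D * ev z y (hh K e x) = 1" by (simp add: evs ee D_def power2_eq_square algebra_simps)
  hence D0: "D \<noteq> 0" by auto
  define h where "h = 1 / D"
  have evh: "ev z y (hh K e x) = complex_of_real h" using hD D0 by (simp add: h_def field_simps)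
  have h: "h * (1 + e * V + e^2 * P^2 / 4) = 1" using D0 by (simp add: h_def D_def)
  define f where "f = - 2 * q - e * P^2 * h * (1 - e * q / 2)"
  have evf: "ev z y (ff K e x) = complex_of_real f" by (simp add: ff_def evs evh f_def power_mult_distrib)
  define Y where "Y = Re (ev z y (Yy K x))"
  have "ev z y (Vv K e x - Vq K e x) = of_real (V - q)" by (simp add: evs)
  hence Yc: "complex_of_real (V - q) = of_real e * (of_real (vv x) + of_real e * ev z y (Yy K x))"
    unfolding Vv_Vq by (simp add: evs)
  have "Re (of_real e * (of_real (vv x) + of_real e * ev z y (Yy K x))) = e * (vv x + e * Y)" by (simp add: Y_def)
  hence Y: "V - q = e * (vv x + e * Y)" unfolding Yc[symmetric] by simp
  \<comment> \<open>Comparison of imaginary parts shows that \<open>Yy\<close> evaluates to a real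
    number; e^2 is divided out here.\<close>
  have "Im (of_real e * (of_real (vv x) + of_real e * ev z y (Yy K x))) = e * e * Im (ev z y (Yy K x))" by simp
  hence "Im (ev z y (Yy K x)) = 0" unfolding Yc[symmetric] using e by simp
  hence evY: "ev z y (Yy K x) = of_real Y" by (simp add: Y_def complex_eq_iff)
  define \<nu> where "\<nu> = P * ((vv x + e * Y) * h + P^2 * h / 4 - P^2 * h^2 / 2 + e * h^2 * P^2 * q / 4 + 3 / 16 * h * f^2)
       + s * (- (P^2 * h / 2) + e^2 * P ^ 4 * h^2 / 16)"
  have i4: "\<i> ^ 4 = 1" by (simp add: eval_nat_numeral)
  have "ev z y (No K e x) = \<i> * complex_of_real \<nu>"
    by (simp add: No_def evs evh evf evY \<nu>_def power_mult_distrib i4) (simp add: power2_eq_square algebra_simps)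
  hence N: "Sf (pz z) (No K e x) y = \<nu>" by (simp add: ev_Complex[OF z] complex_eq_iff)
  note id = flux_identity[OF h Y f_def \<nu>_def]
  interpret bounded_linear "\<lambda>f. Sf (pz z) f y" by (rule bounded_linear_ev[OF admissible_pz[OF z]])
  have "Sf (pz z) X y = e * (P - s - e^2 * \<nu>)" unfolding X_def ev_scaleR diff N P_def s_def ..
  also have "\<dots> = e * P - e * s - e ^ 3 * \<nu>" by (simp add: power2_eq_square power3_eq_cube algebra_simps)
  finally show ?thesis using id by (simp add: V_def P_def q_def s_def)
qed

text \<open>\<open>X\<close> evaluates to twice the flux, the factor k is its divergence, and the
  factor e^2 t n is the time derivative of e V when z grows with rate e^2 t. At k = 0 both sides
  vanish: n = 0 kills the constant v, and the other coefficients of mode 0 are zero.\<close>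

lemma mode_equation:
  assumes "modal_solution K e x"
  defines "X \<equiv> e *\<^sub>R (Vp K e x - Vs K e x - e^2 *\<^sub>R No K e x)"
  shows "of_int k * coef X (n, k) = e^2 * ta x * real n * (e * coef (Vv K e x) (n, k))"
proof -
  note x = assms(1)[unfolded modal_solution_def]
  have anti: "coef (No K e x) (n, - 1) = - coef (No K e x) (n, 1)" using flip_No[of x e K] x by (metis coef_flip coef_uminus)
  have X: "of_int k * coef X (n, k) = e * ((of_int k ^ 2 - of_int k ^ 4) * coef (Vv K e x) (n, k) - e^2 * of_int k * coef (No K e x) (n, k))"
    by (simp add: X_def coef_V_chain eval_nat_numeral algebra_simps)
  have kc: "k = 0 \<or> \<bar>k\<bar> = 1 \<or> \<bar>k\<bar> \<ge> 2" by arith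
  have At: "real n * coef (Atot K e x) (n, 0) = real n * coef (At0 x) (n, 0)" by (auto simp: Atot_def zero_prod_def)
  show ?thesis
  proof (cases "\<bar>k\<bar> \<ge> 2")
    case True
    hence k0: "real_of_int k \<noteq> 0" "k \<noteq> 0" "\<bar>k\<bar> \<noteq> 1" by auto
    define a where "a = \<bar>real_of_int k\<bar> ^ 3"
    have a: "a \<noteq> 0" using k0 by (simp add: a_def)
    have V: "coef (Vv K e x) (n, k) = e^2 * K * coef x (n, k) / a" using k0 by (simp add: coef_Vv a_def)
    have "(K * (real n * e^2 * ta x + (of_int k ^ 4 - of_int k ^ 2)) * coef x (n, k)) * e^2 / a
      = - (a * of_int k * coef (No K e x) (n, k)) * e^2 / a" using x True unfolding a_def by simp
    hence "(real n * e^2 * ta x + (of_int k ^ 4 - of_int k ^ 2)) * coef (Vv K e x) (n, k) = - (e^2 * of_int k * coef (No K e x) (n, k))"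
      unfolding V using a by (simp add: field_simps)
    hence "real n * e^2 * ta x * coef (Vv K e x) (n, k) = (of_int k ^ 2 - of_int k ^ 4) * coef (Vv K e x) (n, k) - e^2 * of_int k * coef (No K e x) (n, k)"
      by (simp add: algebra_simps)
    thus ?thesis unfolding X by (simp add: mult_ac)
  next
    case False
    have "e^2 * ta x * real n * (e * (coef (Atot K e x) (n, 0) / 2)) = e * e^2 * ta x / 2 * (real n * coef (At0 x) (n, 0))"
      unfolding At[symmetric] by simp
    also have "\<dots> = e * e^2 / 2 * (- 2 * coef (No K e x) (n, 1))"
      using x[THEN conjunct2, THEN conjunct2, THEN conjunct1, rule_format, of n, symmetric] by simp
    finally have A: "e^2 * ta x * real n * (e * (coef (Atot K e x) (n, 0) / 2)) = e * e^2 / 2 * (- 2 * coef (No K e x) (n, 1))" .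
    from False kc consider "k = 0" | "k = 1" | "k = - 1" by arith
    thus ?thesis unfolding X by cases (use A in \<open>simp_all add: coef_Vv anti\<close>)
  qed
qed

lemma norm_sqrt_chain:
  assumes "norm (u :: wser) \<le> 1 / 16" "norm u1 \<le> 1 / 16" "norm u2 \<le> 1 / 16"
    "d0 * d0 = 1 + u" "norm (d0 - 1) \<le> norm u"
  defines "w \<equiv> oinv (d0 - 1)"
  defines "d1 \<equiv> (1 / 2) *\<^sub>R (w * u1)"
  shows "d0 * w = 1" "norm (w * ((1 / 2) *\<^sub>R u2 - d1 * d1)) \<le> 1 / 8"
proof -
  have n: "norm (d0 - 1) \<le> 1 / 2" using assms(1,5) by simp
  show "d0 * w = 1" using oinv(1)[OF n] by (simp add: w_def)
  have w: "norm w \<le> 2" unfolding w_def by (rule oinv(2)[OF n])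
  have "norm (w * u1) \<le> 2 * (1 / 16)" by (rule norm_mult_le[OF w assms(2)])
  hence d1: "norm d1 \<le> 1 / 16" by (simp add: d1_def)
  have "norm (d1 * d1) \<le> 1 / 16 * (1 / 16)" by (rule norm_mult_le[OF d1 d1])
  moreover have "norm ((1 / 2) *\<^sub>R u2) \<le> 1 / 32" using assms(3) by simp
  ultimately have "norm ((1 / 2) *\<^sub>R u2 - d1 * d1) \<le> 1 / 16" using norm_triangle_ineq4[of "(1 / 2) *\<^sub>R u2" "d1 * d1"] by linarith
  from norm_mult_le[OF w this] show "norm (w * ((1 / 2) *\<^sub>R u2 - d1 * d1)) \<le> 1 / 8" by simp
qed

text \<open>For Q = 1 + u and r = sqrt Q the series d1, d2, d3 arise by solving 2 r r' = Q', 2 r'^2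
  + 2 r r'' = Q'' and 6 r' r'' + 2 r r''' = Q''' for the highest derivative. Keeping them as
  separate elements of the algebra preserves the full decay in k for r'''.\<close>

lemma sqrt_chain:
  assumes z: "\<bar>z\<bar> \<le> 1 / 64" and d0: "d0 * d0 = 1 + u" "norm (d0 - 1) \<le> 1 / 2" and w: "d0 * w = 1"
    and sym: "flip u = u" "flip u1 = - u1" "flip u2 = u2" "flip u3 = - u3"
    and delta: "\<And>n k. coef u1 (n, k) = of_int k * coef u (n, k)" "\<And>n k. coef u2 (n, k) = of_int k * coef u1 (n, k)"
      "\<And>n k. coef u3 (n, k) = of_int k * coef u2 (n, k)"
  defines "d1 \<equiv> (1 / 2) *\<^sub>R (w * u1)"
  defines "d2 \<equiv> w * ((1 / 2) *\<^sub>R u2 - d1 * d1)"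
  defines "d3 \<equiv> w * ((1 / 2) *\<^sub>R u3 - 3 *\<^sub>R (d1 * d2))"
  shows "Cf (pz z) d0 x \<ge> 1 / 2" "(Cf (pz z) d0 x)^2 = 1 + Cf (pz z) u x"
    "chain3 (Cf (pz z) d0) (\<lambda>x. - Sf (pz z) d1 x) (\<lambda>x. - Cf (pz z) d2 x) (Sf (pz z) d3)"
    "2 * Cf (pz z) d0 x * (- Sf (pz z) d1 x) = - Sf (pz z) u1 x"
    "2 * (- Sf (pz z) d1 x)^2 + 2 * Cf (pz z) d0 x * (- Cf (pz z) d2 x) = - Cf (pz z) u2 x"
    "6 * (- Sf (pz z) d1 x) * (- Cf (pz z) d2 x) + 2 * Cf (pz z) d0 x * Sf (pz z) d3 x = Sf (pz z) u3 x"
proof -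
  define r r1 r2 r3 where "r = Cf (pz z) d0" and "r1 = (\<lambda>x. - Sf (pz z) d1 x)" and "r2 = (\<lambda>x. - Cf (pz z) d2 x)"
    and "r3 = Sf (pz z) d3"
  define Q Q1 Q2 Q3 where "Q x = 1 + Cf (pz z) u x" and "Q1 x = - Sf (pz z) u1 x" and "Q2 x = - Cf (pz z) u2 x"
    and "Q3 x = Sf (pz z) u3 x" for x
  note evs = ev_add[OF z] ev_diff[OF z] ev_smult[OF z] ev_mult[OF z] ev_power[OF z] ev_one[OF z]
  note adm = admissible_pz[OF z]
  have evu: "ev z x u = of_real (Q x - 1)" "ev z x u1 = - \<i> * of_real (Q1 x)" "ev z x u2 = - of_real (Q2 x)" "ev z x u3 = \<i> * of_real (Q3 x)" for x
    using sym by (simp_all add: Q_def Q1_def Q2_def Q3_def ev_Complex[OF z] Sf_sym Cf_anti complex_eq_iff)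
  have r: "ev z x d0 = of_real (r x)" "r x \<ge> 1 / 2" "(r x)^2 = Q x" for x
  proof -
    have sq: "ev z x d0 * ev z x d0 = of_real (Q x)" using arg_cong[OF d0(1), of "ev z x"] by (simp add: evs evu)
    have "norm (ev z x d0 - 1) \<le> 1 / 2" using ev_norm[OF z, of x "d0 - 1"] d0(2) by (simp add: evs)
    \<comment> \<open>Closeness of d0 to 1 selects the branch of the root: the square is real and
      the real part is positive, so the value itself is real.\<close>
    hence Re: "Re (ev z x d0) \<ge> 1 / 2" using abs_Re_le_cmod[of "ev z x d0 - 1"] by auto
    have "Im (ev z x d0 * ev z x d0) = 0" unfolding sq by simp
    hence "Im (ev z x d0) = 0" using Re by simp
    thus c: "ev z x d0 = of_real (r x)" by (simp add: r_def ev_Complex[OF z] complex_eq_iff)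
    show "r x \<ge> 1 / 2" using Re by (simp add: c)
    show "(r x)^2 = Q x" using sq unfolding c by (metis of_real_eq_iff of_real_mult power2_eq_square)
  qed
  have r0: "r x \<noteq> 0" for x using r(2)[of x] by auto
  have evw: "ev z x w = of_real (1 / r x)" for x
  proof -
    have "of_real (r x) * ev z x w = 1" using arg_cong[OF w, of "ev z x"] by (simp add: evs r)
    thus ?thesis using r0[of x] by (simp add: field_simps)
  qed
  have e1: "ev z x d1 = - \<i> * of_real (Q1 x / (2 * r x))" for x by (simp add: d1_def evs evw evu)
  have R1: "r1 x = Q1 x / (2 * r x)" for x using e1[of x] by (simp add: r1_def ev_Complex[OF z] complex_eq_iff)
  have e2: "ev z x d2 = - of_real ((Q2 x / 2 - (r1 x)^2) / r x)" for x
    by (simp add: d2_def evs evw evu e1 R1 power2_eq_square) (simp add: algebra_simps add_divide_distrib diff_divide_distrib)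
  have R2: "r2 x = (Q2 x / 2 - (r1 x)^2) / r x" for x using e2[of x] by (simp add: r2_def ev_Complex[OF z] complex_eq_iff)
  have e3: "ev z x d3 = \<i> * of_real ((Q3 x / 2 - 3 * r1 x * r2 x) / r x)" for x
    by (simp add: d3_def evs evw evu e1 e2 R1 R2) (simp add: algebra_simps add_divide_distrib diff_divide_distrib)
  have R3: "r3 x = (Q3 x / 2 - 3 * r1 x * r2 x) / r x" for x using e3[of x] by (simp add: r3_def ev_Complex[OF z] complex_eq_iff)
  have I1: "2 * r x * r1 x = Q1 x" and I2: "2 * (r1 x)^2 + 2 * r x * r2 x = Q2 x"
    and I3: "6 * r1 x * r2 x + 2 * r x * r3 x = Q3 x" for x using r0[of x] by (simp_all add: R1 R2 R3)
  have dQ: "(Q has_real_derivative Q1 x) (at x)" "(Q1 has_real_derivative Q2 x) (at x)" "(Q2 has_real_derivative Q3 x) (at x)" for x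
    unfolding Q_def[abs_def] Q1_def[abs_def] Q2_def[abs_def] Q3_def[abs_def]
    using Sf1_delta[OF delta(1), of "pz z" x] Cf1_delta[OF delta(2), of "pz z" x] Sf1_delta[OF delta(3), of "pz z" x]
    by (auto intro!: derivative_eq_intros Cf_deriv[OF adm] Sf_deriv[OF adm])
  have "chain3 r r1 r2 r3" unfolding chain3_def
  proof (intro conjI allI)
    fix x
    have "Q x > 0" using r(3)[of x] r0[of x] by (metis zero_less_power2)
    hence "((\<lambda>x. sqrt (Q x)) has_real_derivative Q1 x / (2 * sqrt (Q x))) (at x)"
      by (auto intro!: derivative_eq_intros dQ simp: divide_simps)
    moreover have "sqrt (Q x) = r x" for x using r(2,3)[of x] by (intro real_sqrt_unique) auto
    ultimately show D: "(r has_real_derivative r1 x) (at x)" by (simp add: R1)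
    have "((\<lambda>x. Q1 x / (2 * r x)) has_real_derivative (Q2 x * (2 * r x) - Q1 x * (2 * r1 x)) / (2 * r x * (2 * r x))) (at x)"
      using r0[of x] by (auto intro!: derivative_eq_intros dQ D)
    moreover have "(Q2 x * (2 * r x) - Q1 x * (2 * r1 x)) / (2 * r x * (2 * r x)) = r2 x"
      using r0[of x] unfolding I1[symmetric] I2[symmetric] by (simp add: field_simps power2_eq_square)
    ultimately show D': "(r1 has_real_derivative r2 x) (at x)" by (simp flip: R1)
    have "((\<lambda>x. (Q2 x / 2 - (r1 x)^2) / r x) has_real_derivative
        ((Q3 x / 2 - 2 * r1 x * r2 x) * r x - (Q2 x / 2 - (r1 x)^2) * r1 x) / (r x * r x)) (at x)"
      using r0[of x] by (auto intro!: derivative_eq_intros dQ D D' simp: mult_ac)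
    moreover have "((Q3 x / 2 - 2 * r1 x * r2 x) * r x - (Q2 x / 2 - (r1 x)^2) * r1 x) / (r x * r x) = r3 x"
      using r0[of x] unfolding I3[symmetric] I2[symmetric] by (simp add: field_simps)
    ultimately show "(r2 has_real_derivative r3 x) (at x)" by (simp flip: R2)
  qed
  thus "Cf (pz z) d0 x \<ge> 1 / 2" "(Cf (pz z) d0 x)^2 = 1 + Cf (pz z) u x"
    "chain3 (Cf (pz z) d0) (\<lambda>x. - Sf (pz z) d1 x) (\<lambda>x. - Cf (pz z) d2 x) (Sf (pz z) d3)"
    "2 * Cf (pz z) d0 x * (- Sf (pz z) d1 x) = - Sf (pz z) u1 x"
    "2 * (- Sf (pz z) d1 x)^2 + 2 * Cf (pz z) d0 x * (- Cf (pz z) d2 x) = - Cf (pz z) u2 x"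
    "6 * (- Sf (pz z) d1 x) * (- Cf (pz z) d2 x) + 2 * Cf (pz z) d0 x * Sf (pz z) d3 x = Sf (pz z) u3 x"
    using r(2,3)[of x] I1[of x] I2[of x] I3[of x] unfolding r_def r1_def r2_def r3_def Q_def Q1_def Q2_def Q3_def by simp_all
qed

lemma admissible_pz_diff:
  assumes "\<bar>y\<bar> \<le> 1 / 128" "\<bar>z\<bar> \<le> 1 / 128"
  shows "admissible \<bar>y - z\<bar> (\<lambda>n. pz y n - pz z n)" using power_diff_small(1)[OF assms] by (simp add: admissible_def pz_def)

lemma ev_pz_diff:
  assumes "\<bar>y\<bar> \<le> 1 / 128" "\<bar>z\<bar> \<le> 1 / 128"
  shows "\<bar>Cf (pz y) f x - Cf (pz z) f x\<bar> \<le> \<bar>y - z\<bar> * norm f"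
proof -
  have "\<bar>y\<bar> \<le> 1 / 64" "\<bar>z\<bar> \<le> 1 / 64" using assms by auto
  thus ?thesis
    using ev_diff_weights(1)[OF admissible_pz admissible_pz, of y z f x] ev_bounds(1)[OF admissible_pz_diff[OF assms], of f x] by simp
qed

lemma ev_single:
  assumes "\<bar>z\<bar> \<le> 1 / 64"
  shows "ev z y (single n k) = of_real (z ^ n) * cis (of_int k * y)"
proof -
  have "ev z y (single n k) = (\<Sum>\<^sub>\<infinity>i\<in>{(n, k)}. coef (single n k) i *\<^sub>R (of_real (z ^ fst i) * cis (of_int (snd i) * y)))"
    unfolding ev_def wpair_def by (rule infsum_cong_neutral) auto
  thus ?thesis by simp
qed

lemma Cf_Vv:
  assumes x: "x \<in> XS" and z: "\<bar>z\<bar> \<le> 1 / 64"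
  shows "Cf (pz z) (Vv K e x) y = (1 + z + Cf (pz z) (PA x) y + e * kap K e x) * cos y
     + e * (vv x + e * (K * Cf (pz z) (WO 0 x) y))"
proof -
  note evs = ev_add[OF z] ev_diff[OF z] ev_smult[OF z] ev_mult[OF z] ev_power[OF z] ev_one[OF z] ev_single[OF z]
  have PA: "flip (PA x) = PA x" by (rule wser_eqI) (auto simp: coef_PA modeA_def)
  have "ev z y (PA x) = of_real (Cf (pz z) (PA x) y)" "ev z y (WO 0 x) = of_real (Cf (pz z) (WO 0 x) y)"
    using Sf_sym[OF PA] Sf_sym[of "WO 0 x"] flip_WO[OF x, of 0] by (simp_all add: ev_Complex[OF z] complex_eq_iff)
  moreover have "ev z y c1 = of_real (cos y)" by (simp add: c1_def E1_def F1_def evs complex_eq_iff)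
  ultimately have "ev z y (Vv K e x) = of_real ((1 + z + Cf (pz z) (PA x) y + e * kap K e x) * cos y
     + e * (vv x + e * (K * Cf (pz z) (WO 0 x) y)))" by (simp add: Vv_def Atot_def At0_def zz_def evs)
  thus ?thesis by (simp add: ev_Complex[OF z] complex_eq_iff)
qed

lemma Cf_0_parity:
  "Cf (pz 0) f 0 = wpair (par True) f + wpair (par False) f"
  "Cf (pz 0) f pi = wpair (par True) f - wpair (par False) f"
proof -
  have T: "wpair (par True) f - wpair (\<lambda>i. c * par False i) f = wpair (\<lambda>i. par True i - c * par False i) f" if "\<bar>c\<bar> \<le> 1" for c
  proof (rule wpair_diff_weights[OF par_le])
    show "norm (c * par False i) \<le> 1 * wt i" for i using mult_mono[OF that par_le[of False i]] by (simp add: abs_mult)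
  qed
  have "Cf (pz 0) f 0 = wpair (\<lambda>i. par True i - (- 1) * par False i) f"
    unfolding Cf_def by (rule arg_cong[of _ _ "\<lambda>w. wpair w f"]) (auto simp: pz_def par_def fun_eq_iff power_0_left)
  thus "Cf (pz 0) f 0 = wpair (par True) f + wpair (par False) f"
    using T[of "- 1"] wpair_scale_weights[of "- 1" "par False" f] by simp
  have "Cf (pz 0) f pi = wpair (\<lambda>i. par True i - 1 * par False i) f" unfolding Cf_def by (rule arg_cong[of _ _ "\<lambda>w. wpair w f"])
      (auto simp: pz_def par_def fun_eq_iff power_0_left cos_npi_int mult.commute[of _ pi])
  thus "Cf (pz 0) f pi = wpair (par True) f - wpair (par False) f" using T[of 1] by simp
qed

text \<open>Dividing the coefficients with k nonzero by k is a bounded multiplier. It yields a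
  primitive of everything except the mean, and this primitive vanishes at both end points.\<close>

lemma has_integral_Cf_0:
  assumes "l \<ge> (1 :: nat)"
  shows "((\<lambda>x. Cf (pz 0) f (real l * x)) has_integral 2 * pi * coef f (0, 0)) {-pi..pi}"
proof -
  define m where "m i = (if snd i = 0 then 0 else 1 / real_of_int (snd i))" for i :: "nat \<times> int"
  have m: "\<bar>m i\<bar> \<le> 1" for i
  proof -
    have "\<bar>real_of_int (snd i)\<bar> \<ge> 1" if "snd i \<noteq> 0" using that by linarith
    thus ?thesis by (auto simp: m_def)
  qed
  define g where "g = multop m f"
  note adm = admissible_pz[of 0, simplified]
  have C: "Cf1 (pz 0) g y = Cf (pz 0) f y - coef f (0, 0)" for y
  proof -
    have g1: "Cf1 (pz 0) g y = wpair (\<lambda>i. m i * (pz 0 (fst i) * (of_int (snd i) * cos (of_int (snd i) * y)))) f"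
      unfolding Cf1_def wpair_def by (rule infsum_cong) (simp add: g_def multop(1)[OF m] mult_ac)
    have n: "norm (m i * (pz 0 (fst i) * (of_int (snd i) * cos (of_int (snd i) * y)))) \<le> 1 * wt i" for i
      using mult_mono[OF m[of i] weights(3)[OF adm, of i y]] by (simp add: abs_mult)
    have "Cf (pz 0) f y - Cf1 (pz 0) g y = wpair (\<lambda>i. pz 0 (fst i) * cos (of_int (snd i) * y)
        - m i * (pz 0 (fst i) * (of_int (snd i) * cos (of_int (snd i) * y)))) f"
      unfolding g1 unfolding Cf_def by (rule wpair_diff_weights[OF weights(1)[OF adm] n])
    also have "\<dots> = (\<Sum>\<^sub>\<infinity>i\<in>{(0, 0)}. coef f i *\<^sub>R 1)"
      unfolding wpair_def by (rule infsum_cong_neutral) (auto simp: m_def pz_def power_0_left)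
    finally show ?thesis by simp
  qed
  have "((\<lambda>x. Cf (pz 0) f (real l * x)) has_integral
     (Sf (pz 0) g (real l * pi) / real l + coef f (0, 0) * pi) - (Sf (pz 0) g (real l * (- pi)) / real l + coef f (0, 0) * (- pi))) {-pi..pi}"
  proof (rule fundamental_theorem_of_calculus)
    fix x
    have "((\<lambda>x. Sf (pz 0) g (real l * x)) has_real_derivative Cf1 (pz 0) g (real l * x) * real l) (at x)"
      by (rule DERIV_chain2[OF Sf_deriv[OF adm]]) (auto intro!: derivative_eq_intros)
    hence "((\<lambda>x. Sf (pz 0) g (real l * x) / real l + coef f (0, 0) * x) has_real_derivative Cf (pz 0) f (real l * x)) (at x)"
      using assms by (auto intro!: derivative_eq_intros simp: C)
    thus "((\<lambda>x. Sf (pz 0) g (real l * x) / real l + coef f (0, 0) * x) has_vector_derivative Cf (pz 0) f (real l * x))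
        (at x within {-pi..pi})" by (simp add: has_real_derivative_iff_has_vector_derivative has_vector_derivative_at_within)
  qed simp
  moreover have "Sf (pz 0) g (real l * pi) = 0" "Sf (pz 0) g (real l * (- pi)) = 0"
  proof -
    have s: "sin (of_int k * (real l * pi)) = 0" for k :: int using sin_npi_int[of "k * int l"] by (simp add: mult_ac)
    show "Sf (pz 0) g (real l * pi) = 0" "Sf (pz 0) g (real l * (- pi)) = 0"
      unfolding Sf_def wpair_def by (auto intro!: infsum_0 simp: s)
  qed
  ultimately show ?thesis by (simp add: algebra_simps)
qed

theorem special_exists:
  obtains B0 where "B0 > 0" "\<And>B. B \<noteq> 0 \<Longrightarrow> \<bar>B\<bar> < B0 \<Longrightarrow> \<exists>d0 d1 d2 d3 \<sigma>. special B d0 d1 d2 d3 \<sigma>"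
proof -
  obtain K e0 :: real where K: "K > 0" and e0: "e0 > 0" and
    fp: "\<And>e. e \<noteq> 0 \<Longrightarrow> \<bar>e\<bar> \<le> e0 \<Longrightarrow> \<exists>x. modal_solution K e x" by (rule fixed_point) blast
  obtain L1 a1 where 1: "L1 \<ge> 0" "a1 > 0" "\<And>e x. \<bar>e\<bar> \<le> a1 \<Longrightarrow> x \<in> XS \<Longrightarrow> norm (Vv K e x) \<le> L1"
    using ulip_V(1)[of K] by (rule ulipE) blast
  obtain L2 a2 where 2: "L2 \<ge> 0" "a2 > 0" "\<And>e x. \<bar>e\<bar> \<le> a2 \<Longrightarrow> x \<in> XS \<Longrightarrow> norm (Vp K e x) \<le> L2"
    using ulip_V(2)[of K] by (rule ulipE) blast
  obtain L3 a3 where 3: "L3 \<ge> 0" "a3 > 0" "\<And>e x. \<bar>e\<bar> \<le> a3 \<Longrightarrow> x \<in> XS \<Longrightarrow> norm (Vq K e x) \<le> L3"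
    using ulip_V(3)[of K] by (rule ulipE) blast
  define L where "L = L1 + L2 + L3"
  \<comment> \<open>The bound 1 / (16 (L + 1)) keeps u and its first two derivatives below 1/16 in
    norm. The bound 1 / (K + 1) gives e^2 K <= 1, which is used to show that the orbit leaves the
    equilibrium.\<close>
  define e1 where "e1 = min (min e0 (1 / (16 * (L + 1)))) (min (min a1 a2) (min a3 (1 / (K + 1))))"
  have e1: "e1 > 0" using e0 1 2 3 K by (simp add: e1_def L_def)
  define B0 where "B0 = min (e1 / 2) 1"
  have main: "\<exists>d0 d1 d2 d3 \<sigma>. special B d0 d1 d2 d3 \<sigma>" if B: "B \<noteq> 0" "\<bar>B\<bar> < B0" for B
  proof -
    \<comment> \<open>This makes 1 + e and 1 - e proportional to (1 + B)^2 and (1 - B)^2, so that r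
      has the same ratio of values at 0 and \<pi> as the undulary curve with parameter B. Since |e|
      <= 2 |B|, half of e1 serves as a bound for B.\<close>
    define e where "e = 2 * B / (1 + B^2)"
    have B2: "1 + B^2 > 0" by (simp add: add_pos_nonneg)
    have B1: "\<bar>B\<bar> < 1" using B by (simp add: B0_def)
    have e0': "e \<noteq> 0" using B B2 by (simp add: e_def)
    have "\<bar>e\<bar> = 2 * \<bar>B\<bar> / (1 + B^2)" using B2 by (simp add: e_def abs_mult)
    also have "\<dots> \<le> 2 * \<bar>B\<bar> / 1" using B2 by (intro divide_left_mono) auto
    finally have e_le: "\<bar>e\<bar> \<le> e1" using B by (simp add: B0_def)
    have le: "\<bar>e\<bar> \<le> e0" "\<bar>e\<bar> \<le> a1" "\<bar>e\<bar> \<le> a2" "\<bar>e\<bar> \<le> a3" "\<bar>e\<bar> \<le> 1 / (16 * (L + 1))" "\<bar>e\<bar> \<le> 1 / (K + 1)"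
      using e_le by (auto simp: e1_def)
    have eK: "e^2 * K \<le> 1"
    proof -
      have "1 / (K + 1) \<le> 1" using K by simp
      hence "\<bar>e\<bar> \<le> 1" using le(6) by linarith
      hence "\<bar>e\<bar> * \<bar>e\<bar> \<le> \<bar>e\<bar> * 1" by (intro mult_left_mono) auto
      hence "e^2 \<le> \<bar>e\<bar>" by (simp only: abs_mult_self_eq power2_eq_square mult_1_right)
      hence "e^2 * K \<le> 1 / (K + 1) * K" using le(6) K by (intro mult_right_mono) auto
      also have "\<dots> \<le> 1" using K by (simp add: field_simps)
      finally show ?thesis .
    qed
    obtain x where ms: "modal_solution K e x" using fp[OF e0' le(1)] by blast
    hence x: "x \<in> XS" and half: "norm (e *\<^sub>R ee K e x) \<le> 1 / 2" by (auto simp: modal_solution_def)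
    define u u1 u2 u3 where "u = e *\<^sub>R Vv K e x" and "u1 = e *\<^sub>R Vp K e x" and "u2 = e *\<^sub>R Vq K e x" and "u3 = e *\<^sub>R Vs K e x"
    have small: "norm (e *\<^sub>R v) \<le> 1 / 16" if "norm v \<le> L" for v :: wser
    proof -
      have "norm (e *\<^sub>R v) \<le> 1 / (16 * (L + 1)) * L"
        using le(5) that 1 2 3 by (simp only: norm_scaleR, intro mult_mono) (auto simp: L_def)
      also have "\<dots> \<le> 1 / 16" using 1 2 3 by (simp add: L_def field_simps)
      finally show ?thesis .
    qed
    have nu: "norm u \<le> 1 / 16" "norm u1 \<le> 1 / 16" "norm u2 \<le> 1 / 16" unfolding u_def u1_def u2_def
      using 1(3)[OF le(2) x] 2(3)[OF le(3) x] 3(3)[OF le(4) x] 1(1) 2(1) 3(1) by (intro small, simp add: L_def)+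
    obtain d0 where d0: "d0 * d0 = 1 + u" "norm (d0 - 1) \<le> norm u" using wser_sqrt[of u] nu(1) by auto
    define w d1 d2 d3 where "w = oinv (d0 - 1)" and "d1 = (1 / 2) *\<^sub>R (w * u1)"
      and "d2 = w * ((1 / 2) *\<^sub>R u2 - d1 * d1)" and "d3 = w * ((1 / 2) *\<^sub>R u3 - 3 *\<^sub>R (d1 * d2))"
    have w: "d0 * w = 1" "norm d2 \<le> 1 / 8" using norm_sqrt_chain[OF nu d0] by (simp_all add: w_def d1_def d2_def)
    have d0': "norm (d0 - 1) \<le> 1 / 2" using d0(2) nu(1) by simp
    have sym: "flip u = u" "flip u1 = - u1" "flip u2 = u2" "flip u3 = - u3"
      by (simp_all add: u_def u1_def u2_def u3_def flip_scaleR flip_V[OF x])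
    have delta: "coef u1 (n, k) = of_int k * coef u (n, k)" "coef u2 (n, k) = of_int k * coef u1 (n, k)"
      "coef u3 (n, k) = of_int k * coef u2 (n, k)" for n k by (simp_all add: u_def u1_def u2_def u3_def coef_V_chain)
    note sc = sqrt_chain[OF _ d0(1) d0' w(1) sym delta, folded d1_def d2_def, folded d2_def d3_def]
    define \<sigma> where "\<sigma> = e^2 * ta x"
    have \<sigma>: "\<sigma> > 0" using ta_bounds[OF x] e0' by (simp add: \<sigma>_def)
    have G: "asd_G (Cf (pz z) d0) y = Cf (\<lambda>n. \<sigma> * (real n * z ^ n)) d0 y" if zs: "\<bar>z\<bar> < 1 / 128" for z y
    proof -
      have z: "\<bar>z\<bar> \<le> 1 / 64" using zs by simp
      define r where "r = Cf (pz z) d0"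
      have r: "r y \<ge> 1 / 2" for y unfolding r_def by (rule sc(1)[OF z])
      define X where "X = e *\<^sub>R (Vp K e x - Vs K e x - e^2 *\<^sub>R No K e x)"
      have J: "Jq ((r y)^2) (2 * r y * (- Sf (pz z) d1 y)) (2 * (- Sf (pz z) d1 y)^2 + 2 * r y * (- Cf (pz z) d2 y))
        (6 * (- Sf (pz z) d1 y) * (- Cf (pz z) d2 y) + 2 * r y * Sf (pz z) d3 y) = Sf (pz z) X y / 2" for y
        unfolding r_def sc(2)[OF z] sc(4)[OF z] sc(5)[OF z] sc(6)[OF z] using flux_evaluation[OF x z half e0', of y, folded X_def]
        by (simp add: u_def u1_def u2_def u3_def ev_scaleR)
      have "asd_G r y = 1 / r y * deriv (\<lambda>y. Sf (pz z) X y / 2) y"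
        using asd_G_flux[OF sc(3)[OF z], of y, folded r_def] r unfolding J by (smt (verit, best) half_gt_zero_iff zero_less_one)
      also have "deriv (\<lambda>y. Sf (pz z) X y / 2) y = Cf1 (pz z) X y / 2"
        by (intro DERIV_imp_deriv DERIV_cdivide Sf_deriv[OF admissible_pz[OF z]])
      also have "Cf1 (pz z) X y = Cf (\<lambda>n. \<sigma> * (real n * z ^ n)) u y" unfolding Cf1_def Cf_def wpair_def
      proof (rule infsum_cong, clarify)
        fix n :: nat and k :: int
        have "of_int k * coef X (n, k) = \<sigma> * real n * coef u (n, k)"
          using mode_equation[OF ms, of k n, folded X_def] by (simp add: \<sigma>_def u_def)
        hence "(of_int k * coef X (n, k)) * (z ^ n * cos (of_int k * y)) = (\<sigma> * real n * coef u (n, k)) * (z ^ n * cos (of_int k * y))"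
          by simp
        thus "coef X (n, k) *\<^sub>R (pz z (fst (n, k)) * (of_int (snd (n, k)) * cos (of_int (snd (n, k)) * y)))
          = coef u (n, k) *\<^sub>R (\<sigma> * (real (fst (n, k)) * z ^ fst (n, k)) * cos (of_int (snd (n, k)) * y))"
          by (simp add: pz_def mult_ac)
      qed
      finally have 1: "asd_G r y = 1 / r y * (Cf (\<lambda>n. \<sigma> * (real n * z ^ n)) u y / 2)" .
      have sz: "Cf (\<lambda>n. \<sigma> * (real n * z ^ n)) f y = (\<sigma> * z) * Cf (dz z) f y" for f
      proof -
        have "(\<lambda>n. \<sigma> * (real n * z ^ n)) = (\<lambda>n. (\<sigma> * z) * dz z n)"
        proof
          fix n show "\<sigma> * (real n * z ^ n) = \<sigma> * z * dz z n" by (cases n) (simp_all add: dz_def)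
        qed
        thus ?thesis by (simp add: ev_scale_weights)
      qed
      \<comment> \<open>Differentiating r^2 = 1 + u in z converts the equation for u into the
        equation for r.\<close>
      have "((\<lambda>z. (Cf (pz z) d0 y)\<^sup>2) has_real_derivative 2 * r y * Cf (dz z) d0 y) (at z)"
        unfolding r_def by (auto intro!: derivative_eq_intros Cf_pz_deriv[OF zs])
      hence "((\<lambda>z. 1 + Cf (pz z) u y) has_real_derivative 2 * r y * Cf (dz z) d0 y) (at z)"
      proof (rule has_field_derivative_transform_within_open)
        show "open {- (1 / 128)<..<1 / 128 :: real}" "z \<in> {- (1 / 128)<..<1 / 128}" using zs by auto
        fix v assume "v \<in> {- (1 / 128)<..<1 / 128 :: real}"
        hence "\<bar>v\<bar> \<le> 1 / 64" by auto
        thus "(Cf (pz v) d0 y)^2 = 1 + Cf (pz v) u y" by (rule sc(2))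
      qed
      moreover have "((\<lambda>z. 1 + Cf (pz z) u y) has_real_derivative Cf (dz z) u y) (at z)"
        by (auto intro!: derivative_eq_intros Cf_pz_deriv[OF zs])
      ultimately have "Cf (dz z) u y = 2 * r y * Cf (dz z) d0 y" by (rule DERIV_unique[OF _ _, symmetric])
      thus ?thesis unfolding r_def[symmetric] 1 sz using r[of y] by simp
    qed
    have z0: "\<bar>0 :: real\<bar> \<le> 1 / 64" by simp
    define We Wo where "We = wpair (par True) (WO 0 x)" and "Wo = wpair (par False) (WO 0 x)"
    define Pe where "Pe = e * (e * vv x + e * (e * (K * We)))"
    have PA0: "Cf (pz 0) (PA x) y = 0" for y unfolding Cf_def wpair_def by (rule infsum_0) (auto simp: coef_PA modeA_def pz_def)
    have kap: "kap K e x = e * vv x + e * (e * (K * We)) - e * (K * Wo)" by (simp add: kap_def We_def Wo_def)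
    \<comment> \<open>By the choice of \<open>kap\<close> the odd modes of W cancel, and both values
      share the factor 1 + Pe.\<close>
    have Q0: "(Cf (pz 0) d0 0)^2 = (1 + Pe) * (1 + e)" and Qpi: "(Cf (pz 0) d0 pi)^2 = (1 + Pe) * (1 - e)" unfolding sc(2)[OF z0]
      unfolding u_def ev_scaleR Cf_Vv[OF x z0] PA0 Cf_0_parity[of "WO 0 x"] kap Pe_def We_def Wo_def
      by (simp_all add: algebra_simps)
    have norm_eq: "Cf (pz 0) d0 0 - Cf (pz 0) d0 pi = B * (Cf (pz 0) d0 0 + Cf (pz 0) d0 pi)"
    proof -
      define r s where "r = Cf (pz 0) d0 0" and "s = Cf (pz 0) d0 pi"
      have rs: "r > 0" "s > 0" using sc(1)[OF z0, of 0] sc(1)[OF z0, of pi] by (auto simp: r_def s_def)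
      have e_eq: "1 + e = (1 + B)^2 / (1 + B^2)" "1 - e = (1 - B)^2 / (1 + B^2)"
        using B2 by (simp_all add: e_def field_simps power2_eq_square)
      have "(r * (1 - B))^2 = (s * (1 + B))^2" unfolding power_mult_distrib Q0[folded r_def] Qpi[folded s_def] e_eq by simp
      moreover have "r * (1 - B) \<ge> 0" "s * (1 + B) \<ge> 0" by (rule mult_nonneg_nonneg; use rs B1 in linarith)+
      ultimately have "r * (1 - B) = s * (1 + B)" by (rule power2_eq_imp_eq)
      thus ?thesis unfolding r_def[symmetric] s_def[symmetric] by (simp add: algebra_simps)
    qed
    have close: "\<bar>Cf (pz 0) d0 0 - 1\<bar> \<le> 1 / 8"
    proof -
      have "\<bar>Re (ev 0 0 (d0 - 1))\<bar> \<le> norm (d0 - 1)"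
        using abs_Re_le_cmod[of "ev 0 0 (d0 - 1)"] ev_norm[OF z0, of 0 "d0 - 1"] by linarith
      moreover have "Re (ev 0 0 (d0 - 1)) = Cf (pz 0) d0 0 - 1"
        unfolding ev_diff[OF z0] ev_one[OF z0] by (simp add: ev_Complex[OF z0])
      ultimately show ?thesis using d0(2) nu(1) by simp
    qed
    \<comment> \<open>The increment z of the amplitude dominates: the higher Taylor coefficients of
      A and the contribution of W change the value at x = 0 by at most z/4 each.\<close>
    have leave: "Cf (pz z) d0 0 \<noteq> Cf (pz 0) d0 0" if z: "0 < z" "z < 1 / 128" for z
    proof
      assume eq: "Cf (pz z) d0 0 = Cf (pz 0) d0 0"
      have zz: "\<bar>z\<bar> \<le> 1 / 64" "\<bar>z\<bar> \<le> 1 / 128" using z by auto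
      have "Cf (pz z) u 0 = Cf (pz 0) u 0" using sc(2)[OF zz(1), of 0] sc(2)[OF z0, of 0] eq by simp
      hence "Cf (pz z) (Vv K e x) 0 = Cf (pz 0) (Vv K e x) 0" using e0' by (simp add: u_def ev_scaleR)
      hence E: "z + (Cf (pz z) (PA x) 0 - Cf (pz 0) (PA x) 0) + (e^2 * K) * (Cf (pz z) (WO 0 x) 0 - Cf (pz 0) (WO 0 x) 0) = 0"
        unfolding Cf_Vv[OF x zz(1)] Cf_Vv[OF x z0] by (simp add: algebra_simps power2_eq_square)
      have b: "\<bar>Cf (pz z) f 0 - Cf (pz 0) f 0\<bar> \<le> z * (1 / 4)" if "norm f \<le> norm x" for f
      proof -
        have "\<bar>Cf (pz z) f 0 - Cf (pz 0) f 0\<bar> \<le> \<bar>z - 0\<bar> * norm f" by (rule ev_pz_diff) (use zz in auto)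
        also have "\<dots> \<le> z * (1 / 4)" using z that norm_XS[OF x] by (simp add: mult_left_mono)
        finally show ?thesis .
      qed
      have "norm (PA x) \<le> norm x" "norm (WO 0 x) \<le> norm x"
        using multop(2)[where m = modeA, OF modeA_le, where f = x] multop(2)[where m = "modeW 0", OF modeW_le, where f = x] by auto
      note bs = this[THEN b]
      have "\<bar>(e^2 * K) * (Cf (pz z) (WO 0 x) 0 - Cf (pz 0) (WO 0 x) 0)\<bar> \<le> 1 * (z * (1 / 4))"
        unfolding abs_mult using eK bs(2) K z by (intro mult_mono) auto
      thus False using E bs(1) z by linarith
    qed
    have mean: "\<exists>v. 1 / 8 \<le> v \<and> v \<le> 5 / 8 \<and> (\<forall>l::nat. l \<ge> 1 \<longrightarrow>
        integral {-pi..pi} (\<lambda>x. (Cf (pz 0) d0 (real l * x))\<^sup>2) = 2 * pi * (1 + (2 * B / (1 + B^2))^2 * v))"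
    proof (intro exI[of _ "vv x"] conjI allI impI)
      have "\<bar>coef x (0, 0)\<bar> \<le> 1 / 4" using wt_coef_le_norm[of "(0, 0)" x] norm_XS[OF x] by (simp add: wt_def)
      thus "1 / 8 \<le> vv x" "vv x \<le> 5 / 8" by (auto simp: vv_def)
      fix l :: nat assume l: "l \<ge> 1"
      have "((\<lambda>x. 1 + Cf (pz 0) u (real l * x)) has_integral (pi - (- pi)) * 1 + 2 * pi * coef u (0, 0)) {-pi..pi}"
        by (intro has_integral_add has_integral_Cf_0 l) (use has_integral_const_real[of "1 :: real" "- pi" pi] in \<open>simp add: scaleR_conv_of_real\<close>)
      moreover have "coef u (0, 0) = e^2 * vv x" by (simp add: u_def coef_Vv power2_eq_square)
      ultimately show "integral {-pi..pi} (\<lambda>x. (Cf (pz 0) d0 (real l * x))\<^sup>2) = 2 * pi * (1 + (2 * B / (1 + B^2))^2 * vv x)"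
        unfolding sc(2)[OF z0] e_def[symmetric] by (simp add: integral_unique algebra_simps)
    qed
    have "special B d0 d1 d2 d3 \<sigma>" unfolding special_def
      using \<sigma> sc(1,3) G norm_eq close leave mean w(2) ev_bounds(1)[OF admissible_pz[OF z0], of d2 0] by auto
    thus ?thesis by blast
  qed
  show thesis using that[of B0] main e1 by (simp add: B0_def)
qed

section \<open>Gronwall's inequality and an algebra of Lipschitz functions\<close>

lemma gronwall_zero:
  fixes f f' :: "real \<Rightarrow> real"
  assumes "a \<le> b" and cont: "continuous_on {a..b} f"
    and der: "\<And>t. a < t \<Longrightarrow> t < b \<Longrightarrow> (f has_real_derivative f' t) (at t)"
    and le: "\<And>t. a < t \<Longrightarrow> t < b \<Longrightarrow> f' t \<le> C * f t"
    and nonneg: "\<And>t. a \<le> t \<Longrightarrow> t \<le> b \<Longrightarrow> f t \<ge> 0" and "f a = 0"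
  shows "a \<le> t \<Longrightarrow> t \<le> b \<Longrightarrow> f t = 0"
proof -
  assume t: "a \<le> t" "t \<le> b"
  define g where "g t = f t * exp (- C * t)" for t
  have "g t \<le> g a"
  proof (rule DERIV_nonpos_imp_decreasing_open[OF t(1)])
    fix s assume s: "a < s" "s < t"
    have "(g has_real_derivative (f' s - C * f s) * exp (- C * s)) (at s)"
      unfolding g_def using s t by (auto intro!: derivative_eq_intros der simp: algebra_simps)
    moreover have "(f' s - C * f s) * exp (- C * s) \<le> 0" using le[of s] s t by (intro mult_nonpos_nonneg) auto
    ultimately show "\<exists>y. (g has_real_derivative y) (at s) \<and> y \<le> 0" by blast
  next
    show "continuous_on {a..t} g" unfolding g_def using t by (intro continuous_intros continuous_on_subset[OF cont]) auto
  qed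
  hence "f t * exp (- C * t) \<le> 0" using assms(6) by (simp add: g_def)
  hence "f t \<le> 0" by (simp add: mult_le_0_iff not_le[symmetric])
  thus "f t = 0" using nonneg[OF t] by simp
qed

text \<open>Such functions form an algebra closed under inversion away from 0. Rational expressions
  inherit their Lipschitz bounds without partial derivatives being computed.\<close>

definition lipb :: "'x set \<Rightarrow> ('x \<Rightarrow> 'x \<Rightarrow> real) \<Rightarrow> ('x \<Rightarrow> real) \<Rightarrow> bool" where
  "lipb S \<delta> f \<longleftrightarrow> (\<exists>L\<ge>0. \<forall>x\<in>S. \<bar>f x\<bar> \<le> L \<and> (\<forall>y\<in>S. \<bar>f x - f y\<bar> \<le> L * \<delta> x y))"

lemma lipbI:
  assumes "\<And>x y. \<delta> x y \<ge> 0" "\<And>x. x \<in> S \<Longrightarrow> \<bar>f x\<bar> \<le> A" "\<And>x y. x \<in> S \<Longrightarrow> y \<in> S \<Longrightarrow> \<bar>f x - f y\<bar> \<le> B * \<delta> x y"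
  shows "lipb S \<delta> f" unfolding lipb_def
proof (intro exI conjI ballI)
  fix x assume x: "x \<in> S"
  show "\<bar>f x\<bar> \<le> max 0 (max A B)" using assms(2)[OF x] by auto
  fix y assume y: "y \<in> S"
  have "B * \<delta> x y \<le> max 0 (max A B) * \<delta> x y" using assms(1) by (intro mult_right_mono) auto
  thus "\<bar>f x - f y\<bar> \<le> max 0 (max A B) * \<delta> x y" using assms(3)[OF x y] by linarith
qed simp

context
  fixes S :: "'x set" and \<delta> :: "'x \<Rightarrow> 'x \<Rightarrow> real"
  assumes nn: "\<And>x y. \<delta> x y \<ge> 0"
begin

lemma lipb_const: "lipb S \<delta> (\<lambda>x. c)" by (rule lipbI[where A = "\<bar>c\<bar>" and B = 0]) (auto simp: nn)

lemma lipb_add: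
  assumes "lipb S \<delta> f" "lipb S \<delta> g"
  shows "lipb S \<delta> (\<lambda>x. f x + g x)"
proof -
  obtain L M where L: "\<And>x. x \<in> S \<Longrightarrow> \<bar>f x\<bar> \<le> L" "\<And>x y. x \<in> S \<Longrightarrow> y \<in> S \<Longrightarrow> \<bar>f x - f y\<bar> \<le> L * \<delta> x y"
    and M: "\<And>x. x \<in> S \<Longrightarrow> \<bar>g x\<bar> \<le> M" "\<And>x y. x \<in> S \<Longrightarrow> y \<in> S \<Longrightarrow> \<bar>g x - g y\<bar> \<le> M * \<delta> x y" using assms unfolding lipb_def by blast
  show ?thesis
  proof (rule lipbI[where A = "L + M" and B = "L + M"])
    fix x y assume "x \<in> S" "y \<in> S"
    thus "\<bar>f x + g x - (f y + g y)\<bar> \<le> (L + M) * \<delta> x y" using L(2)[of x y] M(2)[of x y] by (simp add: distrib_right)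
  next
    fix x assume "x \<in> S"
    thus "\<bar>f x + g x\<bar> \<le> L + M" using L(1)[of x] M(1)[of x] by linarith
  qed (rule nn)
qed

lemma lipb_mult:
  assumes "lipb S \<delta> f" "lipb S \<delta> g"
  shows "lipb S \<delta> (\<lambda>x. f x * g x)"
proof -
  obtain L M where L: "L \<ge> 0" "\<And>x. x \<in> S \<Longrightarrow> \<bar>f x\<bar> \<le> L" "\<And>x y. x \<in> S \<Longrightarrow> y \<in> S \<Longrightarrow> \<bar>f x - f y\<bar> \<le> L * \<delta> x y"
    and M: "M \<ge> 0" "\<And>x. x \<in> S \<Longrightarrow> \<bar>g x\<bar> \<le> M" "\<And>x y. x \<in> S \<Longrightarrow> y \<in> S \<Longrightarrow> \<bar>g x - g y\<bar> \<le> M * \<delta> x y" using assms unfolding lipb_def by blast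
  show ?thesis
  proof (rule lipbI[where A = "L * M" and B = "2 * L * M"])
    fix x assume x: "x \<in> S"
    show "\<bar>f x * g x\<bar> \<le> L * M" unfolding abs_mult using x L M by (intro mult_mono) auto
    fix y assume y: "y \<in> S"
    have "\<bar>f x * g x - f y * g y\<bar> = \<bar>(f x - f y) * g x + f y * (g x - g y)\<bar>" by (simp add: algebra_simps)
    also have "\<dots> \<le> \<bar>f x - f y\<bar> * \<bar>g x\<bar> + \<bar>f y\<bar> * \<bar>g x - g y\<bar>" unfolding abs_mult[symmetric] by (rule abs_triangle_ineq)
    also have "\<dots> \<le> (L * \<delta> x y) * M + L * (M * \<delta> x y)" using x y L M nn[of x y] by (intro add_mono mult_mono) auto
    finally show "\<bar>f x * g x - f y * g y\<bar> \<le> 2 * L * M * \<delta> x y" by (simp add: mult_ac)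
  qed (rule nn)
qed

lemma lipb_cmult: "lipb S \<delta> f \<Longrightarrow> lipb S \<delta> (\<lambda>x. c * f x)" by (rule lipb_mult[OF lipb_const])

lemma lipb_diff: "lipb S \<delta> f \<Longrightarrow> lipb S \<delta> g \<Longrightarrow> lipb S \<delta> (\<lambda>x. f x - g x)"
  using lipb_add[of f "\<lambda>x. (- 1) * g x"] lipb_cmult[of g "- 1"] by simp

lemma lipb_power: "lipb S \<delta> f \<Longrightarrow> lipb S \<delta> (\<lambda>x. f x ^ n)" by (induction n) (simp_all add: lipb_const lipb_mult)

lemma lipb_inverse:
  assumes "lipb S \<delta> f" "c > 0" "\<And>x. x \<in> S \<Longrightarrow> f x \<ge> c"
  shows "lipb S \<delta> (\<lambda>x. 1 / f x)"
proof -
  obtain L where L: "L \<ge> 0" "\<And>x y. x \<in> S \<Longrightarrow> y \<in> S \<Longrightarrow> \<bar>f x - f y\<bar> \<le> L * \<delta> x y" using assms unfolding lipb_def by blast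
  have inv: "0 < 1 / f x" "1 / f x \<le> 1 / c" if "x \<in> S" for x using assms(2) assms(3)[OF that] by (auto simp: frac_le)
  show ?thesis
  proof (rule lipbI[where A = "1 / c" and B = "L * (1 / c * (1 / c))"])
    fix x y assume xy: "x \<in> S" "y \<in> S"
    have "f x > 0" "f y > 0" using assms(2) assms(3)[OF xy(1)] assms(3)[OF xy(2)] by auto
    hence "1 / f x - 1 / f y = (f y - f x) * (1 / f x * (1 / f y))" by (simp add: field_simps)
    hence "\<bar>1 / f x - 1 / f y\<bar> = \<bar>f x - f y\<bar> * (1 / f x * (1 / f y))"
      using inv[OF xy(1)] inv[OF xy(2)] by (simp add: abs_mult abs_minus_commute)
    also have "\<dots> \<le> (L * \<delta> x y) * (1 / c * (1 / c))"
      using inv[OF xy(1)] inv[OF xy(2)] L xy nn[of x y] assms(2) by (intro mult_mono) auto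
    finally show "\<bar>1 / f x - 1 / f y\<bar> \<le> L * (1 / c * (1 / c)) * \<delta> x y" by (simp add: mult_ac)
  next
    fix x assume "x \<in> S"
    thus "\<bar>1 / f x\<bar> \<le> 1 / c" using inv[of x] by linarith
  qed (rule nn)
qed

end

section \<open>Undulary curves\<close>

text \<open>At t = H s, \<open>und_D\<close> is the square of H times the height of the undulary
  curve, and \<open>und_xp\<close> is the derivative of its abscissa in s.\<close>

definition und_D :: "real \<Rightarrow> real \<Rightarrow> real" where
  "und_D B t = 1 + B^2 + 2 * B * sin t"

definition und_xp :: "real \<Rightarrow> real \<Rightarrow> real" where
  "und_xp B t = (1 + B * sin t) / sqrt (und_D B t)"

context
  fixes H B :: real
  assumes H: "H > 0" and B: "\<bar>B\<bar> < 1"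
begin

lemma und_sin: "\<bar>B * sin t\<bar> \<le> \<bar>B\<bar>" using mult_left_mono[OF abs_sin_le_one[of t], of "\<bar>B\<bar>"] by (simp add: abs_mult)

lemma und_D_bounds: "(1 - \<bar>B\<bar>)^2 \<le> und_D B t" "und_D B t \<le> (1 + \<bar>B\<bar>)^2"
  using und_sin[of t] by (auto simp: und_D_def power2_eq_square algebra_simps abs_if split: if_splits)

lemma und_D_pos: "und_D B t > 0" using und_D_bounds(1)[of t] B by (smt (verit) zero_less_power2)

lemma und_xp_ge: "und_xp B t \<ge> (1 - \<bar>B\<bar>) / 2"
proof -
  have "sqrt (und_D B t) \<le> sqrt ((1 + \<bar>B\<bar>)^2)" using und_D_bounds(2) by (rule real_sqrt_le_mono)
  hence "sqrt (und_D B t) \<le> 2" using B by simp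
  moreover have "sqrt (und_D B t) > 0" using und_D_pos by simp
  moreover have "1 - \<bar>B\<bar> \<le> 1 + B * sin t" using und_sin[of t] by linarith
  ultimately show ?thesis unfolding und_xp_def using B by (intro frac_le) auto
qed

lemma und_xp_pos: "und_xp B t > 0"
proof -
  have "0 < (1 - \<bar>B\<bar>) / 2" using B by simp
  thus ?thesis using und_xp_ge[of t] by (rule less_le_trans)
qed

lemma und_xp_cont: "continuous_on A (\<lambda>s. und_xp B (H * s))" unfolding und_xp_def und_D_def[abs_def]
  using und_D_pos[unfolded und_D_def] by (intro continuous_intros) (auto simp: less_imp_neq[symmetric])

lemma undulary_x_deriv: "(undulary_x H B has_real_derivative und_xp B (H * s)) (at s)"
proof -
  define c where "c = pi / (2 * H)"
  define a b where "a = min c s - 1" and "b = max c s + 1"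
  have "((\<lambda>u. LBINT t=ereal c..ereal u. und_xp B (H * t)) has_vector_derivative und_xp B (H * s)) (at s within {a..b})"
    by (rule interval_integral_FTC2) (auto simp: a_def b_def intro: und_xp_cont)
  moreover have "(\<lambda>u. LBINT t=ereal c..ereal u. und_xp B (H * t)) = undulary_x H B"
    by (rule ext) (simp add: undulary_x_def und_xp_def und_D_def c_def)
  ultimately have "(undulary_x H B has_real_derivative und_xp B (H * s)) (at s within {a..b})"
    by (simp add: has_real_derivative_iff_has_vector_derivative)
  moreover have "s \<in> interior {a..b}" by (auto simp: a_def b_def)
  ultimately show ?thesis by (simp only: at_within_interior)
qed

lemma undulary_x_start: "undulary_x H B (pi / (2 * H)) = 0" by (simp add: undulary_x_def)

lemma undulary_x_strict_mono: "s < t \<Longrightarrow> undulary_x H B s < undulary_x H B t"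
  by (rule DERIV_pos_imp_increasing) (auto intro: undulary_x_deriv und_xp_pos)

lemma undulary_x_growth:
  assumes "s \<le> t"
  shows "undulary_x H B t - undulary_x H B s \<ge> (1 - \<bar>B\<bar>) / 2 * (t - s)"
proof (cases "s = t")
  case False
  hence "s < t" using assms by simp
  from MVT2[OF this undulary_x_deriv] obtain u where "undulary_x H B t - undulary_x H B s = (t - s) * und_xp B (H * u)" by blast
  hence eq: "undulary_x H B t - undulary_x H B s = und_xp B (H * u) * (t - s)" by (simp only: mult.commute)
  show ?thesis unfolding eq using und_xp_ge assms by (intro mult_right_mono) auto
qed simp

lemma undulary_x_surj: "\<exists>s. undulary_x H B s = x"
proof -
  define c k where "c = pi / (2 * H)" and "k = (1 - \<bar>B\<bar>) / 2"
  have k: "k > 0" using B by (simp add: k_def)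
  define T where "T = \<bar>x\<bar> / k"
  have T: "T \<ge> 0" "k * T = \<bar>x\<bar>" using k by (auto simp: T_def)
  have "undulary_x H B (c + T) \<ge> \<bar>x\<bar>" "undulary_x H B (c - T) \<le> - \<bar>x\<bar>"
    using undulary_x_growth[of c "c + T", folded k_def] undulary_x_growth[of "c - T" c, folded k_def] T
      undulary_x_start[folded c_def] by simp_all
  moreover have "continuous_on {c - T..c + T} (undulary_x H B)"
    by (intro continuous_at_imp_continuous_on ballI DERIV_isCont[OF undulary_x_deriv])
  ultimately obtain s where "undulary_x H B s = x"
    using IVT'[of "undulary_x H B" "c - T" x "c + T"] T abs_ge_self[of x] abs_ge_minus_self[of x] by force
  thus ?thesis by blast
qed

lemma undulary_fun_eval: "undulary_fun H B (undulary_x H B s) = undulary_y H B s"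
proof -
  have "t = s" if "undulary_x H B t = undulary_x H B s" for t
    using that undulary_x_strict_mono[of s t] undulary_x_strict_mono[of t s] by (metis less_irrefl linorder_neqE_linordered_idom)
  thus ?thesis unfolding undulary_fun_def by (intro the_equality) auto
qed

text \<open>The integrand is symmetric about every s for which H s is an odd multiple of \<pi>/2.
  Hence the sum of the abscissae of mirror points is constant, and its value is read off at the
  centre of the reflection.\<close>

lemma undulary_x_reflect:
  fixes j :: int
  shows "undulary_x H B ((2 * of_int j + 1) * pi / H - s) = 2 * undulary_x H B ((2 * of_int j + 1) * pi / (2 * H)) - undulary_x H B s"
proof -
  define m where "m = (2 * of_int j + 1) * pi / H"
  have sin: "sin (H * (m - s)) = sin (H * s)" for s
  proof -
    have "H * (m - s) = (pi - H * s) + 2 * pi * of_int j" using H by (simp add: m_def field_simps)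
    thus ?thesis using sin.plus_of_int[of "pi - H * s" j] by (simp add: mult_ac)
  qed
  have xp: "und_xp B (H * (m - s)) = und_xp B (H * s)" for s by (simp add: und_xp_def und_D_def sin)
  have "((\<lambda>s. undulary_x H B (m - s) + undulary_x H B s) has_real_derivative 0) (at s)" for s
  proof -
    have "((\<lambda>s. undulary_x H B (m - s)) has_real_derivative und_xp B (H * (m - s)) * (- 1)) (at s)"
      by (rule DERIV_chain2[where f = "undulary_x H B" and g = "\<lambda>s. m - s", OF undulary_x_deriv])
         (auto intro!: derivative_eq_intros)
    thus ?thesis by (auto intro!: derivative_eq_intros undulary_x_deriv simp: xp)
  qed
  hence "undulary_x H B (m - s) + undulary_x H B s = undulary_x H B (m - m / 2) + undulary_x H B (m / 2)"
    by (intro DERIV_isconst_all) auto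
  moreover have "m - m / 2 = m / 2" by simp
  ultimately have "undulary_x H B (m - s) = 2 * undulary_x H B (m / 2) - undulary_x H B s" by simp
  moreover have "m / 2 = (2 * of_int j + 1) * pi / (2 * H)" by (simp add: m_def)
  ultimately show ?thesis by (simp only: m_def)
qed

lemma undulary_x_half_period:
  "undulary_x H B (3 * pi / (2 * H)) = integral {pi / 2..3 * pi / 2} (und_xp B) / H"
proof -
  have "(und_xp B has_integral H * undulary_x H B ((3 * pi / 2) / H) - H * undulary_x H B ((pi / 2) / H)) {pi / 2..3 * pi / 2}"
  proof (rule fundamental_theorem_of_calculus)
    fix t
    have "((\<lambda>t. undulary_x H B (t / H)) has_real_derivative und_xp B (H * (t / H)) * (1 / H)) (at t)"
      by (rule DERIV_chain2[where f = "undulary_x H B" and g = "\<lambda>t. t / H", OF undulary_x_deriv])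
         (use H in \<open>auto intro!: derivative_eq_intros\<close>)
    hence "((\<lambda>t. H * undulary_x H B (t / H)) has_real_derivative und_xp B t) (at t)" using H by (auto intro!: derivative_eq_intros)
    thus "((\<lambda>t. H * undulary_x H B (t / H)) has_vector_derivative und_xp B t) (at t within {pi / 2..3 * pi / 2})"
      by (simp add: has_real_derivative_iff_has_vector_derivative has_vector_derivative_at_within)
  qed simp
  thus ?thesis using H undulary_x_start by (simp add: integral_unique mult.commute)
qed

lemma undulary_H_1: "undulary_H B 1 = integral {pi / 2..3 * pi / 2} (und_xp B) / pi"
  by (simp add: undulary_H_def und_xp_def[abs_def] und_D_def)

lemma undulary_H_1_pos: "undulary_H B 1 > 0"
proof -
  have "undulary_x H B (3 * pi / (2 * H)) > undulary_x H B (pi / (2 * H))"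
    by (rule undulary_x_strict_mono) (use H in \<open>simp add: divide_strict_right_mono\<close>)
  hence "integral {pi / 2..3 * pi / 2} (und_xp B) > 0"
    using H by (simp add: undulary_x_start undulary_x_half_period zero_less_divide_iff)
  thus ?thesis unfolding undulary_H_1 by simp
qed

text \<open>Reflection at one extremum maps its predecessor to its successor, which is the recursion
  X (k + 2) = 2 X (k + 1) - X k. The extrema are therefore equidistant, and their distance is the
  integral in the definition of \<open>undulary_H\<close>, up to scaling.\<close>

lemma undulary_x_extrema:
  "undulary_x H B ((2 * real k + 1) * pi / (2 * H)) = real k * (pi * undulary_H B 1 / H)"
proof -
  define X where "X k = undulary_x H B ((2 * real k + 1) * pi / (2 * H))" for k :: nat
  have X0: "X 0 = 0" using undulary_x_start by (simp add: X_def)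
  have X1: "X 1 = pi * undulary_H B 1 / H"
    using undulary_x_half_period by (simp add: X_def undulary_H_1 mult.commute del: One_nat_def)
  have step: "X (Suc (Suc k)) = 2 * X (Suc k) - X k" for k
  proof -
    have "(2 * real (Suc (Suc k)) + 1) * pi / (2 * H) = (2 * of_int (int (Suc k)) + 1) * pi / H - (2 * real k + 1) * pi / (2 * H)"
      using H by (simp add: field_simps)
    thus ?thesis unfolding X_def using undulary_x_reflect[of "int (Suc k)" "(2 * real k + 1) * pi / (2 * H)"] by simp
  qed
  have "X k = real k * X 1 \<and> X (Suc k) = real (Suc k) * X 1" by (induction k) (auto simp: X0 step algebra_simps)
  hence "X k = real k * X 1" by blast
  thus ?thesis unfolding X1 unfolding X_def .
qed

end

section \<open>Even periodic equilibria are undulary curves\<close>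

lemma chain3_periodic:
  assumes "chain3 r r1 r2 r3" "periodic_2pi r"
  shows "periodic_2pi r1" "periodic_2pi r2" "periodic_2pi r3"
proof -
  have d: "deriv r = r1" "deriv r1 = r2" "deriv r2 = r3" using assms(1) unfolding chain3_def by (auto intro!: ext DERIV_imp_deriv)
  have *: "r1 = nth_deriv 1 r" "r2 = nth_deriv 2 r" "r3 = nth_deriv 3 r"
    by (simp_all add: nth_deriv_def numeral_2_eq_2 numeral_3_eq_3 d)
  show "periodic_2pi r1" "periodic_2pi r2" "periodic_2pi r3" unfolding * by (rule periodic_nth_deriv[OF assms(2)])+
qed

lemma periodic_2pi_at: "periodic_2pi f \<Longrightarrow> f (2 * pi) = f 0" unfolding periodic_2pi_def by (metis add_0)

definition "flux r r1 r2 r3 x = Jq ((r x)^2) (2 * r x * r1 x) (2 * (r1 x)^2 + 2 * r x * r2 x) (6 * r1 x * r2 x + 2 * r x * r3 x)"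

lemma flux_deriv:
  assumes c: "chain3 r r1 r2 r3" and pos: "\<And>x. r x > 0" and d: "\<And>x. r3 differentiable (at x)"
  shows "(flux r r1 r2 r3 has_real_derivative r x * asd_G r x) (at x)"
proof -
  have dr: "r differentiable (at x)" "r1 differentiable (at x)" "r2 differentiable (at x)" for x
    using c unfolding chain3_def real_differentiable_def by blast+
  have E: "4 * (r x)^2 + (2 * r x * r1 x)^2 \<noteq> 0" using pos[of x] by (simp add: add_pos_nonneg less_imp_neq[symmetric])
  have "flux r r1 r2 r3 differentiable (at x)" unfolding flux_def[abs_def] Jq_def using E dr d by (intro derivative_intros) auto
  moreover have "deriv (flux r r1 r2 r3) x = r x * asd_G r x"
    using asd_G_flux[OF c pos, of x] pos[of x] by (simp add: flux_def[abs_def])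
  ultimately show ?thesis by (metis DERIV_deriv_iff_real_differentiable)
qed

text \<open>The flux has derivative r G and is periodic, so r G vanishes somewhere, and r > 0. This
  upgrades the projected equation, which only makes G constant, to G = 0.\<close>

lemma asd_G_const_zero:
  assumes c: "chain3 r r1 r2 r3" and pos: "\<And>x. r x > 0" and d: "\<And>x. r3 differentiable (at x)"
    and per: "periodic_2pi r" and eq: "\<And>x. asd_G r x = K"
  shows "K = 0"
proof -
  have "flux r r1 r2 r3 (2 * pi) = flux r r1 r2 r3 0"
    unfolding flux_def using chain3_periodic[OF c per, THEN periodic_2pi_at] periodic_2pi_at[OF per] by simp
  moreover obtain z where "flux r r1 r2 r3 (2 * pi) - flux r r1 r2 r3 0 = (2 * pi - 0) * (r z * K)"
    using MVT2[of 0 "2 * pi" "flux r r1 r2 r3" "\<lambda>x. r x * K"] flux_deriv[OF c pos d] by (auto simp: eq)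
  ultimately show ?thesis using pos[of z] by simp
qed

text \<open>The flux is a constant. The mean curvature is periodic and so has a critical point, at
  which the flux vanishes; hence the constant is 0, and the positive factor in front of the
  derivative of the mean curvature can be divided out.\<close>

lemma equilibrium_mean_curv_const:
  assumes c: "chain3 r r1 r2 r3" and pos: "\<And>x. r x > 0" and d: "\<And>x. r3 differentiable (at x)"
    and per: "periodic_2pi r" and eq: "\<And>x. asd_G r x = 0"
  shows "mean_curv r x = mean_curv r 0"
proof -
  have "flux r r1 r2 r3 y = flux r r1 r2 r3 0" for y by (rule DERIV_isconst_all) (use flux_deriv[OF c pos d] eq in simp)
  then obtain K where K: "\<And>y. flux r r1 r2 r3 y = K" by blast
  have D: "(mean_curv r has_real_derivative deriv (mean_curv r) y) (at y)" for y
    using asd_flux(1)[OF c pos, of y] by (simp add: DERIV_deriv_iff_real_differentiable)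
  have fl: "r y / sqrt (1 + (deriv r y)^2) * deriv (mean_curv r) y = K" for y
    using asd_flux(2)[OF c pos, of y] K[of y] by (simp add: flux_def)
  have "mean_curv r (2 * pi) = mean_curv r 0" unfolding mean_curv_sqrt[OF c]
    using chain3_periodic[OF c per, THEN periodic_2pi_at] periodic_2pi_at[OF per] by simp
  then obtain z where "0 = (2 * pi - 0) * deriv (mean_curv r) z"
    using MVT2[of 0 "2 * pi" "mean_curv r" "deriv (mean_curv r)"] D by auto
  hence "K = 0" using fl[of z] by simp
  have p: "r y / sqrt (1 + (deriv r y)^2) > 0" for y
  proof -
    have "1 + (deriv r y)^2 > 0" by (simp add: add_pos_nonneg)
    thus ?thesis using pos[of y] by simp
  qed
  have "deriv (mean_curv r) y = 0" for y using fl[of y] p[of y] \<open>K = 0\<close> by (metis less_irrefl mult_eq_0_iff)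
  thus ?thesis using D by (intro DERIV_isconst_all) metis
qed

context
  fixes r r1 r2 r3 :: "real \<Rightarrow> real" and H :: real
  assumes c: "chain3 r r1 r2 r3" and pos: "\<And>x. r x > 0" and per: "periodic_2pi r"
    and even: "\<And>x. r (- x) = r x" and mc: "\<And>x. mean_curv r x = H"
begin

lemma DERIV_r: "(r has_real_derivative r1 x) (at x)" "(r1 has_real_derivative r2 x) (at x)" using c by (auto simp: chain3_def)

lemma r1_odd: "r1 (- x) = - r1 x"
proof -
  have "((\<lambda>x. r (- x)) has_real_derivative r1 (- x) * (- 1)) (at x)"
    by (rule DERIV_chain2[where g = "\<lambda>x. - x", OF DERIV_r(1)]) (auto intro!: derivative_eq_intros)
  hence "r1 (- x) * (- 1) = r1 x" unfolding even by (rule DERIV_unique[OF _ DERIV_r(1)])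
  thus ?thesis by simp
qed

lemma r1_0: "r1 0 = 0" using r1_odd[of 0] by simp

lemma r1_pi: "r1 pi = 0"
proof -
  have "r1 (- pi + 2 * pi) = r1 (- pi)" using chain3_periodic(1)[OF c per] unfolding periodic_2pi_def by blast
  thus ?thesis using r1_odd[of pi] by simp
qed

abbreviation "wq \<equiv> \<lambda>x. sqrt (1 + (r1 x)^2)"

lemma wq: "wq x > 0" "(wq x)^2 = 1 + (r1 x)^2"
proof -
  have "1 + (r1 x)^2 > 0" by (simp add: add_pos_nonneg)
  thus "wq x > 0" "(wq x)^2 = 1 + (r1 x)^2" by simp_all
qed

lemma mc_eq: "r2 x / wq x ^ 3 = 1 / (r x * wq x) - H" using mc[of x] by (simp add: mean_curv_sqrt[OF c])

lemma DERIV_wq: "(wq has_real_derivative r1 x * r2 x / wq x) (at x)"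
proof -
  have "1 + (r1 x)^2 > 0" by (simp add: add_pos_nonneg)
  thus ?thesis by (auto intro!: derivative_eq_intros DERIV_r simp: field_simps)
qed

text \<open>The periodic function r' / w, the sine of the inclination, has a critical point. There
  the curvature of the profile curve vanishes, and only the rotational part 1 / (r w) of the mean
  curvature remains.\<close>

lemma H_pos_at: "\<exists>x. 1 / (r x * wq x) = H"
proof -
  have D: "((\<lambda>x. r1 x / wq x) has_real_derivative r2 x / wq x ^ 3) (at x)" for x
  proof -
    have "((\<lambda>x. r1 x / wq x) has_real_derivative (r2 x * wq x - r1 x * (r1 x * r2 x / wq x)) / (wq x * wq x)) (at x)"
      by (rule DERIV_divide[OF DERIV_r(2) DERIV_wq]) (use wq(1)[of x] in simp)
    moreover have "(r2 x * wq x - r1 x * (r1 x * r2 x / wq x)) / (wq x * wq x) = r2 x * ((wq x)^2 - (r1 x)^2) / wq x ^ 3"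
      using wq(1)[of x] by (simp add: field_simps power2_eq_square power3_eq_cube del: real_sqrt_mult_self real_sqrt_pow2 real_sqrt_pow2_iff)
    ultimately show ?thesis by (simp only: wq(2)) simp
  qed
  have "r1 (2 * pi) = r1 0" by (rule periodic_2pi_at[OF chain3_periodic(1)[OF c per]])
  moreover obtain z where "r1 (2 * pi) / wq (2 * pi) - r1 0 / wq 0 = (2 * pi - 0) * (r2 z / wq z ^ 3)"
    using MVT2[of 0 "2 * pi" "\<lambda>x. r1 x / wq x" "\<lambda>x. r2 x / wq x ^ 3"] D by auto
  ultimately have "r2 z / wq z ^ 3 = 0" by simp
  thus ?thesis using mc_eq[of z] by (metis eq_iff_diff_eq_0)
qed

lemma H_pos: "H > 0" using H_pos_at pos wq(1) by (metis mult_pos_pos zero_less_divide_1_iff)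

text \<open>In terms of the arc length \<open>S\<close>, the quantities \<open>V = r / wq\<close> and \<open>U = r r1 / wq\<close> solve the
  linear system \<open>V' = H U\<close>, \<open>U' = 1 - H V\<close> (Kenmotsu's trick).\<close>

lemma oscillator:
  obtains S where "S 0 = pi / (2 * H)" "\<And>x. (S has_real_derivative wq x) (at x)"
    "\<And>x. r x / wq x = (1 + (H * r 0 - 1) * sin (H * S x)) / H"
    "\<And>x. r x * r1 x / wq x = (H * r 0 - 1) * cos (H * S x) / H"
proof -
  have "isCont wq x" for x by (rule DERIV_isCont[OF DERIV_wq])
  then obtain F where F: "\<And>x. (F has_real_derivative wq x) (at x)"
    using einterval_antiderivative[of "-\<infinity>" "\<infinity>" wq] by (auto simp: has_real_derivative_iff_has_vector_derivative)
  define S where "S x = F x - F 0 + pi / (2 * H)" for x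
  have dS: "(S has_real_derivative wq x) (at x)" for x unfolding S_def by (auto intro!: derivative_eq_intros F)
  define U V where "U x = r x * r1 x / wq x" and "V x = r x / wq x" for x
  have dV: "(V has_real_derivative H * (U x * wq x)) (at x)" for x
  proof -
    have "(V has_real_derivative (r1 x * wq x - r x * (r1 x * r2 x / wq x)) / (wq x * wq x)) (at x)"
      unfolding V_def by (rule DERIV_divide[OF DERIV_r(1) DERIV_wq]) (use wq(1)[of x] in simp)
    moreover have "(r1 x * wq x - r x * (r1 x * r2 x / wq x)) / (wq x * wq x) = r1 x / wq x - r x * r1 x * (r2 x / wq x ^ 3)"
      using wq(1)[of x] by (simp add: field_simps power3_eq_cube del: real_sqrt_mult_self)
    moreover have "r1 x / wq x - r x * r1 x * (1 / (r x * wq x) - H) = H * (U x * wq x)"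
      using wq(1)[of x] pos[of x] by (simp add: U_def field_simps)
    ultimately show ?thesis unfolding mc_eq by simp
  qed
  have dU: "(U has_real_derivative wq x * (1 - H * V x)) (at x)" for x
  proof -
    have "(U has_real_derivative ((r1 x * r1 x + r x * r2 x) * wq x - r x * r1 x * (r1 x * r2 x / wq x)) / (wq x * wq x)) (at x)"
      unfolding U_def by (rule DERIV_divide[OF _ DERIV_wq]) (use wq(1)[of x] in \<open>auto intro!: derivative_eq_intros DERIV_r\<close>)
    moreover have "((r1 x * r1 x + r x * r2 x) * wq x - r x * r1 x * (r1 x * r2 x / wq x)) / (wq x * wq x)
        = (r1 x)^2 / wq x + r x * ((wq x)^2 - (r1 x)^2) * (r2 x / wq x ^ 3)"
      using wq(1)[of x] by (simp add: field_simps power2_eq_square power3_eq_cube del: real_sqrt_mult_self real_sqrt_pow2 real_sqrt_pow2_iff)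
    moreover have "r x * ((wq x)^2 - (r1 x)^2) * (r2 x / wq x ^ 3) = 1 / wq x - H * r x"
      unfolding mc_eq wq(2) using pos[of x] wq(1)[of x] by (simp add: field_simps)
    moreover have "(r1 x)^2 / wq x + (1 / wq x - H * r x) = (wq x)^2 / wq x - H * r x"
      unfolding wq(2) by (simp add: add_divide_distrib)
    moreover have "(wq x)^2 / wq x - H * r x = wq x * (1 - H * V x)"
      unfolding V_def using wq(1)[of x] by (simp add: power2_eq_square right_diff_distrib del: real_sqrt_mult_self)
    ultimately show ?thesis by (simp only:)
  qed
  define sn cs where "sn x = sin (H * S x)" and "cs x = cos (H * S x)" for x
  have dsn: "(sn has_real_derivative cs x * (H * wq x)) (at x)" and dcs: "(cs has_real_derivative - sn x * (H * wq x)) (at x)" for x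
    unfolding sn_def[abs_def] cs_def[abs_def] by (auto intro!: derivative_eq_intros dS)
  have one: "sn x * sn x + cs x * cs x = 1" for x unfolding sn_def cs_def by (metis power2_eq_square sin_cos_squared_add)
  have H0: "H \<noteq> 0" using H_pos by simp
  have i: "sn 0 = 1" "cs 0 = 0" "U 0 = 0" "V 0 = r 0" using H0 r1_0 by (simp_all add: S_def sn_def cs_def U_def V_def)
  \<comment> \<open>The vector (V - 1/H, U) rotates with the angle H S, so its two components in the
    rotating frame are constants.\<close>
  have "((\<lambda>x. (V x - 1 / H) * sn x + U x * cs x) has_real_derivative 0) (at x)" for x
    by (rule derivative_eq_intros dV dU dsn dcs refl | use H0 in \<open>simp add: field_simps\<close>)+
  hence c1: "(V x - 1 / H) * sn x + U x * cs x = (V 0 - 1 / H) * sn 0 + U 0 * cs 0" for x by (rule DERIV_isconst_all[rule_format])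
  have "((\<lambda>x. (V x - 1 / H) * cs x - U x * sn x) has_real_derivative 0) (at x)" for x
    by (rule derivative_eq_intros dV dU dsn dcs refl | use H0 in \<open>simp add: field_simps\<close>)+
  hence c2: "(V x - 1 / H) * cs x - U x * sn x = (V 0 - 1 / H) * cs 0 - U 0 * sn 0" for x by (rule DERIV_isconst_all[rule_format])
  have rot: "a = (a * s + b * c) * s + (a * c - b * s) * c" "b = (a * s + b * c) * c - (a * c - b * s) * s"
    if "s * s + c * c = 1" for a b s c :: real using that by algebra+
  have "V x - 1 / H = (r 0 - 1 / H) * sn x" "U x = (r 0 - 1 / H) * cs x" for x
    using rot[OF one[of x], where a = "V x - 1 / H" and b = "U x"] unfolding c1 c2 i by simp_all
  hence "r x / wq x = (1 + (H * r 0 - 1) * sin (H * S x)) / H" "r x * r1 x / wq x = (H * r 0 - 1) * cos (H * S x) / H" for x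
    using H0 unfolding V_def U_def sn_def cs_def by (simp_all add: field_simps)
  thus thesis using that[of S] dS by (simp add: S_def)
qed

text \<open>Since w^2 = 1 + r'^2, the square of r is the sum of the squares of r / w and r r' /
  w.\<close>

lemma r_squared:
  assumes "r x / wq x = (1 + B * s) / H" "r x * r1 x / wq x = B * c / H" "s^2 + c^2 = 1"
  shows "1 + B^2 + 2 * B * s = (H * r x)^2"
proof -
  have "(r x)^2 = (r x / wq x)^2 * (wq x)^2" using wq(1)[of x] by (simp add: power_divide del: real_sqrt_pow2)
  also have "\<dots> = (r x / wq x)^2 + (r x * r1 x / wq x)^2" unfolding wq(2) by (simp add: power_divide power_mult_distrib distrib_left add_divide_distrib)
  finally have "(H * r x)^2 = (1 + B * s)^2 + (B * c)^2" unfolding assms(1,2) using H_pos by (simp add: power_divide power_mult_distrib field_simps)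
  also have "\<dots> = 1 + 2 * B * s + B^2 * (s^2 + c^2)" by (simp add: power2_eq_square algebra_simps)
  finally show ?thesis unfolding assms(3) by simp
qed

text \<open>At a point with 1 / (r w) = H one has (H r)^2 = 1 + B sin (H S). Compared with the
  general relation (H r)^2 = 1 + B^2 + 2 B sin (H S), this gives B^2 = 1 - (H r)^2 < 1.\<close>

lemma B_bound: "\<bar>H * r 0 - 1\<bar> < 1"
proof -
  obtain z where z: "1 / (r z * wq z) = H" using H_pos_at by blast
  obtain S where S: "r z / wq z = (1 + (H * r 0 - 1) * sin (H * S z)) / H" "r z * r1 z / wq z = (H * r 0 - 1) * cos (H * S z) / H"
    by (rule oscillator) (rule that)
  have "(H * r z)^2 = H * (r z / wq z)" unfolding z[symmetric] using pos[of z] wq(1)[of z] by (simp add: power2_eq_square)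
  also have "\<dots> = 1 + (H * r 0 - 1) * sin (H * S z)" unfolding S(1) using H_pos by simp
  finally have "(H * r 0 - 1)^2 = 1 - (H * r z)^2" using r_squared[OF S sin_cos_squared_add] by linarith
  moreover have "(H * r z)^2 > 0" using H_pos pos[of z] by simp
  ultimately have "(H * r 0 - 1)^2 < 1" by linarith
  thus ?thesis by (simp add: abs_square_less_1)
qed

text \<open>The function S inverts the abscissa of the undulary curve:
  \<open>und_xp B (H * S x)\<close> equals 1 / w, the reciprocal of the derivative of S, and the two
  curves start at the same point.\<close>

lemma arc_length:
  defines "B \<equiv> H * r 0 - 1"
  obtains S where "\<And>x. undulary_x H B (S x) = x" "\<And>x. undulary_y H B (S x) = r x"
    "\<And>x. r x * r1 x / wq x = B * cos (H * S x) / H"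
proof -
  have B: "\<bar>B\<bar> < 1" unfolding B_def by (rule B_bound)
  obtain S where S: "S 0 = pi / (2 * H)" "\<And>x. (S has_real_derivative wq x) (at x)"
    "\<And>x. r x / wq x = (1 + B * sin (H * S x)) / H" "\<And>x. r x * r1 x / wq x = B * cos (H * S x) / H"
    by (rule oscillator[folded B_def]) (rule that)
  have D: "sqrt (1 + B^2 + 2 * B * sin (H * S x)) = H * r x" for x
    unfolding r_squared[OF S(3,4) sin_cos_squared_add] using H_pos pos[of x] by (simp add: real_sqrt_abs)
  have "((\<lambda>x. undulary_x H B (S x) - x) has_real_derivative 0) (at x)" for x
  proof -
    have n: "1 + B * sin (H * S x) = H * (r x / wq x)" unfolding S(3) using H_pos by simp
    have "und_xp B (H * S x) = H * (r x / wq x) / (H * r x)" unfolding und_xp_def und_D_def D n ..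
    also have "\<dots> = 1 / wq x" using H_pos pos[of x] by simp
    finally have "und_xp B (H * S x) * wq x = 1" using wq(1)[of x] by simp
    thus ?thesis using DERIV_diff[OF DERIV_chain2[OF undulary_x_deriv[OF H_pos B] S(2)] DERIV_ident, of x] by simp
  qed
  hence "undulary_x H B (S x) - x = undulary_x H B (S 0) - 0" for x by (rule DERIV_isconst_all[rule_format])
  hence "undulary_x H B (S x) = x" for x by (simp add: S(1) undulary_x_start[OF H_pos B])
  thus thesis using that[of S] D S(4) H_pos by (simp add: undulary_y_def)
qed

theorem mean_curv_const_undulary: "r = undulary_fun H (H * r 0 - 1)"
proof
  fix x
  obtain S where S: "\<And>x. undulary_x H (H * r 0 - 1) (S x) = x" "\<And>x. undulary_y H (H * r 0 - 1) (S x) = r x"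
    by (rule arc_length) (rule that)
  show "r x = undulary_fun H (H * r 0 - 1) x" using undulary_fun_eval[OF H_pos B_bound, of "S x"] unfolding S by simp
qed

text \<open>By evenness and periodicity \<pi> is a critical point of r. For B nonzero this makes S
  \<pi> an extremum of the height, and the abscissae of the extrema are the integer multiples of the
  half period.\<close>

theorem undulary_period:
  assumes "H * r 0 \<noteq> 1"
  shows "\<exists>k::nat. k \<ge> 1 \<and> H = real k * undulary_H (H * r 0 - 1) 1"
proof -
  define B where "B = H * r 0 - 1"
  have B: "\<bar>B\<bar> < 1" unfolding B_def by (rule B_bound)
  obtain S where S: "\<And>x. undulary_x H B (S x) = x" "\<And>x. r x * r1 x / wq x = B * cos (H * S x) / H"
    by (rule arc_length[folded B_def]) (rule that)
  define s where "s = S pi"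
  have s: "undulary_x H B s = pi" unfolding s_def by (rule S(1))
  have sge: "pi / (2 * H) \<le> s"
  proof (rule ccontr)
    assume "\<not> pi / (2 * H) \<le> s"
    hence "undulary_x H B s < 0" using undulary_x_strict_mono[OF H_pos B, of s "pi / (2 * H)"] undulary_x_start[OF H_pos B] by simp
    thus False using s by simp
  qed
  have "cos (H * s) = 0" using S(2)[of pi] r1_pi assms H_pos unfolding s_def by (simp add: B_def)
  moreover have "0 \<le> H * s"
  proof (rule mult_nonneg_nonneg)
    have "0 \<le> pi / (2 * H)" using H_pos by simp
    thus "0 \<le> s" using sge by linarith
  qed (use H_pos in simp)
  ultimately obtain n where n: "odd n" "H * s = real n * (pi / 2)" using cos_zero_lemma by blast
  then obtain k where k: "n = 2 * k + 1" by (metis oddE)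
  have "s = (2 * real k + 1) * pi / (2 * H)" using n(2) H_pos by (simp add: k field_simps)
  hence "pi = real k * (pi * undulary_H B 1 / H)" using undulary_x_extrema[OF H_pos B, of k] s by simp
  hence "H = real k * undulary_H B 1" using H_pos by (simp add: field_simps)
  moreover have "k \<ge> 1" using calculation H_pos by (cases k) auto
  ultimately show ?thesis unfolding B_def by blast
qed

end

lemma undulary_H_nat: "undulary_H B k = real k * undulary_H B 1" by (simp add: undulary_H_def)

section \<open>The bifurcating branch\<close>

lemma little_holder_sum:
  assumes "\<sigma> > 0" "\<sigma> \<notin> \<int>" "\<And>n. a n \<in> little_holder \<sigma>"
  shows "(\<lambda>x. \<Sum>n<N::nat. c n * a n x) \<in> little_holder \<sigma>"
    and "j \<le> fkey \<sigma> \<Longrightarrow> nth_deriv j (\<lambda>x. \<Sum>n<N. c n * a n x) = (\<lambda>x. \<Sum>n<N. c n * nth_deriv j (a n) x)"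
proof -
  have "(\<lambda>x. \<Sum>n<N. c n * a n x) \<in> little_holder \<sigma> \<and>
    (j \<le> fkey \<sigma> \<longrightarrow> nth_deriv j (\<lambda>x. \<Sum>n<N. c n * a n x) = (\<lambda>x. \<Sum>n<N. c n * nth_deriv j (a n) x))"
  proof (induction N)
    case 0
    show ?case using const_little_holder(1)[OF assms(1,2), of 0] by (simp add: nth_deriv_const)
  next
    case (Suc N)
    note IH = Suc.IH[THEN conjunct1]
    have "nth_deriv j (\<lambda>x. 1 * (\<Sum>n<N. c n * a n x) + c N * a N x) =
      (\<lambda>x. 1 * nth_deriv j (\<lambda>x. \<Sum>n<N. c n * a n x) x + c N * nth_deriv j (a N) x)" if "j \<le> fkey \<sigma>"
      using nth_deriv_lincomb[OF IH[THEN little_holder_imp, THEN holder_spaceD(2)]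
          assms(3)[of N, THEN little_holder_imp, THEN holder_spaceD(2)] that] .
    thus ?case using little_holder_lincomb[OF IH assms(3)[of N], of 1 "c N"] Suc.IH by simp
  qed
  thus "(\<lambda>x. \<Sum>n<N::nat. c n * a n x) \<in> little_holder \<sigma>"
    and "j \<le> fkey \<sigma> \<Longrightarrow> nth_deriv j (\<lambda>x. \<Sum>n<N. c n * a n x) = (\<lambda>x. \<Sum>n<N. c n * nth_deriv j (a n) x)" by blast+
qed

text \<open>Convergence in norm yields pointwise power series for all derivatives. The last bound,
  uniform in x, comes from consecutive partial sums at the parameter s0 + e; it dominates the series
  by a geometric one at smaller distances from s0.\<close>

lemma lh_analytic_local:
  assumes \<sigma>: "\<sigma> > 0" "\<sigma> \<notin> \<int>" and an: "lh_analytic_on \<sigma> J c" and J: "open J" and s0: "s0 \<in> J"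
  obtains a e M where "e > 0" "\<And>n. a n \<in> little_holder \<sigma>"
    "\<And>s. \<bar>s - s0\<bar> < e \<Longrightarrow> s \<in> J"
    "\<And>s j x. \<bar>s - s0\<bar> < e \<Longrightarrow> j \<le> fkey \<sigma> \<Longrightarrow>
       (\<lambda>n. nth_deriv j (a n) x * (s - s0) ^ n) sums nth_deriv j (c s) x"
    "\<And>n x. \<bar>a n x\<bar> * e ^ n \<le> M"
proof -
  obtain a e0 where e0: "e0 > 0" and a: "\<And>n. a n \<in> little_holder \<sigma>"
    and lim: "\<And>s. s \<in> J \<Longrightarrow> \<bar>s - s0\<bar> < e0 \<Longrightarrow>
          (\<lambda>N. holder_norm \<sigma> (\<lambda>x. c s x - (\<Sum>n<N. (s - s0) ^ n * a n x))) \<longlonglongrightarrow> 0" using an s0 unfolding lh_analytic_on_def by blast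
  obtain e1 where e1: "e1 > 0" "\<And>s. \<bar>s - s0\<bar> < e1 \<Longrightarrow> s \<in> J" using J s0 unfolding open_dist dist_real_def by blast
  define e where "e = min e0 e1 / 2"
  have e: "e > 0" "e < e0" "e < e1" using e0 e1(1) unfolding e_def by auto
  have cJ: "c s \<in> little_holder \<sigma>" if "s \<in> J" for s using an that unfolding lh_analytic_on_def by blast
  define S where "S s N = (\<lambda>x. \<Sum>n<N. (s - s0) ^ n * a n x)" for s and N :: nat
  have S: "S s N \<in> little_holder \<sigma>" for s N unfolding S_def by (rule little_holder_sum(1)[OF \<sigma> a])
  have dif: "\<bar>nth_deriv j (c s) x - nth_deriv j (S s N) x\<bar> \<le> holder_norm \<sigma> (\<lambda>x. c s x - S s N x)"
    if "s \<in> J" "j \<le> fkey \<sigma>" for s j x N by (rule nth_deriv_diff_le_norm[OF cJ[OF that(1)] S that(2)])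
  have sums: "(\<lambda>n. nth_deriv j (a n) x * (s - s0) ^ n) sums nth_deriv j (c s) x"
    if "\<bar>s - s0\<bar> < e" "j \<le> fkey \<sigma>" for s j x
  proof -
    have s: "s \<in> J" "\<bar>s - s0\<bar> < e0" using that e e1 by auto
    have "(\<lambda>N. nth_deriv j (c s) x - nth_deriv j (S s N) x) \<longlonglongrightarrow> 0"
      by (rule Lim_null_comparison[OF always_eventually lim[OF s, folded S_def]]) (use dif[OF s(1) that(2)] in \<open>simp add: S_def\<close>)
    hence "(\<lambda>N. nth_deriv j (c s) x - (nth_deriv j (c s) x - nth_deriv j (S s N) x)) \<longlonglongrightarrow> nth_deriv j (c s) x - 0"
      by (intro tendsto_intros)
    moreover have "nth_deriv j (S s N) x = (\<Sum>n<N. nth_deriv j (a n) x * (s - s0) ^ n)" for N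
      unfolding S_def little_holder_sum(2)[OF \<sigma> a that(2)] by (simp add: mult.commute)
    ultimately show ?thesis unfolding sums_def by simp
  qed
  have "s0 + e \<in> J" "\<bar>s0 + e - s0\<bar> < e0" using e e1 by auto
  hence L: "(\<lambda>N. holder_norm \<sigma> (\<lambda>x. c (s0 + e) x - S (s0 + e) N x)) \<longlonglongrightarrow> 0" unfolding S_def by (rule lim)
  obtain K where K: "\<And>N. holder_norm \<sigma> (\<lambda>x. c (s0 + e) x - S (s0 + e) N x) \<le> K"
  proof -
    have "Bseq (\<lambda>N. holder_norm \<sigma> (\<lambda>x. c (s0 + e) x - S (s0 + e) N x))" by (rule convergent_imp_Bseq[OF convergentI[OF L]])
    then obtain K where "\<forall>N. norm (holder_norm \<sigma> (\<lambda>x. c (s0 + e) x - S (s0 + e) N x)) \<le> K" unfolding Bseq_def by blast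
    hence "holder_norm \<sigma> (\<lambda>x. c (s0 + e) x - S (s0 + e) N x) \<le> K" for N using abs_le_D1 by (metis real_norm_def)
    thus ?thesis by (rule that)
  qed
  have bd: "\<bar>a n x\<bar> * e ^ n \<le> 2 * K" for n x
  proof -
    have "S (s0 + e) (Suc n) x - S (s0 + e) n x = e ^ n * a n x" unfolding S_def by simp
    hence "\<bar>a n x\<bar> * e ^ n = \<bar>S (s0 + e) (Suc n) x - S (s0 + e) n x\<bar>" using e by (simp add: abs_mult mult.commute)
    also have "\<dots> \<le> 2 * K" using dif[OF \<open>s0 + e \<in> J\<close>, of 0 x n] dif[OF \<open>s0 + e \<in> J\<close>, of 0 x "Suc n"] K[of n] K[of "Suc n"] by simp
    finally show ?thesis .
  qed
  show ?thesis by (rule that[of e a "2 * K"]) (use e a e1 sums bd in auto)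
qed

lemma lh_analytic_eval:
  assumes "\<sigma> > 0" "\<sigma> \<notin> \<int>" "lh_analytic_on \<sigma> J c" "open J" "j \<le> fkey \<sigma>"
  shows "real_analytic_on J (\<lambda>s. nth_deriv j (c s) x)" unfolding real_analytic_on_def
proof
  fix s0 assume s0: "s0 \<in> J"
  obtain a e M where e: "e > 0" and a: "\<And>n. a n \<in> little_holder \<sigma>"
    and s: "\<And>s j x. \<bar>s - s0\<bar> < e \<Longrightarrow> j \<le> fkey \<sigma> \<Longrightarrow>
       (\<lambda>n. nth_deriv j (a n) x * (s - s0) ^ n) sums nth_deriv j (c s) x" by (rule lh_analytic_local[OF assms(1-4) s0]) (rule that)
  show "\<exists>a e. e > 0 \<and> (\<forall>s\<in>J. \<bar>s - s0\<bar> < e \<longrightarrow> (\<lambda>n. a n * (s - s0) ^ n) sums nth_deriv j (c s) x)"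
    using e s[OF _ assms(5)] by (intro exI[of _ "\<lambda>n. nth_deriv j (a n) x"] exI[of _ e]) auto
qed

text \<open>The volume constraint expresses the mean of the lift through this integral, so the
  analyticity of the lifted curve rests on it. The square is a Cauchy product, and the bound (n + 1)
  q^n permits integration term by term.\<close>

lemma lh_analytic_square_integral:
  assumes "\<sigma> > 0" "\<sigma> \<notin> \<int>" "lh_analytic_on \<sigma> J c" "open J"
  shows "real_analytic_on J (\<lambda>s. integral {-pi..pi} (\<lambda>x. (c s x)\<^sup>2))" unfolding real_analytic_on_def
proof
  fix s0 assume s0: "s0 \<in> J"
  obtain a e M where e: "e > 0" and a: "\<And>n. a n \<in> little_holder \<sigma>"
    and s: "\<And>s j x. \<bar>s - s0\<bar> < e \<Longrightarrow> j \<le> fkey \<sigma> \<Longrightarrow>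
       (\<lambda>n. nth_deriv j (a n) x * (s - s0) ^ n) sums nth_deriv j (c s) x"
    and M: "\<And>n x. \<bar>a n x\<bar> * e ^ n \<le> M" by (rule lh_analytic_local[OF assms(1-4) s0]) (rule that)
  have ac: "continuous_on A (a n)" for n A using holder_spaceD(3)[OF little_holder_imp[OF a], of 0 n] continuous_on_subset by auto
  have M0: "M \<ge> 0" using M[of 0 0] by simp
  define b where "b n x = (\<Sum>i\<le>n. a i x * a (n - i) x)" for n x
  have bc: "continuous_on A (\<lambda>x. k * b n x)" for n A k unfolding b_def by (intro continuous_intros ac)
  have "(\<lambda>n. integral {-pi..pi} (b n) * (t - s0) ^ n) sums integral {-pi..pi} (\<lambda>x. (c t x)\<^sup>2)"
    if t: "\<bar>t - s0\<bar> < e" for t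
  proof -
    define h where "h = t - s0"
    define q where "q = \<bar>h\<bar> / e"
    have q: "0 \<le> q" "q < 1" "\<bar>h\<bar> = q * e" using t e unfolding q_def h_def by auto
    have tm: "\<bar>a n x * h ^ n\<bar> \<le> M * q ^ n" for n x
    proof -
      have "\<bar>a n x * h ^ n\<bar> = (\<bar>a n x\<bar> * e ^ n) * q ^ n" by (simp add: abs_mult power_abs q power_mult_distrib)
      also have "\<dots> \<le> M * q ^ n" by (rule mult_right_mono[OF M]) (use q in simp)
      finally show ?thesis .
    qed
    have sm: "summable (\<lambda>n. norm (a n x * h ^ n))" for x by (rule summable_comparison_test'[of "\<lambda>n. M * q ^ n" 0])
        (use tm q in \<open>auto intro!: summable_mult summable_geometric\<close>)
    have bh: "(\<Sum>i\<le>n. (a i x * h ^ i) * (a (n - i) x * h ^ (n - i))) = h ^ n * b n x" for n x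
      unfolding b_def sum_distrib_left by (rule sum.cong) (simp_all add: mult_ac flip: power_add)
    have sq: "(\<lambda>n. h ^ n * b n x) sums (c t x)\<^sup>2" for x
    proof -
      have "(\<lambda>n. a n x * h ^ n) sums c t x" using s[OF t, of 0 x] unfolding h_def by simp
      hence "(\<Sum>n. a n x * h ^ n) = c t x" by (simp add: sums_iff)
      thus ?thesis using Cauchy_product_sums[OF sm sm, of x x] unfolding bh by (simp add: power2_eq_square)
    qed
    have bb: "norm (h ^ n * b n x) \<le> M^2 * (of_nat (Suc n) * q ^ n)" for n x
    proof -
      have "norm (h ^ n * b n x) \<le> (\<Sum>i\<le>n. M\<^sup>2 * q ^ n)" unfolding bh[symmetric]
      proof (rule order_trans[OF norm_sum], rule sum_mono)
        fix i assume i: "i \<in> {..n}"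
        have "norm ((a i x * h ^ i) * (a (n - i) x * h ^ (n - i))) = \<bar>a i x * h ^ i\<bar> * \<bar>a (n - i) x * h ^ (n - i)\<bar>"
          by (simp only: real_norm_def abs_mult)
        also have "\<dots> \<le> (M * q ^ i) * (M * q ^ (n - i))" by (rule mult_mono[OF tm tm]) (use M0 q in auto)
        also have "\<dots> = M^2 * (q ^ i * q ^ (n - i))" by (simp add: power2_eq_square)
        also have "q ^ i * q ^ (n - i) = q ^ n" using i by (simp flip: power_add)
        finally show "norm ((a i x * h ^ i) * (a (n - i) x * h ^ (n - i))) \<le> M^2 * q ^ n" .
      qed
      thus ?thesis by (simp add: algebra_simps)
    qed
    have "summable (\<lambda>n. M\<^sup>2 * (of_nat (Suc n) * q ^ n))"
      using geometric_deriv_sums[of q] q by (intro summable_mult) (auto simp: sums_iff)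
    hence "uniform_limit {-pi..pi} (\<lambda>N x. \<Sum>n<N. h ^ n * b n x) (\<lambda>x. \<Sum>n. h ^ n * b n x) sequentially"
      by (rule Weierstrass_m_test[OF bb])
    moreover have "(\<Sum>n. h ^ n * b n x) = (c t x)^2" for x using sq[of x] by (simp add: sums_iff)
    ultimately have "uniform_limit {-pi..pi} (\<lambda>N x. \<Sum>n<N. h ^ n * b n x) (\<lambda>x. (c t x)\<^sup>2) sequentially" by simp
    moreover have "continuous_on {-pi..pi} (\<lambda>x. \<Sum>n<N. h ^ n * b n x)" for N by (intro continuous_on_sum bc)
    ultimately obtain I L where IL: "\<And>N. ((\<lambda>x. \<Sum>n<N. h ^ n * b n x) has_integral I N) {-pi..pi}"
        "((\<lambda>x. (c t x)\<^sup>2) has_integral L) {-pi..pi}" "I \<longlonglongrightarrow> L" by (rule uniform_limit_integral[where F = sequentially]) auto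
    have "I N = (\<Sum>n<N. integral {-pi..pi} (b n) * h ^ n)" for N
    proof -
      have "integral {-pi..pi} (\<lambda>x. \<Sum>n<N. h ^ n * b n x) = (\<Sum>n<N. integral {-pi..pi} (\<lambda>x. h ^ n * b n x))"
        by (intro integral_sum integrable_continuous_real bc) auto
      thus ?thesis using integral_unique[OF IL(1)] by (simp add: mult.commute)
    qed
    hence "I = (\<lambda>N. \<Sum>n<N. integral {-pi..pi} (b n) * h ^ n)" by blast
    thus ?thesis using IL(3) integral_unique[OF IL(2)] unfolding sums_def h_def[symmetric] by simp
  qed
  thus "\<exists>a e. e > 0 \<and> (\<forall>t\<in>J. \<bar>t - s0\<bar> < e \<longrightarrow>
      (\<lambda>n. a n * (t - s0) ^ n) sums integral {-pi..pi} (\<lambda>x. (c t x)\<^sup>2))"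
    using e by (intro exI[of _ "\<lambda>n. integral {-pi..pi} (b n)"] exI[of _ e]) auto
qed

text \<open>In the complexification, quotients and square roots of analytic functions are handled by
  holomorphy. \<open>holomorphic_extension_real_analytic\<close> is the way back.\<close>

lemma real_analytic_holomorphic_extension:
  assumes an: "real_analytic_on J f" and J: "open J" and s0: "s0 \<in> J"
  obtains F e where "e > 0" "F holomorphic_on ball 0 e" "\<And>h. \<bar>h\<bar> < e \<Longrightarrow> s0 + h \<in> J"
    "\<And>h. \<bar>h\<bar> < e \<Longrightarrow> F (of_real h) = of_real (f (s0 + h))"
proof -
  obtain a e0 where e0: "e0 > 0" and s: "\<And>s. s \<in> J \<Longrightarrow> \<bar>s - s0\<bar> < e0 \<Longrightarrow> (\<lambda>n. a n * (s - s0) ^ n) sums f s"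
    using an s0 unfolding real_analytic_on_def by blast
  obtain e1 where e1: "e1 > 0" "\<And>s. \<bar>s - s0\<bar> < e1 \<Longrightarrow> s \<in> J" using J s0 unfolding open_dist dist_real_def by blast
  \<comment> \<open>Halving puts the real increment e itself inside the region of convergence,
    whence absolute convergence for all complex arguments of modulus below e.\<close>
  define e where "e = min e0 e1 / 2"
  have e: "e > 0" "e < e0" "e < e1" using e0 e1(1) unfolding e_def by auto
  have "(\<lambda>n. a n * e ^ n) sums f (s0 + e)" using s[of "s0 + e"] e1(2)[of "s0 + e"] e by simp
  hence "summable (\<lambda>n. of_real (a n * e ^ n) :: complex)" by (rule summable_of_real[OF sums_summable])
  hence "summable (\<lambda>n. of_real (a n) * (of_real e) ^ n :: complex)" by simp
  note P = powser_insidea[OF this]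
  define F where "F z = (\<Sum>n. of_real (a n) * z ^ n :: complex)" for z
  have Fs: "(\<lambda>n. of_real (a n) * z ^ n) sums F z" if "norm z < e" for z
    using summable_norm_cancel[OF P[of z]] that e unfolding F_def by (simp add: summable_sums)
  have "F holomorphic_on ball 0 e" by (rule power_series_holomorphic[of 0 e "\<lambda>n. of_real (a n)"]) (use Fs in auto)
  moreover have "F (of_real h) = of_real (f (s0 + h))" if "\<bar>h\<bar> < e" for h
  proof -
    have "(\<lambda>n. a n * h ^ n) sums f (s0 + h)" using s[of "s0 + h"] e1(2)[of "s0 + h"] e that by simp
    hence "(\<lambda>n. of_real (a n * h ^ n) :: complex) sums of_real (f (s0 + h))" by (rule sums_of_real)
    moreover have "(\<lambda>n. of_real (a n * h ^ n) :: complex) sums F (of_real h)" using Fs[of "of_real h"] that by simp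
    ultimately show ?thesis using sums_unique2 by blast
  qed
  ultimately show ?thesis using that[of e F] e e1 by auto
qed

lemma holomorphic_extension_real_analytic:
  assumes "\<And>s0. s0 \<in> J \<Longrightarrow> \<exists>F e. e > 0 \<and> F holomorphic_on ball 0 e \<and>
    (\<forall>h. \<bar>h\<bar> < e \<longrightarrow> F (of_real h) = of_real (f (s0 + h)))"
  shows "real_analytic_on J f" unfolding real_analytic_on_def
proof
  fix s0 assume "s0 \<in> J"
  then obtain F e where e: "e > 0" and F: "F holomorphic_on ball 0 e"
    and Ff: "\<And>h. \<bar>h\<bar> < e \<Longrightarrow> F (of_real h) = of_real (f (s0 + h))" using assms by blast
  have "(\<lambda>n. Re ((deriv ^^ n) F 0 / fact n) * (s - s0) ^ n) sums f s" if "\<bar>s - s0\<bar> < e" for s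
  proof -
    define h where "h = s - s0"
    have h: "\<bar>h\<bar> < e" "s0 + h = s" using that unfolding h_def by auto
    have "(\<lambda>n. (deriv ^^ n) F 0 / fact n * (of_real h - 0) ^ n) sums F (of_real h)"
      by (rule holomorphic_power_series[OF F]) (use h in simp)
    hence "(\<lambda>n. Re ((deriv ^^ n) F 0 / fact n * (of_real h - 0) ^ n)) sums Re (F (of_real h))" by (rule sums_Re)
    moreover have "Re (c * (of_real h - 0) ^ n) = Re c * h ^ n" for c n by (simp flip: of_real_power)
    ultimately have "(\<lambda>n. Re ((deriv ^^ n) F 0 / fact n) * h ^ n) sums Re (F (of_real h))" by (simp only:)
    thus ?thesis using Ff[OF h(1)] h(2) unfolding h_def[symmetric] by simp
  qed
  thus "\<exists>a e. e > 0 \<and> (\<forall>s\<in>J. \<bar>s - s0\<bar> < e \<longrightarrow> (\<lambda>n. a n * (s - s0) ^ n) sums f s)"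
    using e by (intro exI[of _ "\<lambda>n. Re ((deriv ^^ n) F 0 / fact n)"] exI[of _ e]) auto
qed

lemma real_analytic_continuous:
  assumes "real_analytic_on J f" "open J"
  shows "continuous_on J f" unfolding continuous_on_eq_continuous_at[OF assms(2)]
proof
  fix s0 assume "s0 \<in> J"
  obtain F e where e: "e > 0" and F: "F holomorphic_on ball 0 e"
    and Ff: "\<And>h. \<bar>h\<bar> < e \<Longrightarrow> F (of_real h) = of_real (f (s0 + h))"
    by (rule real_analytic_holomorphic_extension[OF assms \<open>s0 \<in> J\<close>]) (rule that)
  have "isCont F (of_real (s0 - s0))" using holomorphic_on_imp_continuous_on[OF F] e by (simp add: continuous_on_eq_continuous_at)
  hence "isCont (\<lambda>s. F (of_real (s - s0))) s0"
    by (intro continuous_at_compose[of s0 "\<lambda>s. of_real (s - s0)" F, unfolded o_def] continuous_intros) simp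
  hence "isCont (\<lambda>s. Re (F (of_real (s - s0)))) s0" by (rule isCont_Re)
  moreover have "eventually (\<lambda>s. f s = Re (F (of_real (s - s0)))) (nhds s0)" unfolding eventually_nhds_metric dist_real_def
  proof (intro exI[of _ e] conjI e allI impI)
    fix s assume "\<bar>s - s0\<bar> < e"
    thus "f s = Re (F (of_real (s - s0)))" using Ff[of "s - s0"] by (simp del: of_real_diff)
  qed
  ultimately show "isCont f s0" by (simp add: isCont_cong)
qed

text \<open>This is the mean of the lifted profile when I is the integral of the square of \<rho>.
  Positivity of the radicand keeps its extension away from the branch cut of the complex
  root.\<close>

lemma real_analytic_lift_mean:
  assumes I: "real_analytic_on J I" and lam: "real_analytic_on J lam" and J: "open J"
    and pos: "\<And>s. s \<in> J \<Longrightarrow> lam s > 0" "\<And>s. s \<in> J \<Longrightarrow> 1 / (lam s)^2 - I s / (2 * pi) > 0"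
  shows "real_analytic_on J (\<lambda>s. sqrt (1 / (lam s)^2 - I s / (2 * pi)))"
proof (rule holomorphic_extension_real_analytic)
  fix s0 assume s0: "s0 \<in> J"
  obtain F e where e: "e > 0" and F: "F holomorphic_on ball 0 e" and FJ: "\<And>h. \<bar>h\<bar> < e \<Longrightarrow> s0 + h \<in> J"
    and Ff: "\<And>h. \<bar>h\<bar> < e \<Longrightarrow> F (of_real h) = of_real (I (s0 + h))"
    by (rule real_analytic_holomorphic_extension[OF I J s0]) (rule that)
  obtain L d where d: "d > 0" and L: "L holomorphic_on ball 0 d"
    and Lf: "\<And>h. \<bar>h\<bar> < d \<Longrightarrow> L (of_real h) = of_real (lam (s0 + h))"
    by (rule real_analytic_holomorphic_extension[OF lam J s0]) (rule that)
  have "isCont L 0" using holomorphic_on_imp_continuous_on[OF L] d by (simp add: continuous_on_eq_continuous_at)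
  moreover have L0: "L 0 = of_real (lam s0)" using Lf[of 0] d by simp
  hence L0': "L 0 \<noteq> 0" using pos(1)[OF s0] by simp
  ultimately obtain d1 where d1: "d1 > 0" "\<And>z. norm z < d1 \<Longrightarrow> L z \<noteq> 0" using continuous_at_avoid[of 0 L 0] by (auto simp: dist_norm)
  define m where "m = min e (min d d1)"
  have m: "m > 0" "m \<le> e" "m \<le> d" "m \<le> d1" using e d d1(1) unfolding m_def by auto
  define g where "g z = 1 / (L z)^2 - F z / of_real (2 * pi)" for z
  have g: "g holomorphic_on ball 0 m" unfolding g_def
    by (intro holomorphic_intros holomorphic_on_subset[OF L] holomorphic_on_subset[OF F]) (use m d1 in \<open>auto simp: subset_ball\<close>)
  have gr: "g (of_real h) = of_real (1 / (lam (s0 + h))^2 - I (s0 + h) / (2 * pi))" if "\<bar>h\<bar> < m" for h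
    unfolding g_def using Ff[of h] Lf[of h] that m by simp
  have "isCont g 0" using holomorphic_on_imp_continuous_on[OF g] m by (simp add: continuous_on_eq_continuous_at)
  hence "isCont (\<lambda>z. Re (g z)) 0" by (rule isCont_Re)
  moreover have "Re (g 0) > 0" using gr[of 0] pos(2)[OF s0] m by simp
  ultimately have "eventually (\<lambda>z. Re (g z) > 0) (nhds 0)" using order_tendstoD(1)[of "\<lambda>z. Re (g z)" "Re (g 0)" "nhds 0" 0]
    unfolding continuous_at tendsto_at_iff_tendsto_nhds[of "\<lambda>z. Re (g z)" 0] by blast
  then obtain k where k: "k > 0" "\<And>z. norm z < k \<Longrightarrow> Re (g z) > 0" unfolding eventually_nhds_metric by (auto simp: dist_norm)
  define n where "n = min k m"
  have n: "n > 0" "n \<le> k" "n \<le> m" using k m unfolding n_def by auto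
  have "(\<lambda>z. csqrt (g z)) holomorphic_on ball 0 n"
  proof (rule holomorphic_on_csqrt')
    show "g holomorphic_on ball 0 n" by (rule holomorphic_on_subset[OF g]) (use n in \<open>auto simp: subset_ball\<close>)
    fix z assume "z \<in> ball (0 :: complex) n"
    hence "Re (g z) > 0" using k n by simp
    thus "g z \<notin> \<real>\<^sub>\<le>\<^sub>0" by (auto simp: complex_nonpos_Reals_iff)
  qed
  moreover have "csqrt (g (of_real h)) = of_real (sqrt (1 / (lam (s0 + h))^2 - I (s0 + h) / (2 * pi)))" if h: "\<bar>h\<bar> < n" for h
  proof -
    have hm: "\<bar>h\<bar> < m" "s0 + h \<in> J" using h n m FJ[of h] by auto
    show ?thesis unfolding gr[OF hm(1)] using pos(2)[OF hm(2)] by (subst csqrt_of_real_nonneg) simp_all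
  qed
  ultimately show "\<exists>F e. e > 0 \<and> F holomorphic_on ball 0 e \<and>
    (\<forall>h. \<bar>h\<bar> < e \<longrightarrow> F (of_real h) = of_real (sqrt (1 / (lam (s0 + h))^2 - I (s0 + h) / (2 * pi))))" using n by blast
qed

text \<open>Taylor's formula with a convergent quotient g. Inequalities for f near 0 then pass to
  its second derivative.\<close>

lemma real_analytic_second_order:
  assumes an: "real_analytic_on J f" and J: "open J" and "0 \<in> J"
  obtains g where "(g \<longlongrightarrow> deriv (deriv f) 0 / 2) (at 0)"
    "eventually (\<lambda>s. f s = f 0 + deriv f 0 * s + s^2 * g s) (at 0)"
proof -
  obtain a e0 where e0: "e0 > 0" and s: "\<And>s. s \<in> J \<Longrightarrow> \<bar>s - 0\<bar> < e0 \<Longrightarrow> (\<lambda>n. a n * (s - 0) ^ n) sums f s"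
    using an \<open>0 \<in> J\<close> unfolding real_analytic_on_def by blast
  obtain e1 where e1: "e1 > 0" "\<And>s. \<bar>s - 0\<bar> < e1 \<Longrightarrow> s \<in> J" using J \<open>0 \<in> J\<close> unfolding open_dist dist_real_def by blast
  define e where "e = min e0 e1"
  have e: "e > 0" using e0 e1(1) unfolding e_def by auto
  have sums: "(\<lambda>n. a n * s ^ n) sums f s" if "\<bar>s\<bar> < e" for s using s[of s] e1(2)[of s] that unfolding e_def by simp
  have near: "eventually (\<lambda>s. \<bar>s\<bar> < r) (nhds (x :: real))" if "\<bar>x\<bar> < r" for r x
  proof -
    have "open {s :: real. \<bar>s\<bar> < r}" by (intro open_Collect_less continuous_intros)
    thus ?thesis using that eventually_nhds_in_open by fastforce
  qed
  have D: "(F has_field_derivative (\<Sum>n. diffs c n * x ^ n)) (at x)"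
    if sF: "\<And>s. \<bar>s\<bar> < e \<Longrightarrow> (\<lambda>n. c n * s ^ n) sums F s" and x: "\<bar>x\<bar> < e" for c F x
  proof -
    define k where "k = (\<bar>x\<bar> + e) / 2"
    have k: "\<bar>x\<bar> < k" "k < e" "0 < k" using x unfolding k_def by auto
    have "summable (\<lambda>n. c n * k ^ n)" using sF[of k] k by (simp add: sums_iff)
    hence "((\<lambda>x. \<Sum>n. c n * x ^ n) has_field_derivative (\<Sum>n. diffs c n * x ^ n)) (at x)" by (rule termdiffs_strong) (use k in simp)
    moreover have ev: "eventually (\<lambda>s. (\<Sum>n. c n * s ^ n) = F s) (nhds x)"
      using near[OF x] by eventually_elim (use sF in \<open>simp add: sums_iff\<close>)
    ultimately show ?thesis using DERIV_cong_ev[OF refl ev refl] by blast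
  qed
  have d1: "(\<lambda>n. diffs a n * s ^ n) sums deriv f s" if "\<bar>s\<bar> < e" for s
  proof -
    have "summable (\<lambda>n. diffs a n * s ^ n)"
    proof (rule termdiff_converges[where K = e])
      show "norm s < e" using that by simp
      fix x :: real assume "norm x < e" thus "summable (\<lambda>n. a n * x ^ n)" using sums[of x] by (simp add: sums_iff)
    qed
    thus ?thesis using DERIV_imp_deriv[OF D[OF sums that]] by (simp add: summable_sums)
  qed
  have v1: "deriv f 0 = a 1" using sums_unique2[OF d1[of 0]] powser_sums_zero[of "diffs a"] e by (simp add: diffs_def)
  have "deriv (deriv f) 0 = (\<Sum>n. diffs (diffs a) n * 0 ^ n)" using DERIV_imp_deriv[OF D[OF d1, of 0]] e by simp
  also have "\<dots> = diffs (diffs a) 0" by (rule powser_zero)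
  finally have v2: "deriv (deriv f) 0 / 2 = a 2" by (simp add: diffs_def numeral_2_eq_2)
  have v0: "f 0 = a 0" using sums_unique2[OF sums[of 0]] powser_sums_zero[of a] e by simp
  define g where "g s = (f s - a 0 - a 1 * s) / s^2" for s
  have "(g \<longlongrightarrow> (\<lambda>n. a (n + 2)) 0) (at 0)"
  proof (rule powser_limit_0_strong[OF e])
    fix x :: real assume x: "x \<noteq> 0" "norm x < e"
    have "(\<lambda>n. a (n + 2) * x ^ (n + 2)) sums (f x - (\<Sum>i<2. a i * x ^ i))"
      using sums_split_initial_segment[OF sums[of x], of 2] x by simp
    hence "(\<lambda>n. a (n + 2) * x ^ (n + 2) / x^2) sums ((f x - (\<Sum>i<2. a i * x ^ i)) / x^2)" by (rule sums_divide)
    moreover have "a (n + 2) * x ^ (n + 2) / x^2 = a (n + 2) * x ^ n" for n using x by (simp add: power_add power2_eq_square)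
    ultimately show "(\<lambda>n. a (n + 2) * x ^ n) sums g x" unfolding g_def by (simp add: numeral_2_eq_2 algebra_simps)
  qed
  moreover have "eventually (\<lambda>s. f s = f 0 + deriv f 0 * s + s^2 * g s) (at 0)"
    unfolding v0 v1 g_def eventually_at_filter by (rule always_eventually) simp
  ultimately show ?thesis using that[of g] v2 by (simp add: numeral_2_eq_2)
qed

lemma lh_analytic_add_const:
  assumes \<sigma>: "\<sigma> > 0" "\<sigma> \<notin> \<int>" and c: "lh_analytic_on \<sigma> J c" and m: "real_analytic_on J m"
  shows "lh_analytic_on \<sigma> J (\<lambda>s x. c s x + m s)" unfolding lh_analytic_on_def
proof (intro conjI ballI)
  have cJ: "c s \<in> little_holder \<sigma>" if "s \<in> J" for s using c that unfolding lh_analytic_on_def by blast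
  show "(\<lambda>x. c s x + m s) \<in> little_holder \<sigma>" if "s \<in> J" for s
    by (rule little_holder_add(1)[OF cJ[OF that] const_little_holder(1)[OF \<sigma>]])
  fix s0 assume s0: "s0 \<in> J"
  obtain a e0 where e0: "e0 > 0" and a: "\<And>n. a n \<in> little_holder \<sigma>"
    and lim: "\<And>s. s \<in> J \<Longrightarrow> \<bar>s - s0\<bar> < e0 \<Longrightarrow>
          (\<lambda>N. holder_norm \<sigma> (\<lambda>x. c s x - (\<Sum>n<N. (s - s0) ^ n * a n x))) \<longlonglongrightarrow> 0" using c s0 unfolding lh_analytic_on_def by blast
  obtain b e1 where e1: "e1 > 0" and b: "\<And>s. s \<in> J \<Longrightarrow> \<bar>s - s0\<bar> < e1 \<Longrightarrow> (\<lambda>n. b n * (s - s0) ^ n) sums m s"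
    using m s0 unfolding real_analytic_on_def by blast
  define d where "d n = (\<lambda>x. a n x + b n)" for n
  have "(\<lambda>N. holder_norm \<sigma> (\<lambda>x. (c s x + m s) - (\<Sum>n<N. (s - s0) ^ n * d n x))) \<longlonglongrightarrow> 0"
    if s: "s \<in> J" "\<bar>s - s0\<bar> < e0" "\<bar>s - s0\<bar> < e1" for s
  proof -
    define S where "S N = (\<lambda>x. c s x - (\<Sum>n<N. (s - s0) ^ n * a n x))" for N
    define t where "t N = m s - (\<Sum>n<N. b n * (s - s0) ^ n)" for N
    have SN: "S N \<in> little_holder \<sigma>" for N
      unfolding S_def by (rule little_holder_diff(1)[OF cJ[OF s(1)] little_holder_sum(1)[OF \<sigma> a]])
    have eq: "(\<lambda>x. (c s x + m s) - (\<Sum>n<N. (s - s0) ^ n * d n x)) = (\<lambda>x. S N x + t N)" for N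
      unfolding S_def t_def d_def by (auto simp: algebra_simps sum.distrib)
    have "t \<longlonglongrightarrow> m s - m s" unfolding t_def using b[OF s(1,3)] unfolding sums_def by (intro tendsto_intros)
    hence "(\<lambda>N. holder_norm \<sigma> (S N) + (real (fkey \<sigma>) + 1) * \<bar>t N\<bar>) \<longlonglongrightarrow> 0 + (real (fkey \<sigma>) + 1) * \<bar>m s - m s\<bar>"
      using lim[OF s(1,2)] unfolding S_def[symmetric] by (intro tendsto_intros)
    hence L: "(\<lambda>N. holder_norm \<sigma> (S N) + (real (fkey \<sigma>) + 1) * \<bar>t N\<bar>) \<longlonglongrightarrow> 0" by simp
    have le: "norm (holder_norm \<sigma> (\<lambda>x. S N x + t N)) \<le> holder_norm \<sigma> (S N) + (real (fkey \<sigma>) + 1) * \<bar>t N\<bar>" for N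
      using little_holder_add[OF SN[of N] const_little_holder(1)[OF \<sigma>, of "t N"]] const_little_holder(2)[OF \<sigma>, of "t N"]
        holder_norm_nonneg[OF little_holder_imp] by fastforce
    show ?thesis unfolding eq by (rule Lim_null_comparison[OF always_eventually L]) (use le in blast)
  qed
  moreover have "d n \<in> little_holder \<sigma>" for n unfolding d_def by (rule little_holder_add(1)[OF a const_little_holder(1)[OF \<sigma>]])
  ultimately show "\<exists>a e. e > 0 \<and> (\<forall>n. a n \<in> little_holder \<sigma>) \<and>
        (\<forall>s\<in>J. \<bar>s - s0\<bar> < e \<longrightarrow>
          (\<lambda>N. holder_norm \<sigma> (\<lambda>x. (c s x + m s) - (\<Sum>n<N. (s - s0) ^ n * a n x))) \<longlonglongrightarrow> 0)"
    using e0 e1 by (intro exI[of _ d] exI[of _ "min e0 e1"]) auto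
qed

section \<open>The constructed equilibria as undulary curves\<close>

lemma undulary_H_lower:
  assumes B: "\<bar>B\<bar> < 1"
  shows "undulary_H B 1 \<ge> (1 - \<bar>B\<bar>) / (1 + \<bar>B\<bar>)"
proof -
  have H: "(0 :: real) < 1" by simp
  have le: "(1 - \<bar>B\<bar>) / (1 + \<bar>B\<bar>) \<le> und_xp B t" for t
  proof -
    have "sqrt (und_D B t) \<le> sqrt ((1 + \<bar>B\<bar>)^2)" using und_D_bounds(2)[OF H B] by (rule real_sqrt_le_mono)
    hence "sqrt (und_D B t) \<le> 1 + \<bar>B\<bar>" by simp
    moreover have "sqrt (und_D B t) > 0" using und_D_pos[OF H B] by simp
    moreover have "1 - \<bar>B\<bar> \<le> 1 + B * sin t" using und_sin[OF H B, of t] by linarith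
    ultimately show ?thesis unfolding und_xp_def using B by (intro frac_le) auto
  qed
  have "integral {pi / 2..3 * pi / 2} (\<lambda>t. (1 - \<bar>B\<bar>) / (1 + \<bar>B\<bar>)) \<le> integral {pi / 2..3 * pi / 2} (und_xp B)"
    using und_xp_cont[OF H B, of "{pi / 2..3 * pi / 2}"] le by (intro integral_le integrable_continuous_real) auto
  hence "(1 - \<bar>B\<bar>) / (1 + \<bar>B\<bar>) * pi \<le> integral {pi / 2..3 * pi / 2} (und_xp B)" by (simp add: mult.commute)
  thus ?thesis unfolding undulary_H_1[OF H B] by (simp add: pos_le_divide_eq)
qed

lemma undulary_H_0: "undulary_H 0 1 = 1" by (simp add: undulary_H_def)

lemma undulary_H_continuous: "continuous_on {-1<..<1 :: real} (\<lambda>B. undulary_H B 1)"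
proof -
  have "continuous_on ({-1<..<1 :: real} \<times> cbox (pi / 2) (3 * pi / 2)) (\<lambda>(B, t). und_xp B t)"
    unfolding und_xp_def und_D_def case_prod_unfold
  proof (intro continuous_intros ballI)
    fix p assume "p \<in> {-1<..<1 :: real} \<times> cbox (pi / 2) (3 * pi / 2)"
    hence "\<bar>fst p\<bar> < 1" by auto
    thus "sqrt (1 + (fst p)^2 + 2 * fst p * sin (snd p)) \<noteq> 0" using und_D_pos[of 1 "fst p" "snd p"] by (simp add: und_D_def)
  qed
  hence "continuous_on {-1<..<1} (\<lambda>B. integral (cbox (pi / 2) (3 * pi / 2)) (und_xp B))" by (rule integral_continuous_on_param)
  hence "continuous_on {-1<..<1} (\<lambda>B. integral (cbox (pi / 2) (3 * pi / 2)) (und_xp B) / pi)" by (intro continuous_intros) auto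
  thus ?thesis by (rule continuous_on_eq) (subst undulary_H_1[of 1], auto)
qed

lemma undulary_H_pos: "\<bar>B\<bar> < 1 \<Longrightarrow> k \<ge> 1 \<Longrightarrow> undulary_H B k > 0" using undulary_H_1_pos[of 1 B] by (subst undulary_H_nat) simp

lemma undulary_fun_at:
  assumes H: "H > 0" and B: "\<bar>B\<bar> < 1"
  shows "undulary_fun H B 0 = (1 + B) / H"
    and "undulary_fun H B (pi * undulary_H B 1 / H) = (1 - B) / H"
proof -
  have "sqrt (1 + B^2 + 2 * B * 1) = sqrt ((1 + B)^2)" "sqrt (1 + B^2 + 2 * B * (- 1)) = sqrt ((1 - B)^2)"
    by (simp_all add: power2_eq_square algebra_simps)
  hence sq: "sqrt (1 + B^2 + 2 * B * 1) = 1 + B" "sqrt (1 + B^2 + 2 * B * (- 1)) = 1 - B" using B by auto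
  have "undulary_fun H B (undulary_x H B (pi / (2 * H))) = undulary_y H B (pi / (2 * H))" by (rule undulary_fun_eval[OF H B])
  thus "undulary_fun H B 0 = (1 + B) / H" using sq(1) H by (simp add: undulary_x_start[OF H B] undulary_y_def)
  have "undulary_fun H B (undulary_x H B (3 * pi / (2 * H))) = undulary_y H B (3 * pi / (2 * H))"
    by (rule undulary_fun_eval[OF H B])
  moreover have "undulary_x H B (3 * pi / (2 * H)) = pi * undulary_H B 1 / H" using undulary_x_extrema[OF H B, of 1] by simp
  moreover have "sin (H * (3 * pi / (2 * H))) = - 1" using H by (simp add: sin_3over2_pi[symmetric])
  ultimately show "undulary_fun H B (pi * undulary_H B 1 / H) = (1 - B) / H" using sq(2) by (simp add: undulary_y_def)
qed

lemma undulary_fun_0: "H > 0 \<Longrightarrow> undulary_fun H 0 x = 1 / H"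
proof -
  assume H: "H > 0"
  obtain s where "undulary_x H 0 s = x" using undulary_x_surj[OF H, of 0] by auto
  thus ?thesis using undulary_fun_eval[OF H, of 0 s] by (simp add: undulary_y_def)
qed

lemma undulary_at:
  assumes "\<bar>B\<bar> < 1" "k \<ge> 1"
  shows "undulary B k 0 = (1 + B) / undulary_H B k" "undulary B k (pi / real k) = (1 - B) / undulary_H B k"
proof -
  have H: "undulary_H B k > 0" by (rule undulary_H_pos[OF assms])
  show "undulary B k 0 = (1 + B) / undulary_H B k" unfolding undulary_def by (rule undulary_fun_at(1)[OF H assms(1)])
  have "pi * undulary_H B 1 / undulary_H B k = pi / real k" using undulary_H_1_pos[of 1 B] assms by (subst undulary_H_nat) simp
  thus "undulary B k (pi / real k) = (1 - B) / undulary_H B k"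
    unfolding undulary_def using undulary_fun_at(2)[OF H assms(1)] by simp
qed

text \<open>Multiplying H by k shrinks arc length, abscissa and height by the same factor k.\<close>

lemma undulary_scaling:
  assumes "\<bar>B\<bar> < 1" "k \<ge> 1"
  shows "undulary B k x = undulary B 1 (real k * x) / real k"
proof -
  define H where "H = undulary_H B 1"
  have H: "H > 0" unfolding H_def using undulary_H_1_pos[of 1 B] assms by simp
  have k: "real k > 0" using assms(2) by simp
  define K where "K = real k * H"
  have K: "K > 0" using H k by (simp add: K_def)
  have Hk: "undulary_H B k = K" unfolding K_def H_def by (rule undulary_H_nat)
  obtain s where s: "undulary_x K B s = x" using undulary_x_surj[OF K assms(1)] by blast
  have sc: "undulary_x H B (real k * s) = real k * undulary_x K B s" for s
  proof -
    have "((\<lambda>s. undulary_x H B (real k * s) - real k * undulary_x K B s) has_real_derivative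
      und_xp B (H * (real k * s)) * real k - real k * und_xp B (K * s)) (at s)" for s
      by (intro derivative_intros DERIV_cmult DERIV_chain2[OF undulary_x_deriv[OF H assms(1)]]
          undulary_x_deriv[OF K assms(1)]) (auto intro!: derivative_eq_intros)
    hence "((\<lambda>s. undulary_x H B (real k * s) - real k * undulary_x K B s) has_real_derivative 0) (at s)" for s
      by (simp add: K_def mult_ac)
    hence "undulary_x H B (real k * s) - real k * undulary_x K B s =
       undulary_x H B (real k * (pi / (2 * K))) - real k * undulary_x K B (pi / (2 * K))" by (rule DERIV_isconst_all[rule_format])
    moreover have "real k * (pi / (2 * K)) = pi / (2 * H)" using k by (simp add: K_def)
    ultimately show ?thesis by (simp add: undulary_x_start[OF H assms(1)] undulary_x_start[OF K assms(1)])
  qed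
  have "undulary B k x = undulary_y K B s" unfolding undulary_def Hk using undulary_fun_eval[OF K assms(1), of s] s by simp
  also have "\<dots> = undulary_y H B (real k * s) / real k" unfolding undulary_y_def K_def by (simp add: mult_ac)
  also have "undulary_y H B (real k * s) = undulary B 1 (real k * x)"
    unfolding undulary_def H_def[symmetric] using undulary_fun_eval[OF H assms(1), of "real k * s"] unfolding sc s by simp
  finally show ?thesis .
qed

text \<open>The formula for H is the mean curvature at 0, where evenness forces r' = 0.\<close>

lemma equilibrium_undulary:
  assumes c: "chain3 r r1 r2 r3" and pos: "\<And>x. r x > 0" and d: "\<And>x. r3 differentiable (at x)"
    and per: "periodic_2pi r" and even: "\<And>x. r (- x) = r x" and eq: "\<And>x. asd_G r x = 0"
    and H: "H = 1 / r 0 - r2 0" and B: "B = H * r 0 - 1"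
  shows "H > 0" "\<bar>B\<bar> < 1" "r = undulary_fun H B" "B \<noteq> 0 \<Longrightarrow> \<exists>k::nat. k \<ge> 1 \<and> H = real k * undulary_H B 1"
proof -
  have mc: "mean_curv r x = mean_curv r 0" for x by (rule equilibrium_mean_curv_const[OF c pos d per eq])
  have "mean_curv r 0 = H" unfolding mean_curv_sqrt[OF c] r1_0[OF c pos per even mc] H by simp
  hence mc: "mean_curv r x = H" for x using mc by simp
  show "H > 0" by (rule H_pos[OF c pos per even mc])
  show "\<bar>B\<bar> < 1" unfolding B by (rule B_bound[OF c pos per even mc])
  show "r = undulary_fun H B" unfolding B by (rule mean_curv_const_undulary[OF c pos per even mc])
  show "\<exists>k::nat. k \<ge> 1 \<and> H = real k * undulary_H B 1" if "B \<noteq> 0"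
    unfolding B by (rule undulary_period[OF c pos per even mc]) (use that in \<open>simp add: B\<close>)
qed

lemma special_equilibrium:
  assumes "special B d0 d1 d2 d3 \<sigma>"
  shows "chain3 (Cf (pz 0) d0) (\<lambda>x. - Sf (pz 0) d1 x) (\<lambda>x. - Cf (pz 0) d2 x) (Sf (pz 0) d3)"
    "Cf (pz 0) d0 x > 0" "Sf (pz 0) d3 differentiable (at x)" "asd_G (Cf (pz 0) d0) x = 0"
proof -
  show "chain3 (Cf (pz 0) d0) (\<lambda>x. - Sf (pz 0) d1 x) (\<lambda>x. - Cf (pz 0) d2 x) (Sf (pz 0) d3)"
    using assms unfolding special_def by simp
  have "Cf (pz 0) d0 x \<ge> 1 / 2" using assms unfolding special_def by simp
  thus "Cf (pz 0) d0 x > 0" by linarith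
  show "Sf (pz 0) d3 differentiable (at x)" using Sf_deriv[OF admissible_pz, of 0] real_differentiable_def by fastforce
  have "asd_G (Cf (pz 0) d0) x = Cf (\<lambda>n. \<sigma> * (real n * 0 ^ n)) d0 x" using assms unfolding special_def by simp
  also have "(\<lambda>n. \<sigma> * (real n * 0 ^ n)) = (\<lambda>n. 0)" by (auto simp: power_0_left)
  also have "Cf (\<lambda>n. 0) d0 x = 0" using ev_scale_weights(1)[of 0 "\<lambda>n. 0"] by simp
  finally show "asd_G (Cf (pz 0) d0) x = 0" .
qed

text \<open>An equilibrium could have any number k of periods. The bounds at x = 0 give H < 1.3,
  whereas k >= 2 would force H > 1.5; so k = 1. The ratio of the values at 0 and \<pi> then
  identifies the parameter as B.\<close>

theorem special_undulary:
  assumes sp: "special B d0 d1 d2 d3 \<sigma>" and B: "B \<noteq> 0"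
  shows "Cf (pz 0) d0 = undulary B 1" "\<bar>B\<bar> < 1"
proof -
  define r where "r = Cf (pz 0) d0"
  define r2 where "r2 = (\<lambda>x. - Cf (pz 0) d2 x)"
  define H where "H = 1 / r 0 - r2 0"
  define b where "b = H * r 0 - 1"
  note eq = special_equilibrium[OF sp, folded r_def, folded r2_def]
  have per: "periodic_2pi r" unfolding r_def periodic_2pi_def by (simp add: ev_periodic)
  have even: "r (- x) = r x" for x unfolding r_def by (rule Cf_even)
  note eu = equilibrium_undulary[OF eq(1,2,3) per even eq(4) H_def b_def]
  have rel: "r 0 - r pi = B * (r 0 + r pi)" and r0: "\<bar>r 0 - 1\<bar> \<le> 1 / 8" and r20: "\<bar>r2 0\<bar> \<le> 1 / 8"
    using sp unfolding special_def r_def r2_def by simp_all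
  have sum: "r 0 + r pi > 0" using eq(2)[of 0] eq(2)[of pi] by linarith
  hence ne: "r 0 \<noteq> r pi" using rel B by auto
  have r0': "7 / 8 \<le> r 0" "r 0 \<le> 9 / 8" using r0 by linarith+
  have "b = - r2 0 * r 0" unfolding b_def H_def using r0' by (simp add: field_simps)
  hence "\<bar>b\<bar> = \<bar>r2 0\<bar> * \<bar>r 0\<bar>" by (simp add: abs_mult)
  also have "\<dots> \<le> 1 / 8 * (9 / 8)" by (rule mult_mono[OF r20]) (use r0' in auto)
  finally have bb: "\<bar>b\<bar> \<le> 9 / 64" by simp
  have "1 / r 0 \<le> 1 / (7 / 8)" by (rule divide_left_mono) (use r0' in auto)
  hence HU: "H \<le> 8 / 7 + 1 / 8" unfolding H_def using r20 by (simp add: abs_le_iff)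
  have b0: "b \<noteq> 0"
  proof
    assume "b = 0"
    thus False using ne undulary_fun_0[OF eu(1)] unfolding eu(3) by simp
  qed
  obtain k :: nat where k: "k \<ge> 1" "H = real k * undulary_H b 1" using eu(4)[OF b0] by blast
  have "(55 / 73 :: real) \<le> (1 - \<bar>b\<bar>) / (1 + \<bar>b\<bar>)" using bb by (simp add: field_simps)
  hence hL: "55 / 73 \<le> undulary_H b 1" using undulary_H_lower[OF eu(2)] by linarith
  have "k < 2"
  proof (rule ccontr)
    assume "\<not> k < 2"
    hence "2 * (55 / 73) \<le> real k * undulary_H b 1" using hL by (intro mult_mono) auto
    thus False using k(2) HU by simp
  qed
  hence "H = undulary_H b 1" using k by simp
  hence ru: "r = undulary b 1" unfolding undulary_def using eu(3) by simp
  have "r 0 = (1 + b) / undulary_H b 1" "r pi = (1 - b) / undulary_H b 1" using undulary_at[OF eu(2), of 1] unfolding ru by simp_all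
  hence "r 0 - r pi = b * (r 0 + r pi)" by (simp add: add_divide_distrib diff_divide_distrib distrib_left)
  hence "b = B" using rel sum by auto
  thus "Cf (pz 0) d0 = undulary B 1" "\<bar>B\<bar> < 1" using ru eu(2) by (simp_all add: r_def)
qed

section \<open>Properties of the lifted branch\<close>

lemma holder4_chain3:
  assumes "0 < \<alpha>" "\<alpha> < 1" "f \<in> little_holder (4 + \<alpha>)"
  shows "chain3 f (nth_deriv 1 f) (nth_deriv 2 f) (nth_deriv 3 f)" "nth_deriv 3 f differentiable (at x)" "periodic_2pi f"
proof -
  note h = holder_spaceD[OF little_holder_imp[OF assms(3)], unfolded order_facts(3)[OF assms(1,2)]]
  show "periodic_2pi f" by (rule h(1))
  show "chain3 f (nth_deriv 1 f) (nth_deriv 2 f) (nth_deriv 3 f)"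
    using hdiff_DERIV[OF h(2), of 0] hdiff_DERIV[OF h(2), of 1] hdiff_DERIV[OF h(2), of 2]
    unfolding chain3_def by (simp add: eval_nat_numeral)
  show "nth_deriv 3 f differentiable (at x)" using h(2) unfolding hdiff_def by simp
qed

lemma mean_free_const_diff:
  fixes f g :: "real \<Rightarrow> real"
  assumes "integral {-pi..pi} f = 0" "integral {-pi..pi} g = 0" "\<And>x. f x = g x + c"
    and "continuous_on UNIV g"
  shows "f = g"
proof -
  have "integral {-pi..pi} (\<lambda>x. g x + c) = integral {-pi..pi} g + integral {-pi..pi} (\<lambda>x. c)"
    by (intro integral_add integrable_continuous_real continuous_on_const continuous_on_subset[OF assms(4)] subset_UNIV)
  moreover have "f = (\<lambda>x. g x + c)" using assms(3) by blast
  ultimately have "c * (2 * pi) = 0" using assms(1,2) by (simp add: mult.commute)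
  thus ?thesis using assms(3) by auto
qed

lemma little_holder_0_evenD:
  assumes \<alpha>: "0 < \<alpha>" "\<alpha> < 1" and \<rho>: "\<rho> \<in> little_holder_0_even (4 + \<alpha>)"
  shows "\<rho> \<in> little_holder (4 + \<alpha>)" "\<rho> (- x) = \<rho> x" "integral {-pi..pi} \<rho> = 0" "continuous_on UNIV \<rho>"
proof -
  note n = order_facts(4,5)[OF \<alpha>]
  obtain g where g: "g \<in> little_holder (4 + \<alpha>)" and eq: "\<rho> = mean_free g"
    using \<rho> unfolding little_holder_0_even_def little_holder_0_def by auto
  show "\<rho> \<in> little_holder (4 + \<alpha>)"
    unfolding eq mean_free_def by (rule little_holder_diff(1)[OF g const_little_holder(1)[OF n(2,1)]])
  thus "continuous_on UNIV \<rho>" using holder_spaceD(3)[OF little_holder_imp, of \<rho> "4 + \<alpha>" 0] by simp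
  have gc: "continuous_on {-pi..pi} g" using holder_spaceD(3)[OF little_holder_imp[OF g], of 0] continuous_on_subset by auto
  have "integral {-pi..pi} \<rho> = integral {-pi..pi} g - integral {-pi..pi} (\<lambda>x. integral {-pi..pi} g / (2 * pi))"
    unfolding eq mean_free_def by (intro integral_diff integrable_continuous_real gc continuous_intros)
  thus "integral {-pi..pi} \<rho> = 0" by simp
  show "\<rho> (- x) = \<rho> x" using \<rho> unfolding little_holder_0_even_def by auto
qed

text \<open>Write R = \<rho> + m with \<rho> of mean zero. The constraint on the integral of R^2
  reads 1 / \<open>lam\<close>^2 = m^2 + mean of \<rho>^2, and positivity of R selects the positive
  root m.\<close>

theorem lifted_profile_formula:
  assumes \<alpha>: "0 < \<alpha>" "\<alpha> < 1" and sol: "reduced_solution \<alpha> \<rho> lam"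
  defines "R \<equiv> lifted_profile \<alpha> lam \<rho>"
  shows "1 / lam^2 - integral {-pi..pi} (\<lambda>x. (\<rho> x)\<^sup>2) / (2 * pi) > 0"
    and "R = (\<lambda>x. \<rho> x + sqrt (1 / lam^2 - integral {-pi..pi} (\<lambda>x. (\<rho> x)\<^sup>2) / (2 * pi)))"
    and "R x > 0" "integral {-pi..pi} (\<lambda>x. (R x)\<^sup>2) = 2 * pi / lam^2"
    and "R \<in> little_holder (4 + \<alpha>)" "R (- x) = R x" "asd_G R x = 0"
proof -
  note n = order_facts(4,5)[OF \<alpha>]
  have \<rho>: "\<rho> \<in> little_holder_0_even (4 + \<alpha>)" and "\<rho> \<in> lift_domain \<alpha> lam" and lam: "lam > 0"
    and G: "mean_free (asd_G R) = (\<lambda>x. 0)" using sol unfolding reduced_solution_def reduced_G_def R_def by auto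
  note e = little_holder_0_evenD[OF \<alpha> \<rho>]
  define v where "v = lift \<alpha> lam \<rho>"
  have lift: "is_lift \<alpha> lam \<rho> v" unfolding v_def by (rule is_lift_lift[OF \<alpha>]) fact
  define m where "m = integral {-pi..pi} v / (2 * pi) + 1 / lam"
  have Rm: "R = (\<lambda>x. \<rho> x + m)"
    using lift unfolding R_def lifted_profile_def v_def[symmetric] m_def is_lift_def mean_free_def by auto
  have Rpos: "R x > 0" for x
    using lift unfolding R_def lifted_profile_def v_def[symmetric] is_lift_def by (metis add.commute diff_gt_0_iff_gt diff_minus_eq_add)
  show "R x > 0" by (rule Rpos)
  have \<rho>c: "continuous_on {-pi..pi} \<rho>" by (rule continuous_on_subset[OF e(4)]) simp
  have R2: "integral {-pi..pi} (\<lambda>x. (R x)\<^sup>2) = 2 * pi / lam^2"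
    using lift lam unfolding R_def lifted_profile_def v_def[symmetric] is_lift_def F_star_def by (simp add: power_divide)
  thus "integral {-pi..pi} (\<lambda>x. (R x)\<^sup>2) = 2 * pi / lam^2" .
  have "integral {-pi..pi} (\<lambda>x. (\<rho> x)\<^sup>2 + (2 * m * \<rho> x + m^2))
    = integral {-pi..pi} (\<lambda>x. (\<rho> x)\<^sup>2) + integral {-pi..pi} (\<lambda>x. 2 * m * \<rho> x + m^2)"
    by (intro integral_add integrable_continuous_real continuous_intros \<rho>c)
  also have "integral {-pi..pi} (\<lambda>x. 2 * m * \<rho> x + m^2) = integral {-pi..pi} (\<lambda>x. 2 * m * \<rho> x) + integral {-pi..pi} (\<lambda>x. m\<^sup>2)"
    by (intro integral_add integrable_continuous_real continuous_intros \<rho>c)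
  also have "integral {-pi..pi} (\<lambda>x. 2 * m * \<rho> x) = 2 * m * integral {-pi..pi} \<rho>" by (rule integral_mult_right)
  also have "(\<lambda>x. (\<rho> x)\<^sup>2 + (2 * m * \<rho> x + m^2)) = (\<lambda>x. (R x)\<^sup>2)" by (rule ext) (simp add: Rm power2_eq_square algebra_simps)
  finally have "2 * pi / lam^2 = integral {-pi..pi} (\<lambda>x. (\<rho> x)\<^sup>2) + 2 * pi * m^2" unfolding R2 e(3) by simp
  hence "(2 * pi / lam^2) / (2 * pi) = (integral {-pi..pi} (\<lambda>x. (\<rho> x)\<^sup>2) + 2 * pi * m^2) / (2 * pi)" by simp
  hence m2: "1 / lam^2 - integral {-pi..pi} (\<lambda>x. (\<rho> x)\<^sup>2) / (2 * pi) = m^2" by (simp add: add_divide_distrib)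
  have "integral {-pi..pi} (\<lambda>x. 0) < integral {-pi..pi} R"
    unfolding Rm by (rule integral_less_real) (use Rpos Rm pi_gt_zero in \<open>auto simp del: pi_gt_zero simp: not_le intro!: continuous_intros \<rho>c\<close>)
  moreover have "integral {-pi..pi} R = integral {-pi..pi} \<rho> + integral {-pi..pi} (\<lambda>x. m)"
    unfolding Rm by (intro integral_add integrable_continuous_real continuous_intros \<rho>c)
  ultimately have "0 < 2 * pi * m" using e(3) by simp
  hence m0: "m > 0" by (simp add: zero_less_mult_iff)
  thus "1 / lam^2 - integral {-pi..pi} (\<lambda>x. (\<rho> x)\<^sup>2) / (2 * pi) > 0" unfolding m2 by simp
  show "R = (\<lambda>x. \<rho> x + sqrt (1 / lam^2 - integral {-pi..pi} (\<lambda>x. (\<rho> x)\<^sup>2) / (2 * pi)))" unfolding m2 using m0 Rm by simp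
  show RH: "R \<in> little_holder (4 + \<alpha>)" unfolding Rm by (rule little_holder_add(1)[OF e(1) const_little_holder(1)[OF n(2,1)]])
  show "R (- x) = R x" unfolding Rm by (simp add: e(2))
  note ch = holder4_chain3[OF \<alpha> RH]
  have K: "asd_G R x = integral {-pi..pi} (asd_G R) / (2 * pi)" for x using fun_cong[OF G, of x] unfolding mean_free_def by simp
  have "integral {-pi..pi} (asd_G R) / (2 * pi) = 0" by (rule asd_G_const_zero[OF ch(1) Rpos ch(2) ch(3) K])
  thus "asd_G R x = 0" using K by simp
qed

lemma equilibrium_even_undulary:
  assumes \<alpha>: "0 < \<alpha>" "\<alpha> < 1" and R: "R \<in> little_holder (4 + \<alpha>)" and pos: "\<And>x. R x > 0"
    and even: "\<And>x. R (- x) = R x" and eq: "\<And>x. asd_G R x = 0"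
    and H: "H = 1 / R 0 - nth_deriv 2 R 0" and B: "B = H * R 0 - 1"
  shows "H > 0" "\<bar>B\<bar> < 1" "R = undulary_fun H B" "B \<noteq> 0 \<Longrightarrow> \<exists>k::nat. k \<ge> 1 \<and> H = real k * undulary_H B 1"
  using equilibrium_undulary[OF holder4_chain3(1)[OF \<alpha> R] pos holder4_chain3(2)[OF \<alpha> R] holder4_chain3(3)[OF \<alpha> R] even eq H B]
  by blast+

lemma lh_analytic_on_cong:
  "lh_analytic_on \<sigma> J c \<Longrightarrow> (\<And>s. s \<in> J \<Longrightarrow> c' s = c s) \<Longrightarrow> lh_analytic_on \<sigma> J c'" unfolding lh_analytic_on_def by simp

context
  fixes \<alpha> :: real and l :: nat and \<delta> :: real and \<rho> :: "real \<Rightarrow> real \<Rightarrow> real" and lam :: "real \<Rightarrow> real"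
  assumes \<alpha>: "0 < \<alpha>" "\<alpha> < 1" and l: "l \<ge> 1" and branch: "bifurcation_branch \<alpha> l \<delta> \<rho> lam"
begin

definition Rs where "Rs s = lifted_profile \<alpha> (lam s) (\<rho> s)"
definition ms where "ms s = sqrt (1 / (lam s)^2 - integral {-pi..pi} (\<lambda>x. (\<rho> s x)\<^sup>2) / (2 * pi))"
text \<open>The mean curvature of the profile, read off at its critical point 0. \<open>Bs\<close>
  is the undulary parameter that goes with it.\<close>

definition Hs where "Hs s = 1 / Rs s 0 - nth_deriv 2 (Rs s) 0"
definition Bs where "Bs s = Hs s * Rs s 0 - 1"

lemmas four_\<alpha> = order_facts(5,4,3)[OF \<alpha>]

lemma branch_facts:
  "\<delta> > 0" "lh_analytic_on (4 + \<alpha>) {-\<delta><..<\<delta>} \<rho>" "real_analytic_on {-\<delta><..<\<delta>} lam"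
  "s \<in> {-\<delta><..<\<delta>} \<Longrightarrow> reduced_solution \<alpha> (\<rho> s) (lam s)"
  "\<rho> 0 = (\<lambda>x. 0)" "lam 0 = real l" "s \<in> {-\<delta><..<\<delta>} \<Longrightarrow> s \<noteq> 0 \<Longrightarrow> \<rho> s \<noteq> (\<lambda>x. 0)"
  "((\<lambda>s. holder_norm (4 + \<alpha>) (\<lambda>x. \<rho> s x / s - cos (real l * x))) \<longlongrightarrow> 0) (at 0)"
  using branch unfolding bifurcation_branch_def by blast+

lemma open_J: "open {-\<delta><..<\<delta>}" and zero_J: "0 \<in> {-\<delta><..<\<delta>}" using branch_facts(1) by auto

lemma \<rho>_facts:
  assumes "s \<in> {-\<delta><..<\<delta>}"
  shows "\<rho> s \<in> little_holder (4 + \<alpha>)" "integral {-pi..pi} (\<rho> s) = 0" "continuous_on UNIV (\<rho> s)" "lam s > 0"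
  using little_holder_0_evenD[OF \<alpha>, of "\<rho> s"] branch_facts(4)[OF assms] unfolding reduced_solution_def by blast+

lemma Rs_facts:
  assumes s: "s \<in> {-\<delta><..<\<delta>}"
  shows "1 / (lam s)^2 - integral {-pi..pi} (\<lambda>x. (\<rho> s x)\<^sup>2) / (2 * pi) > 0"
    "Rs s = (\<lambda>x. \<rho> s x + ms s)" "Rs s x > 0" "integral {-pi..pi} (\<lambda>x. (Rs s x)\<^sup>2) = 2 * pi / (lam s)^2"
    "Rs s \<in> little_holder (4 + \<alpha>)" "Rs s (- x) = Rs s x" "asd_G (Rs s) x = 0"
  unfolding Rs_def ms_def by (rule lifted_profile_formula[OF \<alpha> branch_facts(4)[OF s]])+

lemma ms_analytic: "real_analytic_on {-\<delta><..<\<delta>} ms" unfolding ms_def[abs_def]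
  by (rule real_analytic_lift_mean[OF lh_analytic_square_integral[OF four_\<alpha>(1,2) branch_facts(2) open_J] branch_facts(3) open_J \<rho>_facts(4) Rs_facts(1)])

lemma Rs_analytic: "lh_analytic_on (4 + \<alpha>) {-\<delta><..<\<delta>} Rs"
  by (rule lh_analytic_on_cong[OF lh_analytic_add_const[OF four_\<alpha>(1,2) branch_facts(2) ms_analytic]]) (rule Rs_facts(2))

lemma Rs_nonconstant:
  assumes s: "s \<in> {-\<delta><..<\<delta>}" "s \<noteq> 0"
  shows "Rs s \<noteq> (\<lambda>x. c)"
proof
  assume "Rs s = (\<lambda>x. c)"
  hence "\<rho> s x = 0 + (c - ms s)" for x using fun_cong[OF Rs_facts(2)[OF s(1)], of x] by simp
  hence "\<rho> s = (\<lambda>x. 0)" by (intro mean_free_const_diff[where g = "\<lambda>x. 0", OF \<rho>_facts(2)[OF s(1)]]) auto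
  thus False using branch_facts(7)[OF s] by simp
qed

lemma Rs_0: "Rs 0 = (\<lambda>x. 1 / real l)" unfolding Rs_facts(2)[OF zero_J] ms_def branch_facts(5,6) by (simp add: real_sqrt_divide)

lemma eq_facts:
  assumes s: "s \<in> {-\<delta><..<\<delta>}"
  shows "Hs s > 0" "\<bar>Bs s\<bar> < 1" "Rs s = undulary_fun (Hs s) (Bs s)" "Bs s \<noteq> 0 \<Longrightarrow> \<exists>k::nat. k \<ge> 1 \<and> Hs s = real k * undulary_H (Bs s) 1"
  using equilibrium_even_undulary[OF \<alpha> Rs_facts(5)[OF s] Rs_facts(3)[OF s] Rs_facts(6)[OF s] Rs_facts(7)[OF s] Hs_def Bs_def]
  by blast+

lemma Hs_continuous: "continuous_on {-\<delta><..<\<delta>} Hs"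
proof -
  have "continuous_on {-\<delta><..<\<delta>} (\<lambda>s. nth_deriv j (Rs s) x)" if "j \<le> 4" for j x
    by (rule real_analytic_continuous[OF lh_analytic_eval[OF four_\<alpha>(1,2) Rs_analytic open_J] open_J]) (use that four_\<alpha>(3) in simp)
  from this[of 0] this[of 2] have "continuous_on {-\<delta><..<\<delta>} (\<lambda>s. 1 / Rs s 0 - nth_deriv 2 (Rs s) 0)"
    by (intro continuous_intros) (auto dest: Rs_facts(3)[of _ 0])
  thus ?thesis unfolding Hs_def[abs_def] .
qed

lemma Rs_eval_continuous: "continuous_on {-\<delta><..<\<delta>} (\<lambda>s. Rs s x)"
  using real_analytic_continuous[OF lh_analytic_eval[OF four_\<alpha>(1,2) Rs_analytic open_J, of 0 x] open_J] by simp

lemma Bs_continuous: "continuous_on {-\<delta><..<\<delta>} Bs"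
  unfolding Bs_def[abs_def] by (intro continuous_intros Hs_continuous Rs_eval_continuous)

lemma Bs_0: "Bs 0 = 0" "Hs 0 = real l" using l unfolding Bs_def Hs_def Rs_0 nth_deriv_const by simp_all

lemma Bs_nonzero:
  assumes s: "s \<in> {-\<delta><..<\<delta>}" "s \<noteq> 0"
  shows "Bs s \<noteq> 0"
proof
  assume "Bs s = 0"
  hence "Rs s = (\<lambda>x. 1 / Hs s)" using eq_facts(3)[OF s(1)] undulary_fun_0[OF eq_facts(1)[OF s(1)]] by auto
  thus False using Rs_nonconstant[OF s] by blast
qed

text \<open>The number of periods of \<open>Rs s\<close> is an integer depending continuously on \<open>s\<close>.\<close>

lemma Hs_undulary_H:
  assumes s: "s \<in> {-\<delta><..<\<delta>}"
  shows "Hs s = undulary_H (Bs s) l"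
proof -
  define \<kappa> where "\<kappa> s = Hs s / undulary_H (Bs s) 1" for s
  have pos: "undulary_H (Bs s) 1 > 0" if "s \<in> {-\<delta><..<\<delta>}" for s by (rule undulary_H_pos[OF eq_facts(2)[OF that]]) simp
  have "continuous_on {-\<delta><..<\<delta>} (\<lambda>s. undulary_H (Bs s) 1)"
    by (rule continuous_on_compose2[OF undulary_H_continuous Bs_continuous]) (use eq_facts(2) in \<open>fastforce simp: abs_less_iff\<close>)
  hence c: "continuous_on {-\<delta><..<\<delta>} \<kappa>" unfolding \<kappa>_def[abs_def] by (intro continuous_intros Hs_continuous) (auto dest: pos)
  have int: "\<kappa> s \<in> \<int>" if sJ: "s \<in> {-\<delta><..<\<delta>}" for s
  proof (cases "s = 0")
    case True
    thus ?thesis unfolding \<kappa>_def using Bs_0 undulary_H_0 by simp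
  next
    case False
    then obtain k :: nat where "Hs s = real k * undulary_H (Bs s) 1" using eq_facts(4)[OF sJ Bs_nonzero[OF sJ False]] by blast
    thus ?thesis unfolding \<kappa>_def using pos[OF that] by simp
  qed
  have "\<kappa> constant_on {-\<delta><..<\<delta>}"
  proof (rule continuous_discrete_range_constant[OF _ c])
    show "connected {-\<delta><..<\<delta>}" by simp
    fix x assume x: "x \<in> {-\<delta><..<\<delta>}"
    show "\<exists>e>0. \<forall>y. y \<in> {-\<delta><..<\<delta>} \<and> \<kappa> y \<noteq> \<kappa> x \<longrightarrow> e \<le> norm (\<kappa> y - \<kappa> x)"
    proof (intro exI[of _ 1] conjI allI impI)
      fix y assume y: "y \<in> {-\<delta><..<\<delta>} \<and> \<kappa> y \<noteq> \<kappa> x"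
      hence "\<kappa> y - \<kappa> x \<in> \<int>" "\<kappa> y - \<kappa> x \<noteq> 0" using int x by auto
      thus "1 \<le> norm (\<kappa> y - \<kappa> x)" using Ints_nonzero_abs_ge1[of "\<kappa> y - \<kappa> x"] by simp
    qed simp
  qed
  hence "\<kappa> s = \<kappa> 0" using s zero_J unfolding constant_on_def by metis
  also have "\<kappa> 0 = real l" unfolding \<kappa>_def using Bs_0 undulary_H_0 by simp
  finally show ?thesis using pos[OF s] unfolding \<kappa>_def undulary_H_nat[of _ l] by (simp add: field_simps)
qed

lemma Rs_undulary: "s \<in> {-\<delta><..<\<delta>} \<Longrightarrow> Rs s = undulary (Bs s) l" unfolding undulary_def using eq_facts(3) Hs_undulary_H by metis

text \<open>Equal parameters give equal profiles and hence equal mean-free parts. The component of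
  \<rho> along \<open>cos (l x)\<close> with respect to the complement Z is the curve parameter
  itself.\<close>

lemma Bs_injective: "inj_on Bs {-\<delta><..<\<delta>}"
proof (rule inj_onI)
  fix s t assume st: "s \<in> {-\<delta><..<\<delta>}" "t \<in> {-\<delta><..<\<delta>}" "Bs s = Bs t"
  hence "Rs s = Rs t" using Rs_undulary by metis
  hence "\<rho> s x = \<rho> t x + (ms t - ms s)" for x
    using fun_cong[OF Rs_facts(2)[OF st(1)], of x] fun_cong[OF Rs_facts(2)[OF st(2)], of x] by simp
  hence eq: "\<rho> s = \<rho> t" by (rule mean_free_const_diff[OF \<rho>_facts(2)[OF st(1)] \<rho>_facts(2)[OF st(2)] _ \<rho>_facts(3)[OF st(2)]])
  obtain Z where Z: "cos_complement (4 + \<alpha>) l Z" and in_Z: "\<forall>s\<in>{-\<delta><..<\<delta>}. (\<lambda>x. \<rho> s x - s * cos (real l * x)) \<in> Z"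
    using branch unfolding bifurcation_branch_def by blast
  have "\<rho> s \<in> little_holder_0_even (4 + \<alpha>)" using branch_facts(4)[OF st(1)] unfolding reduced_solution_def by blast
  hence "\<exists>!c. (\<lambda>x. \<rho> s x - c * cos (real l * x)) \<in> Z" using Z unfolding cos_complement_def by blast
  moreover have "(\<lambda>x. \<rho> s x - s * cos (real l * x)) \<in> Z" "(\<lambda>x. \<rho> s x - t * cos (real l * x)) \<in> Z"
    using bspec[OF in_Z st(1)] bspec[OF in_Z st(2)] unfolding eq by simp_all
  ultimately show "s = t" by blast
qed

text \<open>Invariance of domain on the line. The branch therefore covers a whole open range of
  undulary parameters.\<close>

lemma Bs_image_open: "open (Bs ` {-\<delta><..<\<delta>})" by (rule invariance_of_domain[OF Bs_continuous open_J Bs_injective])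

text \<open>The functional q f = (f 0 - f (\<pi>/l)) / (f 0 + f (\<pi>/l)) is continuous and
  recovers B from an undulary curve. Taking for N the preimage of the open set of parameters on the
  branch gives equality of the two sets for the given \<delta>, without shrinking it.\<close>

theorem branch_undulary_neighbourhood:
  "\<exists>N. lh_open (4 + \<alpha>) N \<and> (\<lambda>x. 1 / real l) \<in> N \<and>
     {Rs s | s. s \<in> {-\<delta><..<\<delta>}} = {undulary B l | B. B \<in> {-1<..<1}} \<inter> N"
proof -
  define y where "y = pi / real l"
  define q where "q f = (f 0 - f y) / (f 0 + f y)" for f :: "real \<Rightarrow> real"
  define N where "N = {f \<in> little_holder (4 + \<alpha>). f 0 + f y > 0 \<and> q f \<in> Bs ` {-\<delta><..<\<delta>}}"
  have sum: "undulary B l 0 + undulary B l y > 0" "q (undulary B l) = B" if "\<bar>B\<bar> < 1" for B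
  proof -
    have H: "undulary_H B l > 0" by (rule undulary_H_pos[OF that l])
    have *: "undulary B l 0 + undulary B l y = 2 / undulary_H B l" "undulary B l 0 - undulary B l y = 2 * B / undulary_H B l"
      unfolding y_def undulary_at[OF that l] by (simp_all add: add_divide_distrib diff_divide_distrib)
    show "undulary B l 0 + undulary B l y > 0" unfolding * using H by simp
    show "q (undulary B l) = B" unfolding q_def * using H by simp
  qed
  have in_N: "Rs s \<in> N" if "s \<in> {-\<delta><..<\<delta>}" for s
    using sum[OF eq_facts(2)[OF that]] Rs_facts(5)[OF that] that unfolding N_def Rs_undulary[OF that, symmetric] by auto
  have "lh_open (4 + \<alpha>) N" unfolding lh_open_def
  proof (intro conjI ballI)
    show "N \<subseteq> little_holder (4 + \<alpha>)" unfolding N_def by blast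
    fix f assume f: "f \<in> N"
    define S where "S = {p :: real \<times> real. fst p + snd p > 0}"
    have oS: "open S" unfolding S_def by (intro open_Collect_less continuous_intros)
    have "continuous_on S (\<lambda>p. (fst p - snd p) / (fst p + snd p))" by (intro continuous_intros) (auto simp: S_def)
    hence "open (S \<inter> (\<lambda>p. (fst p - snd p) / (fst p + snd p)) -` (Bs ` {-\<delta><..<\<delta>}))"
      by (rule continuous_open_preimage[OF _ oS Bs_image_open])
    moreover have "(f 0, f y) \<in> S \<inter> (\<lambda>p. (fst p - snd p) / (fst p + snd p)) -` (Bs ` {-\<delta><..<\<delta>})"
      using f unfolding N_def S_def q_def by simp
    ultimately obtain e where e: "e > 0" and eb:
      "\<And>p. dist p (f 0, f y) < e \<Longrightarrow> p \<in> S \<inter> (\<lambda>p. (fst p - snd p) / (fst p + snd p)) -` (Bs ` {-\<delta><..<\<delta>})" unfolding open_dist by meson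
    show "\<exists>e>0. \<forall>g\<in>little_holder (4 + \<alpha>). holder_norm (4 + \<alpha>) (\<lambda>x. g x - f x) < e \<longrightarrow> g \<in> N"
    proof (intro exI[of _ "e / 2"] conjI ballI impI)
      fix g assume g: "g \<in> little_holder (4 + \<alpha>)" "holder_norm (4 + \<alpha>) (\<lambda>x. g x - f x) < e / 2"
      have fl: "f \<in> little_holder (4 + \<alpha>)" using f unfolding N_def by blast
      have "\<bar>g x - f x\<bar> < e / 2" for x using nth_deriv_diff_le_norm[OF g(1) fl, of 0 x] g(2) by simp
      hence "dist (g 0) (f 0) + dist (g y) (f y) < e" unfolding dist_real_def using field_sum_of_halves[of e] add_strict_mono by metis
      moreover have "dist (g 0, g y) (f 0, f y) \<le> dist (g 0) (f 0) + dist (g y) (f y)"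
        unfolding dist_Pair_Pair by (rule sqrt_sum_squares_le_sum) auto
      ultimately have "dist (g 0, g y) (f 0, f y) < e" by linarith
      from eb[OF this] show "g \<in> N" using g(1) unfolding N_def S_def q_def by simp
    qed (use e in simp)
  qed
  moreover have "(\<lambda>x. 1 / real l) \<in> N" using in_N[OF zero_J] unfolding Rs_0 .
  moreover have "{Rs s | s. s \<in> {-\<delta><..<\<delta>}} = {undulary B l | B. B \<in> {-1<..<1}} \<inter> N"
  proof (intro equalityI subsetI)
    fix f assume "f \<in> {Rs s | s. s \<in> {-\<delta><..<\<delta>}}"
    then obtain s where s: "s \<in> {-\<delta><..<\<delta>}" "f = Rs s" by blast
    have "Bs s \<in> {-1<..<1}" using eq_facts(2)[OF s(1)] by auto
    thus "f \<in> {undulary B l | B. B \<in> {-1<..<1}} \<inter> N" using in_N[OF s(1)] Rs_undulary[OF s(1)] s(2) by blast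
  next
    fix f assume "f \<in> {undulary B l | B. B \<in> {-1<..<1}} \<inter> N"
    then obtain B where B: "\<bar>B\<bar> < 1" "f = undulary B l" and N: "f \<in> N" by (auto simp: abs_less_iff)
    obtain s where s: "s \<in> {-\<delta><..<\<delta>}" "q f = Bs s" using N unfolding N_def by blast
    have "B = Bs s" using sum(2)[OF B(1)] s(2) B(2) by simp
    hence "f = Rs s" using Rs_undulary[OF s(1)] B(2) by simp
    thus "f \<in> {Rs s | s. s \<in> {-\<delta><..<\<delta>}}" using s(1) by blast
  qed
  ultimately show ?thesis by blast
qed

text \<open>The same quotient along the branch: the numerator is 2 s up to o(s) by the tangent
  direction \<open>cos (l x)\<close>, and the denominator tends to 2/l.\<close>

lemma Bs_tangent: "((\<lambda>s. Bs s / s) \<longlongrightarrow> real l) (at 0)"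
proof -
  define y where "y = pi / real l"
  obtain Z where Z: "cos_complement (4 + \<alpha>) l Z" and in_Z: "\<forall>s\<in>{-\<delta><..<\<delta>}. (\<lambda>x. \<rho> s x - s * cos (real l * x)) \<in> Z"
    using branch unfolding bifurcation_branch_def by blast
  have ev: "eventually (\<lambda>s. s \<in> {-\<delta><..<\<delta>} \<and> s \<noteq> 0) (at 0)" using eventually_at_in_open[OF open_J zero_J] by (simp add: conj_commute)
  have "eventually (\<lambda>s. norm (\<rho> s x / s - cos (real l * x)) \<le> holder_norm (4 + \<alpha>) (\<lambda>x. \<rho> s x / s - cos (real l * x))) (at 0)" for x
    using ev
  proof eventually_elim
    case (elim s)
    have "(\<lambda>x. \<rho> s x - s * cos (real l * x)) \<in> little_holder_0_even (4 + \<alpha>)" using in_Z elim Z unfolding cos_complement_def by blast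
    from little_holder_0_evenD(1)[OF \<alpha> this]
    have "(\<lambda>x. (1 / s) * (\<rho> s x - s * cos (real l * x)) + 0 * (\<rho> s x - s * cos (real l * x))) \<in> little_holder (4 + \<alpha>)"
      by (intro little_holder_lincomb)
    moreover have "(\<lambda>x. (1 / s) * (\<rho> s x - s * cos (real l * x)) + 0 * (\<rho> s x - s * cos (real l * x))) = (\<lambda>x. \<rho> s x / s - cos (real l * x))"
      using elim by (simp add: right_diff_distrib)
    ultimately show ?case using nth_deriv_le_norm[OF little_holder_imp, of _ "4 + \<alpha>" 0 x] by simp
  qed
  hence "((\<lambda>s. \<rho> s x / s - cos (real l * x)) \<longlongrightarrow> 0) (at 0)" for x by (rule Lim_null_comparison[OF _ branch_facts(8)])
  hence lim: "((\<lambda>s. \<rho> s x / s) \<longlongrightarrow> cos (real l * x)) (at 0)" for x by (simp add: LIM_zero_iff)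
  have cR: "((\<lambda>s. Rs s x) \<longlongrightarrow> Rs 0 x) (at 0)" for x
    using Rs_eval_continuous[of x] zero_J open_J by (simp add: continuous_on_eq_continuous_at isCont_def)
  have "((\<lambda>s. (\<rho> s 0 / s - \<rho> s y / s) / (Rs s 0 + Rs s y)) \<longlongrightarrow> (cos (real l * 0) - cos (real l * y)) / (Rs 0 0 + Rs 0 y)) (at 0)"
    by (intro tendsto_intros lim cR) (use l in \<open>simp add: Rs_0\<close>)
  moreover have "(cos (real l * 0) - cos (real l * y)) / (Rs 0 0 + Rs 0 y) = real l" using l by (simp add: Rs_0 y_def)
  moreover have evB: "eventually (\<lambda>s. (\<rho> s 0 / s - \<rho> s y / s) / (Rs s 0 + Rs s y) = Bs s / s) (at 0)" using ev
  proof eventually_elim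
    case (elim s)
    hence s: "s \<in> {-\<delta><..<\<delta>}" by blast
    have H: "undulary_H (Bs s) l > 0" by (rule undulary_H_pos[OF eq_facts(2)[OF s] l])
    have *: "Rs s 0 + Rs s y = 2 / undulary_H (Bs s) l" "Rs s 0 - Rs s y = 2 * Bs s / undulary_H (Bs s) l"
      unfolding y_def Rs_undulary[OF s] undulary_at[OF eq_facts(2)[OF s] l] by (simp_all add: add_divide_distrib diff_divide_distrib)
    have "\<rho> s 0 / s - \<rho> s y / s = (Rs s 0 - Rs s y) / s" using fun_cong[OF Rs_facts(2)[OF s]] by (simp add: diff_divide_distrib)
    thus ?case unfolding * using H by simp
  qed
  ultimately show ?thesis using tendsto_cong[OF evB] by simp
qed

text \<open>The volume constraint reads 1 / \<open>lam\<close>^2 = (1 + e^2 v) / l^2 with v between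
  1/8 and 5/8. These bounds squeeze (l - \<open>lam\<close>) / s^2 between positive multiples of w,
  which has a positive limit. The upper one gives the vanishing first derivative, the lower one the
  sign of the second, whose existence is due to analyticity.\<close>

theorem branch_subcritical: "deriv lam 0 = 0" "deriv (deriv lam) 0 < 0"
proof -
  obtain B0 where B0: "B0 > 0" "\<And>B. B \<noteq> 0 \<Longrightarrow> \<bar>B\<bar> < B0 \<Longrightarrow> \<exists>d0 d1 d2 d3 \<sigma>. special B d0 d1 d2 d3 \<sigma>" by (rule special_exists) (rule that)
  have "continuous (at 0) Bs" using Bs_continuous zero_J open_J by (simp add: continuous_on_eq_continuous_at)
  hence Bt: "(Bs \<longlongrightarrow> 0) (at 0)" using Bs_0 by (simp add: isCont_def)
  have lt: "(lam \<longlongrightarrow> real l) (at 0)" using real_analytic_continuous[OF branch_facts(3) open_J] zero_J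
    unfolding continuous_on_eq_continuous_at[OF open_J] isCont_def branch_facts(6)[symmetric] by blast
  define e where "e s = 2 * Bs s / (1 + (Bs s)^2)" for s
  define w where "w s = (lam s)^2 * (e s / s)^2 / (lam s + real l)" for s
  have ev: "eventually (\<lambda>s. s \<in> {-\<delta><..<\<delta>} \<and> s \<noteq> 0) (at 0)" using eventually_at_in_open[OF open_J zero_J] by (simp add: conj_commute)
  have "eventually (\<lambda>s. \<bar>Bs s\<bar> < B0) (at 0)" using order_tendstoD(2)[OF tendsto_rabs[OF Bt]] B0(1) by simp
  with ev have bds: "eventually (\<lambda>s. w s * (1 / 8) \<le> (real l - lam s) / s^2 \<and> (real l - lam s) / s^2 \<le> w s * (5 / 8)) (at 0)"
  proof eventually_elim
    case (elim s)
    hence s: "s \<in> {-\<delta><..<\<delta>}" "s \<noteq> 0" by blast+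
    obtain d0 d1 d2 d3 \<sigma> where sp: "special (Bs s) d0 d1 d2 d3 \<sigma>" using B0(2)[OF Bs_nonzero[OF s]] elim by blast
    note su = special_undulary(1)[OF sp Bs_nonzero[OF s]]
    obtain v where v: "1 / 8 \<le> v" "v \<le> 5 / 8" and
      vi: "\<forall>l::nat. l \<ge> 1 \<longrightarrow> integral {-pi..pi} (\<lambda>x. (Cf (pz 0) d0 (real l * x))\<^sup>2) = 2 * pi * (1 + (2 * Bs s / (1 + (Bs s)^2))^2 * v)"
      using sp unfolding special_def by blast
    have "(\<lambda>x. (Rs s x)\<^sup>2) = (\<lambda>x. (1 / (real l)^2) * (Cf (pz 0) d0 (real l * x))^2)"
      unfolding Rs_undulary[OF s(1)] undulary_scaling[OF eq_facts(2)[OF s(1)] l, abs_def] su by (simp add: power_divide)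
    hence "integral {-pi..pi} (\<lambda>x. (Rs s x)\<^sup>2) = (1 / (real l)^2) * integral {-pi..pi} (\<lambda>x. (Cf (pz 0) d0 (real l * x))\<^sup>2)"
      by (simp only: integral_mult_right)
    hence "2 * pi / (lam s)^2 = (1 / (real l)^2) * (2 * pi * (1 + (e s)^2 * v))"
      using vi l unfolding Rs_facts(4)[OF s(1)] e_def by simp
    hence "(2 * pi) * (1 / (lam s)^2) = (2 * pi) * ((1 / (real l)^2) * (1 + (e s)^2 * v))" by simp
    hence "1 / (lam s)^2 = (1 / (real l)^2) * (1 + (e s)^2 * v)" by (rule mult_left_cancel[THEN iffD1, rotated]) simp
    hence "(real l)^2 = (lam s)^2 * (1 + (e s)^2 * v)" using l \<rho>_facts(4)[OF s(1)] by (simp add: divide_eq_eq eq_divide_eq mult_ac)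
    hence "(real l - lam s) * (lam s + real l) = (lam s)^2 * (e s)^2 * v" by (simp add: power2_eq_square algebra_simps)
    hence "real l - lam s = (lam s)^2 * (e s)^2 * v / (lam s + real l)" using \<rho>_facts(4)[OF s(1)] by (simp add: eq_divide_eq)
    hence eq: "(real l - lam s) / s^2 = w s * v" unfolding w_def by (simp add: power_divide)
    have "w s \<ge> 0" unfolding w_def using \<rho>_facts(4)[OF s(1)] by simp
    thus ?case unfolding eq using v by (intro conjI mult_left_mono)
  qed
  have "((\<lambda>s. 2 * (Bs s / s) / (1 + (Bs s)^2)) \<longlongrightarrow> 2 * real l / (1 + 0^2)) (at 0)" by (intro tendsto_intros Bt Bs_tangent) simp
  hence "((\<lambda>s. e s / s) \<longlongrightarrow> 2 * real l) (at 0)" unfolding e_def by (simp add: mult.commute)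
  hence "(w \<longlongrightarrow> (real l)\<^sup>2 * (2 * real l)^2 / (real l + real l)) (at 0)"
    unfolding w_def[abs_def] by (intro tendsto_intros lt) (use l in auto)
  moreover define W where "W = (real l)^2 * (2 * real l)^2 / (real l + real l)"
  ultimately have wt: "(w \<longlongrightarrow> W) (at 0)" by simp
  have W: "W > 0" unfolding W_def using l by simp
  obtain g where g: "(g \<longlongrightarrow> deriv (deriv lam) 0 / 2) (at 0)"
    and lg: "eventually (\<lambda>s. lam s = lam 0 + deriv lam 0 * s + s^2 * g s) (at 0)"
    by (rule real_analytic_second_order[OF branch_facts(3) open_J zero_J]) (rule that)
  have b1: "((\<lambda>s. \<bar>s\<bar> * (w s * (5 / 8))) \<longlongrightarrow> \<bar>0\<bar> * (W * (5 / 8))) (at 0)" by (intro tendsto_intros wt)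
  have "((\<lambda>s. (real l - lam s) / s) \<longlongrightarrow> 0) (at 0)"
  proof (rule Lim_null_comparison)
    show "((\<lambda>s. \<bar>s\<bar> * (w s * (5 / 8))) \<longlongrightarrow> 0) (at 0)" using b1 by simp
    have "eventually (\<lambda>s. w s > 0) (at 0)" using order_tendstoD(1)[OF wt W] .
    with bds ev show "eventually (\<lambda>s. norm ((real l - lam s) / s) \<le> \<bar>s\<bar> * (w s * (5 / 8))) (at 0)"
    proof eventually_elim
      case (elim s)
      have "(real l - lam s) / s = s * ((real l - lam s) / s^2)" using elim by (simp add: power2_eq_square)
      hence "norm ((real l - lam s) / s) = \<bar>s\<bar> * \<bar>(real l - lam s) / s^2\<bar>" by (simp only: real_norm_def abs_mult)
      also have "\<dots> \<le> \<bar>s\<bar> * (w s * (5 / 8))"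
      proof (rule mult_left_mono)
        show "\<bar>(real l - lam s) / s^2\<bar> \<le> w s * (5 / 8)" using elim by linarith
      qed simp
      finally show ?case .
    qed
  qed
  moreover have "((\<lambda>s. - deriv lam 0 - s * g s) \<longlongrightarrow> - deriv lam 0 - 0 * (deriv (deriv lam) 0 / 2)) (at 0)" by (intro tendsto_intros g)
  moreover have evl: "eventually (\<lambda>s. (real l - lam s) / s = - deriv lam 0 - s * g s) (at 0)"
    using lg ev by eventually_elim (simp add: branch_facts(6) power2_eq_square field_simps)
  ultimately have "- deriv lam 0 - 0 * (deriv (deriv lam) 0 / 2) = 0" using tendsto_cong[OF evl] LIM_unique by blast
  thus d0: "deriv lam 0 = 0" by simp
  have "eventually (\<lambda>s. w s * (1 / 8) \<le> - g s) (at 0)" using lg bds ev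
  proof eventually_elim
    case (elim s)
    have "(real l - lam s) / s^2 = - g s" using elim d0 by (simp add: branch_facts(6))
    thus ?case using elim by simp
  qed
  hence "W * (1 / 8) \<le> - (deriv (deriv lam) 0 / 2)" by (intro tendsto_le[OF _ tendsto_minus[OF g] tendsto_mult_right[OF wt]]) auto
  thus "deriv (deriv lam) 0 < 0" using W by simp
qed

lemma branch_equilibria:
  "lh_analytic_on (4 + \<alpha>) {-\<delta><..<\<delta>} Rs \<and> (\<forall>s\<in>{-\<delta><..<\<delta>}. asd_equilibrium \<alpha> (Rs s)) \<and>
   Rs 0 = (\<lambda>x. 1 / real l) \<and> (\<forall>s\<in>{-\<delta><..<\<delta>}. s \<noteq> 0 \<longrightarrow> \<not> (\<exists>c. Rs s = (\<lambda>x. c))) \<and>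
   deriv lam 0 = 0 \<and> deriv (deriv lam) 0 < 0"
  unfolding asd_equilibrium_def using Rs_analytic Rs_facts(3,5,7) Rs_0 Rs_nonconstant branch_subcritical by blast

text \<open>Every parameter on the branch satisfies |B| < 1, so the radius 1 serves. Closeness to
  the cylinder is the content of \<open>branch_undulary_neighbourhood\<close>.\<close>

lemma branch_undulary: "\<exists>\<epsilon>>0. \<epsilon> \<le> 1 \<and> (\<forall>s\<in>{-\<delta><..<\<delta>}. \<exists>B\<in>{-\<epsilon><..<\<epsilon>}. Rs s = undulary B l)"
proof (intro exI[of _ 1] conjI ballI)
  fix s assume s: "s \<in> {-\<delta><..<\<delta>}"
  have "Bs s \<in> {-1<..<1}" using eq_facts(2)[OF s] by auto
  thus "\<exists>B\<in>{-1<..<1}. Rs s = undulary B l" using Rs_undulary[OF s] by blast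
qed auto

lemmas branch_summary = branch_equilibria[unfolded Rs_def[abs_def]] branch_undulary[unfolded Rs_def[abs_def]]
  branch_undulary_neighbourhood[unfolded Rs_def[abs_def]]

end

section \<open>Uniqueness of solutions\<close>

text \<open>The flux is affine in the third derivative c of Q = r^2, namely
  \<open>fJ - aJ c\<close>, with a positive leading coefficient. \<open>aJ1\<close> is the
  derivative of \<open>aJ\<close> in x when a and b are the first two derivatives of Q.\<close>

definition aJ :: "real \<Rightarrow> real \<Rightarrow> real" where "aJ Q a = 8 * Q^2 / (4 * Q + a^2) ^ 2"
definition fJ :: "real \<Rightarrow> real \<Rightarrow> real \<Rightarrow> real" where
  "fJ Q a b = - 2 * a / (4 * Q + a^2) + 4 * a * (2 * Q * b - a^2) / (4 * Q + a^2) ^ 2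
     + 6 * a * (2 * Q * b - a^2)^2 / (4 * Q + a^2) ^ 3"
definition aJ1 :: "real \<Rightarrow> real \<Rightarrow> real \<Rightarrow> real" where
  "aJ1 Q a b = 16 * Q * a / (4 * Q + a^2) ^ 2 - 16 * Q^2 * (4 * a + 2 * a * b) / (4 * Q + a^2) ^ 3"

lemma Jq_split: "Jq Q a b c = fJ Q a b - aJ Q a * c" unfolding Jq_def fJ_def aJ_def by simp

lemma aJ_deriv:
  assumes "(p has_real_derivative p1 x) (at x)" "(p1 has_real_derivative b) (at x)" "p x > 0"
  shows "((\<lambda>x. aJ (p x) (p1 x)) has_real_derivative aJ1 (p x) (p1 x) b) (at x)"
proof -
  have E: "4 * p x + (p1 x)^2 > 0" using assms(3) by (simp add: add_pos_nonneg)
  have "((\<lambda>x. aJ (p x) (p1 x)) has_real_derivative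
     (8 * (2 * p x * p1 x) * (4 * p x + (p1 x)^2) ^ 2 - 8 * (p x)^2 * (2 * (4 * p x + (p1 x)^2) * (4 * p1 x + 2 * p1 x * b))) /
       ((4 * p x + (p1 x)^2) ^ 2 * (4 * p x + (p1 x)^2) ^ 2)) (at x)"
  proof -
    define E where "E x = 4 * p x + (p1 x)^2" for x
    have dE: "(E has_real_derivative 4 * p1 x + 2 * p1 x * b) (at x)"
      unfolding E_def by (rule derivative_eq_intros assms(1,2) refl | simp)+
    have "((\<lambda>x. (E x) ^ 2) has_real_derivative 2 * E x * (4 * p1 x + 2 * p1 x * b)) (at x)"
      by (rule derivative_eq_intros dE refl | simp)+
    moreover have "((\<lambda>x. 8 * (p x)^2) has_real_derivative 8 * (2 * p x * p1 x)) (at x)"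
      by (rule derivative_eq_intros assms(1) refl | simp)+
    moreover have "(E x) ^ 2 \<noteq> 0" using E by (simp add: E_def)
    ultimately show ?thesis unfolding aJ_def E_def[symmetric]
      using DERIV_divide[of "\<lambda>x. 8 * (p x)^2" "8 * (2 * p x * p1 x)" x UNIV "\<lambda>x. (E x)\<^sup>2" "2 * E x * (4 * p1 x + 2 * p1 x * b)"]
      by blast
  qed
  also have "(8 * (2 * p x * p1 x) * (4 * p x + (p1 x)^2) ^ 2 - 8 * (p x)^2 * (2 * (4 * p x + (p1 x)^2) * (4 * p1 x + 2 * p1 x * b))) /
       ((4 * p x + (p1 x)^2) ^ 2 * (4 * p x + (p1 x)^2) ^ 2) = aJ1 (p x) (p1 x) b"
  proof -
    have "(8 * (2 * q * a) * E ^ 2 - 8 * q^2 * (2 * E * k)) / (E ^ 2 * E ^ 2) = 16 * q * a / E ^ 2 - 16 * q^2 * k / E ^ 3"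
      if "E > 0" for q a E k :: real using that by (simp add: diff_divide_distrib power2_eq_square power3_eq_cube)
    from this[OF E] show ?thesis unfolding aJ1_def .
  qed
  finally show ?thesis .
qed

text \<open>All coefficients are polynomials divided by powers of 4 Q + a^2 >= 4 m. The constant a0
  expresses uniform parabolicity on bounded profiles.\<close>

lemma coefficient_lipschitz:
  assumes m: "m > 0" and M: "M > 0"
  obtains L a0 where "L \<ge> 0" "a0 > 0"
    "\<And>Q a b Q' a' b'. \<lbrakk>m \<le> Q; Q \<le> M; \<bar>a\<bar> \<le> M; \<bar>b\<bar> \<le> M; m \<le> Q'; Q' \<le> M; \<bar>a'\<bar> \<le> M; \<bar>b'\<bar> \<le> M\<rbrakk> \<Longrightarrow>
      \<bar>fJ Q a b - fJ Q' a' b'\<bar> \<le> L * (\<bar>Q - Q'\<bar> + \<bar>a - a'\<bar> + \<bar>b - b'\<bar>) \<and>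
      \<bar>aJ Q a - aJ Q' a'\<bar> \<le> L * (\<bar>Q - Q'\<bar> + \<bar>a - a'\<bar> + \<bar>b - b'\<bar>) \<and> \<bar>aJ1 Q a b\<bar> \<le> L \<and> a0 \<le> aJ Q a"
proof -
  define S where "S = {(Q, a, b). m \<le> Q \<and> Q \<le> M \<and> \<bar>a\<bar> \<le> M \<and> \<bar>b\<bar> \<le> M}"
  define \<delta> :: "real \<times> real \<times> real \<Rightarrow> real \<times> real \<times> real \<Rightarrow> real"
    where "\<delta> x y = \<bar>fst x - fst y\<bar> + \<bar>fst (snd x) - fst (snd y)\<bar> + \<bar>snd (snd x) - snd (snd y)\<bar>" for x y
  define Qv av bv :: "real \<times> real \<times> real \<Rightarrow> real" where "Qv = fst" and "av x = fst (snd x)" and "bv x = snd (snd x)" for x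
  have nn: "\<delta> x y \<ge> 0" for x y by (simp add: \<delta>_def)
  have lQ: "lipb S \<delta> Qv" by (rule lipbI[where A = M and B = 1]) (use m in \<open>auto simp: S_def \<delta>_def Qv_def\<close>)
  have la: "lipb S \<delta> av" by (rule lipbI[where A = M and B = 1]) (auto simp: S_def \<delta>_def av_def)
  have lb: "lipb S \<delta> bv" by (rule lipbI[where A = M and B = 1]) (auto simp: S_def \<delta>_def bv_def)
  note I = lipb_const[OF nn] lipb_add[OF nn] lipb_mult[OF nn] lipb_diff[OF nn] lipb_power[OF nn]
  define E where "E x = 4 * Qv x + (av x)^2" for x
  have lE: "lipb S \<delta> E" unfolding E_def by (intro I lQ la)
  have Em: "E x \<ge> 4 * m" if "x \<in> S" for x
  proof -
    have "Qv x \<ge> m" using that by (auto simp: S_def Qv_def)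
    thus ?thesis unfolding E_def by (simp add: add_increasing2)
  qed
  have lI: "lipb S \<delta> (\<lambda>x. 1 / E x)" by (rule lipb_inverse[where c = "4 * m", OF nn lE]) (use m Em in simp_all)
  have "lipb S \<delta> (\<lambda>x. 8 * Qv x ^ 2 * (1 / E x) ^ 2)" by (intro I lQ lI)
  moreover have "8 * Qv x ^ 2 * (1 / E x) ^ 2 = aJ (Qv x) (av x)" for x
    unfolding aJ_def E_def[symmetric] by (simp add: power_divide)
  ultimately have A: "lipb S \<delta> (\<lambda>x. aJ (Qv x) (av x))" by simp
  have "lipb S \<delta> (\<lambda>x. (- 2) * av x * (1 / E x) + 4 * av x * (2 * Qv x * bv x - av x ^ 2) * (1 / E x) ^ 2
     + 6 * av x * (2 * Qv x * bv x - av x ^ 2) ^ 2 * (1 / E x) ^ 3)" by (intro I lQ la lb lI)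
  moreover have "(- 2) * av x * (1 / E x) + 4 * av x * (2 * Qv x * bv x - av x ^ 2) * (1 / E x) ^ 2
     + 6 * av x * (2 * Qv x * bv x - av x ^ 2) ^ 2 * (1 / E x) ^ 3 = fJ (Qv x) (av x) (bv x)" for x
    unfolding fJ_def E_def[symmetric] by (simp add: power_divide)
  ultimately have F: "lipb S \<delta> (\<lambda>x. fJ (Qv x) (av x) (bv x))" by simp
  have "lipb S \<delta> (\<lambda>x. 16 * Qv x * av x * (1 / E x) ^ 2 - 16 * Qv x ^ 2 * (4 * av x + 2 * av x * bv x) * (1 / E x) ^ 3)"
    by (intro I lQ la lb lI)
  moreover have "16 * Qv x * av x * (1 / E x) ^ 2 - 16 * Qv x ^ 2 * (4 * av x + 2 * av x * bv x) * (1 / E x) ^ 3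
    = aJ1 (Qv x) (av x) (bv x)" for x unfolding aJ1_def E_def[symmetric] by (simp add: power_divide)
  ultimately have A1: "lipb S \<delta> (\<lambda>x. aJ1 (Qv x) (av x) (bv x))" by simp
  obtain L1 where L1: "L1 \<ge> 0" "\<And>x y. x \<in> S \<Longrightarrow> y \<in> S \<Longrightarrow> \<bar>fJ (Qv x) (av x) (bv x) - fJ (Qv y) (av y) (bv y)\<bar> \<le> L1 * \<delta> x y"
    using F unfolding lipb_def by blast
  obtain L2 where L2: "L2 \<ge> 0" "\<And>x y. x \<in> S \<Longrightarrow> y \<in> S \<Longrightarrow> \<bar>aJ (Qv x) (av x) - aJ (Qv y) (av y)\<bar> \<le> L2 * \<delta> x y"
    using A unfolding lipb_def by blast
  obtain L3 where L3: "L3 \<ge> 0" "\<And>x. x \<in> S \<Longrightarrow> \<bar>aJ1 (Qv x) (av x) (bv x)\<bar> \<le> L3" using A1 unfolding lipb_def by blast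
  define a0 where "a0 = 8 * m^2 / (4 * M + M^2) ^ 2"
  have mono: "(L1 + L2 + L3) * \<delta> x y \<ge> L1 * \<delta> x y" "(L1 + L2 + L3) * \<delta> x y \<ge> L2 * \<delta> x y" for x y
    using L1(1) L2(1) L3(1) nn[of x y] by (auto intro!: mult_right_mono)
  show ?thesis
  proof (rule that[of "L1 + L2 + L3" a0])
    show "L1 + L2 + L3 \<ge> 0" using L1 L2 L3 by simp
    have "4 * M + M^2 > 0" using M by (simp add: add_pos_nonneg)
    thus "a0 > 0" using m unfolding a0_def by simp
    fix Q a b Q' a' b' :: real
    assume b1: "m \<le> Q" "Q \<le> M" "\<bar>a\<bar> \<le> M" "\<bar>b\<bar> \<le> M" and b2: "m \<le> Q'" "Q' \<le> M" "\<bar>a'\<bar> \<le> M" "\<bar>b'\<bar> \<le> M"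
    hence S: "(Q, a, b) \<in> S" "(Q', a', b') \<in> S" unfolding S_def by auto
    have "a^2 \<le> M^2" using b1 abs_le_square_iff[of a M] M by simp
    hence "4 * Q + a^2 \<le> 4 * M + M^2" "0 \<le> 4 * Q + a^2" using b1 m by simp_all
    hence "(4 * Q + a^2) ^ 2 \<le> (4 * M + M^2) ^ 2" by (rule power_mono)
    moreover have "m^2 \<le> Q^2" using b1 m by (intro power_mono) auto
    moreover have "0 < 4 * Q + a^2" using b1 m by (simp add: add_pos_nonneg)
    hence "0 < (4 * Q + a^2) ^ 2" by simp
    ultimately have "a0 \<le> aJ Q a" unfolding a0_def aJ_def by (intro frac_le) auto
    moreover have "\<bar>fJ Q a b - fJ Q' a' b'\<bar> \<le> (L1 + L2 + L3) * (\<bar>Q - Q'\<bar> + \<bar>a - a'\<bar> + \<bar>b - b'\<bar>)"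
      using L1(2)[OF S] mono(1)[of "(Q, a, b)" "(Q', a', b')"] by (simp add: \<delta>_def Qv_def av_def bv_def)
    moreover have "\<bar>aJ Q a - aJ Q' a'\<bar> \<le> (L1 + L2 + L3) * (\<bar>Q - Q'\<bar> + \<bar>a - a'\<bar> + \<bar>b - b'\<bar>)"
      using L2(2)[OF S] mono(2)[of "(Q, a, b)" "(Q', a', b')"] by (simp add: \<delta>_def Qv_def av_def bv_def)
    moreover have "\<bar>aJ1 Q a b\<bar> \<le> L1 + L2 + L3" using L3(2)[OF S(1)] L1(1) L2(1) by (simp add: Qv_def av_def bv_def)
    ultimately show "\<bar>fJ Q a b - fJ Q' a' b'\<bar> \<le> (L1 + L2 + L3) * (\<bar>Q - Q'\<bar> + \<bar>a - a'\<bar> + \<bar>b - b'\<bar>) \<and>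
      \<bar>aJ Q a - aJ Q' a'\<bar> \<le> (L1 + L2 + L3) * (\<bar>Q - Q'\<bar> + \<bar>a - a'\<bar> + \<bar>b - b'\<bar>) \<and> \<bar>aJ1 Q a b\<bar> \<le> L1 + L2 + L3 \<and> a0 \<le> aJ Q a" by blast
  qed
qed

text \<open>Young's inequality, with \<open>K\<close> chosen so that the interpolation term
  \<open>K (d1^2 + d d2)\<close>, a total derivative, dominates \<open>d1\<^sup>2\<close>.\<close>

lemma energy_young:
  fixes N a0 d d1 d2 e A A1 :: real
  assumes a0: "a0 > 0" and A: "a0 \<le> A" and N: "N \<ge> 0"
    and e: "\<bar>e\<bar> \<le> N * (\<bar>d\<bar> + \<bar>d1\<bar> + \<bar>d2\<bar>)" and A1: "\<bar>A1\<bar> \<le> N"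
  defines "K \<equiv> (2 * N)\<^sup>2 / a0 + 3 * N"
  shows "- 2 * d1 * e \<le> 2 * (A1 * d1 * d2 + A * d2^2) + K * (d1^2 + d * d2) + (N + K^2 / (4 * a0)) * d^2"
proof -
  have young: "2 * k * x * y \<le> a0 * y^2 + k^2 / a0 * x^2" for k x y :: real
  proof -
    have "0 \<le> (a0 * y - k * x)^2 / a0" using a0 by simp
    also have "\<dots> = a0 * y^2 + k^2 / a0 * x^2 - 2 * k * x * y" using a0 by (simp add: power2_eq_square field_simps)
    finally show ?thesis by simp
  qed
  have "- 2 * d1 * e \<le> 2 * (\<bar>d1\<bar> * \<bar>e\<bar>)" using abs_ge_minus_self[of "d1 * e"] by (simp add: abs_mult)
  also have "\<bar>d1\<bar> * \<bar>e\<bar> \<le> \<bar>d1\<bar> * (N * (\<bar>d\<bar> + \<bar>d1\<bar> + \<bar>d2\<bar>))" by (rule mult_left_mono[OF e]) simp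
  finally have 1: "- 2 * d1 * e \<le> 2 * N * \<bar>d1\<bar> * \<bar>d\<bar> + 2 * N * (\<bar>d1\<bar> * \<bar>d1\<bar>) + 2 * N * \<bar>d1\<bar> * \<bar>d2\<bar>" by (simp add: algebra_simps)
  have "- (A1 * d1 * d2) \<le> \<bar>A1\<bar> * (\<bar>d1\<bar> * \<bar>d2\<bar>)" using abs_ge_minus_self[of "A1 * d1 * d2"] by (simp add: abs_mult mult.assoc)
  also have "\<dots> \<le> N * (\<bar>d1\<bar> * \<bar>d2\<bar>)" by (rule mult_right_mono[OF A1]) simp
  finally have 2: "- (A1 * d1 * d2) \<le> N * (\<bar>d1\<bar> * \<bar>d2\<bar>)" .
  have 3: "2 * (2 * N) * \<bar>d1\<bar> * \<bar>d2\<bar> \<le> a0 * d2^2 + (2 * N)^2 / a0 * d1^2" using young[of "2 * N" "\<bar>d1\<bar>" "\<bar>d2\<bar>"] by simp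
  have "2 * \<bar>d1\<bar> * \<bar>d\<bar> \<le> \<bar>d1\<bar>\<^sup>2 + \<bar>d\<bar>\<^sup>2" by (rule sum_squares_bound)
  hence "N * (2 * \<bar>d1\<bar> * \<bar>d\<bar>) \<le> N * (d1^2 + d^2)" using N by (intro mult_left_mono) auto
  hence 4: "2 * N * \<bar>d1\<bar> * \<bar>d\<bar> \<le> N * d1^2 + N * d^2" by (simp add: algebra_simps)
  have 5: "- (K * (d * d2)) \<le> a0 * d2^2 + K^2 / (4 * a0) * d^2" using young[of "K / 2" "- d" d2] by (simp add: power_divide)
  have 6: "a0 * d2^2 \<le> A * d2^2" by (rule mult_right_mono[OF A]) simp
  have 7: "K * d1^2 = (2 * N)^2 / a0 * d1^2 + 3 * (N * d1^2)" unfolding K_def by (simp add: algebra_simps)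
  have 8: "\<bar>d1\<bar> * \<bar>d1\<bar> = d1^2" by (simp add: power2_eq_square)
  have 9: "2 * (A1 * d1 * d2 + A * d2^2) + K * (d1^2 + d * d2) + (N + K^2 / (4 * a0)) * d^2
     = 2 * (A1 * d1 * d2) + 2 * (A * d2^2) + K * d1^2 + K * (d * d2) + N * d^2 + K^2 / (4 * a0) * d^2" by (simp add: algebra_simps)
  have 10: "2 * N * \<bar>d1\<bar> * \<bar>d2\<bar> = 2 * (N * (\<bar>d1\<bar> * \<bar>d2\<bar>))" "2 * (2 * N) * \<bar>d1\<bar> * \<bar>d2\<bar> = 4 * (N * (\<bar>d1\<bar> * \<bar>d2\<bar>))" by simp_all
  have 11: "2 * N * (\<bar>d1\<bar> * \<bar>d1\<bar>) = 2 * (N * d1^2)" unfolding 8 by simp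
  show ?thesis unfolding 9 7 using 1 2 3 4 5 6 unfolding 10 11 by linarith
qed

definition "sq1 r r1 x = 2 * r x * r1 x"
definition "sq2 r r1 r2 x = 2 * (r1 x)^2 + 2 * r x * r2 x"
definition "sq3 r r1 r2 r3 x = 6 * r1 x * r2 x + 2 * r x * r3 x"

lemma chain3_square:
  assumes "chain3 r r1 r2 r3"
  shows "((\<lambda>x. (r x)\<^sup>2) has_real_derivative sq1 r r1 x) (at x)"
    "(sq1 r r1 has_real_derivative sq2 r r1 r2 x) (at x)"
    "(sq2 r r1 r2 has_real_derivative sq3 r r1 r2 r3 x) (at x)"
  using assms unfolding chain3_def sq1_def[abs_def] sq2_def[abs_def] sq3_def
  by (auto intro!: derivative_eq_intros simp: power2_eq_square algebra_simps)

lemma square_bounds: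
  assumes "0 < (m :: real)" "m \<le> r x" "r x \<le> M" "\<bar>r1 x\<bar> \<le> M" "\<bar>r2 x\<bar> \<le> M"
  shows "m^2 \<le> (r x)^2" "(r x)^2 \<le> 8 * M^2" "\<bar>sq1 r r1 x\<bar> \<le> 8 * M^2" "\<bar>sq2 r r1 r2 x\<bar> \<le> 8 * M^2"
    "\<bar>r3 x\<bar> \<le> M \<Longrightarrow> \<bar>sq3 r r1 r2 r3 x\<bar> \<le> 8 * M^2"
proof -
  have M: "M \<ge> 0" "\<bar>r x\<bar> \<le> M" using assms by auto
  have p: "\<bar>u * v\<bar> \<le> M^2" if "\<bar>u\<bar> \<le> M" "\<bar>v\<bar> \<le> M" for u v unfolding abs_mult power2_eq_square using that M by (intro mult_mono) auto
  show "m^2 \<le> (r x)^2" using assms by (intro power_mono) auto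
  have M2: "0 \<le> M^2" by simp
  show "(r x)^2 \<le> 8 * M^2" using p[OF M(2) M(2)] M2 unfolding power2_eq_square[of "r x"] by linarith
  show "\<bar>sq1 r r1 x\<bar> \<le> 8 * M^2" using p[OF M(2) assms(4)] M2 unfolding sq1_def mult.assoc abs_le_iff by linarith
  show "\<bar>sq2 r r1 r2 x\<bar> \<le> 8 * M^2"
    using p[OF M(2) assms(5)] p[OF assms(4) assms(4)] M2 unfolding sq2_def mult.assoc power2_eq_square[of "r1 x"] abs_le_iff by linarith
  show "\<bar>sq3 r r1 r2 r3 x\<bar> \<le> 8 * M^2" if "\<bar>r3 x\<bar> \<le> M"
    using p[OF M(2) that] p[OF assms(4) assms(5)] M2 unfolding sq3_def mult.assoc abs_le_iff by linarith
qed

lemma flux_sq: "flux r r1 r2 r3 x = fJ ((r x)^2) (sq1 r r1 x) (sq2 r r1 r2 x) - aJ ((r x)^2) (sq1 r r1 x) * sq3 r r1 r2 r3 x"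
  unfolding flux_def sq1_def sq2_def sq3_def by (rule Jq_split)

lemma periodic_ends: "periodic_2pi f \<Longrightarrow> f pi = f (- pi)" using periodic_2pi_of_int[of f "- pi" 1] by simp

text \<open>The bounds stop at the second derivative, which is what the norm of
  \<open>h^(4\<mu>+\<alpha>)\<close> with \<mu> >= 1/2 controls down to the initial time.\<close>

definition bounded_profile where
  "bounded_profile m M r r1 r2 r3 \<longleftrightarrow> chain3 r r1 r2 r3 \<and> (\<forall>x. r3 differentiable (at x)) \<and> periodic_2pi r \<and>
     continuous_on {-pi..pi} (asd_G r) \<and> (\<forall>x. m \<le> r x \<and> r x \<le> M \<and> \<bar>r1 x\<bar> \<le> M \<and> \<bar>r2 x\<bar> \<le> M)"

text \<open>The time derivative of the integral of (r^2 - q^2)^2, because r^2 has the time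
  derivative 2 r G.\<close>

definition energy_rate :: "(real \<Rightarrow> real) \<Rightarrow> (real \<Rightarrow> real) \<Rightarrow> real" where
  "energy_rate r q = integral {-pi..pi} (\<lambda>x. ((r x)^2 - (q x)^2) * (4 * (r x * asd_G r x - q x * asd_G q x)))"

text \<open>The difference of the fluxes is written with the leading coefficient taken at r and the
  difference of leading coefficients multiplied by the third derivative of q^2. In this form the
  third derivative of r enters only through the difference d3, and that term cancels after
  integration by parts.\<close>

theorem energy_inequality:
  assumes m: "0 < m" and M: "0 < M"
  obtains C where "\<And>r r1 r2 r3 q q1 q2 q3. bounded_profile m M r r1 r2 r3 \<Longrightarrow> bounded_profile m M q q1 q2 q3 \<Longrightarrow>
    \<forall>x. \<bar>q3 x\<bar> \<le> M \<Longrightarrow> energy_rate r q \<le> C * integral {-pi..pi} (\<lambda>x. ((r x)^2 - (q x)^2)\<^sup>2)"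
proof -
  define M' where "M' = 8 * M^2"
  have m': "m^2 > 0" and M': "M' > 0" using m M by (simp_all add: M'_def)
  obtain L a0 where L: "L \<ge> 0" and a0: "a0 > 0" and
    lip: "\<And>Q a b Q' a' b'. \<lbrakk>m\<^sup>2 \<le> Q; Q \<le> M'; \<bar>a\<bar> \<le> M'; \<bar>b\<bar> \<le> M'; m\<^sup>2 \<le> Q'; Q' \<le> M'; \<bar>a'\<bar> \<le> M'; \<bar>b'\<bar> \<le> M'\<rbrakk> \<Longrightarrow>
      \<bar>fJ Q a b - fJ Q' a' b'\<bar> \<le> L * (\<bar>Q - Q'\<bar> + \<bar>a - a'\<bar> + \<bar>b - b'\<bar>) \<and>
      \<bar>aJ Q a - aJ Q' a'\<bar> \<le> L * (\<bar>Q - Q'\<bar> + \<bar>a - a'\<bar> + \<bar>b - b'\<bar>) \<and> \<bar>aJ1 Q a b\<bar> \<le> L \<and> a0 \<le> aJ Q a"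
    by (rule coefficient_lipschitz[OF m' M']) (rule that)
  define N where "N = L + L * M'"
  have N: "N \<ge> 0" "L \<le> N" using L M' by (simp_all add: N_def)
  define K where "K = (2 * N)^2 / a0 + 3 * N"
  define C where "C = 2 * (N + K^2 / (4 * a0))"
  show ?thesis
  proof (rule that[of C])
    fix r r1 r2 r3 q q1 q2 q3 :: "real \<Rightarrow> real"
    assume br: "bounded_profile m M r r1 r2 r3" and bq: "bounded_profile m M q q1 q2 q3" and q3: "\<forall>x. \<bar>q3 x\<bar> \<le> M"
    have r: "chain3 r r1 r2 r3" "\<And>x. r3 differentiable (at x)" "periodic_2pi r"
      and q: "chain3 q q1 q2 q3" "\<And>x. q3 differentiable (at x)" "periodic_2pi q"
      and Gc: "continuous_on {-pi..pi} (asd_G r)" "continuous_on {-pi..pi} (asd_G q)"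
      and rb: "\<And>x. m \<le> r x \<and> r x \<le> M \<and> \<bar>r1 x\<bar> \<le> M \<and> \<bar>r2 x\<bar> \<le> M"
      and qb: "\<And>x. m \<le> q x \<and> q x \<le> M \<and> \<bar>q1 x\<bar> \<le> M \<and> \<bar>q2 x\<bar> \<le> M" using br bq unfolding bounded_profile_def by auto
    have pos: "r x > 0" "q x > 0" for x using rb[of x] qb[of x] m by linarith+
    define P where "P x = (r x)^2" for x
    define P1 P2 P3 where "P1 = sq1 r r1" and "P2 = sq2 r r1 r2" and "P3 = sq3 r r1 r2 r3"
    define Q where "Q x = (q x)^2" for x
    define Q1 Q2 Q3 where "Q1 = sq1 q q1" and "Q2 = sq2 q q1 q2" and "Q3 = sq3 q q1 q2 q3"
    have dP: "(P has_real_derivative P1 x) (at x)" "(P1 has_real_derivative P2 x) (at x)" "(P2 has_real_derivative P3 x) (at x)" for x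
      using chain3_square[OF r(1), of x] unfolding P_def[abs_def] P1_def P2_def P3_def .
    have dQ: "(Q has_real_derivative Q1 x) (at x)" "(Q1 has_real_derivative Q2 x) (at x)" "(Q2 has_real_derivative Q3 x) (at x)" for x
      using chain3_square[OF q(1), of x] unfolding Q_def[abs_def] Q1_def Q2_def Q3_def .
    have bP: "m^2 \<le> P x" "P x \<le> M'" "\<bar>P1 x\<bar> \<le> M'" "\<bar>P2 x\<bar> \<le> M'" for x
      unfolding P_def P1_def P2_def M'_def using rb[of x] m by (auto intro!: square_bounds)
    have bQ: "m^2 \<le> Q x" "Q x \<le> M'" "\<bar>Q1 x\<bar> \<le> M'" "\<bar>Q2 x\<bar> \<le> M'" "\<bar>Q3 x\<bar> \<le> M'" for x
      unfolding Q_def Q1_def Q2_def Q3_def M'_def using qb[of x] q3 m by (auto intro!: square_bounds)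
    define JP JQ where "JP = flux r r1 r2 r3" and "JQ = flux q q1 q2 q3"
    have dJ: "(JP has_real_derivative r x * asd_G r x) (at x)" "(JQ has_real_derivative q x * asd_G q x) (at x)" for x
      unfolding JP_def JQ_def by (rule flux_deriv[OF r(1) pos(1) r(2)] flux_deriv[OF q(1) pos(2) q(2)])+
    define A where "A x = aJ (P x) (P1 x)" for x
    have dA: "(A has_real_derivative aJ1 (P x) (P1 x) (P2 x)) (at x)" for x
      unfolding A_def by (rule aJ_deriv[OF dP(1,2)]) (use pos[of x] in \<open>simp add: P_def\<close>)
    \<comment> \<open>A periodic function whose derivative performs all integrations by parts at
      once: its terms treat the divergence of the flux, the product of d1 and d3, and the
      interpolation of d1^2 between d^2 and d2^2.\<close>
    define \<Psi> where "\<Psi> x = 4 * ((P x - Q x) * (JP x - JQ x)) + 4 * (A x * ((P1 x - Q1 x) * (P2 x - Q2 x)))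
      + 2 * (K * ((P x - Q x) * (P1 x - Q1 x)))" for x
    define \<Psi>' where "\<Psi>' x = 4 * ((P1 x - Q1 x) * (JP x - JQ x)) + 4 * ((P x - Q x) * (r x * asd_G r x - q x * asd_G q x))
      + 4 * (aJ1 (P x) (P1 x) (P2 x) * (P1 x - Q1 x) * (P2 x - Q2 x) + A x * (P2 x - Q2 x)^2 + A x * ((P1 x - Q1 x) * (P3 x - Q3 x)))
      + 2 * (K * ((P1 x - Q1 x)^2 + (P x - Q x) * (P2 x - Q2 x)))" for x
    have d\<Psi>: "(\<Psi> has_real_derivative \<Psi>' x) (at x)" for x unfolding \<Psi>_def \<Psi>'_def
      by (rule derivative_eq_intros dP dQ dJ dA refl | simp add: power2_eq_square algebra_simps)+
    have per: "\<Psi> pi = \<Psi> (- pi)"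
    proof -
      note pr = periodic_ends[OF r(3)] chain3_periodic[OF r(1,3), THEN periodic_ends]
      note pq = periodic_ends[OF q(3)] chain3_periodic[OF q(1,3), THEN periodic_ends]
      show ?thesis unfolding \<Psi>_def P_def Q_def P1_def Q1_def P2_def Q2_def A_def JP_def JQ_def flux_def sq1_def sq2_def pr pq ..
    qed
    have pw: "(P x - Q x) * (4 * (r x * asd_G r x - q x * asd_G q x)) \<le> \<Psi>' x + C * (P x - Q x)^2" for x
    proof -
      define d d1 d2 d3 where "d = P x - Q x" and "d1 = P1 x - Q1 x" and "d2 = P2 x - Q2 x" and "d3 = P3 x - Q3 x"
      define e where "e = (fJ (P x) (P1 x) (P2 x) - fJ (Q x) (Q1 x) (Q2 x)) - (A x - aJ (Q x) (Q1 x)) * Q3 x"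
      note lp = lip[of "P x" "P1 x" "P2 x" "Q x" "Q1 x" "Q2 x", OF bP bQ(1-4)]
      have e: "\<bar>e\<bar> \<le> N * (\<bar>d\<bar> + \<bar>d1\<bar> + \<bar>d2\<bar>)"
      proof -
        have "\<bar>(A x - aJ (Q x) (Q1 x)) * Q3 x\<bar> \<le> (L * (\<bar>d\<bar> + \<bar>d1\<bar> + \<bar>d2\<bar>)) * M'"
          unfolding abs_mult using lp bQ(5)[of x] L unfolding A_def d_def d1_def d2_def by (intro mult_mono) auto
        moreover have "\<bar>fJ (P x) (P1 x) (P2 x) - fJ (Q x) (Q1 x) (Q2 x)\<bar> \<le> L * (\<bar>d\<bar> + \<bar>d1\<bar> + \<bar>d2\<bar>)"
          using lp unfolding d_def d1_def d2_def by blast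
        ultimately have "\<bar>e\<bar> \<le> L * (\<bar>d\<bar> + \<bar>d1\<bar> + \<bar>d2\<bar>) + (L * (\<bar>d\<bar> + \<bar>d1\<bar> + \<bar>d2\<bar>)) * M'" unfolding e_def by linarith
        thus ?thesis unfolding N_def by (simp add: algebra_simps)
      qed
      have J: "JP x - JQ x = e - A x * d3"
        unfolding JP_def JQ_def flux_sq e_def d3_def A_def P_def P1_def P2_def P3_def Q_def Q1_def Q2_def Q3_def
        by (simp add: algebra_simps)
      have "\<bar>aJ1 (P x) (P1 x) (P2 x)\<bar> \<le> N" "a0 \<le> A x" using lp N(2) unfolding A_def by linarith+
      from energy_young[OF a0 this(2) N(1) e this(1)]
      have y: "- 2 * d1 * e \<le> 2 * (aJ1 (P x) (P1 x) (P2 x) * d1 * d2 + A x * d2^2) + K * (d1^2 + d * d2) + (N + K^2 / (4 * a0)) * d^2"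
        unfolding K_def .
      have "\<Psi>' x + C * d^2 - d * (4 * (r x * asd_G r x - q x * asd_G q x)) =
        4 * (d1 * e) - 4 * (d1 * (A x * d3)) + 4 * (aJ1 (P x) (P1 x) (P2 x) * d1 * d2 + A x * d2^2) + 4 * (A x * (d1 * d3))
          + 2 * (K * (d1^2 + d * d2)) + C * d^2"
        unfolding \<Psi>'_def d_def[symmetric] d1_def[symmetric] d2_def[symmetric] d3_def[symmetric] J by (simp add: algebra_simps)
      also have "\<dots> = 2 * (2 * (aJ1 (P x) (P1 x) (P2 x) * d1 * d2 + A x * d2^2) + K * (d1^2 + d * d2) + (N + K^2 / (4 * a0)) * d^2
          - (- 2 * d1 * e))" unfolding C_def by (simp add: algebra_simps)
      also have "\<dots> \<ge> 0" using y by simp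
      finally show ?thesis unfolding d_def by simp
    qed
    have \<Psi>i: "(\<Psi>' has_integral (\<Psi> pi - \<Psi> (- pi))) {-pi..pi}" by (rule fundamental_theorem_of_calculus)
        (auto simp flip: has_real_derivative_iff_has_vector_derivative intro: DERIV_subset[OF d\<Psi>])
    have cP: "continuous_on {-pi..pi} P" "continuous_on {-pi..pi} Q"
      using dP(1) dQ(1) by (meson DERIV_isCont continuous_at_imp_continuous_on)+
    have cr: "continuous_on {-pi..pi} r" "continuous_on {-pi..pi} q"
      using r(1) q(1) unfolding chain3_def by (meson DERIV_isCont continuous_at_imp_continuous_on)+
    have i2: "((\<lambda>x. (P x - Q x)\<^sup>2) has_integral integral {-pi..pi} (\<lambda>x. (P x - Q x)\<^sup>2)) {-pi..pi}"
      by (intro integrable_integral integrable_continuous_real continuous_intros cP)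
    note i1 = integrable_integral[OF integrable_continuous_real, of "- pi" pi "\<lambda>x. (P x - Q x) * (4 * (r x * asd_G r x - q x * asd_G q x))",
      OF continuous_on_mult[OF continuous_on_diff[OF cP] continuous_on_mult[OF continuous_on_const
        continuous_on_diff[OF continuous_on_mult[OF cr(1) Gc(1)] continuous_on_mult[OF cr(2) Gc(2)]]]]]
    have "energy_rate r q \<le> (\<Psi> pi - \<Psi> (- pi)) + C * integral {-pi..pi} (\<lambda>x. (P x - Q x)\<^sup>2)"
      unfolding energy_rate_def P_def[symmetric] Q_def[symmetric]
      by (rule has_integral_le[OF i1 has_integral_add[OF \<Psi>i has_integral_mult_right[OF i2]]]) (rule pw)
    thus "energy_rate r q \<le> C * integral {-pi..pi} (\<lambda>x. ((r x)^2 - (q x)^2)\<^sup>2)" unfolding per P_def Q_def by simp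
  qed
qed

section \<open>Regularity of solutions in time and uniqueness\<close>

lemma uniform_limit_integral_eventually:
  fixes g :: "'a \<Rightarrow> real \<Rightarrow> real"
  assumes u: "uniform_limit {a..b} g G F" and c: "eventually (\<lambda>u. continuous_on {a..b} (g u)) F"
    and G: "continuous_on {a..b} G"
  shows "((\<lambda>u. integral {a..b} (g u)) \<longlongrightarrow> integral {a..b} G) F"
proof (cases "F = bot")
  case False
  \<comment> \<open>Where \<open>g u\<close> fails to be continuous it is replaced by the limit, so
    that the theorem for families of integrable functions applies.\<close>
  define h where "h u = (if continuous_on {a..b} (g u) then g u else G)" for u
  have ev: "eventually (\<lambda>u. h u = g u) F" using c by eventually_elim (simp add: h_def)
  have ev': "eventually (\<lambda>u. \<forall>x\<in>{a..b}. h u x = g u x) F" using ev by eventually_elim simp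
  have uh: "uniform_limit {a..b} h G F" using uniform_limit_cong[OF ev', of G G] u by simp
  have ch: "continuous_on {a..b} (h u)" for u unfolding h_def using G by simp
  obtain I L where IL: "\<And>n. (h n has_integral I n) {a..b}" "(G has_integral L) {a..b}" "(I \<longlongrightarrow> L) F"
    by (rule uniform_limit_integral[OF uh ch False]) (rule that)
  have "I n = integral {a..b} (h n)" for n using integral_unique[OF IL(1)] by simp
  hence "I = (\<lambda>n. integral {a..b} (h n))" "L = integral {a..b} G" using integral_unique[OF IL(2)] by auto
  hence lim: "((\<lambda>n. integral {a..b} (h n)) \<longlongrightarrow> integral {a..b} G) F" using IL(3) by simp
  have "eventually (\<lambda>n. integral {a..b} (h n) = integral {a..b} (g n)) F" using ev by eventually_elim simp
  from tendsto_cong[OF this] lim show ?thesis by blast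
qed simp

text \<open>Differentiability in time at t, uniformly on X. The boundedness clauses are what lets
  products inherit it.\<close>

definition ud :: "real set \<Rightarrow> real \<Rightarrow> (real \<Rightarrow> real \<Rightarrow> real) \<Rightarrow> (real \<Rightarrow> real) \<Rightarrow> bool" where
  "ud X t f F \<longleftrightarrow> uniform_limit X f (f t) (at t) \<and> uniform_limit X (\<lambda>u x. (f u x - f t x) / (u - t)) F (at t) \<and>
     bounded (f t ` X) \<and> bounded (F ` X)"

lemma bounded_image_mult:
  fixes f g :: "real \<Rightarrow> real"
  assumes "bounded (f ` X)" "bounded (g ` X)"
  shows "bounded ((\<lambda>x. f x * g x) ` X)"
proof -
  obtain a b where a: "\<And>x. x \<in> X \<Longrightarrow> \<bar>f x\<bar> \<le> a" and b: "\<And>x. x \<in> X \<Longrightarrow> \<bar>g x\<bar> \<le> b" using assms by (auto simp: bounded_iff)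
  have "\<bar>f x * g x\<bar> \<le> \<bar>a\<bar> * \<bar>b\<bar>" if "x \<in> X" for x unfolding abs_mult using a[OF that] b[OF that] by (intro mult_mono) auto
  thus ?thesis by (auto simp: bounded_iff)
qed

lemma ud_mult:
  assumes "ud X t f F" "ud X t g G"
  shows "ud X t (\<lambda>u x. f u x * g u x) (\<lambda>x. F x * g t x + f t x * G x)"
proof -
  note f = assms(1)[unfolded ud_def] and g = assms(2)[unfolded ud_def]
  have 1: "uniform_limit X (\<lambda>u x. f u x * g u x) (\<lambda>x. f t x * g t x) (at t)" by (rule uniform_lim_mult) (use f g in blast)+
  have "uniform_limit X (\<lambda>u x. (f u x - f t x) / (u - t) * g u x) (\<lambda>x. F x * g t x) (at t)"
    by (rule uniform_lim_mult) (use f g in blast)+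
  moreover have "uniform_limit X (\<lambda>u x. f t x * ((g u x - g t x) / (u - t))) (\<lambda>x. f t x * G x) (at t)"
    by (rule uniform_lim_mult[OF uniform_limit_const]) (use f g in blast)+
  ultimately have "uniform_limit X (\<lambda>u x. (f u x - f t x) / (u - t) * g u x + f t x * ((g u x - g t x) / (u - t)))
      (\<lambda>x. F x * g t x + f t x * G x) (at t)" by (rule uniform_limit_add)
  moreover have "(f u x - f t x) / (u - t) * g u x + f t x * ((g u x - g t x) / (u - t)) = (f u x * g u x - f t x * g t x) / (u - t)" for u x
    by (simp add: add_divide_distrib[symmetric] algebra_simps)
  ultimately have 2: "uniform_limit X (\<lambda>u x. (f u x * g u x - f t x * g t x) / (u - t)) (\<lambda>x. F x * g t x + f t x * G x) (at t)"
    by simp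
  have "bounded ((\<lambda>x. F x * g t x) ` X)" "bounded ((\<lambda>x. f t x * G x) ` X)" "bounded ((\<lambda>x. f t x * g t x) ` X)"
    using f g by (auto intro!: bounded_image_mult)
  thus ?thesis unfolding ud_def using 1 2 by (auto intro: bounded_plus_comp)
qed

lemma ud_diff:
  assumes "ud X t f F" "ud X t g G"
  shows "ud X t (\<lambda>u x. f u x - g u x) (\<lambda>x. F x - G x)"
proof -
  note f = assms(1)[unfolded ud_def] and g = assms(2)[unfolded ud_def]
  have "uniform_limit X (\<lambda>u x. (f u x - f t x) / (u - t) - (g u x - g t x) / (u - t)) (\<lambda>x. F x - G x) (at t)"
    by (rule uniform_limit_minus) (use f g in blast)+
  moreover have "(f u x - f t x) / (u - t) - (g u x - g t x) / (u - t) = (f u x - g u x - (f t x - g t x)) / (u - t)" for u x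
    by (simp add: diff_divide_distrib)
  ultimately show ?thesis unfolding ud_def using f g by (auto intro!: uniform_limit_minus bounded_minus_comp)
qed

lemma ud_integral:
  assumes f: "ud {a..b} t f F" and c: "eventually (\<lambda>u. continuous_on {a..b} (f u)) (at t)"
    and ct: "continuous_on {a..b} (f t)" and F: "continuous_on {a..b} F"
  shows "((\<lambda>u. integral {a..b} (f u)) has_real_derivative integral {a..b} F) (at t)" unfolding has_field_derivative_iff
proof -
  have "((\<lambda>u. integral {a..b} (\<lambda>x. (f u x - f t x) / (u - t))) \<longlongrightarrow> integral {a..b} F) (at t)"
  proof (rule uniform_limit_integral_eventually[OF _ _ F])
    show "uniform_limit {a..b} (\<lambda>u x. (f u x - f t x) / (u - t)) F (at t)" using f unfolding ud_def by blast
    show "eventually (\<lambda>u. continuous_on {a..b} (\<lambda>x. (f u x - f t x) / (u - t))) (at t)"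
      using c eventually_neq_at_within[of t t UNIV] by eventually_elim (use ct in \<open>auto intro!: continuous_intros\<close>)
  qed
  moreover have ev: "eventually (\<lambda>u. integral {a..b} (\<lambda>x. (f u x - f t x) / (u - t)) =
      (integral {a..b} (f u) - integral {a..b} (f t)) / (u - t)) (at t)" using c
  proof eventually_elim
    case (elim u)
    have "integral {a..b} (\<lambda>x. (f u x - f t x) / (u - t)) = integral {a..b} (\<lambda>x. f u x - f t x) / (u - t)" by simp
    also have "integral {a..b} (\<lambda>x. f u x - f t x) = integral {a..b} (f u) - integral {a..b} (f t)"
      by (intro integral_diff integrable_continuous_real elim ct)
    finally show ?case .
  qed
  ultimately show "((\<lambda>u. (integral {a..b} (f u) - integral {a..b} (f t)) / (u - t)) \<longlongrightarrow> integral {a..b} F) (at t)"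
    using tendsto_cong[OF ev] by blast
qed

lemma holder4_lipschitz:
  assumes "0 < \<alpha>" "\<alpha> < 1" "f \<in> little_holder (4 + \<alpha>)"
  shows "f \<in> little_holder \<alpha>"
proof -
  note k = order_facts(1,2)[OF assms(1,2)]
  note h = holder4_chain3[OF assms]
  have d: "(f has_real_derivative nth_deriv 1 f x) (at x)" for x using h(1) unfolding chain3_def by blast
  have "continuous_on UNIV (nth_deriv 1 f)" using h(1) unfolding chain3_def by (meson DERIV_isCont continuous_at_imp_continuous_on)
  then obtain B where B: "\<And>x. \<bar>nth_deriv 1 f x\<bar> \<le> B" using periodic_continuous_bounded[OF periodic_nth_deriv[OF h(3)]] by blast
  have "\<bar>f x - f y\<bar> \<le> B * \<bar>x - y\<bar>" for x y using field_differentiable_bound[of UNIV f "nth_deriv 1 f" B x y] d B by auto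
  thus ?thesis by (intro lipschitz_little_holder(1)[OF assms(1) k(2) h(3)]) (auto simp: k hdiff_def)
qed

lemma holder_norm_triangle:
  assumes "f \<in> little_holder \<sigma>" "g \<in> little_holder \<sigma>"
  shows "\<bar>holder_norm \<sigma> f - holder_norm \<sigma> g\<bar> \<le> holder_norm \<sigma> (\<lambda>x. f x - g x)"
proof -
  have d: "(\<lambda>x. f x - g x) \<in> little_holder \<sigma>" by (rule little_holder_diff(1)[OF assms])
  have 1: "holder_norm \<sigma> f \<le> holder_norm \<sigma> g + holder_norm \<sigma> (\<lambda>x. f x - g x)" using little_holder_add(2)[OF assms(2) d] by simp
  have "holder_norm \<sigma> (\<lambda>x. 1 * f x + (- 1) * (f x - g x)) \<le> \<bar>1\<bar> * holder_norm \<sigma> f + \<bar>- 1\<bar> * holder_norm \<sigma> (\<lambda>x. f x - g x)"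
    by (rule holder_space_lincomb(2)[OF assms(1)[THEN little_holder_imp] d[THEN little_holder_imp]])
  hence "holder_norm \<sigma> g \<le> holder_norm \<sigma> f + holder_norm \<sigma> (\<lambda>x. f x - g x)" by simp
  with 1 show ?thesis by linarith
qed

lemma periodic_reduce:
  obtains y where "y \<in> {-pi..pi}" "\<And>f. periodic_2pi f \<Longrightarrow> f x = f y"
proof -
  define n where "n = - round (x / (2 * pi))"
  have "\<bar>of_int (round (x / (2 * pi))) - x / (2 * pi)\<bar> \<le> 1 / 2" by (rule of_int_round_abs_le)
  hence "2 * pi * \<bar>of_int (round (x / (2 * pi))) - x / (2 * pi)\<bar> \<le> 2 * pi * (1 / 2)" by (intro mult_left_mono) auto
  moreover have "2 * pi * \<bar>of_int (round (x / (2 * pi))) - x / (2 * pi)\<bar> = \<bar>2 * pi * (of_int (round (x / (2 * pi))) - x / (2 * pi))\<bar>"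
    by (simp add: abs_mult)
  moreover have "2 * pi * (of_int (round (x / (2 * pi))) - x / (2 * pi)) = - (x + 2 * pi * of_int n)"
    unfolding n_def by (simp add: algebra_simps)
  ultimately have "\<bar>x + 2 * pi * of_int n\<bar> \<le> pi" by simp
  hence "x + 2 * pi * of_int n \<in> {-pi..pi}" by (auto simp: abs_le_iff)
  thus ?thesis using that[of "x + 2 * pi * of_int n"] periodic_2pi_of_int by metis
qed

lemma eventually_in_interval: "eventually (\<lambda>u. u \<in> {0..t1}) (at t within {0..t1 :: real})" by (simp add: eventually_at_filter)

context
  fixes \<alpha> \<mu> :: real
  assumes \<alpha>: "0 < \<alpha>" "\<alpha> < 1" and \<mu>: "1 / 2 \<le> \<mu>" "4 * \<mu> + \<alpha> \<notin> \<int>"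
begin

text \<open>Since 4 \<mu> + \<alpha> > 2, two space derivatives are controlled up to the initial
  time.\<close>

lemma sigma_facts: "4 * \<mu> + \<alpha> > 0" "j \<le> 2 \<Longrightarrow> j \<le> fkey (4 * \<mu> + \<alpha>)"
proof -
  show "4 * \<mu> + \<alpha> > 0" using \<alpha> \<mu> by simp
  have "2 \<le> \<lfloor>4 * \<mu> + \<alpha>\<rfloor>" using \<alpha> \<mu> by (simp add: le_floor_iff)
  thus "j \<le> 2 \<Longrightarrow> j \<le> fkey (4 * \<mu> + \<alpha>)" unfolding fkey_def by linarith
qed

context
  fixes r0 T r t1
  assumes sol: "asd_solution \<alpha> \<mu> r0 T r" and t1: "0 \<le> t1" "ereal t1 < T"
begin

lemma before_T: "t \<le> t1 \<Longrightarrow> ereal t < T" using t1(2) by (meson ereal_less_eq(3) le_less_trans)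

lemma sol_holder: "0 \<le> t \<Longrightarrow> t \<le> t1 \<Longrightarrow> r t \<in> little_holder (4 * \<mu> + \<alpha>)"
  and sol_pos: "0 \<le> t \<Longrightarrow> t \<le> t1 \<Longrightarrow> r t x > 0"
  and sol_holder4: "0 < t \<Longrightarrow> t \<le> t1 \<Longrightarrow> r t \<in> little_holder (4 + \<alpha>)"
  and sol_G: "0 < t \<Longrightarrow> t \<le> t1 \<Longrightarrow> asd_G (r t) \<in> little_holder \<alpha>"
  using sol before_T unfolding asd_solution_def lh_continuous_on_def by auto

lemma sol_lim:
  assumes t: "0 \<le> t" "t \<le> t1"
  shows "((\<lambda>u. holder_norm (4 * \<mu> + \<alpha>) (\<lambda>x. r u x - r t x)) \<longlongrightarrow> 0) (at t within {0..t1})"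
proof -
  have "((\<lambda>u. holder_norm (4 * \<mu> + \<alpha>) (\<lambda>x. r u x - r t x)) \<longlongrightarrow> 0) (at t within {t. 0 \<le> t \<and> ereal t < T})"
    using sol before_T[OF t(2)] t unfolding asd_solution_def lh_continuous_on_def by blast
  thus ?thesis by (rule tendsto_within_subset) (use before_T in auto)
qed

lemma sol_uniform:
  assumes t: "0 \<le> t" "t \<le> t1"
  shows "uniform_limit X r (r t) (at t within {0..t1})"
proof (rule uniform_limitI)
  fix e :: real assume "e > 0"
  hence "eventually (\<lambda>u. holder_norm (4 * \<mu> + \<alpha>) (\<lambda>x. r u x - r t x) < e) (at t within {0..t1})"
    using order_tendstoD(2)[OF sol_lim[OF t]] by simp
  thus "eventually (\<lambda>u. \<forall>x\<in>X. dist (r u x) (r t x) < e) (at t within {0..t1})" using eventually_in_interval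
  proof eventually_elim
    case (elim u)
    hence "\<bar>nth_deriv 0 (r u) x - nth_deriv 0 (r t) x\<bar> \<le> holder_norm (4 * \<mu> + \<alpha>) (\<lambda>x. r u x - r t x)" for x
      by (intro nth_deriv_diff_le_norm sol_holder t) auto
    thus ?case using elim by (auto simp: dist_real_def intro: le_less_trans)
  qed
qed

lemma sol_continuous: "0 \<le> t \<Longrightarrow> t \<le> t1 \<Longrightarrow> continuous_on X (r t)"
  using holder_spaceD(3)[OF little_holder_imp[OF sol_holder], of t 0] continuous_on_subset by auto

lemma sol_norm_bound: obtains M where "\<And>t. 0 \<le> t \<Longrightarrow> t \<le> t1 \<Longrightarrow> holder_norm (4 * \<mu> + \<alpha>) (r t) \<le> M"
proof -
  have "continuous_on {0..t1} (\<lambda>t. holder_norm (4 * \<mu> + \<alpha>) (r t))" unfolding continuous_on_def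
  proof
    fix t assume t: "t \<in> {0..t1}"
    have "((\<lambda>u. holder_norm (4 * \<mu> + \<alpha>) (r u) - holder_norm (4 * \<mu> + \<alpha>) (r t)) \<longlongrightarrow> 0) (at t within {0..t1})"
    proof (rule Lim_null_comparison)
      show "((\<lambda>u. holder_norm (4 * \<mu> + \<alpha>) (\<lambda>x. r u x - r t x)) \<longlongrightarrow> 0) (at t within {0..t1})" using sol_lim t by simp
      show "eventually (\<lambda>u. norm (holder_norm (4 * \<mu> + \<alpha>) (r u) - holder_norm (4 * \<mu> + \<alpha>) (r t)) \<le> holder_norm (4 * \<mu> + \<alpha>) (\<lambda>x. r u x - r t x)) (at t within {0..t1})"
        using eventually_in_interval by eventually_elim (use t in \<open>auto intro!: holder_norm_triangle sol_holder\<close>)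
    qed
    thus "((\<lambda>u. holder_norm (4 * \<mu> + \<alpha>) (r u)) \<longlongrightarrow> holder_norm (4 * \<mu> + \<alpha>) (r t)) (at t within {0..t1})" by (simp add: LIM_zero_iff)
  qed
  hence "bounded ((\<lambda>t. holder_norm (4 * \<mu> + \<alpha>) (r t)) ` {0..t1})" by (intro compact_imp_bounded compact_continuous_image) auto
  then obtain M where M: "\<forall>y\<in>(\<lambda>t. holder_norm (4 * \<mu> + \<alpha>) (r t)) ` {0..t1}. norm y \<le> M" unfolding bounded_iff by blast
  show ?thesis
  proof (rule that)
    fix t assume "0 \<le> t" "t \<le> t1"
    thus "holder_norm (4 * \<mu> + \<alpha>) (r t) \<le> M" using bspec[OF M, of "holder_norm (4 * \<mu> + \<alpha>) (r t)"] by auto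
  qed
qed

text \<open>Joint continuity in time and space on a compact rectangle turns positivity into a
  uniform bound; periodicity carries it to all x.\<close>

lemma sol_lower_bound: obtains m where "m > 0" "\<And>t x. 0 \<le> t \<Longrightarrow> t \<le> t1 \<Longrightarrow> m \<le> r t x"
proof -
  have "continuous_on ({0..t1} \<times> {-pi..pi}) (\<lambda>p. r (fst p) (snd p))" unfolding continuous_on_iff
  proof (intro ballI allI impI)
    fix p :: "real \<times> real" and e :: real assume p: "p \<in> {0..t1} \<times> {-pi..pi}" and e: "e > 0"
    define t x where "t = fst p" and "x = snd p"
    have t: "0 \<le> t" "t \<le> t1" using p by (auto simp: t_def)
    obtain d1 where d1: "d1 > 0" "\<And>u y. u \<in> {0..t1} \<Longrightarrow> dist u t < d1 \<Longrightarrow> u \<noteq> t \<Longrightarrow> dist (r u y) (r t y) < e / 2"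
      using uniform_limitD[OF sol_uniform[OF t, of UNIV], of "e / 2"] e unfolding eventually_at by auto
    obtain d2 where d2: "d2 > 0" "\<And>y. dist y x < d2 \<Longrightarrow> dist (r t y) (r t x) < e / 2"
      using sol_continuous[OF t, of UNIV] e unfolding continuous_on_iff by (metis UNIV_I half_gt_zero)
    show "\<exists>d>0. \<forall>p'\<in>{0..t1} \<times> {-pi..pi}. dist p' p < d \<longrightarrow> dist (r (fst p') (snd p')) (r (fst p) (snd p)) < e"
    proof (intro exI[of _ "min d1 d2"] conjI ballI impI)
      fix p' assume p': "p' \<in> {0..t1} \<times> {-pi..pi}" "dist p' p < min d1 d2"
      have "dist (fst p') t < d1" "dist (snd p') x < d2"
        using dist_fst_le[of p' p] dist_snd_le[of p' p] p'(2) unfolding t_def x_def by linarith+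
      hence "dist (r (fst p') (snd p')) (r t (snd p')) < e / 2" "dist (r t (snd p')) (r t x) < e / 2"
        using d1(2)[of "fst p'" "snd p'"] d2(2)[of "snd p'"] p'(1) e by (cases "fst p' = t"; auto)+
      thus "dist (r (fst p') (snd p')) (r (fst p) (snd p)) < e"
        unfolding t_def x_def using dist_triangle_half_l[of "r (fst p) (snd p')" "r (fst p') (snd p')" e] dist_triangle_lt
        by (smt (verit) dist_commute dist_triangle field_sum_of_halves)
    qed (use d1 d2 in simp)
  qed
  moreover have "compact ({0..t1} \<times> {-pi..pi})" "{0..t1} \<times> {-pi..pi} \<noteq> {}" using t1 by (auto intro!: compact_Times)
  ultimately obtain p where p: "p \<in> {0..t1} \<times> {-pi..pi}" "\<And>p'. p' \<in> {0..t1} \<times> {-pi..pi} \<Longrightarrow> r (fst p) (snd p) \<le> r (fst p') (snd p')"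
    using continuous_attains_inf[of "{0..t1} \<times> {-pi..pi}" "\<lambda>p. r (fst p) (snd p)"] by blast
  show ?thesis
  proof (rule that[of "r (fst p) (snd p)"])
    show "r (fst p) (snd p) > 0" using p(1) by (intro sol_pos) auto
    fix t x assume t: "0 \<le> t" "t \<le> t1"
    obtain y where y: "y \<in> {-pi..pi}" "\<And>f. periodic_2pi f \<Longrightarrow> f x = f y" by (rule periodic_reduce) (rule that)
    have "r t x = r t y" by (rule y(2)[OF holder_spaceD(1)[OF little_holder_imp[OF sol_holder[OF t]]]])
    thus "r (fst p) (snd p) \<le> r t x" using p(2)[of "(t, y)"] t y(1) by auto
  qed
qed

lemma sol_ud:
  assumes t: "0 < t" "t < t1"
  shows "ud {-pi..pi} t r (asd_G (r t))" unfolding ud_def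
proof (intro conjI)
  have "at t within {0..t1} = at t" by (rule at_within_interior) (use t in simp)
  thus "uniform_limit {-pi..pi} r (r t) (at t)" using sol_uniform[of t] t by simp
  show "bounded (r t ` {-pi..pi})" by (intro compact_imp_bounded compact_continuous_image sol_continuous) (use t in auto)
  have Gc: "continuous_on UNIV (asd_G (r t))" using holder_spaceD(3)[OF little_holder_imp[OF sol_G], of t 0] t by simp
  show "bounded (asd_G (r t) ` {-pi..pi})" by (intro compact_imp_bounded compact_continuous_image continuous_on_subset[OF Gc]) auto
  show "uniform_limit {-pi..pi} (\<lambda>u x. (r u x - r t x) / (u - t)) (asd_G (r t)) (at t)"
  proof (rule uniform_limitI)
    fix e :: real assume "e > 0"
    have "((\<lambda>u. holder_norm \<alpha> (\<lambda>x. (r u x - r t x) / (u - t) - asd_G (r t) x)) \<longlongrightarrow> 0) (at t)"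
      using sol before_T[of t] t unfolding asd_solution_def by simp
    from order_tendstoD(2)[OF this \<open>e > 0\<close>]
    have "eventually (\<lambda>u. holder_norm \<alpha> (\<lambda>x. (r u x - r t x) / (u - t) - asd_G (r t) x) < e) (at t)" .
    moreover have "eventually (\<lambda>u. u \<in> {0<..<t1}) (at t)" by (rule eventually_at_in_open') (use t in auto)
    ultimately show "eventually (\<lambda>u. \<forall>x\<in>{-pi..pi}. dist ((r u x - r t x) / (u - t)) (asd_G (r t) x) < e) (at t)"
    proof eventually_elim
      case (elim u)
      have "(\<lambda>x. (1 / (u - t)) * r u x + (- 1 / (u - t)) * r t x) \<in> little_holder \<alpha>"
        by (intro little_holder_lincomb holder4_lipschitz[OF \<alpha>] sol_holder4) (use elim t in auto)
      hence "(\<lambda>x. (r u x - r t x) / (u - t)) \<in> little_holder \<alpha>" by (simp add: diff_divide_distrib)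
      from nth_deriv_diff_le_norm[OF this sol_G, of t 0]
      show ?case using elim t by (auto simp: dist_real_def intro: le_less_trans)
    qed
  qed
qed

end

text \<open>Gronwall for the integral E of (r^2 - q^2)^2, starting from E 0 = 0. E is differentiated
  only at positive times and is merely continuous at 0. The constant depends on t through the norm
  bounds and the positive lower bounds of both solutions on [0, t].\<close>

theorem asd_unique:
  assumes r: "asd_solution \<alpha> \<mu> r0 T r" and q: "asd_solution \<alpha> \<mu> r0 T' q"
    and q3: "\<And>t x. 0 \<le> t \<Longrightarrow> ereal t < T' \<Longrightarrow> \<bar>nth_deriv 3 (q t) x\<bar> \<le> M3"
    and t: "0 \<le> t" "ereal t < T" "ereal t < T'"
  shows "r t = q t"
proof -
  note R = t(1,2) and Q = t(1,3)
  obtain Mr where Mr: "\<And>s. 0 \<le> s \<Longrightarrow> s \<le> t \<Longrightarrow> holder_norm (4 * \<mu> + \<alpha>) (r s) \<le> Mr" by (rule sol_norm_bound[OF r R]) (rule that)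
  obtain Mq where Mq: "\<And>s. 0 \<le> s \<Longrightarrow> s \<le> t \<Longrightarrow> holder_norm (4 * \<mu> + \<alpha>) (q s) \<le> Mq" by (rule sol_norm_bound[OF q Q]) (rule that)
  obtain mr where mr: "mr > 0" "\<And>s x. 0 \<le> s \<Longrightarrow> s \<le> t \<Longrightarrow> mr \<le> r s x" by (rule sol_lower_bound[OF r R]) (rule that)
  obtain mq where mq: "mq > 0" "\<And>s x. 0 \<le> s \<Longrightarrow> s \<le> t \<Longrightarrow> mq \<le> q s x" by (rule sol_lower_bound[OF q Q]) (rule that)
  define m M where "m = min mr mq" and "M = max 1 (max Mr (max Mq M3))"
  have mM: "0 < m" "0 < M" using mr(1) mq(1) by (auto simp: m_def M_def)
  obtain C where C: "\<And>r r1 r2 r3 q q1 q2 q3. bounded_profile m M r r1 r2 r3 \<Longrightarrow> bounded_profile m M q q1 q2 q3 \<Longrightarrow>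
    \<forall>x. \<bar>q3 x\<bar> \<le> M \<Longrightarrow> energy_rate r q \<le> C * integral {-pi..pi} (\<lambda>x. ((r x)^2 - (q x)^2)\<^sup>2)"
    by (rule energy_inequality[OF mM]) (rule that)
  have bd: "\<bar>nth_deriv j (r s) x\<bar> \<le> M" "\<bar>nth_deriv j (q s) x\<bar> \<le> M" if "0 \<le> s" "s \<le> t" "j \<le> 2" for s j x
    using nth_deriv_le_norm[OF little_holder_imp[OF sol_holder[OF r R that(1,2)]] sigma_facts(2)[OF that(3)], of x] Mr[OF that(1,2)]
      nth_deriv_le_norm[OF little_holder_imp[OF sol_holder[OF q Q that(1,2)]] sigma_facts(2)[OF that(3)], of x] Mq[OF that(1,2)]
    unfolding M_def by linarith+
  define h where "h s x = ((r s x * r s x) - (q s x * q s x)) * ((r s x * r s x) - (q s x * q s x))" for s x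
  define E where "E s = integral {-pi..pi} (h s)" for s
  have cont: "continuous_on {-pi..pi} (r s)" "continuous_on {-pi..pi} (q s)" if "0 \<le> s" "s \<le> t" for s
    using sol_continuous[OF r R that] sol_continuous[OF q Q that] by blast+
  have hc: "continuous_on {-pi..pi} (h s)" if "0 \<le> s" "s \<le> t" for s unfolding h_def by (intro continuous_intros cont that)
  have cG: "continuous_on {-pi..pi} (asd_G (r s))" "continuous_on {-pi..pi} (asd_G (q s))" if "0 < s" "s \<le> t" for s
    using holder_spaceD(3)[OF little_holder_imp[OF sol_G[OF r R that]], of 0]
      holder_spaceD(3)[OF little_holder_imp[OF sol_G[OF q Q that]], of 0] continuous_on_subset by auto
  have Et: "E t = 0"
  proof (rule gronwall_zero[where a = 0 and b = t and C = C and f = E and t = t and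
        f' = "\<lambda>s. energy_rate (r s) (q s)"])
    show "E 0 = 0" using r q unfolding E_def h_def asd_solution_def by simp
    show "E s \<ge> 0" if "0 \<le> s" "s \<le> t" for s
      unfolding E_def by (rule integral_nonneg[OF integrable_continuous_real[OF hc[OF that]]]) (simp add: h_def)
    show "continuous_on {0..t} E" unfolding continuous_on_def
    proof
      fix s assume s: "s \<in> {0..t}"
      hence s': "0 \<le> s" "s \<le> t" by auto
      note u = sol_uniform[OF r R s', of "{-pi..pi}"] sol_uniform[OF q Q s', of "{-pi..pi}"]
      have b: "bounded (r s ` {-pi..pi})" "bounded (q s ` {-pi..pi})"
        by (intro compact_imp_bounded compact_continuous_image cont s' compact_Icc)+
      have "uniform_limit {-pi..pi} h (h s) (at s within {0..t})" unfolding h_def[abs_def]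
        by (intro uniform_lim_mult uniform_limit_minus u b bounded_minus_comp bounded_image_mult)
      moreover have "eventually (\<lambda>u. continuous_on {-pi..pi} (h u)) (at s within {0..t})"
        using eventually_in_interval by eventually_elim (use hc in auto)
      ultimately show "(E \<longlongrightarrow> E s) (at s within {0..t})"
        unfolding E_def by (rule uniform_limit_integral_eventually) (use hc s' in blast)
    qed
    fix s assume s: "0 < s" "s < t"
    hence s': "0 \<le> s" "s \<le> t" by auto
    note ur = sol_ud[OF r R s] and uq = sol_ud[OF q Q s]
    note ud = ud_diff[OF ud_mult[OF ur ur] ud_mult[OF uq uq]]
    note uh = ud_mult[OF ud ud, folded h_def]
    have "eventually (\<lambda>u. u \<in> {0<..<t}) (at s)" by (rule eventually_at_in_open') (use s in auto)
    hence ev: "eventually (\<lambda>u. continuous_on {-pi..pi} (h u)) (at s)" by eventually_elim (use hc in auto)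
    show "(E has_real_derivative energy_rate (r s) (q s)) (at s)" unfolding E_def
    proof (rule DERIV_cong[OF ud_integral[OF uh ev hc[OF s']]])
    qed (intro continuous_intros cont cG s s' | simp add: energy_rate_def power2_eq_square algebra_simps)+
    have Eeq: "E s = integral {-pi..pi} (\<lambda>x. ((r s x)^2 - (q s x)^2)\<^sup>2)" unfolding E_def h_def by (simp add: power2_eq_square)
    note hr = holder4_chain3[OF \<alpha> sol_holder4[OF r R s(1) s'(2)]] and hq = holder4_chain3[OF \<alpha> sol_holder4[OF q Q s(1) s'(2)]]
    show "energy_rate (r s) (q s) \<le> C * E s" unfolding Eeq
    proof (rule C)
      show "bounded_profile m M (r s) (nth_deriv 1 (r s)) (nth_deriv 2 (r s)) (nth_deriv 3 (r s))"
        "bounded_profile m M (q s) (nth_deriv 1 (q s)) (nth_deriv 2 (q s)) (nth_deriv 3 (q s))"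
        unfolding bounded_profile_def using hr hq cG[OF s(1) s'(2)] mr(2)[OF s'] mq(2)[OF s']
          bd[OF s', of 0] bd[OF s', of 1] bd[OF s', of 2] by (auto simp: m_def abs_le_iff intro: min.coboundedI1 min.coboundedI2)
      show "\<forall>x. \<bar>nth_deriv 3 (q s) x\<bar> \<le> M" using q3[OF s'(1) before_T[OF q Q s'(2)]] by (auto simp: M_def le_max_iff_disj)
    qed
  qed (use t in auto)
  have rq: "r t x = q t x" if x: "x \<in> {-pi..pi}" for x
  proof -
    have "(h t has_integral 0) {-pi..pi}"
      using integrable_integral[OF integrable_continuous_real[OF hc[of t]]] Et t(1) unfolding E_def by simp
    hence "h t x = 0"
      using has_integral_0_cbox_imp_0[of "- pi" pi "h t" x] hc[of t] t(1) x pi_gt_zero by (auto simp: h_def simp del: pi_gt_zero)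
    hence "r t x * r t x = q t x * q t x" unfolding h_def by simp
    moreover have "r t x > 0" "q t x > 0" using sol_pos[OF r R t(1) order_refl] sol_pos[OF q Q t(1) order_refl] by auto
    ultimately show ?thesis by (simp add: square_eq_iff)
  qed
  show ?thesis
  proof
    fix x
    obtain y where y: "y \<in> {-pi..pi}" "\<And>f. periodic_2pi f \<Longrightarrow> f x = f y" by (rule periodic_reduce) (rule that)
    have "r t x = r t y" "q t x = q t y"
      using y(2)[OF holder_spaceD(1)[OF little_holder_imp[OF sol_holder[OF r R t(1) order_refl]]]]
        y(2)[OF holder_spaceD(1)[OF little_holder_imp[OF sol_holder[OF q Q t(1) order_refl]]]] by blast+
    thus "r t x = q t x" using rq[OF y(1)] by simp
  qed
qed

end

section \<open>Instability\<close>

lemma open_less_ereal: "open {u. ereal u < T}"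
proof (cases T)
  case (real x)
  hence "{u. ereal u < T} = {..<x}" by auto
  thus ?thesis by simp
qed auto

lemma lh_continuous_on_local:
  assumes "\<And>t. t \<in> J \<Longrightarrow> \<exists>U c'. open U \<and> t \<in> U \<and> lh_continuous_on \<sigma> (J \<inter> U) c' \<and> (\<forall>u\<in>J \<inter> U. c' u = c u)"
  shows "lh_continuous_on \<sigma> J c" unfolding lh_continuous_on_def
proof (intro conjI ballI)
  fix t assume t: "t \<in> J"
  then obtain U c' where U: "open U" "t \<in> U" "lh_continuous_on \<sigma> (J \<inter> U) c'" and eq: "\<And>u. u \<in> J \<inter> U \<Longrightarrow> c' u = c u"
    using assms by meson
  have tu: "t \<in> J \<inter> U" using t U by blast
  show "c t \<in> little_holder \<sigma>" using U(3) tu eq[OF tu] unfolding lh_continuous_on_def by metis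
  have "((\<lambda>u. holder_norm \<sigma> (\<lambda>x. c' u x - c' t x)) \<longlongrightarrow> 0) (at t within J \<inter> U)" using U(3) tu unfolding lh_continuous_on_def by blast
  moreover have ev: "eventually (\<lambda>u. holder_norm \<sigma> (\<lambda>x. c' u x - c' t x) = holder_norm \<sigma> (\<lambda>x. c u x - c t x)) (at t within J \<inter> U)"
    unfolding eventually_at_filter using eq tu by (intro always_eventually) auto
  moreover have "at t within J \<inter> U = at t within J" by (rule at_within_nhd[OF U(2,1)]) auto
  ultimately show "((\<lambda>u. holder_norm \<sigma> (\<lambda>x. c u x - c t x)) \<longlongrightarrow> 0) (at t within J)" using tendsto_cong[OF ev] by simp
qed

lemma lh_continuous_on_subset: "lh_continuous_on \<sigma> J c \<Longrightarrow> J' \<subseteq> J \<Longrightarrow> lh_continuous_on \<sigma> J' c"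
  unfolding lh_continuous_on_def by (meson subsetD tendsto_within_subset)

text \<open>Every clause in the definition of a solution is local in time, so it suffices to agree,
  for each t, with some solution that lives beyond t. Unions of chains of solutions have this
  property.\<close>

lemma asd_solution_local:
  assumes T: "0 < T" and r0: "r 0 = r0"
    and loc: "\<And>t. 0 \<le> t \<Longrightarrow> ereal t < T \<Longrightarrow>
      \<exists>T' r'. asd_solution \<alpha> \<mu> r0 T' r' \<and> ereal t < T' \<and> T' \<le> T \<and> (\<forall>s. 0 \<le> s \<and> ereal s < T' \<longrightarrow> r' s = r s)"
  shows "asd_solution \<alpha> \<mu> r0 T r" unfolding asd_solution_def
proof (intro conjI allI impI)
  fix t x assume t: "0 \<le> t \<and> ereal t < T"
  then obtain T' r' where s: "asd_solution \<alpha> \<mu> r0 T' r'" "ereal t < T'" "\<forall>s. 0 \<le> s \<and> ereal s < T' \<longrightarrow> r' s = r s" using loc by meson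
  hence "r' t x > 0" "r' t = r t" using t unfolding asd_solution_def by blast+
  thus "r t x > 0" by simp
next
  have *: "\<exists>U c'. open U \<and> t \<in> U \<and> lh_continuous_on s (J \<inter> U) c' \<and> (\<forall>u\<in>J \<inter> U. c' u = f (r u))"
    if t: "t \<in> J" and J: "J \<subseteq> {t. 0 \<le> t \<and> ereal t < T}"
      and s: "\<And>T' r'. asd_solution \<alpha> \<mu> r0 T' r' \<Longrightarrow> T' \<le> T \<Longrightarrow> lh_continuous_on s (J \<inter> {u. ereal u < T'}) (\<lambda>t. f (r' t))"
    for t s J and f :: "(real \<Rightarrow> real) \<Rightarrow> real \<Rightarrow> real"
  proof -
    obtain T' r' where r': "asd_solution \<alpha> \<mu> r0 T' r'" "ereal t < T'" "T' \<le> T" "\<forall>s. 0 \<le> s \<and> ereal s < T' \<longrightarrow> r' s = r s"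
      using loc[of t] t J by blast
    show ?thesis using open_less_ereal[of T'] r'(2) s[OF r'(1,3)] r'(4) J
      by (intro exI[of _ "{u. ereal u < T'}"] exI[of _ "\<lambda>t. f (r' t)"]) auto
  qed
  show "lh_continuous_on (4 * \<mu> + \<alpha>) {t. 0 \<le> t \<and> ereal t < T} r" by (rule lh_continuous_on_local, rule *[where f = "\<lambda>f. f"])
      (auto simp: asd_solution_def elim!: lh_continuous_on_subset)
  show "lh_continuous_on (4 + \<alpha>) {t. 0 < t \<and> ereal t < T} r" by (rule lh_continuous_on_local, rule *[where f = "\<lambda>f. f"])
      (auto simp: asd_solution_def elim!: lh_continuous_on_subset)
  show "lh_continuous_on \<alpha> {t. 0 < t \<and> ereal t < T} (\<lambda>t. asd_G (r t))" by (rule lh_continuous_on_local, rule *[where f = asd_G])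
      (auto simp: asd_solution_def elim!: lh_continuous_on_subset)
next
  fix t assume t: "0 < t \<and> ereal t < T"
  then obtain T' r' where r': "asd_solution \<alpha> \<mu> r0 T' r'" "ereal t < T'" "\<forall>s. 0 \<le> s \<and> ereal s < T' \<longrightarrow> r' s = r s"
    using loc[of t] by auto
  have "((\<lambda>u. holder_norm \<alpha> (\<lambda>x. (r' u x - r' t x) / (u - t) - asd_G (r' t) x)) \<longlongrightarrow> 0) (at t)"
    using r'(1,2) t unfolding asd_solution_def by blast
  moreover have "eventually (\<lambda>u. u \<in> {u. ereal u < T'} \<inter> {0<..}) (at t)"
    by (rule eventually_at_in_open') (use t r' open_less_ereal in auto)
  hence ev: "eventually (\<lambda>u. holder_norm \<alpha> (\<lambda>x. (r' u x - r' t x) / (u - t) - asd_G (r' t) x) =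
       holder_norm \<alpha> (\<lambda>x. (r u x - r t x) / (u - t) - asd_G (r t) x)) (at t)" by eventually_elim (use r'(2,3) t in auto)
  ultimately show "((\<lambda>u. holder_norm \<alpha> (\<lambda>x. (r u x - r t x) / (u - t) - asd_G (r t) x)) \<longlongrightarrow> 0) (at t)"
    using tendsto_cong[OF ev] by blast
qed (use T r0 in auto)

text \<open>Zorn's lemma is applied to graphs over [0, T) and not to pairs (T, r): the values of r
  outside its interval are arbitrary, and inclusion of graphs expresses extension exactly.\<close>

theorem asd_maximal_exists:
  assumes sol: "asd_solution \<alpha> \<mu> r0 T0 q"
  shows "\<exists>T r. asd_maximal_solution \<alpha> \<mu> r0 T r"
proof -
  define gr :: "ereal \<Rightarrow> (real \<Rightarrow> real \<Rightarrow> real) \<Rightarrow> (real \<times> (real \<Rightarrow> real)) set"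
    where "gr T r = {(t, r t) | t. 0 \<le> t \<and> ereal t < T}" for T r
  have gr_iff: "(t, v) \<in> gr T r \<longleftrightarrow> 0 \<le> t \<and> ereal t < T \<and> v = r t" for t v T r unfolding gr_def by auto
  define A where "A = {gr T r | T r. asd_solution \<alpha> \<mu> r0 T r}"
  have "\<exists>M\<in>A. \<forall>X\<in>A. M \<subseteq> X \<longrightarrow> X = M"
  proof (rule subset_Zorn_nonempty)
    show "A \<noteq> {}" unfolding A_def using sol by blast
    fix C assume C: "C \<noteq> {}" "subset.chain A C"
    have CA: "C \<subseteq> A" using C(2) unfolding subset_chain_def by blast
    define I where "I = {(T, r). asd_solution \<alpha> \<mu> r0 T r \<and> gr T r \<in> C}"
    have I: "\<exists>p\<in>I. X = gr (fst p) (snd p)" if "X \<in> C" for X using that CA unfolding A_def I_def by force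
    have agree: "r t = r' t" if "(T, r) \<in> I" "(T', r') \<in> I" "0 \<le> t" "ereal t < T" "ereal t < T'" for T r T' r' t
    proof -
      have "gr T r \<subseteq> gr T' r' \<or> gr T' r' \<subseteq> gr T r" using that(1,2) C(2) unfolding I_def subset_chain_def by blast
      moreover have "(t, r t) \<in> gr T r" "(t, r' t) \<in> gr T' r'" unfolding gr_iff using that(3-5) by simp_all
      ultimately have "(t, r t) \<in> gr T' r' \<or> (t, r' t) \<in> gr T r" by (meson subsetD)
      thus ?thesis unfolding gr_iff by (elim disjE) simp_all
    qed
    define T where "T = (SUP p\<in>I. fst p)"
    \<comment> \<open>At each time any member of the chain that is alive may be used, since members
      agree on common times.\<close>
    define r where "r t = snd (SOME p. p \<in> I \<and> ereal t < fst p) t" for t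
    have r: "r t = r' t" if "(T', r') \<in> I" "0 \<le> t" "ereal t < T'" for t T' r'
    proof -
      have "\<exists>p. p \<in> I \<and> ereal t < fst p" using that by force
      hence *: "(SOME p. p \<in> I \<and> ereal t < fst p) \<in> I \<and> ereal t < fst (SOME p. p \<in> I \<and> ereal t < fst p)" by (rule someI_ex)
      show ?thesis unfolding r_def by (rule agree[of "fst (SOME p. p \<in> I \<and> ereal t < fst p)" _ T' r' t]) (use * that in simp_all)
    qed
    obtain T1 r1 where I1: "(T1, r1) \<in> I" using C(1) I by (metis ex_in_conv surj_pair)
    have le: "T' \<le> T" if "(T', r') \<in> I" for T' r' unfolding T_def using SUP_upper[OF that, of fst] by simp
    have s1: "asd_solution \<alpha> \<mu> r0 T1 r1" using I1 unfolding I_def by blast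
    have T1: "0 < T1" using s1 unfolding asd_solution_def by blast
    have "asd_solution \<alpha> \<mu> r0 T r"
    proof (rule asd_solution_local)
      show "0 < T" using T1 le[OF I1] by (rule less_le_trans)
      show "r 0 = r0" using r[OF I1, of 0] T1 s1 unfolding asd_solution_def by (simp add: zero_ereal_def)
      fix t :: real assume t: "0 \<le> t" "ereal t < T"
      then obtain p where p: "p \<in> I" "ereal t < fst p" unfolding T_def less_SUP_iff by blast
      obtain T' r' where p': "p = (T', r')" by (cases p)
      show "\<exists>T' r'. asd_solution \<alpha> \<mu> r0 T' r' \<and> ereal t < T' \<and> T' \<le> T \<and> (\<forall>s. 0 \<le> s \<and> ereal s < T' \<longrightarrow> r' s = r s)"
        using p p' le[of T' r'] r[of T' r'] unfolding I_def by (intro exI[of _ T'] exI[of _ r']) auto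
    qed
    moreover have "\<Union>C = gr T r"
    proof (rule set_eqI)
      fix z :: "real \<times> (real \<Rightarrow> real)"
      obtain t v where z: "z = (t, v)" by (cases z)
      have "z \<in> \<Union>C \<longleftrightarrow> (\<exists>p\<in>I. (t, v) \<in> gr (fst p) (snd p))" unfolding z using I unfolding I_def by force
      also have "\<dots> \<longleftrightarrow> 0 \<le> t \<and> ereal t < T \<and> v = r t"
      proof
        assume "\<exists>p\<in>I. (t, v) \<in> gr (fst p) (snd p)"
        then obtain T' r' where p: "(T', r') \<in> I" "0 \<le> t" "ereal t < T'" "v = r' t" unfolding gr_iff by force
        thus "0 \<le> t \<and> ereal t < T \<and> v = r t" using le[OF p(1)] r[OF p(1-3)] by auto
      next
        assume t: "0 \<le> t \<and> ereal t < T \<and> v = r t"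
        then obtain p where p: "p \<in> I" "ereal t < fst p" unfolding T_def less_SUP_iff by blast
        hence "r t = snd p t" using r[of "fst p" "snd p" t] t by simp
        thus "\<exists>p\<in>I. (t, v) \<in> gr (fst p) (snd p)" using p t unfolding gr_iff by auto
      qed
      finally show "z \<in> \<Union>C \<longleftrightarrow> z \<in> gr T r" unfolding z gr_iff .
    qed
    ultimately show "\<Union>C \<in> A" unfolding A_def by blast
  qed
  then obtain M where M: "M \<in> A" and max': "\<forall>X\<in>A. M \<subseteq> X \<longrightarrow> X = M" by (elim bexE)
  obtain T r where s: "asd_solution \<alpha> \<mu> r0 T r" and MT: "M = gr T r" using M unfolding A_def by blast
  have max: "X = gr T r" if "X \<in> A" "gr T r \<subseteq> X" for X using max' that unfolding MT by simp
  have "\<not> (\<exists>T' r'. T < T' \<and> asd_solution \<alpha> \<mu> r0 T' r' \<and> (\<forall>t. 0 \<le> t \<and> ereal t < T \<longrightarrow> r' t = r t))"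
  proof
    assume "\<exists>T' r'. T < T' \<and> asd_solution \<alpha> \<mu> r0 T' r' \<and> (\<forall>t. 0 \<le> t \<and> ereal t < T \<longrightarrow> r' t = r t)"
    then obtain T' r' where r': "T < T'" "asd_solution \<alpha> \<mu> r0 T' r'" "\<forall>t. 0 \<le> t \<and> ereal t < T \<longrightarrow> r' t = r t" by blast
    have "gr T r \<subseteq> gr T' r'" using r'(1,3) unfolding gr_def by (auto intro: less_trans)
    hence eq: "gr T' r' = gr T r" using max r'(2) unfolding A_def by blast
    have "0 < T" using s unfolding asd_solution_def by blast
    \<comment> \<open>A later end time makes T finite, and the graph of the extension contains the
      time T itself, which the graph over [0, T) does not.\<close>
    then obtain t where t: "T = ereal t" "0 < t" by (cases T) (use r'(1) in auto)
    hence "(t, r' t) \<in> gr T' r'" unfolding gr_iff using r'(1) by (metis less_imp_le)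
    thus False unfolding eq gr_iff using t by simp
  qed
  thus ?thesis unfolding asd_maximal_solution_def using s by blast
qed

text \<open>G has the dimension of an inverse cubed length: one factor from the mean curvature and
  two from the differentiations along the surface.\<close>

lemma asd_G_scaling:
  assumes c: "chain3 f f1 f2 f3" and pos: "\<And>x. f x > 0" and d: "\<And>x. f3 differentiable (at x)" and k: "k > 0"
  shows "asd_G (\<lambda>x. f (k * x) / k) x = k ^ 3 * asd_G f (k * x)"
proof -
  define g where "g x = f (k * x) / k" for x
  define F where "F z = f z / sqrt (1 + (deriv f z)^2) * deriv (mean_curv f) z" for z
  have comp: "deriv (\<lambda>x. c * h (k * x)) x = c * (k * D)" if "(h has_real_derivative D) (at (k * x))" for c h D x
    by (rule DERIV_imp_deriv[OF DERIV_cmult])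
      (use DERIV_chain2[where f = h and g = "\<lambda>x. k * x" and x = x, OF that DERIV_cmult_Id] in \<open>simp only: mult.commute\<close>)
  note c' = c[unfolded chain3_def, THEN conjunct1] c[unfolded chain3_def, THEN conjunct2, THEN conjunct1]
  have g1: "deriv g = (\<lambda>x. f1 (k * x))" using comp[OF c'(1)[rule_format], of "1 / k"] k by (simp add: g_def[abs_def] fun_eq_iff)
  have "deriv (\<lambda>x. f1 (k * x)) = (\<lambda>x. k * f2 (k * x))" using comp[OF c'(2)[rule_format], of 1] by (simp add: fun_eq_iff)
  hence m: "mean_curv g = (\<lambda>x. k * mean_curv f (k * x))"
    using k by (auto simp: mean_curv_def g1 chain3_deriv[OF c] g_def right_diff_distrib)
  have mk: "deriv (mean_curv g) x = k * (k * deriv (mean_curv f) (k * x))" for x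
    unfolding m by (rule comp[OF DERIV_deriv_iff_real_differentiable[THEN iffD2, OF asd_flux(1)[OF c pos]]])
  have "F = flux f f1 f2 f3" unfolding F_def flux_def asd_flux(2)[OF c pos] ..
  hence "(F has_real_derivative f z * asd_G f z) (at z)" for z using flux_deriv[OF c pos d] by simp
  hence "deriv (\<lambda>z. k * F (k * z)) x = k * (k * (f (k * x) * asd_G f (k * x)))" by (rule comp)
  moreover have "(\<lambda>z. g z / sqrt (1 + (deriv g z)^2) * deriv (mean_curv g) z) = (\<lambda>z. k * F (k * z))"
    using k by (simp add: mk g1 F_def g_def chain3_deriv[OF c]) (simp add: mult_ac)
  ultimately have "asd_G g x = 1 / g x * (k * (k * (f (k * x) * asd_G f (k * x))))" by (simp add: asd_G_def)
  thus ?thesis using pos[of "k * x"] k unfolding g_def[abs_def] by (simp add: power3_eq_cube)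
qed

section \<open>The explicit orbit as a solution of the flow\<close>

lemma dz_diff: "y \<noteq> z \<Longrightarrow> \<bar>y\<bar> \<le> 1 / 128 \<Longrightarrow> \<bar>z\<bar> \<le> 1 / 128 \<Longrightarrow> \<bar>dz y n - dz z n\<bar> \<le> 512 * \<bar>y - z\<bar> * wtn n"
proof -
  assume y: "y \<noteq> z" "\<bar>y\<bar> \<le> 1 / 128" "\<bar>z\<bar> \<le> 1 / 128"
  \<comment> \<open>The Taylor remainders about z and about y add up to the difference of the
    derivatives times y - z.\<close>
  have "\<bar>(dz y n - dz z n) * (y - z)\<bar> = \<bar>(y ^ n - z ^ n - dz z n * (y - z)) + (z ^ n - y ^ n - dz y n * (z - y))\<bar>"
    by (simp add: algebra_simps)
  also have "\<dots> \<le> 256 * (y - z)^2 * wtn n + 256 * (z - y)^2 * wtn n"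
    unfolding dz_def using power_diff_small(3)[OF y(2,3), of n] power_diff_small(3)[OF y(3,2), of n]
    by (intro order_trans[OF abs_triangle_ineq] add_mono) auto
  also have "\<dots> = (512 * \<bar>y - z\<bar> * wtn n) * \<bar>y - z\<bar>"
  proof -
    have "(y - z)^2 = \<bar>y - z\<bar> * \<bar>y - z\<bar>" by (simp add: power2_eq_square)
    thus ?thesis unfolding power2_commute[of z y] by simp
  qed
  finally show "\<bar>dz y n - dz z n\<bar> \<le> 512 * \<bar>y - z\<bar> * wtn n" unfolding abs_mult using y(1) by (simp add: mult_le_cancel_right)
qed

lemma admissible_zdz_diff:
  assumes "\<bar>y\<bar> \<le> 1 / 128" "\<bar>z\<bar> \<le> 1 / 128"
  shows "admissible (513 * \<bar>y - z\<bar>) (\<lambda>n. y * dz y n - z * dz z n)" unfolding admissible_def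
proof (intro conjI allI)
  fix n
  show "\<bar>y * dz y n - z * dz z n\<bar> \<le> 513 * \<bar>y - z\<bar> * wtn n"
  proof (cases "y = z")
    case False
    have "y * dz y n - z * dz z n = y * (dz y n - dz z n) + (y - z) * dz z n" by (simp add: algebra_simps)
    hence "\<bar>y * dz y n - z * dz z n\<bar> \<le> \<bar>y\<bar> * \<bar>dz y n - dz z n\<bar> + \<bar>y - z\<bar> * \<bar>dz z n\<bar>" by (metis abs_mult abs_triangle_ineq)
    also have "\<dots> \<le> 1 * (512 * \<bar>y - z\<bar> * wtn n) + \<bar>y - z\<bar> * (1 * wtn n)"
      using dz_diff[OF False assms] admissible_dz[OF assms(2)] assms(1) unfolding admissible_def by (intro add_mono mult_mono) auto
    finally show ?thesis by (simp add: mult_ac)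
  qed simp
qed simp

lemma admissible_scale: "admissible M \<phi> \<Longrightarrow> admissible (\<bar>c\<bar> * M) (\<lambda>n. c * \<phi> n)"
  unfolding admissible_def by (auto simp: abs_mult mult.assoc intro!: mult_left_mono)

lemma admissible_add: "admissible M \<phi> \<Longrightarrow> admissible M' \<psi> \<Longrightarrow> admissible (M + M') (\<lambda>n. \<phi> n + \<psi> n)"
  unfolding admissible_def by (auto simp: distrib_right intro!: order_trans[OF abs_triangle_ineq] add_mono)

lemma chain3_diff:
  "chain3 f f1 f2 f3 \<Longrightarrow> chain3 g g1 g2 g3 \<Longrightarrow>
    chain3 (\<lambda>x. f x - g x) (\<lambda>x. f1 x - g1 x) (\<lambda>x. f2 x - g2 x) (\<lambda>x. f3 x - g3 x)"
  unfolding chain3_def by (auto intro!: derivative_intros)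

lemma lh_continuous_on_lipschitz:
  assumes c: "\<And>t. t \<in> J \<Longrightarrow> c t \<in> little_holder s" and g: "\<And>t. isCont g t"
    and L: "\<And>t u. t \<in> J \<Longrightarrow> u \<in> J \<Longrightarrow> holder_norm s (\<lambda>x. c u x - c t x) \<le> K * \<bar>g u - g t\<bar>"
  shows "lh_continuous_on s J c" unfolding lh_continuous_on_def
proof (intro conjI ballI c)
  fix t assume t: "t \<in> J"
  have "(g \<longlongrightarrow> g t) (at t within J)" using g[of t] by (simp add: continuous_at tendsto_within_subset[OF _ subset_UNIV])
  hence "((\<lambda>u. K * \<bar>g u - g t\<bar>) \<longlongrightarrow> K * \<bar>g t - g t\<bar>) (at t within J)" by (intro tendsto_intros)
  hence lim: "((\<lambda>u. K * \<bar>g u - g t\<bar>) \<longlongrightarrow> 0) (at t within J)" by simp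
  show "((\<lambda>u. holder_norm s (\<lambda>x. c u x - c t x)) \<longlongrightarrow> 0) (at t within J)"
  proof (rule Lim_null_comparison[OF _ lim])
    have "eventually (\<lambda>u. u \<in> J) (at t within J)" by (simp add: eventually_at_filter)
    thus "eventually (\<lambda>u. norm (holder_norm s (\<lambda>x. c u x - c t x)) \<le> K * \<bar>g u - g t\<bar>) (at t within J)"
    proof eventually_elim
      case (elim u)
      have "holder_norm s (\<lambda>x. c u x - c t x) \<ge> 0"
        by (rule holder_norm_nonneg[OF little_holder_imp[OF little_holder_diff(1)[OF c[OF elim] c[OF t]]]])
      thus ?case using L[OF t elim] by simp
    qed
  qed
qed

context
  fixes B :: real and d0 d1 d2 d3 :: wser and \<sigma> :: real and l :: nat and \<alpha> :: real
  assumes sp: "special B d0 d1 d2 d3 \<sigma>" and B: "B \<noteq> 0" and l: "l \<ge> 1" and \<alpha>: "0 < \<alpha>" "\<alpha> < 1"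
begin

definition "Wp \<phi> x = Cf \<phi> d0 (real l * x) / real l"
definition "Nd = norm d0 + norm d1 + norm d2 + norm d3"
text \<open>The 9 is 5 + 4: at most five suprema of derivatives, plus the factor 4 in the Hoelder
  bound for Lipschitz functions. The power l^4 bounds the chain rule factors.\<close>

definition "Kd = 9 * (real l) ^ 4 * Nd"
text \<open>Says that d1, d2, d3 represent the derivatives for the weights \<open>\<phi>\<close>.
  For the powers of z this is part of \<open>special\<close>, and it passes to differences of
  powers. The estimates in \<open>h^\<alpha>\<close> for time derivatives involve no space
  derivative and use other weights.\<close>

definition "chained \<phi> \<longleftrightarrow> chain3 (Cf \<phi> d0) (\<lambda>x. - Sf \<phi> d1 x) (\<lambda>x. - Cf \<phi> d2 x) (Sf \<phi> d3)"
definition "derivs \<phi> j x = (if j = 0 then Cf \<phi> d0 x else if j = 1 then - Sf \<phi> d1 x else if j = 2 then - Cf \<phi> d2 x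
   else if j = 3 then Sf \<phi> d3 x else Cf1 \<phi> d3 x)" for j :: nat

lemma Nd_bounds: "norm d0 \<le> Nd" "norm d1 \<le> Nd" "norm d2 \<le> Nd" "norm d3 \<le> Nd" "0 \<le> Nd" unfolding Nd_def by simp_all

lemma l_pow: "1 \<le> real l" "j \<le> 4 \<Longrightarrow> real l ^ j \<le> real l ^ 4" using l by (auto intro!: power_increasing)

lemma derivs_DERIV:
  assumes "admissible M \<phi>" "chained \<phi>" "j < 4"
  shows "(derivs \<phi> j has_real_derivative derivs \<phi> (Suc j) x) (at x)"
proof -
  consider "j = 0" | "j = 1" | "j = 2" | "j = 3" using assms(3) by linarith
  thus ?thesis using assms(2) Sf_deriv[OF assms(1), of d3 x] unfolding chained_def chain3_def derivs_def[abs_def] by cases simp_all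
qed

lemma derivs_bound:
  assumes "admissible M \<phi>"
  shows "\<bar>derivs \<phi> j x\<bar> \<le> M * Nd"
proof -
  have M: "M \<ge> 0" using assms unfolding admissible_def by blast
  note m = Nd_bounds(1-4)[THEN mult_left_mono[OF _ M]]
  show ?thesis unfolding derivs_def
    using ev_bounds(1)[OF assms, of d0 x] ev_bounds(2)[OF assms, of d1 x] ev_bounds(1)[OF assms, of d2 x]
      ev_bounds(2)[OF assms, of d3 x] ev_bounds(3)[OF assms, of d3 x] m by auto
qed

lemma derivs_lipschitz:
  assumes "admissible M \<phi>" "j = 0 \<or> chained \<phi>" "j \<le> 4"
  shows "\<bar>derivs \<phi> j x - derivs \<phi> j y\<bar> \<le> M * Nd * \<bar>x - y\<bar>"
proof -
  have M: "M \<ge> 0" using assms(1) unfolding admissible_def by blast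
  have N: "M * norm d * \<bar>x - y\<bar> \<le> M * Nd * \<bar>x - y\<bar>" if "norm d \<le> Nd" for d :: wser
    by (intro mult_right_mono mult_left_mono that M) auto
  consider "j = 0" | "j = 4" | "chained \<phi>" "j < 4" using assms(2,3) by linarith
  thus ?thesis
  proof cases
    case 1
    thus ?thesis using order_trans[OF Cf_lipschitz[OF assms(1)] N[OF Nd_bounds(1)]] by (simp add: derivs_def)
  next
    case 2
    thus ?thesis using order_trans[OF Cf1_lipschitz[OF assms(1)] N[OF Nd_bounds(4)]] by (simp add: derivs_def)
  next
    case 3
    have "norm (derivs \<phi> j x - derivs \<phi> j y) \<le> (M * Nd) * norm (x - y)"
      by (rule field_differentiable_bound[of UNIV _ "derivs \<phi> (Suc j)"])
        (auto intro: derivs_DERIV[OF assms(1) 3] derivs_bound[OF assms(1)])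
    thus ?thesis by simp
  qed
qed

lemma Wp_nth_deriv:
  assumes "admissible M \<phi>" "j = 0 \<or> chained \<phi>" "j \<le> 4"
  shows "nth_deriv j (Wp \<phi>) = (\<lambda>x. real l ^ j * derivs \<phi> j (real l * x) / real l)"
    and "chained \<phi> \<Longrightarrow> j < 4 \<Longrightarrow> nth_deriv j (Wp \<phi>) differentiable (at x)"
proof -
  have D: "((\<lambda>x. real l ^ j * derivs \<phi> j (real l * x) / real l) has_real_derivative
     real l ^ Suc j * derivs \<phi> (Suc j) (real l * x) / real l) (at x)" if "chained \<phi>" "j < 4" for j x
  proof -
    have "((\<lambda>x. derivs \<phi> j (real l * x)) has_real_derivative derivs \<phi> (Suc j) (real l * x) * real l) (at x)"
      by (rule DERIV_chain2[where f = "derivs \<phi> j" and g = "\<lambda>x. real l * x" and x = x, OF derivs_DERIV[OF assms(1) that] DERIV_cmult_Id])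
    from DERIV_cdivide[OF DERIV_cmult[OF this, of "real l ^ j"], of "real l"] show ?thesis by (simp add: mult_ac)
  qed
  show eq: "nth_deriv j (Wp \<phi>) = (\<lambda>x. real l ^ j * derivs \<phi> j (real l * x) / real l)" using assms(2,3)
  proof (induction j)
    case 0
    show ?case by (rule ext) (simp add: Wp_def derivs_def)
  next
    case (Suc j)
    thus ?case unfolding nth_deriv_Suc using D[of j] by (auto intro!: DERIV_imp_deriv ext)
  qed
  show "nth_deriv j (Wp \<phi>) differentiable (at x)" if "chained \<phi>" "j < 4"
    unfolding eq real_differentiable_def using D[OF that] by blast
qed

lemma Wp_periodic: "periodic_2pi (Wp \<phi>)"
proof -
  have "periodic_2pi (Cf \<phi> d0)" unfolding periodic_2pi_def by (simp add: ev_periodic)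
  from periodic_2pi_of_int[OF this, of "real l * x" "int l" for x] show ?thesis
    unfolding periodic_2pi_def Wp_def by (simp add: algebra_simps)
qed

text \<open>The fourth derivative is represented by \<open>Cf1\<close> of d3 and is still Lipschitz,
  so all orders with integer part at most 4 are reached.\<close>

lemma Wp_holder:
  assumes s: "s > 0" "s \<notin> \<int>" and k: "fkey s \<le> 4" and a: "admissible M \<phi>" "fkey s = 0 \<or> chained \<phi>"
  shows "Wp \<phi> \<in> little_holder s" "holder_norm s (Wp \<phi>) \<le> Kd * M"
proof -
  have M: "M \<ge> 0" using a(1) unfolding admissible_def by blast
  have MN: "0 \<le> M * Nd" using M Nd_bounds(5) by simp
  have hd: "hdiff (fkey s) (Wp \<phi>)" unfolding hdiff_def using Wp_nth_deriv(2)[OF a(1)] a(2) k by auto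
  have L: "\<bar>nth_deriv (fkey s) (Wp \<phi>) x - nth_deriv (fkey s) (Wp \<phi>) y\<bar> \<le> (real l ^ 4 * (M * Nd)) * \<bar>x - y\<bar>" for x y
  proof -
    have "nth_deriv (fkey s) (Wp \<phi>) x - nth_deriv (fkey s) (Wp \<phi>) y =
      (real l ^ fkey s / real l) * (derivs \<phi> (fkey s) (real l * x) - derivs \<phi> (fkey s) (real l * y))"
      unfolding Wp_nth_deriv(1)[OF a k] by (simp add: right_diff_distrib diff_divide_distrib)
    hence "\<bar>nth_deriv (fkey s) (Wp \<phi>) x - nth_deriv (fkey s) (Wp \<phi>) y\<bar> =
      (real l ^ fkey s / real l) * \<bar>derivs \<phi> (fkey s) (real l * x) - derivs \<phi> (fkey s) (real l * y)\<bar>" by (simp add: abs_mult)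
    also have "\<dots> \<le> (real l ^ fkey s / real l) * (M * Nd * \<bar>real l * x - real l * y\<bar>)"
      by (intro mult_left_mono derivs_lipschitz[OF a k]) auto
    also have "\<bar>real l * x - real l * y\<bar> = real l * \<bar>x - y\<bar>" by (simp add: abs_mult flip: right_diff_distrib)
    also have "(real l ^ fkey s / real l) * (M * Nd * (real l * \<bar>x - y\<bar>)) = real l ^ fkey s * (M * Nd * \<bar>x - y\<bar>)" using l by simp
    also have "\<dots> \<le> real l ^ 4 * (M * Nd * \<bar>x - y\<bar>)" using l_pow(2)[OF k] MN by (intro mult_right_mono) auto
    finally show ?thesis by (simp add: mult.assoc)
  qed
  note h = lipschitz_little_holder[OF s Wp_periodic hd L]
  show "Wp \<phi> \<in> little_holder s" by (rule h(1))
  have b: "\<bar>nth_deriv j (Wp \<phi>) x\<bar> \<le> real l ^ 4 * (M * Nd)" if "j \<le> fkey s" for j x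
  proof -
    have j: "j = 0 \<or> chained \<phi>" "j \<le> 4" using that k a(2) by auto
    have "\<bar>nth_deriv j (Wp \<phi>) x\<bar> = (real l ^ j / real l) * \<bar>derivs \<phi> j (real l * x)\<bar>"
      unfolding Wp_nth_deriv(1)[OF a(1) j] by (simp add: abs_mult)
    also have "\<dots> \<le> real l ^ 4 * (M * Nd)"
    proof (rule mult_mono[OF _ derivs_bound[OF a(1)]])
      have "real l ^ j / real l \<le> real l ^ j" using l_pow(1) by (simp add: divide_le_eq_1 mult_le_cancel_left1 pos_divide_le_eq)
      thus "real l ^ j / real l \<le> real l ^ 4" using l_pow(2)[OF j(2)] by linarith
    qed simp_all
    finally show ?thesis .
  qed
  have "holder_norm s (Wp \<phi>) \<le> (real (fkey s) + 1) * (real l ^ 4 * (M * Nd)) + 4 * (real l ^ 4 * (M * Nd))" by (rule h(2)[OF b])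
  also have "\<dots> \<le> 5 * (real l ^ 4 * (M * Nd)) + 4 * (real l ^ 4 * (M * Nd))"
    using k MN by (intro add_right_mono mult_right_mono) auto
  finally show "holder_norm s (Wp \<phi>) \<le> Kd * M" unfolding Kd_def by (simp add: algebra_simps)
qed

lemmas \<alpha>_facts = \<alpha>(1) order_facts(2,1)[OF \<alpha>]
lemmas Wp_holder_\<alpha> = Wp_holder[OF \<alpha>_facts(1,2) _ _ disjI1[OF \<alpha>_facts(3)], unfolded \<alpha>_facts(3), OF zero_le]

lemma Wp_diff: "admissible M \<phi> \<Longrightarrow> admissible M' \<psi> \<Longrightarrow> Wp \<phi> x - Wp \<psi> x = Wp (\<lambda>n. \<phi> n - \<psi> n) x"
  unfolding Wp_def using ev_diff_weights(1)[of M \<phi> M' \<psi> d0] by (simp flip: diff_divide_distrib)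

lemma Wp_scale: "Wp (\<lambda>n. c * \<phi> n) x = c * Wp \<phi> x" unfolding Wp_def by (simp add: ev_scale_weights)

lemma chained_pz: "\<bar>z\<bar> \<le> 1 / 64 \<Longrightarrow> chained (pz z)" using sp unfolding special_def chained_def by blast

lemma chained_pz_diff:
  assumes "\<bar>y\<bar> \<le> 1 / 64" "\<bar>z\<bar> \<le> 1 / 64"
  shows "chained (\<lambda>n. pz y n - pz z n)"
proof -
  have "Cf (\<lambda>n. pz y n - pz z n) f = (\<lambda>x. Cf (pz y) f x - Cf (pz z) f x)"
    "Sf (\<lambda>n. pz y n - pz z n) f = (\<lambda>x. Sf (pz y) f x - Sf (pz z) f x)" for f
    using ev_diff_weights[OF admissible_pz[OF assms(1)] admissible_pz[OF assms(2)], of f] by auto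
  thus ?thesis using chain3_diff[OF chained_pz[OF assms(1), unfolded chained_def] chained_pz[OF assms(2), unfolded chained_def]]
    unfolding chained_def by (simp add: algebra_simps)
qed

definition "slice z = Wp (pz z)"

lemma slice_pos:
  assumes "\<bar>z\<bar> \<le> 1 / 64"
  shows "slice z x > 0"
proof -
  have "Cf (pz z) d0 (real l * x) \<ge> 1 / 2" using sp assms unfolding special_def by blast
  thus ?thesis unfolding slice_def Wp_def using l by (intro divide_pos_pos) auto
qed

lemma slice_holder:
  assumes s: "s > 0" "s \<notin> \<int>" "fkey s \<le> 4" and z: "\<bar>z\<bar> \<le> 1 / 64"
  shows "slice z \<in> little_holder s" unfolding slice_def by (rule Wp_holder(1)[OF s admissible_pz[OF z] disjI2[OF chained_pz[OF z]]])

lemma slice_diff: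
  assumes s: "s > 0" "s \<notin> \<int>" "fkey s \<le> 4" and y: "\<bar>y\<bar> \<le> 1 / 128" and z: "\<bar>z\<bar> \<le> 1 / 128"
  shows "holder_norm s (\<lambda>x. slice y x - slice z x) \<le> Kd * \<bar>y - z\<bar>"
proof -
  have yz: "\<bar>y\<bar> \<le> 1 / 64" "\<bar>z\<bar> \<le> 1 / 64" using y z by linarith+
  have "(\<lambda>x. slice y x - slice z x) = Wp (\<lambda>n. pz y n - pz z n)"
    unfolding slice_def by (rule ext) (rule Wp_diff[OF admissible_pz[OF yz(1)] admissible_pz[OF yz(2)]])
  thus ?thesis using Wp_holder(2)[OF s admissible_pz_diff[OF y z] disjI2[OF chained_pz_diff[OF yz]]] by simp
qed

text \<open>The scaling of G contributes l^3; expressing the result through \<open>Wp\<close>, which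
  carries a factor 1/l, makes it l^4.\<close>

lemma slice_G:
  assumes z: "\<bar>z\<bar> < 1 / 128"
  shows "asd_G (slice z) x = Wp (\<lambda>n. \<sigma> * real l ^ 4 * (z * dz z n)) x"
proof -
  have z': "\<bar>z\<bar> \<le> 1 / 64" using z by simp
  have pos: "Cf (pz z) d0 x > 0" for x
  proof -
    have "Cf (pz z) d0 x \<ge> 1 / 2" using sp z' unfolding special_def by blast
    thus ?thesis by linarith
  qed
  have d: "Sf (pz z) d3 differentiable (at x)" for x using Sf_deriv[OF admissible_pz[OF z']] real_differentiable_def by blast
  have "asd_G (slice z) x = real l ^ 3 * asd_G (Cf (pz z) d0) (real l * x)" unfolding slice_def Wp_def[abs_def]
    by (rule asd_G_scaling[OF chained_pz[OF z', unfolded chained_def] pos d]) (use l in simp)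
  also have "asd_G (Cf (pz z) d0) (real l * x) = Cf (\<lambda>n. \<sigma> * (real n * z ^ n)) d0 (real l * x)"
    using sp z unfolding special_def by blast
  also have "(\<lambda>n. \<sigma> * (real n * z ^ n)) = (\<lambda>n. \<sigma> * (z * dz z n))"
  proof
    fix n show "\<sigma> * (real n * z ^ n) = \<sigma> * (z * dz z n)" by (cases n) (simp_all add: dz_def)
  qed
  also have "real l ^ 3 * Cf (\<lambda>n. \<sigma> * (z * dz z n)) d0 (real l * x) = Wp (\<lambda>n. \<sigma> * real l ^ 4 * (z * dz z n)) x"
    unfolding Wp_def ev_scale_weights using l by (simp add: eval_nat_numeral)
  finally show ?thesis .
qed

lemma slice_undulary: "slice 0 = undulary B l"
  using special_undulary[OF sp B] undulary_scaling[of B l] l unfolding slice_def Wp_def by auto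

lemma slice_equilibrium: "asd_equilibrium \<alpha> (slice 0)" unfolding asd_equilibrium_def
proof (intro conjI allI)
  show "slice 0 \<in> little_holder (4 + \<alpha>)" by (rule slice_holder) (use order_facts[OF \<alpha>] in auto)
  show "slice 0 x > 0" for x by (rule slice_pos) simp
  show "asd_G (slice 0) x = 0" for x using slice_G[of 0 x] Wp_scale[of 0 "\<lambda>n. 0" x] by simp
qed

context
  fixes \<mu> z0 :: real
  assumes \<mu>: "1 / 2 \<le> \<mu>" "\<mu> \<le> 1" "4 * \<mu> + \<alpha> \<notin> \<int>" and z0: "0 < z0" "z0 < 1 / 256"
begin

definition "\<kappa> = \<sigma> * real l ^ 4"
definition "zt t = z0 * exp (\<kappa> * t)"
text \<open>The time at which z reaches 1/200. This value lies beyond the exit value 1/256 and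
  inside the radius 1/128 on which the series is known to solve the equation.\<close>

definition "Tz = ln (1 / (200 * z0)) / \<kappa>"

lemma \<kappa>_pos: "\<kappa> > 0" using sp l unfolding \<kappa>_def special_def by simp

lemma zt_deriv: "(zt has_real_derivative \<kappa> * zt t) (at t)" unfolding zt_def[abs_def] by (auto intro!: derivative_eq_intros)

lemma zt_less: "zt t < 1 / 200 \<longleftrightarrow> t < Tz"
proof -
  have "zt t < 1 / 200 \<longleftrightarrow> exp (\<kappa> * t) < 1 / (200 * z0)" unfolding zt_def using z0 by (simp add: field_simps)
  also have "\<dots> \<longleftrightarrow> exp (\<kappa> * t) < exp (ln (1 / (200 * z0)))" using z0 by simp
  also have "\<dots> \<longleftrightarrow> t < Tz" unfolding Tz_def exp_less_cancel_iff using \<kappa>_pos by (simp add: field_simps)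
  finally show ?thesis .
qed

lemma zt_range: "t < Tz \<Longrightarrow> \<bar>zt t\<bar> < 1 / 128" using zt_less[of t] z0 by (simp add: zt_def)

lemma zt_hits: obtains t where "0 \<le> t" "t < Tz" "zt t = 1 / 256"
proof -
  define t where "t = ln (1 / (256 * z0)) / \<kappa>"
  have "1 / (256 * z0) > 1" using z0 by (simp add: field_simps)
  hence "0 \<le> t" unfolding t_def using \<kappa>_pos by (intro divide_nonneg_pos) auto
  moreover have zt: "zt t = 1 / 256" unfolding t_def zt_def using \<kappa>_pos z0 by simp
  moreover have "t < Tz" using zt_less[of t] unfolding zt by simp
  ultimately show ?thesis using that by blast
qed

lemma zt_isCont: "isCont zt t" using zt_deriv DERIV_isCont by blast

lemma slice_continuous:
  assumes s: "s > 0" "s \<notin> \<int>" "fkey s \<le> 4" and J: "J \<subseteq> {t. t < Tz}"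
  shows "lh_continuous_on s J (\<lambda>t. slice (zt t))"
proof (rule lh_continuous_on_lipschitz[where g = zt, OF _ zt_isCont])
  have J': "\<bar>zt t\<bar> \<le> 1 / 128" if "t \<in> J" for t using zt_range[of t] J that by auto
  show "slice (zt t) \<in> little_holder s" if "t \<in> J" for t by (rule slice_holder[OF s]) (use J'[OF that] in simp)
  show "holder_norm s (\<lambda>x. slice (zt u) x - slice (zt t) x) \<le> Kd * \<bar>zt u - zt t\<bar>" if "t \<in> J" "u \<in> J" for t u
    by (rule slice_diff[OF s J' J']) (use that in auto)
qed

lemma slice_solution: "asd_solution \<alpha> \<mu> (slice z0) (ereal Tz) (\<lambda>t. slice (zt t))" unfolding asd_solution_def
proof (intro conjI allI impI)
  have "zt 0 < 1 / 200" unfolding zt_def using z0 by simp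
  thus "0 < ereal Tz" using zt_less[of 0] by simp
  show "slice (zt 0) = slice z0" by (simp add: zt_def)
  show "slice (zt t) x > 0" if "0 \<le> t \<and> ereal t < ereal Tz" for t x by (rule slice_pos) (use zt_range[of t] that in auto)
  have "\<lfloor>4 * \<mu> + \<alpha>\<rfloor> < 5" using \<mu> \<alpha> by (simp add: floor_less_iff)
  hence k: "fkey (4 * \<mu> + \<alpha>) \<le> 4" unfolding fkey_def by linarith
  show "lh_continuous_on (4 * \<mu> + \<alpha>) {t. 0 \<le> t \<and> ereal t < ereal Tz} (\<lambda>t. slice (zt t))"
    by (rule slice_continuous) (use \<mu> \<alpha> k in auto)
  show "lh_continuous_on (4 + \<alpha>) {t. 0 < t \<and> ereal t < ereal Tz} (\<lambda>t. slice (zt t))"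
    by (rule slice_continuous) (use order_facts[OF \<alpha>] in auto)
  have G: "asd_G (slice (zt t)) = Wp (\<lambda>n. \<kappa> * (zt t * dz (zt t) n))" if "t < Tz" for t
    using slice_G[OF zt_range[OF that]] unfolding \<kappa>_def by auto
  have J: "\<bar>zt t\<bar> \<le> 1 / 128" if "t < Tz" for t using zt_range[OF that] by simp
  have adm: "admissible (\<bar>\<kappa>\<bar> * (\<bar>zt t\<bar> * 1)) (\<lambda>n. \<kappa> * (zt t * dz (zt t) n))" if "t < Tz" for t
    by (intro admissible_scale admissible_dz J that)
  have Gh: "asd_G (slice (zt t)) \<in> little_holder \<alpha>" if "t < Tz" for t unfolding G[OF that] by (rule Wp_holder_\<alpha>(1)[OF adm[OF that]])
  show "lh_continuous_on \<alpha> {t. 0 < t \<and> ereal t < ereal Tz} (\<lambda>t. asd_G (slice (zt t)))"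
  proof (rule lh_continuous_on_lipschitz[where g = zt, OF _ zt_isCont])
    show "asd_G (slice (zt t)) \<in> little_holder \<alpha>" if "t \<in> {t. 0 < t \<and> ereal t < ereal Tz}" for t by (rule Gh) (use that in simp)
    fix t u assume "t \<in> {t. 0 < t \<and> ereal t < ereal Tz}" "u \<in> {t. 0 < t \<and> ereal t < ereal Tz}"
    hence tT: "t < Tz" and uT: "u < Tz" by simp_all
    have "(\<lambda>x. asd_G (slice (zt u)) x - asd_G (slice (zt t)) x) = Wp (\<lambda>n. \<kappa> * (zt u * dz (zt u) n) - \<kappa> * (zt t * dz (zt t) n))"
      unfolding G[OF tT] G[OF uT] by (rule ext) (rule Wp_diff[OF adm[OF uT] adm[OF tT]])
    hence "(\<lambda>x. asd_G (slice (zt u)) x - asd_G (slice (zt t)) x) = Wp (\<lambda>n. \<kappa> * (zt u * dz (zt u) n - zt t * dz (zt t) n))"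
      by (simp add: right_diff_distrib)
    thus "holder_norm \<alpha> (\<lambda>x. asd_G (slice (zt u)) x - asd_G (slice (zt t)) x) \<le> (Kd * \<bar>\<kappa>\<bar> * 513) * \<bar>zt u - zt t\<bar>"
      using Wp_holder_\<alpha>(2)[OF admissible_scale[OF admissible_zdz_diff[OF J[OF uT] J[OF tT]]], of \<kappa>] by (simp add: mult.assoc)
  qed
  show "((\<lambda>u. holder_norm \<alpha> (\<lambda>x. (slice (zt u) x - slice (zt t) x) / (u - t) - asd_G (slice (zt t)) x)) \<longlongrightarrow> 0) (at t)"
    if "0 < t \<and> ereal t < ereal Tz" for t
  proof -
    have t: "t < Tz" using that by simp
    define e where "e u = (zt u - zt t) / (u - t) - \<kappa> * zt t" for u
    have q: "((\<lambda>u. (zt u - zt t) / (u - t)) \<longlongrightarrow> \<kappa> * zt t) (at t)" using zt_deriv[of t] by (simp add: has_field_derivative_iff)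
    have zc: "(zt \<longlongrightarrow> zt t) (at t)" using zt_deriv[of t] DERIV_isCont by (simp add: isCont_def)
    have "((\<lambda>u. Kd * (256 * (\<bar>zt u - zt t\<bar> * \<bar>(zt u - zt t) / (u - t)\<bar>) + \<bar>e u\<bar>)) \<longlongrightarrow>
        Kd * (256 * (\<bar>zt t - zt t\<bar> * \<bar>\<kappa> * zt t\<bar>) + \<bar>\<kappa> * zt t - \<kappa> * zt t\<bar>)) (at t)" unfolding e_def by (intro tendsto_intros q zc)
    hence lim: "((\<lambda>u. Kd * (256 * (\<bar>zt u - zt t\<bar> * \<bar>(zt u - zt t) / (u - t)\<bar>) + \<bar>e u\<bar>)) \<longlongrightarrow> 0) (at t)" by simp
    show ?thesis
    proof (rule Lim_null_comparison[OF _ lim])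
      have "eventually (\<lambda>u. u \<in> {..<Tz}) (at t)" by (rule eventually_at_in_open') (use t in auto)
      thus "eventually (\<lambda>u. norm (holder_norm \<alpha> (\<lambda>x. (slice (zt u) x - slice (zt t) x) / (u - t) - asd_G (slice (zt t)) x))
        \<le> Kd * (256 * (\<bar>zt u - zt t\<bar> * \<bar>(zt u - zt t) / (u - t)\<bar>) + \<bar>e u\<bar>)) (at t)" using eventually_neq_at_within[of t t UNIV]
      proof eventually_elim
        case (elim u)
        hence uT: "u < Tz" and ut: "u - t \<noteq> 0" by auto
        \<comment> \<open>The weights of the error: the Taylor remainder in z divided by u - t, plus
          the error of the difference quotient of z times the derivative weights. Both are
          admissible with bounds tending to 0 as u tends to t.\<close>
        define \<phi> where "\<phi> n = (1 / (u - t)) * (pz (zt u) n - pz (zt t) n - (zt u - zt t) * dz (zt t) n) + e u * dz (zt t) n" for n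
        have a: "admissible (\<bar>1 / (u - t)\<bar> * (256 * (zt u - zt t)^2) + \<bar>e u\<bar> * 1) \<phi>"
          unfolding \<phi>_def by (intro admissible_add admissible_scale admissible_taylor admissible_dz J uT t)
        have pd: "admissible \<bar>zt u - zt t\<bar> (\<lambda>n. pz (zt u) n - pz (zt t) n)" by (rule admissible_pz_diff[OF J[OF uT] J[OF t]])
        have yz: "\<bar>zt u\<bar> \<le> 1 / 64" "\<bar>zt t\<bar> \<le> 1 / 64" using J[OF uT] J[OF t] by linarith+
        have "(slice (zt u) x - slice (zt t) x) / (u - t) - asd_G (slice (zt t)) x = Wp \<phi> x" for x
        proof -
          have "(slice (zt u) x - slice (zt t) x) / (u - t) = (1 / (u - t)) * Wp (\<lambda>n. pz (zt u) n - pz (zt t) n) x"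
            unfolding slice_def Wp_diff[OF admissible_pz[OF yz(1)] admissible_pz[OF yz(2)]] by simp
          also have "\<dots> = Wp (\<lambda>n. (1 / (u - t)) * (pz (zt u) n - pz (zt t) n)) x" by (rule Wp_scale[symmetric])
          finally have q: "(slice (zt u) x - slice (zt t) x) / (u - t) = Wp (\<lambda>n. (1 / (u - t)) * (pz (zt u) n - pz (zt t) n)) x" .
          have "(slice (zt u) x - slice (zt t) x) / (u - t) - asd_G (slice (zt t)) x =
            Wp (\<lambda>n. (1 / (u - t)) * (pz (zt u) n - pz (zt t) n) - \<kappa> * (zt t * dz (zt t) n)) x"
            unfolding q G[OF t] by (rule Wp_diff[OF admissible_scale[OF pd] adm[OF t]])
          also have "(\<lambda>n. (1 / (u - t)) * (pz (zt u) n - pz (zt t) n) - \<kappa> * (zt t * dz (zt t) n)) = \<phi>"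
            unfolding \<phi>_def e_def by (rule ext) (simp add: algebra_simps diff_divide_distrib)
          finally show ?thesis .
        qed
        hence eq: "(\<lambda>x. (slice (zt u) x - slice (zt t) x) / (u - t) - asd_G (slice (zt t)) x) = Wp \<phi>" by auto
        have eqM: "\<bar>1 / (u - t)\<bar> * (256 * (zt u - zt t)^2) + \<bar>e u\<bar> * 1 = 256 * (\<bar>zt u - zt t\<bar> * \<bar>(zt u - zt t) / (u - t)\<bar>) + \<bar>e u\<bar>"
          by (simp add: abs_divide power2_eq_square)
        show ?case unfolding eq real_norm_def abs_of_nonneg[OF holder_norm_nonneg[OF little_holder_imp[OF Wp_holder_\<alpha>(1)[OF a]]]]
          by (rule Wp_holder_\<alpha>(2)[OF a, unfolded eqM])
      qed
    qed
  qed
qed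

lemma slice_third: "t < Tz \<Longrightarrow> \<bar>nth_deriv 3 (slice (zt t)) x\<bar> \<le> Kd"
proof -
  assume t: "t < Tz"
  note n = order_facts(4,5)[OF \<alpha>] and k = order_facts(3)[OF \<alpha>]
  have z: "\<bar>zt t\<bar> \<le> 1 / 64" using zt_range[OF t] by simp
  note h = Wp_holder[OF n(2,1) eq_refl[OF k] admissible_pz[OF z] disjI2[OF chained_pz[OF z]], folded slice_def]
  show ?thesis using nth_deriv_le_norm[OF little_holder_imp[OF h(1)], of 3 x] h(2) k by simp
qed

text \<open>Uniqueness identifies the solution with the orbit as long as both exist. If it ended
  before the orbit reaches z = 1/256, the orbit would extend it, against maximality. The exit
  profile does not depend on z0.\<close>

lemma maximal_solution_escapes:
  assumes max: "asd_maximal_solution \<alpha> \<mu> (slice z0) T r"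
  shows "\<exists>t. 0 \<le> t \<and> ereal t < T \<and> r t = slice (1 / 256)"
proof -
  obtain t where t: "0 \<le> t" "t < Tz" "zt t = 1 / 256" by (rule zt_hits)
  have sol: "asd_solution \<alpha> \<mu> (slice z0) T r" using max unfolding asd_maximal_solution_def by blast
  have third: "\<bar>nth_deriv 3 (slice (zt s)) x\<bar> \<le> Kd" if "0 \<le> s" "ereal s < ereal Tz" for s x by (rule slice_third) (use that in simp)
  have uniq: "r s = slice (zt s)" if "0 \<le> s" "ereal s < T" "ereal s < ereal Tz" for s
    by (rule asd_unique[OF \<alpha> \<mu>(1,3) sol slice_solution third that])
  have "ereal t < T"
  proof (rule ccontr)
    assume "\<not> ereal t < T"
    hence T: "T < ereal Tz" using t(2) by (meson ereal_less_ereal_Ex less_ereal.simps(1) not_le order_le_less_trans)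
    have "\<forall>s. 0 \<le> s \<and> ereal s < T \<longrightarrow> slice (zt s) = r s" using uniq T by (metis less_trans)
    thus False using max slice_solution T unfolding asd_maximal_solution_def by blast
  qed
  thus ?thesis using uniq[OF t(1)] t by auto
qed

end

theorem special_unstable: "asd_unstable_equilibrium \<alpha> (undulary B l)"
  unfolding asd_unstable_equilibrium_def slice_undulary[symmetric]
proof (intro conjI ballI impI slice_equilibrium)
  fix \<mu> assume \<mu>: "\<mu> \<in> {1 / 2..1}" "4 * \<mu> + \<alpha> \<notin> \<int>"
  hence \<mu>': "1 / 2 \<le> \<mu>" "\<mu> \<le> 1" by auto
  have "\<lfloor>4 * \<mu> + \<alpha>\<rfloor> < 5" using \<mu>' \<alpha> by (simp add: floor_less_iff)
  hence k: "fkey (4 * \<mu> + \<alpha>) \<le> 4" unfolding fkey_def by linarith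
  have s: "4 * \<mu> + \<alpha> > 0" using \<mu>' \<alpha> by simp
  note sh = slice_holder[OF s \<mu>(2) k]
  \<comment> \<open>The distance at the point 0 between the common exit profile and the equilibrium.
    It bounds the Hoelder norm of the difference from below and is positive by the clause of
    \<open>special\<close> saying that the orbit moves.\<close>
  define \<epsilon> where "\<epsilon> = \<bar>slice (1 / 256) 0 - slice 0 0\<bar>"
  define zn where "zn n = 1 / (256 * (real n + 2))" for n :: nat
  have zn: "0 < zn n" "zn n < 1 / 256" for n unfolding zn_def by (simp_all add: field_simps)
  have zn': "\<bar>zn n\<bar> \<le> 1 / 128" "\<bar>zn n\<bar> \<le> 1 / 64" for n using zn[of n] by auto
  have "Cf (pz (1 / 256)) d0 0 \<noteq> Cf (pz 0) d0 0" using sp unfolding special_def by simp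
  hence \<epsilon>: "\<epsilon> > 0" unfolding \<epsilon>_def slice_def Wp_def using l by simp
  show "asd_unstable_in \<alpha> \<mu> (slice 0)" unfolding asd_unstable_in_def
  proof (rule exI[of _ \<epsilon>], rule conjI[OF \<epsilon>], rule exI[of _ "\<lambda>n. slice (zn n)"], intro conjI allI impI)
    show "slice (zn n) \<in> little_holder (4 * \<mu> + \<alpha>)" for n by (rule sh[OF zn'(2)])
    show "slice (zn n) x > 0" for n x by (rule slice_pos[OF zn'(2)])
    have "zn \<longlonglongrightarrow> 0" unfolding zn_def by real_asymp
    hence "(\<lambda>n. Kd * \<bar>zn n - 0\<bar>) \<longlonglongrightarrow> Kd * \<bar>0 - 0\<bar>" by (intro tendsto_intros)
    hence lim: "(\<lambda>n. Kd * \<bar>zn n - 0\<bar>) \<longlonglongrightarrow> 0" by simp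
    show "(\<lambda>n. holder_norm (4 * \<mu> + \<alpha>) (\<lambda>x. slice (zn n) x - slice 0 x)) \<longlonglongrightarrow> 0"
    proof (rule Lim_null_comparison[OF always_eventually lim], rule allI)
      fix n
      have "holder_norm (4 * \<mu> + \<alpha>) (\<lambda>x. slice (zn n) x - slice 0 x) \<ge> 0"
        by (rule holder_norm_nonneg[OF little_holder_imp[OF little_holder_diff(1)[OF sh[OF zn'(2)] sh]]]) simp
      thus "norm (holder_norm (4 * \<mu> + \<alpha>) (\<lambda>x. slice (zn n) x - slice 0 x)) \<le> Kd * \<bar>zn n - 0\<bar>"
        using slice_diff[OF s \<mu>(2) k zn'(1), of 0] by simp
    qed
    fix n
    show "\<exists>T r. asd_maximal_solution \<alpha> \<mu> (slice (zn n)) T r" by (rule asd_maximal_exists[OF slice_solution[OF \<mu>' \<mu>(2) zn]])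
    fix T r assume "asd_maximal_solution \<alpha> \<mu> (slice (zn n)) T r"
    then obtain t where t: "0 \<le> t" "ereal t < T" "r t = slice (1 / 256)" using maximal_solution_escapes[OF \<mu>' \<mu>(2) zn] by blast
    have "\<epsilon> \<le> holder_norm (4 * \<mu> + \<alpha>) (\<lambda>x. slice (1 / 256) x - slice 0 x)"
      using nth_deriv_diff_le_norm[OF sh sh, of "1 / 256" 0 0 0] unfolding \<epsilon>_def by simp
    thus "\<exists>t. 0 \<le> t \<and> ereal t < T \<and> holder_norm (4 * \<mu> + \<alpha>) (\<lambda>x. r t x - slice 0 x) \<ge> \<epsilon>" using t by metis
  qed
qed

end

theorem theorem6p6:
  fixes \<alpha> :: real and l :: nat
  assumes "0 < \<alpha>" and "\<alpha> < 1" and "l \<ge> 1"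
  shows
    "(\<forall>\<delta> \<rho> lam. bifurcation_branch \<alpha> l \<delta> \<rho> lam \<longrightarrow>
        \<comment> \<open>(a)\<close>
        (lh_analytic_on (4 + \<alpha>) {-\<delta><..<\<delta>} (\<lambda>s. lifted_profile \<alpha> (lam s) (\<rho> s)) \<and>
         (\<forall>s\<in>{-\<delta><..<\<delta>}. asd_equilibrium \<alpha> (lifted_profile \<alpha> (lam s) (\<rho> s))) \<and>
         lifted_profile \<alpha> (lam 0) (\<rho> 0) = (\<lambda>x. 1 / real l) \<and>
         (\<forall>s\<in>{-\<delta><..<\<delta>}. s \<noteq> 0 \<longrightarrow> \<not> (\<exists>c. lifted_profile \<alpha> (lam s) (\<rho> s) = (\<lambda>x. c))) \<and>
         deriv lam 0 = 0 \<and> deriv (deriv lam) 0 < 0) \<and>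
        \<comment> \<open>(b)\<close>
        (\<exists>\<epsilon>>0. \<epsilon> \<le> 1 \<and>
           (\<forall>s\<in>{-\<delta><..<\<delta>}. \<exists>B\<in>{-\<epsilon><..<\<epsilon>}. lifted_profile \<alpha> (lam s) (\<rho> s) = undulary B l)) \<and>
        (\<exists>N. lh_open (4 + \<alpha>) N \<and> (\<lambda>x. 1 / real l) \<in> N \<and>
           {lifted_profile \<alpha> (lam s) (\<rho> s) | s. s \<in> {-\<delta><..<\<delta>}} =
           {undulary B l | B. B \<in> {-1<..<1}} \<inter> N)) \<and>
     \<comment> \<open>(c)\<close>
     (\<exists>B0>0. B0 \<le> 1 \<and>
        (\<forall>B. 0 < \<bar>B\<bar> \<and> \<bar>B\<bar> < B0 \<longrightarrow> asd_unstable_equilibrium \<alpha> (undulary B l)))"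
proof (rule conjI, intro allI impI, rule conjI[OF _ conjI])
  obtain B0 where B0: "B0 > 0" "\<And>B. B \<noteq> 0 \<Longrightarrow> \<bar>B\<bar> < B0 \<Longrightarrow> \<exists>d0 d1 d2 d3 \<sigma>. special B d0 d1 d2 d3 \<sigma>"
    by (rule special_exists) (rule that)
  show "\<exists>B0>0. B0 \<le> 1 \<and> (\<forall>B. 0 < \<bar>B\<bar> \<and> \<bar>B\<bar> < B0 \<longrightarrow> asd_unstable_equilibrium \<alpha> (undulary B l))"
  proof (intro exI[of _ "min B0 1"] conjI allI impI)
    fix B assume B: "0 < \<bar>B\<bar> \<and> \<bar>B\<bar> < min B0 1"
    then obtain d0 d1 d2 d3 \<sigma> where "special B d0 d1 d2 d3 \<sigma>" using B0(2)[of B] by auto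
    thus "asd_unstable_equilibrium \<alpha> (undulary B l)" by (rule special_unstable) (use B assms in auto)
  qed (use B0(1) in auto)
qed (rule branch_summary[OF assms], assumption)+

end
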